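(* For $R>0$ let $B_R$ be the open ball in $\mathbb{R}^n$ of radius $R$ centered at $0$, and for $0<R_0<R_1<\infty$ let $A_{R_0}^{R_1}=B_{R_1}\setminus\overline{B_{R_0}}$. In each item the boundary is given a constant signature ($\chi\equiv 1$ or $\chi\equiv-1$). (i) For all $n\ge1$, all balls $B_R$ are calibrable. (ii) For all $n\ge1$ with $n\ne2$, all complements of balls $\mathbb{R}^n\setminus\overline{B_R}$ are calibrable. (iii) If $n=2$, no complement of a ball $\mathbb{R}^2\setminus\overline{B_R}$ is calibrable. (iv) For all $n\ge1$ with $n\neq2$, all annuli $A_{R_0}^{R_1}$ are calibrable. (v) If $n=2$, there exists $Q_*>1$ such that an annulus $A_{R_0}^{R_1}$ is calibrable if and only if $R_1/R_0\le Q_*$.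
   Context: Let $U\subset\mathbb{R}^n$ be a smooth open set with exterior unit normal $\nu$ on $\partial U$. A signature for $U$ is a continuous function $\chi:\partial U\to\{-1,1\}$. Let $\kappa=\operatorname{div}\nu$ on $\partial U$ denote the sum of the principal curvatures of $\partial U$ (so $\kappa=(n-1)/R$ on $\partial B_R$ for $U=B_R$ and $\kappa=-(n-1)/R$ for $U=\mathbb{R}^n\setminus\overline{B_R}$). We say that $U$ is ($D^{-1}$-)calibrable with signature $\chi$ if there exists $Z_0\in L^\infty(U;\mathbb{R}^n)$ with $\nabla\operatorname{div}Z_0\in L^2(U;\mathbb{R}^n)$ such that $|Z_0|\le1$ a.e. in $U$; $\nu\cdot Z_0=\chi$ and $\operatorname{div}Z_0=\chi\kappa$ on $\partial U$ (in the sense of traces); and $\Delta\operatorname{div}Z_0$ is constant in $U$. *)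

theory Defs
  imports "HOL-Analysis.Analysis"
begin

primrec C_k_on :: "nat \<Rightarrow> 'a::euclidean_space set \<Rightarrow> ('a \<Rightarrow> 'b::real_normed_vector) \<Rightarrow> bool" where
  "C_k_on 0 S f \<longleftrightarrow> continuous_on S f"
| "C_k_on (Suc k) S f \<longleftrightarrow>
     (\<forall>x\<in>S. f differentiable (at x)) \<and> (\<forall>v. C_k_on k S (\<lambda>x. frechet_derivative f (at x) v))"

definition smooth_on :: "'a::euclidean_space set \<Rightarrow> ('a \<Rightarrow> 'b::real_normed_vector) \<Rightarrow> bool" where
  "smooth_on S f \<longleftrightarrow> (\<forall>k. C_k_on k S f)"

definition grad :: "('a::euclidean_space \<Rightarrow> real) \<Rightarrow> 'a \<Rightarrow> 'a" where
  "grad f x = (\<Sum>i\<in>Basis. frechet_derivative f (at x) i *\<^sub>R i)"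

definition divergence :: "('a::euclidean_space \<Rightarrow> 'a) \<Rightarrow> 'a \<Rightarrow> real" where
  "divergence F x = (\<Sum>i\<in>Basis. frechet_derivative F (at x) i \<bullet> i)"

definition laplacian :: "('a::euclidean_space \<Rightarrow> real) \<Rightarrow> 'a \<Rightarrow> real" where
  "laplacian f x = divergence (grad f) x"

definition test_function :: "'a::euclidean_space set \<Rightarrow> ('a \<Rightarrow> 'b::real_normed_vector) \<Rightarrow> bool" where
  "test_function U \<phi> \<longleftrightarrow> smooth_on UNIV \<phi> \<and>
     compact (closure {x. \<phi> x \<noteq> 0}) \<and> closure {x. \<phi> x \<noteq> 0} \<subseteq> U"

definition local_defining_function ::
    "'a::euclidean_space set \<Rightarrow> 'a \<Rightarrow> 'a set \<Rightarrow> ('a \<Rightarrow> real) \<Rightarrow> bool" where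
  "local_defining_function U p V f \<longleftrightarrow> open V \<and> p \<in> V \<and> smooth_on V f \<and>
     (\<forall>x\<in>V. grad f x \<noteq> 0) \<and> U \<inter> V = {x \<in> V. f x < 0}"

definition smooth_open_set :: "'a::euclidean_space set \<Rightarrow> bool" where
  "smooth_open_set U \<longleftrightarrow> open U \<and> (\<forall>p\<in>frontier U. \<exists>V f. local_defining_function U p V f)"

definition outer_normal :: "'a::euclidean_space set \<Rightarrow> 'a \<Rightarrow> 'a" where
  "outer_normal U p =
     (THE v. \<exists>V f. local_defining_function U p V f \<and> v = grad f p /\<^sub>R norm (grad f p))"

text \<open>
  The divergence of the normal is that of a local extension by unit vectors. It does not depend
  on the extension \<open>N\<close>: the tangential derivatives of \<open>N\<close> at \<open>p\<close> are determined by the values on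
  the boundary, and the normal derivative is orthogonal to \<open>N p\<close> because \<open>N\<close> has constant length.
\<close>

definition mean_curvature :: "'a::euclidean_space set \<Rightarrow> 'a \<Rightarrow> real" where
  "mean_curvature U p =
     (THE k. \<exists>V N. open V \<and> p \<in> V \<and> smooth_on V N \<and> (\<forall>x\<in>V. norm (N x) = 1) \<and>
        (\<forall>x\<in>V \<inter> frontier U. N x = outer_normal U x) \<and> k = divergence N p)"

text \<open>
  The library has no \<open>(n-1)\<close>-dimensional surface measure. As in the theory of sets of finite
  perimeter, it is obtained from the Gauss--Green formula: for a smooth open set the
  \<open>(n-1)\<close>-dimensional Hausdorff measure restricted to the boundary is the only locally finite Borel
  measure concentrated on the boundary with this property. In dimension one it is the counting
  measure on the boundary points.
\<close>

definition is_surface_measure :: "'a::euclidean_space set \<Rightarrow> 'a measure \<Rightarrow> bool" where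
  "is_surface_measure U \<sigma> \<longleftrightarrow>
     sets \<sigma> = sets borel \<and> (\<forall>K. compact K \<longrightarrow> emeasure \<sigma> K < \<infinity>) \<and>
     emeasure \<sigma> (- frontier U) = 0 \<and>
     (\<forall>\<psi> :: 'a \<Rightarrow> 'a. test_function UNIV \<psi> \<longrightarrow>
        (LINT x|lebesgue_on U. divergence \<psi> x) =
        (LINT x:frontier U|\<sigma>. \<psi> x \<bullet> outer_normal U x))"

definition surface_measure :: "'a::euclidean_space set \<Rightarrow> 'a measure" where
  "surface_measure U = (SOME \<sigma>. is_surface_measure U \<sigma>)"

definition locally_integrable_on ::
    "'a::euclidean_space set \<Rightarrow> ('a \<Rightarrow> 'b::euclidean_space) \<Rightarrow> bool" where
  "locally_integrable_on U f \<longleftrightarrow> (\<forall>K. compact K \<and> K \<subseteq> U \<longrightarrow> integrable (lebesgue_on K) f)"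

definition square_integrable_on ::
    "'a::euclidean_space set \<Rightarrow> ('a \<Rightarrow> 'b::euclidean_space) \<Rightarrow> bool" where
  "square_integrable_on U f \<longleftrightarrow> f \<in> borel_measurable (lebesgue_on U) \<and>
     integrable (lebesgue_on U) (\<lambda>x. (norm (f x))\<^sup>2)"

definition weak_divergence ::
    "'a::euclidean_space set \<Rightarrow> ('a \<Rightarrow> 'a) \<Rightarrow> ('a \<Rightarrow> real) \<Rightarrow> bool" where
  "weak_divergence U Z w \<longleftrightarrow> locally_integrable_on U Z \<and> locally_integrable_on U w \<and>
     (\<forall>\<phi>. test_function U \<phi> \<longrightarrow>
        (LINT x|lebesgue_on U. Z x \<bullet> grad \<phi> x) = - (LINT x|lebesgue_on U. w x * \<phi> x))"

definition weak_gradient ::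
    "'a::euclidean_space set \<Rightarrow> ('a \<Rightarrow> real) \<Rightarrow> ('a \<Rightarrow> 'a) \<Rightarrow> bool" where
  "weak_gradient U w G \<longleftrightarrow> locally_integrable_on U w \<and> locally_integrable_on U G \<and>
     (\<forall>\<psi> :: 'a \<Rightarrow> 'a. test_function U \<psi> \<longrightarrow>
        (LINT x|lebesgue_on U. w x * divergence \<psi> x) = - (LINT x|lebesgue_on U. G x \<bullet> \<psi> x))"

definition weak_laplacian ::
    "'a::euclidean_space set \<Rightarrow> ('a \<Rightarrow> real) \<Rightarrow> ('a \<Rightarrow> real) \<Rightarrow> bool" where
  "weak_laplacian U w h \<longleftrightarrow> locally_integrable_on U w \<and> locally_integrable_on U h \<and>
     (\<forall>\<phi>. test_function U \<phi> \<longrightarrow>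
        (LINT x|lebesgue_on U. w x * laplacian \<phi> x) = (LINT x|lebesgue_on U. h x * \<phi> x))"

text \<open>
  Traces are given by Green's formula against test functions that need not vanish on the boundary.
  This needs integrability up to the boundary, on \<open>U \<inter> K\<close> with \<open>K\<close> compact. For smooth \<open>U\<close> this is
  no restriction on a function whose weak gradient is square integrable on \<open>U\<close>.
\<close>

definition integrable_up_to_boundary ::
    "'a::euclidean_space set \<Rightarrow> ('a \<Rightarrow> 'b::euclidean_space) \<Rightarrow> bool" where
  "integrable_up_to_boundary U f \<longleftrightarrow> (\<forall>K. compact K \<longrightarrow> integrable (lebesgue_on (U \<inter> K)) f)"

text \<open>\<open>w\<close> is the weak divergence of \<open>Z\<close>, and \<open>g\<close> the trace of its normal component.\<close>

definition has_normal_trace ::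
    "'a::euclidean_space set \<Rightarrow> ('a \<Rightarrow> 'a) \<Rightarrow> ('a \<Rightarrow> real) \<Rightarrow> ('a \<Rightarrow> real) \<Rightarrow> bool" where
  "has_normal_trace U Z w g \<longleftrightarrow>
     integrable_up_to_boundary U Z \<and> integrable_up_to_boundary U w \<and>
     (\<forall>\<phi>. test_function UNIV \<phi> \<longrightarrow>
        (LINT x|lebesgue_on U. w x * \<phi> x + Z x \<bullet> grad \<phi> x) =
        (LINT x:frontier U|surface_measure U. g x * \<phi> x))"

text \<open>\<open>G\<close> is the weak gradient of \<open>w\<close>, and \<open>g\<close> the trace of \<open>w\<close>.\<close>

definition has_trace ::
    "'a::euclidean_space set \<Rightarrow> ('a \<Rightarrow> real) \<Rightarrow> ('a \<Rightarrow> 'a) \<Rightarrow> ('a \<Rightarrow> real) \<Rightarrow> bool" where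
  "has_trace U w G g \<longleftrightarrow>
     integrable_up_to_boundary U w \<and> integrable_up_to_boundary U G \<and>
     (\<forall>\<psi> :: 'a \<Rightarrow> 'a. test_function UNIV \<psi> \<longrightarrow>
        (LINT x|lebesgue_on U. w x * divergence \<psi> x + G x \<bullet> \<psi> x) =
        (LINT x:frontier U|surface_measure U. g x * (\<psi> x \<bullet> outer_normal U x)))"

definition signature_on :: "'a::euclidean_space set \<Rightarrow> ('a \<Rightarrow> real) \<Rightarrow> bool" where
  "signature_on U \<eta> \<longleftrightarrow> continuous_on (frontier U) \<eta> \<and> \<eta> ` frontier U \<subseteq> {-1, 1}"

text \<open>Here \<open>w\<close> is \<open>div Z\<close> and \<open>G\<close> is its gradient. The bound on \<open>norm (Z x)\<close> subsumes that \<open>Z\<close> is essentially bounded.\<close>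

definition calibrable :: "'a::euclidean_space set \<Rightarrow> ('a \<Rightarrow> real) \<Rightarrow> bool" where
  "calibrable U \<eta> \<longleftrightarrow> smooth_open_set U \<and> signature_on U \<eta> \<and>
     (\<exists>(Z :: 'a \<Rightarrow> 'a) w G c.
        Z \<in> borel_measurable (lebesgue_on U) \<and>
        (AE x in lebesgue_on U. norm (Z x) \<le> 1) \<and>
        weak_divergence U Z w \<and>
        weak_gradient U w G \<and> square_integrable_on U G \<and>
        has_normal_trace U Z w \<eta> \<and>
        has_trace U w G (\<lambda>x. \<eta> x * mean_curvature U x) \<and>
        weak_laplacian U w (\<lambda>_. c))"

definition annulus :: "real \<Rightarrow> real \<Rightarrow> 'a::euclidean_space set" where
  "annulus R\<^sub>0 R\<^sub>1 = ball 0 R\<^sub>1 - cball 0 R\<^sub>0"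

end

theory Submission
  imports Defs
begin

text \<open>
  On a radial domain one takes \<open>Z = z(r) x / r\<close>. Then \<open>div Z = z' + (n - 1) z / r\<close>, and its Laplacian is
  constant when its derivative is \<open>b r\<^bsup>1-n\<^esup> + c r\<close>. The constants are found from the traces, and \<open>|z| \<le> 1\<close>
  follows from a maximum principle for \<open>z'\<close>. On exterior domains square integrability of the gradient forces
  \<open>c = 0\<close>, and in the plane also \<open>b = 0\<close> because \<open>1/r\<close> just fails to be square integrable at infinity. On
  annuli in the plane the profile stays above \<open>-1\<close> exactly when its second derivative at the inner radius is
  nonnegative, which is a condition on the ratio of the radii with a single threshold.

  No symmetrization of \<open>Z\<close> is needed for the negative results: testing the weak equations with radial functions
  determines the flux of \<open>Z\<close> through every sphere. In an annulus with too large a ratio this flux is too large for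
  a field of length at most one. In the exterior domain, radial cut-offs of the logarithm at distance \<open>N\<close>
  would make the length of the circle \<open>O(1/N)\<close>.
\<close>

section \<open>Calculus of smooth functions\<close>

text \<open>Normal, curvature and surface measure are given only by choice or description operators,
  so they must first be identified on radial domains. The surface measure is obtained by projecting
  Lebesgue measure radially onto spheres. Its Gauss-Green formula on balls comes from translation
  invariance and scaling of Lebesgue measure, and is what the boundary integrals rely on afterwards.
  The profile has four constants, matched on an annulus by two values of z and two of div Z. These
  conditions make z' vanish at both radii, which is why the second derivative is the first quantity
  that can decide whether z leaves [-1,1]. For nonexistence the obstacle is that the Laplace
  equation is tested only inside the domain, and the trace of div Z gives its values but not its
  normal derivative. Test functions that vanish on the boundary, but whose gradient does not, see
  the trace without seeing that unknown flux. On annuli they come from a radial Poisson problem; on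
  the exterior domain they arise by subtracting a cut-off far away.\<close>

lemma frechet_derivative_eqI:
  "(f has_derivative D) (at x) \<Longrightarrow> frechet_derivative f (at x) = D"
  by (metis frechet_derivative_at)

lemma C_k_on_cong:
  assumes "open S" "\<And>x. x \<in> S \<Longrightarrow> f x = g x"
  shows "C_k_on k S f = C_k_on k S g"
  using assms(2)
proof (induction k arbitrary: f g)
  case 0
  then show ?case using continuous_on_cong by (metis C_k_on.simps(1))
next
  case (Suc k)
  have d: "(f has_derivative D) (at x) = (g has_derivative D) (at x)" if "x \<in> S" for x D
    using has_derivative_transform_within_open[of f D x UNIV S g]
      has_derivative_transform_within_open[of g D x UNIV S f] that Suc.prems assms(1) by auto
  have "f differentiable (at x) \<longleftrightarrow> g differentiable (at x)" if "x \<in> S" for x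
    using d[OF that] by (auto simp: differentiable_def)
  moreover have "frechet_derivative f (at x) = frechet_derivative g (at x)" if "x \<in> S" for x
    using d[OF that] by (simp add: frechet_derivative_def)
  moreover have "C_k_on k S (\<lambda>x. frechet_derivative f (at x) v) =
      C_k_on k S (\<lambda>x. frechet_derivative g (at x) v)" for v
    by (rule Suc.IH) (simp add: calculation)
  ultimately show ?case by simp
qed

lemma C_k_on_subset: "C_k_on k T f \<Longrightarrow> S \<subseteq> T \<Longrightarrow> C_k_on k S f"
proof (induction k arbitrary: f)
  case (Suc k)
  then show ?case by (auto simp: subset_iff)
qed (auto intro: continuous_on_subset)

text \<open>\<open>frechet_derivative\<close> is a choice; on \<open>S\<close> it agrees with any
  supplied family \<open>D\<close>, so the closure properties below follow from the ordinary
  derivative rules.\<close>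

lemma C_k_on_SucI:
  assumes "open S" "\<And>x. x \<in> S \<Longrightarrow> (f has_derivative D x) (at x)"
    and "\<And>v. C_k_on k S (\<lambda>x. D x v)"
  shows "C_k_on (Suc k) S f"
proof -
  have "frechet_derivative f (at x) = D x" if "x \<in> S" for x
    using assms(2)[OF that] by (rule frechet_derivative_eqI)
  then have "C_k_on k S (\<lambda>x. frechet_derivative f (at x) v) = C_k_on k S (\<lambda>x. D x v)" for v
    by (intro C_k_on_cong assms) simp
  moreover have "f differentiable (at x)" if "x \<in> S" for x
    using assms(2)[OF that] by (rule differentiableI)
  ultimately show ?thesis using assms(3) by simp
qed

lemma C_k_on_SucD:
  assumes "C_k_on (Suc k) S f"
  shows "x \<in> S \<Longrightarrow> (f has_derivative frechet_derivative f (at x)) (at x)"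
    and "C_k_on k S (\<lambda>x. frechet_derivative f (at x) v)"
  using assms by (auto simp: frechet_derivative_works[symmetric])

lemma C_k_on_Suc_imp: "C_k_on (Suc k) S f \<Longrightarrow> C_k_on k S f"
proof (induction k arbitrary: f)
  case 0
  then show ?case
    by (auto intro!: continuous_at_imp_continuous_on differentiable_imp_continuous_within)
next
  case (Suc k)
  then show ?case by (metis C_k_on.simps(2))
qed

lemma C_k_on_const [simp]: "open S \<Longrightarrow> C_k_on k S (\<lambda>x. c)"
proof (induction k arbitrary: c)
  case (Suc k)
  show ?case by (rule C_k_on_SucI[where D="\<lambda>_ _. 0"]) (simp_all add: Suc)
qed simp

lemma C_k_on_bounded_linear: 
  assumes "bounded_linear h" "open S"
  shows "C_k_on k S h"
proof (cases k)
  case 0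
  then show ?thesis using assms linear_continuous_on by auto
next
  case (Suc k)
  show ?thesis unfolding Suc
    by (rule C_k_on_SucI[where D="\<lambda>_. h"]) (simp_all add: assms bounded_linear_imp_has_derivative)
qed

lemma C_k_on_bounded_linear_comp:
  assumes "bounded_linear h" "open S"
  shows "C_k_on k S f \<Longrightarrow> C_k_on k S (\<lambda>x. h (f x))"
proof (induction k arbitrary: f)
  case 0
  then show ?case using assms linear_continuous_on[of h UNIV]
    by (auto intro: continuous_on_compose2)
next
  case (Suc k)
  show ?case
    by (rule C_k_on_SucI[OF assms(2), where D="\<lambda>x v. h (frechet_derivative f (at x) v)"])
       (rule bounded_linear.has_derivative[OF assms(1)] Suc.IH C_k_on_SucD[OF Suc.prems] | assumption)+
qed

lemma C_k_on_add:
  assumes "open S"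
  shows "C_k_on k S f \<Longrightarrow> C_k_on k S g \<Longrightarrow> C_k_on k S (\<lambda>x. f x + g x)"
proof (induction k arbitrary: f g)
  case (Suc k)
  show ?case
    by (rule C_k_on_SucI[OF assms, where D="\<lambda>x v. frechet_derivative f (at x) v + frechet_derivative g (at x) v"])
       (rule has_derivative_add Suc.IH C_k_on_SucD[OF Suc.prems(1)] C_k_on_SucD[OF Suc.prems(2)] | assumption)+
qed (auto intro: continuous_intros)

text \<open>The Leibniz rule stays within the class: each summand is a bilinear product of one
  factor with the derivative of the other, both of class \<open>k\<close>. Hence the induction over
  arbitrary \<open>f\<close> and \<open>g\<close>.\<close>

lemma C_k_on_bilinear:
  assumes "bounded_bilinear b" "open S"
  shows "C_k_on k S f \<Longrightarrow> C_k_on k S g \<Longrightarrow> C_k_on k S (\<lambda>x. b (f x) (g x))"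
proof (induction k arbitrary: f g)
  case 0
  then show ?case using bounded_bilinear.continuous_on[OF assms(1)] by auto
next
  case (Suc k)
  show ?case
    by (rule C_k_on_SucI[OF assms(2), where D="\<lambda>x v. b (f x) (frechet_derivative g (at x) v) + b (frechet_derivative f (at x) v) (g x)"])
       (rule bounded_bilinear.FDERIV[OF assms(1)] C_k_on_add assms(2) Suc.IH
          C_k_on_SucD[OF Suc.prems(1)] C_k_on_SucD[OF Suc.prems(2)]
          C_k_on_Suc_imp[OF Suc.prems(1)] C_k_on_Suc_imp[OF Suc.prems(2)] | assumption)+
qed

text \<open>The derivative is \<open>h'\<close> after \<open>f\<close>, times the derivative of
  \<open>f\<close>. The induction changes only the outer function, so \<open>h\<close> alone is
  arbitrary.\<close>

lemma C_k_on_comp_real: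
  fixes h :: "real \<Rightarrow> real"
  assumes "open S" "open T"
  shows "C_k_on k S f \<Longrightarrow> C_k_on k T h \<Longrightarrow> f ` S \<subseteq> T \<Longrightarrow> C_k_on k S (\<lambda>x. h (f x))"
proof (induction k arbitrary: h)
  case 0
  then show ?case by (auto intro: continuous_on_compose2)
next
  case (Suc k)
  \<comment> \<open>On the line a derivative is multiplication by its value at 1. This turns the
    chain rule into a product, to which \<open>C_k_on_bilinear\<close> applies.\<close>
  have lin: "frechet_derivative h (at (f x)) v = frechet_derivative h (at (f x)) 1 * v" if "x \<in> S" for x v
  proof -
    have "linear (frechet_derivative h (at (f x)))"
      using C_k_on_SucD(1)[OF Suc.prems(2), of "f x"] that Suc.prems(3)
      by (meson has_derivative_linear image_subset_iff)
    from linear_cmul[OF this, of v 1] show ?thesis by simp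
  qed
  show ?case
  proof (rule C_k_on_SucI[OF assms(1), where D="\<lambda>x v. frechet_derivative h (at (f x)) 1 * frechet_derivative f (at x) v"])
    fix x assume x: "x \<in> S"
    have "((\<lambda>x. h (f x)) has_derivative (\<lambda>v. frechet_derivative h (at (f x)) (frechet_derivative f (at x) v))) (at x)"
      using x Suc.prems(3)
      by (intro has_derivative_compose[OF C_k_on_SucD(1)[OF Suc.prems(1) x] C_k_on_SucD(1)[OF Suc.prems(2)]]) blast
    then show "((\<lambda>x. h (f x)) has_derivative (\<lambda>v. frechet_derivative h (at (f x)) 1 * frechet_derivative f (at x) v)) (at x)"
      by (simp only: lin[OF x, symmetric])
  next
    fix v
    have "C_k_on k S (\<lambda>x. frechet_derivative h (at (f x)) 1)"
      by (rule Suc.IH[OF C_k_on_Suc_imp[OF Suc.prems(1)] C_k_on_SucD(2)[OF Suc.prems(2)] Suc.prems(3)])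
    then show "C_k_on k S (\<lambda>x. frechet_derivative h (at (f x)) 1 * frechet_derivative f (at x) v)"
      by (rule C_k_on_bilinear[OF bounded_bilinear_mult assms(1) _ C_k_on_SucD(2)[OF Suc.prems(1)]])
  qed
qed

lemma C_k_on_Un:
  assumes "open S" "open T"
  shows "C_k_on k S f \<Longrightarrow> C_k_on k T f \<Longrightarrow> C_k_on k (S \<union> T) f"
  by (induction k arbitrary: f) (auto simp: continuous_on_open_Un assms)

lemma smooth_onI: "(\<And>k. C_k_on k S f) \<Longrightarrow> smooth_on S f"
  by (simp add: smooth_on_def)

lemma smooth_on_cong:
  "open S \<Longrightarrow> (\<And>x. x \<in> S \<Longrightarrow> f x = g x) \<Longrightarrow> smooth_on S f = smooth_on S g"
  using C_k_on_cong unfolding smooth_on_def by blast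

lemma smooth_on_subset: "smooth_on T f \<Longrightarrow> S \<subseteq> T \<Longrightarrow> smooth_on S f"
  by (auto simp: smooth_on_def intro: C_k_on_subset)

lemma smooth_on_Un: "open S \<Longrightarrow> open T \<Longrightarrow> smooth_on S f \<Longrightarrow> smooth_on T f \<Longrightarrow> smooth_on (S \<union> T) f"
  by (auto simp: smooth_on_def intro: C_k_on_Un)

lemma smooth_on_const: "open S \<Longrightarrow> smooth_on S (\<lambda>x. c)"
  by (auto simp: smooth_on_def)

lemma smooth_on_bounded_linear: "bounded_linear h \<Longrightarrow> open S \<Longrightarrow> smooth_on S h"
  by (auto simp: smooth_on_def C_k_on_bounded_linear)

lemma smooth_on_bounded_linear_comp:
  "bounded_linear h \<Longrightarrow> open S \<Longrightarrow> smooth_on S f \<Longrightarrow> smooth_on S (\<lambda>x. h (f x))"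
  by (auto simp: smooth_on_def C_k_on_bounded_linear_comp)

lemma smooth_on_id: "open S \<Longrightarrow> smooth_on S (\<lambda>x. x)"
  by (rule smooth_on_bounded_linear[OF bounded_linear_ident])

lemma smooth_on_add: "open S \<Longrightarrow> smooth_on S f \<Longrightarrow> smooth_on S g \<Longrightarrow> smooth_on S (\<lambda>x. f x + g x)"
  by (auto simp: smooth_on_def C_k_on_add)

lemma smooth_on_scaleR:
  "open S \<Longrightarrow> smooth_on S f \<Longrightarrow> smooth_on S g \<Longrightarrow> smooth_on S (\<lambda>x. f x *\<^sub>R g x)"
  by (auto simp: smooth_on_def intro: C_k_on_bilinear[OF bounded_bilinear_scaleR])

lemma smooth_on_mult:
  fixes f g :: "'a::euclidean_space \<Rightarrow> real"
  shows "open S \<Longrightarrow> smooth_on S f \<Longrightarrow> smooth_on S g \<Longrightarrow> smooth_on S (\<lambda>x. f x * g x)"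
  by (auto simp: smooth_on_def intro: C_k_on_bilinear[OF bounded_bilinear_mult])

lemma smooth_on_inner:
  "open S \<Longrightarrow> smooth_on S f \<Longrightarrow> smooth_on S g \<Longrightarrow> smooth_on S (\<lambda>x. f x \<bullet> g x)"
  by (auto simp: smooth_on_def intro: C_k_on_bilinear[OF bounded_bilinear_inner])

lemma smooth_on_uminus: "open S \<Longrightarrow> smooth_on S f \<Longrightarrow> smooth_on S (\<lambda>x. - f x)"
  by (rule smooth_on_bounded_linear_comp[OF bounded_linear_minus[OF bounded_linear_ident]])

lemma smooth_on_diff:
  "open S \<Longrightarrow> smooth_on S f \<Longrightarrow> smooth_on S g \<Longrightarrow> smooth_on S (\<lambda>x. f x - g x)"
  using smooth_on_add[of S f "\<lambda>x. - g x"] smooth_on_uminus by auto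

lemma smooth_on_sum:
  "open S \<Longrightarrow> (\<And>i. i \<in> I \<Longrightarrow> smooth_on S (f i)) \<Longrightarrow> smooth_on S (\<lambda>x. \<Sum>i\<in>I. f i x)"
  by (induction I rule: infinite_finite_induct) (auto simp: smooth_on_const smooth_on_add)

lemma smooth_on_power:
  fixes f :: "'a::euclidean_space \<Rightarrow> real"
  shows "open S \<Longrightarrow> smooth_on S f \<Longrightarrow> smooth_on S (\<lambda>x. f x ^ m)"
  by (induction m) (auto simp: smooth_on_const smooth_on_mult)

lemma smooth_on_comp_real:
  fixes h :: "real \<Rightarrow> real"
  shows "open S \<Longrightarrow> smooth_on S f \<Longrightarrow> open T \<Longrightarrow> smooth_on T h \<Longrightarrow> (\<And>x. x \<in> S \<Longrightarrow> f x \<in> T) \<Longrightarrow>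
     smooth_on S (\<lambda>x. h (f x))"
  unfolding smooth_on_def using C_k_on_comp_real[of S T _ f h] by (simp add: image_subset_iff)

lemma smooth_on_has_derivative:
  "smooth_on S f \<Longrightarrow> x \<in> S \<Longrightarrow> (f has_derivative frechet_derivative f (at x)) (at x)"
  using C_k_on_SucD(1) unfolding smooth_on_def by blast

lemma smooth_on_frechet_derivative:
  "smooth_on S f \<Longrightarrow> smooth_on S (\<lambda>x. frechet_derivative f (at x) v)"
  using C_k_on_SucD(2) unfolding smooth_on_def by blast

lemma smooth_on_continuous_on: "smooth_on S f \<Longrightarrow> continuous_on S f"
  unfolding smooth_on_def using C_k_on.simps(1) by blast

lemma smooth_on_grad: "open S \<Longrightarrow> smooth_on S f \<Longrightarrow> smooth_on S (grad f)"
  unfolding grad_def[abs_def]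
  by (intro smooth_on_sum smooth_on_scaleR smooth_on_frechet_derivative smooth_on_const) auto

lemma smooth_on_divergence: "open S \<Longrightarrow> smooth_on S f \<Longrightarrow> smooth_on S (divergence f)"
  unfolding divergence_def[abs_def]
  by (intro smooth_on_sum smooth_on_inner smooth_on_frechet_derivative smooth_on_const) auto

lemma smooth_on_deriv:
  fixes f :: "real \<Rightarrow> real"
  assumes "open S" "smooth_on S f"
  shows "smooth_on S (deriv f)" and "x \<in> S \<Longrightarrow> (f has_real_derivative deriv f x) (at x)"
proof -
  have *: "(f has_real_derivative frechet_derivative f (at x) 1) (at x)" if "x \<in> S" for x
  proof -
    have d: "(f has_derivative frechet_derivative f (at x)) (at x)"
      using assms that smooth_on_has_derivative by blast
    have "frechet_derivative f (at x) = (*) (frechet_derivative f (at x) 1)"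
    proof
      fix v
      show "frechet_derivative f (at x) v = frechet_derivative f (at x) 1 * v"
        using linear_cmul[OF has_derivative_linear[OF d], of v 1] by (simp add: mult.commute)
    qed
    with d show ?thesis unfolding has_field_derivative_def by simp
  qed
  have eq: "deriv f x = frechet_derivative f (at x) 1" if "x \<in> S" for x
    by (rule DERIV_imp_deriv[OF *[OF that]])
  have "smooth_on S (\<lambda>x. frechet_derivative f (at x) 1)"
    by (rule smooth_on_frechet_derivative[OF assms(2)])
  then show "smooth_on S (deriv f)"
    by (subst smooth_on_cong[OF assms(1) eq])
  show "x \<in> S \<Longrightarrow> (f has_real_derivative deriv f x) (at x)"
    using *[of x] eq[of x] by simp
qed

section \<open>Smoothness on the real line and of the norm\<close>

lemma C_k_on_Suc_realI:
  fixes f :: "real \<Rightarrow> real"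
  assumes "open S" "\<And>x. x \<in> S \<Longrightarrow> (f has_real_derivative f' x) (at x)" "C_k_on k S f'"
  shows "C_k_on (Suc k) S f"
proof (rule C_k_on_SucI[where D="\<lambda>x v. f' x * v"])
  show "C_k_on k S (\<lambda>x. f' x * v)" for v
    by (rule C_k_on_bilinear[OF bounded_bilinear_mult]) (simp_all add: assms)
qed (use assms in \<open>auto simp: has_field_derivative_def\<close>)

lemma smooth_on_realI:
  fixes f :: "real \<Rightarrow> real"
  assumes "open S" "\<And>x. x \<in> S \<Longrightarrow> (f has_real_derivative f' x) (at x)" "smooth_on S f'"
  shows "smooth_on S f"
proof (rule smooth_onI)
  fix k
  have "C_k_on (Suc k) S f"
    using assms C_k_on_Suc_realI unfolding smooth_on_def by blast
  then show "C_k_on k S f" by (rule C_k_on_Suc_imp)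
qed

text \<open>Bootstrapping through the equation f' = - f f: if the inverse is of class
  \<open>k\<close>, so is its derivative.\<close>

lemma smooth_on_inverse: "smooth_on {0<..} (inverse :: real \<Rightarrow> real)"
proof (rule smooth_onI)
  fix k show "C_k_on k {0<..} (inverse :: real \<Rightarrow> real)"
  proof (induction k)
    case 0
    show ?case by (auto intro!: continuous_intros)
  next
    case (Suc k)
    have 1: "C_k_on k {0<..} (\<lambda>x::real. inverse x * inverse x)"
      by (rule C_k_on_bilinear[OF bounded_bilinear_mult]) (simp_all add: Suc)
    have 2: "C_k_on k {0<..} (\<lambda>x::real. - (inverse x * inverse x))"
      by (rule C_k_on_bounded_linear_comp[OF bounded_linear_minus[OF bounded_linear_ident] _ 1]) simp
    show ?case
    proof (rule C_k_on_Suc_realI[OF _ _ 2])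
      show "(inverse has_real_derivative - (inverse x * inverse x)) (at x)" if "x \<in> {0<..}" for x :: real
        using that DERIV_inverse[of x] by (simp add: power2_eq_square)
    qed simp
  qed
qed

lemma smooth_on_ln: "smooth_on {0<..} (ln :: real \<Rightarrow> real)"
  by (rule smooth_on_realI[OF _ DERIV_ln smooth_on_inverse]) auto

text \<open>The same bootstrap with f' = 1 / (2 f): the derivative is a composition of
  \<open>inverse\<close> with \<open>sqrt\<close> itself.\<close>

lemma smooth_on_sqrt: "smooth_on {0<..} sqrt"
proof (rule smooth_onI)
  fix k show "C_k_on k {0<..} sqrt"
  proof (induction k)
    case 0
    show ?case by (auto intro!: continuous_intros)
  next
    case (Suc k)
    have "C_k_on k {0<..} (inverse :: real \<Rightarrow> real)"
      using smooth_on_inverse unfolding smooth_on_def by simp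
    then have "C_k_on k {0<..} (\<lambda>x. inverse (sqrt x))"
      by (rule C_k_on_comp_real[OF _ _ Suc, rotated 2]) auto
    then have "C_k_on k {0<..} (\<lambda>x. inverse (sqrt x) / 2)"
      by (rule C_k_on_bounded_linear_comp[OF bounded_linear_divide, rotated]) simp
    then show ?case
      by (intro C_k_on_Suc_realI[where f'="\<lambda>x. inverse (sqrt x) / 2"]) (auto simp: DERIV_real_sqrt)
  qed
qed

lemma smooth_on_norm: "smooth_on (- {0}) (norm :: 'a::euclidean_space \<Rightarrow> real)"
  unfolding norm_eq_sqrt_inner
proof (rule smooth_on_comp_real[OF _ _ _ smooth_on_sqrt])
  show "smooth_on (- {0}) (\<lambda>x::'a. x \<bullet> x)"
    by (intro smooth_on_inner smooth_on_id) auto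
qed auto

section \<open>Smooth cut-offs\<close>

text \<open>The family is closed under differentiation: the derivative of member \<open>k\<close> is
  \<open>-k\<close> times member \<open>k+1\<close> plus member \<open>k+2\<close>.\<close>

definition flat :: "nat \<Rightarrow> real \<Rightarrow> real" where
  "flat k x = (if x \<le> 0 then 0 else inverse x ^ k * exp (- inverse x))"

text \<open>The substitution x -> 1/x reduces this to the growth of exp against powers at
  infinity.\<close>

lemma flat_at_right: "((\<lambda>x. inverse x ^ k * exp (- inverse x)) \<longlongrightarrow> (0::real)) (at_right 0)"
proof -
  have "((\<lambda>x::real. x ^ k / exp x) \<longlongrightarrow> 0) at_top"
    by (rule tendsto_power_div_exp_0)
  then have "((\<lambda>x::real. inverse x ^ k / exp (inverse x)) \<longlongrightarrow> 0) (at_right 0)"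
    by (rule filterlim_compose[OF _ filterlim_inverse_at_top_right])
  then show ?thesis by (simp add: exp_minus divide_inverse)
qed

lemma has_real_derivative_flat:
  "(flat k has_real_derivative flat (k + 2) x - real k * flat (k + 1) x) (at x)"
proof (cases x "0::real" rule: linorder_cases)
  case less
  have "((\<lambda>x. 0) has_real_derivative 0) (at x)" by simp
  then have "(flat k has_real_derivative 0) (at x)"
    by (rule has_field_derivative_transform_within_open[where S="{..<0}"]) (use less in \<open>auto simp: flat_def\<close>)
  then show ?thesis using less by (simp add: flat_def)
next
  case greater
  have "((\<lambda>x. inverse x ^ k * exp (- inverse x)) has_real_derivative
      flat (k + 2) x - real k * flat (k + 1) x) (at x)"
  proof -
    have inv: "(inverse has_real_derivative - (inverse x * inverse x)) (at x)"
      using greater DERIV_inverse[of x] by (simp add: power2_eq_square)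
    have "((\<lambda>x. inverse x ^ k * exp (- inverse x)) has_real_derivative
      real k * inverse x ^ (k - 1) * (- (inverse x * inverse x)) * exp (- inverse x)
        + inverse x ^ k * (exp (- inverse x) * (inverse x * inverse x))) (at x)"
      by (rule derivative_eq_intros inv refl | simp)+
    then show ?thesis
      using greater by (cases k) (simp_all add: flat_def algebra_simps)
  qed
  then show ?thesis
    by (rule has_field_derivative_transform_within_open[where S="{0<..}"]) (use greater in \<open>auto simp: flat_def\<close>)
next
  case equal
  \<comment> \<open>From the right the difference quotient at 0 is the next member
    \<open>flat (k + 1)\<close>, which tends to 0; from the left it is 0.\<close>
  have "((\<lambda>h. flat k h / h) \<longlongrightarrow> 0) (at_right 0)"
    by (rule Lim_transform_eventually[OF flat_at_right[of "Suc k"]])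
       (auto simp: eventually_at_filter flat_def divide_inverse)
  moreover have "((\<lambda>h. flat k h / h) \<longlongrightarrow> 0) (at_left 0)"
    by (rule Lim_transform_eventually[OF tendsto_const])
       (auto simp: eventually_at_filter flat_def)
  ultimately have "((\<lambda>h. flat k h / h) \<longlongrightarrow> 0) (at 0)"
    by (simp add: filterlim_split_at)
  then show ?thesis using equal by (simp add: DERIV_def flat_def)
qed

lemma smooth_on_flat: "smooth_on UNIV (flat m)"
proof (rule smooth_onI)
  fix k show "C_k_on k UNIV (flat m)"
  proof (induction k arbitrary: m)
    case 0
    have "isCont (flat m) x" for x
      using has_real_derivative_flat by (rule DERIV_isCont)
    then show ?case by (simp add: continuous_at_imp_continuous_on)
  next
    case (Suc k)
    have "C_k_on k UNIV (\<lambda>x. flat (m + 2) x + (- real m) * flat (m + 1) x)"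
      by (intro C_k_on_add C_k_on_bilinear[OF bounded_bilinear_mult] Suc C_k_on_const open_UNIV)
    then show ?case
      by (intro C_k_on_Suc_realI[OF _ has_real_derivative_flat]) simp_all
  qed
qed

text \<open>A monotone transition from 0 on the left of 0 to 1 on the right of 1. The denominator
  never vanishes, since \<open>x\<close> and \<open>1 - x\<close> are not both nonpositive.\<close>

definition smooth_step :: "real \<Rightarrow> real" where
  "smooth_step x = flat 0 x * inverse (flat 0 x + flat 0 (1 - x))"

lemma flat_0_pos: "0 < flat 0 x + flat 0 (1 - x)"
  by (auto simp: flat_def add_pos_pos)

lemma smooth_on_smooth_step: "smooth_on UNIV smooth_step"
proof -
  have 0: "smooth_on UNIV (\<lambda>x::real. 1 - x)"
    by (intro smooth_on_diff smooth_on_const smooth_on_id open_UNIV)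
  have 1: "smooth_on UNIV (\<lambda>x. flat 0 (1 - x))"
    by (rule smooth_on_comp_real[OF _ 0 open_UNIV smooth_on_flat]) auto
  have "smooth_on UNIV (\<lambda>x. inverse (flat 0 x + flat 0 (1 - x)))"
  proof (rule smooth_on_comp_real[OF _ _ _ smooth_on_inverse])
    show "smooth_on UNIV (\<lambda>x. flat 0 x + flat 0 (1 - x))"
      by (intro smooth_on_add 1 smooth_on_flat open_UNIV)
  qed (auto simp: flat_0_pos)
  then show ?thesis unfolding smooth_step_def[abs_def]
    by (intro smooth_on_mult smooth_on_flat) auto
qed

lemma smooth_step_0: "x \<le> 0 \<Longrightarrow> smooth_step x = 0"
  by (simp add: smooth_step_def flat_def)

lemma smooth_step_1: "x \<ge> 1 \<Longrightarrow> smooth_step x = 1"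
  by (simp add: smooth_step_def flat_def)

lemma flat_0_mono: "x \<le> y \<Longrightarrow> flat 0 x \<le> flat 0 y"
  by (auto simp: flat_def le_imp_inverse_le)

lemma flat_0_nonneg: "0 \<le> flat 0 x"
  by (auto simp: flat_def)

text \<open>Cross-multiplying cancels the common product \<open>flat 0 x * flat 0 y\<close>; what
  remains compares two products of monotone factors.\<close>

lemma smooth_step_mono: "x \<le> y \<Longrightarrow> smooth_step x \<le> smooth_step y"
proof -
  assume "x \<le> y"
  then have "flat 0 x * flat 0 (1 - y) \<le> flat 0 y * flat 0 (1 - x)"
    by (intro mult_mono flat_0_mono flat_0_nonneg) auto
  then show ?thesis
    using flat_0_pos[of x] flat_0_pos[of y]
    by (simp add: smooth_step_def divide_inverse[symmetric] divide_simps algebra_simps)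
qed

lemma smooth_step_bounds: "0 \<le> smooth_step x" "smooth_step x \<le> 1"
  using smooth_step_mono[of "min x 0" x] smooth_step_mono[of x "max x 1"] smooth_step_0[of "min x 0"]
    smooth_step_1[of "max x 1"] by auto

section \<open>Vector calculus\<close>

lemma grad_inner:
  assumes "(f has_derivative D) (at x)"
  shows "D v = grad f x \<bullet> v"
proof -
  have l: "linear D" using assms by (rule has_derivative_linear)
  have "D v = D (\<Sum>i\<in>Basis. (v \<bullet> i) *\<^sub>R i)" by (simp add: euclidean_representation)
  also have "\<dots> = (\<Sum>i\<in>Basis. (v \<bullet> i) * D i)" using l by (simp add: linear_sum linear_cmul)
  also have "\<dots> = grad f x \<bullet> v"
    by (simp add: grad_def inner_sum_left frechet_derivative_eqI[OF assms] mult.commute inner_commute[of _ v] inner_sum_right)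
  finally show ?thesis .
qed

lemma grad_eqI:
  assumes "(f has_derivative (\<lambda>v. g \<bullet> v)) (at x)"
  shows "grad f x = g"
  by (rule vector_eq_rdot[THEN iffD1]) (simp add: grad_inner[OF assms, symmetric])

lemma has_derivative_grad:
  assumes "f differentiable (at x)"
  shows "(f has_derivative (\<lambda>v. grad f x \<bullet> v)) (at x)"
proof -
  have *: "(f has_derivative frechet_derivative f (at x)) (at x)"
    using assms by (simp add: frechet_derivative_works)
  have "frechet_derivative f (at x) = (\<lambda>v. grad f x \<bullet> v)"
    using grad_inner[OF *] by blast
  with * show ?thesis by simp
qed

lemma divergence_eqI:
  "(F has_derivative D) (at x) \<Longrightarrow> divergence F x = (\<Sum>i\<in>Basis. D i \<bullet> i)"
  by (simp add: divergence_def frechet_derivative_eqI)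

lemma frechet_derivative_transform_open:
  assumes "open S" "x \<in> S" "\<And>y. y \<in> S \<Longrightarrow> f y = g y"
  shows "frechet_derivative f (at x) = frechet_derivative g (at x)"
proof -
  have "(f has_derivative D) (at x) = (g has_derivative D) (at x)" for D
    using has_derivative_transform_within_open[of f D x UNIV S g]
      has_derivative_transform_within_open[of g D x UNIV S f] assms by auto
  then show ?thesis by (simp add: frechet_derivative_def)
qed

lemma grad_transform_open:
  "open S \<Longrightarrow> x \<in> S \<Longrightarrow> (\<And>y. y \<in> S \<Longrightarrow> f y = g y) \<Longrightarrow> grad f x = grad g x"
  unfolding grad_def using frechet_derivative_transform_open[of S x f g] by simp

lemma divergence_transform_open:
  "open S \<Longrightarrow> x \<in> S \<Longrightarrow> (\<And>y. y \<in> S \<Longrightarrow> f y = g y) \<Longrightarrow> divergence f x = divergence g x"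
  unfolding divergence_def using frechet_derivative_transform_open[of S x f g] by simp

lemma laplacian_transform_open:
  "open S \<Longrightarrow> x \<in> S \<Longrightarrow> (\<And>y. y \<in> S \<Longrightarrow> f y = g y) \<Longrightarrow> laplacian f x = laplacian g x"
  unfolding laplacian_def using divergence_transform_open[of S x "grad f" "grad g"] grad_transform_open[of S _ f g]
  by blast

lemma smooth_on_differentiable: "smooth_on S f \<Longrightarrow> x \<in> S \<Longrightarrow> f differentiable (at x)"
  using smooth_on_has_derivative differentiableI by blast

lemma divergence_scaleR:
  assumes "f differentiable (at x)" "F differentiable (at x)"
  shows "divergence (\<lambda>x. f x *\<^sub>R F x) x = f x * divergence F x + grad f x \<bullet> F x"
proof -
  have F: "(F has_derivative frechet_derivative F (at x)) (at x)"
    using assms(2) by (simp add: frechet_derivative_works)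
  have "((\<lambda>x. f x *\<^sub>R F x) has_derivative
      (\<lambda>v. f x *\<^sub>R frechet_derivative F (at x) v + (grad f x \<bullet> v) *\<^sub>R F x)) (at x)"
    by (rule has_derivative_scaleR[OF has_derivative_grad[OF assms(1)] F])
  then have "divergence (\<lambda>x. f x *\<^sub>R F x) x =
     (\<Sum>i\<in>Basis. f x * (frechet_derivative F (at x) i \<bullet> i) + (grad f x \<bullet> i) * (F x \<bullet> i))"
    by (simp add: divergence_eqI inner_add_left)
  also have "\<dots> = f x * divergence F x + (\<Sum>i\<in>Basis. (grad f x \<bullet> i) * (F x \<bullet> i))"
    by (simp add: sum.distrib divergence_def sum_distrib_left)
  also have "\<dots> = f x * divergence F x + grad f x \<bullet> F x"
    by (simp only: euclidean_inner[symmetric])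
  finally show ?thesis .
qed

lemma grad_mult:
  fixes f g :: "'a::euclidean_space \<Rightarrow> real"
  assumes "f differentiable (at x)" "g differentiable (at x)"
  shows "grad (\<lambda>x. f x * g x) x = f x *\<^sub>R grad g x + g x *\<^sub>R grad f x"
proof (rule grad_eqI)
  show "((\<lambda>x. f x * g x) has_derivative (\<lambda>v. (f x *\<^sub>R grad g x + g x *\<^sub>R grad f x) \<bullet> v)) (at x)"
    using has_derivative_mult[OF has_derivative_grad[OF assms(1)] has_derivative_grad[OF assms(2)]]
    by (simp add: inner_add_left mult.commute)
qed

lemma grad_cmult:
  assumes "f differentiable (at x)"
  shows "grad (\<lambda>x. c * f x) x = c *\<^sub>R grad f x"
  by (rule grad_eqI) (use has_derivative_mult_right[OF has_derivative_grad[OF assms], of c] in simp)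

lemma divergence_cmult:
  assumes "F differentiable (at x)"
  shows "divergence (\<lambda>x. c *\<^sub>R F x) x = c * divergence F x"
proof -
  have "((\<lambda>x. c *\<^sub>R F x) has_derivative (\<lambda>v. c *\<^sub>R frechet_derivative F (at x) v)) (at x)"
    using assms by (intro has_derivative_scaleR_right) (simp add: frechet_derivative_works)
  then show ?thesis by (simp add: divergence_eqI) (simp add: divergence_def sum_distrib_left)
qed

section \<open>Test functions\<close>

lemma test_function_smooth: "test_function U \<phi> \<Longrightarrow> smooth_on UNIV \<phi>"
  by (simp add: test_function_def)

lemma test_function_differentiable: "test_function U \<phi> \<Longrightarrow> \<phi> differentiable (at x)"
  by (simp add: smooth_on_differentiable[OF test_function_smooth])

lemma test_function_mono: "test_function U \<phi> \<Longrightarrow> U \<subseteq> V \<Longrightarrow> test_function V \<phi>"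
  unfolding test_function_def by blast

lemma test_functionI:
  assumes "smooth_on UNIV \<psi>" "compact K" "K \<subseteq> U" "\<And>x. x \<notin> K \<Longrightarrow> \<psi> x = 0"
  shows "test_function U \<psi>"
proof -
  have "closure {x. \<psi> x \<noteq> 0} \<subseteq> K" using assms by (intro closure_minimal compact_imp_closed) blast+
  moreover from this have "K \<inter> closure {x. \<psi> x \<noteq> 0} = closure {x. \<psi> x \<noteq> 0}" by blast
  then have "compact (closure {x. \<psi> x \<noteq> 0})"
    using compact_Int_closed[OF assms(2) closed_closure, of "{x. \<psi> x \<noteq> 0}"] by simp
  ultimately show ?thesis using assms unfolding test_function_def by blast
qed

lemma test_function_subset:
  assumes "test_function U \<phi>" "smooth_on UNIV \<psi>" "\<And>x. x \<notin> closure {x. \<phi> x \<noteq> 0} \<Longrightarrow> \<psi> x = 0"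
  shows "test_function U \<psi>"
  by (rule test_functionI[where K="closure {x. \<phi> x \<noteq> 0}"]) (use assms in \<open>auto simp: test_function_def\<close>)

lemma frechet_derivative_outside_support:
  assumes "x \<notin> closure {x. \<phi> x \<noteq> 0}"
  shows "frechet_derivative \<phi> (at x) v = 0"
proof -
  have "frechet_derivative \<phi> (at x) = frechet_derivative (\<lambda>_. 0) (at x)"
  proof (rule frechet_derivative_transform_open[where S="- closure {x. \<phi> x \<noteq> 0}"])
    show "\<phi> y = 0" if "y \<in> - closure {x. \<phi> x \<noteq> 0}" for y
      using that closure_subset by force
  qed (use assms in auto)
  then show ?thesis by simp
qed

lemma eq_0_outside_support: "x \<notin> closure {x. \<phi> x \<noteq> 0} \<Longrightarrow> \<phi> x = 0"
  using closure_subset by force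

lemma test_function_grad:
  assumes "test_function U \<phi>"
  shows "test_function U (grad \<phi>)"
  by (rule test_function_subset[OF assms smooth_on_grad[OF open_UNIV test_function_smooth[OF assms]]])
     (simp add: grad_def frechet_derivative_outside_support)

lemma test_function_divergence:
  assumes "test_function U \<phi>"
  shows "test_function U (divergence \<phi>)"
  by (rule test_function_subset[OF assms smooth_on_divergence[OF open_UNIV test_function_smooth[OF assms]]])
     (simp add: divergence_def frechet_derivative_outside_support)

lemma test_function_scaleR:
  assumes "test_function U \<phi>" "smooth_on UNIV F"
  shows "test_function U (\<lambda>x. \<phi> x *\<^sub>R F x)"
proof (rule test_function_subset[OF assms(1)])
  show "smooth_on UNIV (\<lambda>x. \<phi> x *\<^sub>R F x)"
    by (rule smooth_on_scaleR[OF open_UNIV test_function_smooth[OF assms(1)] assms(2)])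
  show "\<phi> x *\<^sub>R F x = 0" if "x \<notin> closure {x. \<phi> x \<noteq> 0}" for x
    using eq_0_outside_support[OF that] by simp
qed

lemma test_function_scaleR':
  assumes "test_function U \<phi>" "smooth_on UNIV f"
  shows "test_function U (\<lambda>x. f x *\<^sub>R \<phi> x)"
proof (rule test_function_subset[OF assms(1)])
  show "smooth_on UNIV (\<lambda>x. f x *\<^sub>R \<phi> x)"
    by (rule smooth_on_scaleR[OF open_UNIV assms(2) test_function_smooth[OF assms(1)]])
  show "f x *\<^sub>R \<phi> x = 0" if "x \<notin> closure {x. \<phi> x \<noteq> 0}" for x
    using eq_0_outside_support[OF that] by simp
qed

lemma test_function_inner:
  assumes "test_function U \<phi>"
  shows "test_function U (\<lambda>x. \<phi> x \<bullet> i)"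
proof (rule test_function_subset[OF assms])
  show "smooth_on UNIV (\<lambda>x. \<phi> x \<bullet> i)"
    by (rule smooth_on_inner[OF open_UNIV test_function_smooth[OF assms] smooth_on_const[OF open_UNIV]])
  show "\<phi> x \<bullet> i = 0" if "x \<notin> closure {x. \<phi> x \<noteq> 0}" for x
    using eq_0_outside_support[OF that] by simp
qed

lemma test_function_obtain_ball:
  assumes "test_function U \<phi>"
  obtains B where "B > 0" "\<And>x. norm x \<ge> B \<Longrightarrow> \<phi> x = 0"
proof -
  have "bounded (closure {x. \<phi> x \<noteq> 0})"
    using assms compact_imp_bounded unfolding test_function_def by blast
  then obtain B where B: "B > 0" "\<And>x. x \<in> closure {x. \<phi> x \<noteq> 0} \<Longrightarrow> norm x \<le> B"
    by (meson bounded_pos)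
  show thesis
  proof (rule that[of "B + 1"])
    fix x :: 'a assume "norm x \<ge> B + 1"
    then have "x \<notin> closure {x. \<phi> x \<noteq> 0}" using B(2)[of x] by auto
    then show "\<phi> x = 0" by (rule eq_0_outside_support)
  qed (use B in simp)
qed

lemma test_function_bounded:
  assumes "test_function U \<phi>"
  obtains M where "M > 0" "\<And>x. norm (\<phi> x) \<le> M"
proof -
  obtain B where B: "B > 0" "\<And>x. norm x \<ge> B \<Longrightarrow> \<phi> x = 0"
    using test_function_obtain_ball[OF assms] by blast
  have "continuous_on (cball 0 B) \<phi>"
    by (rule continuous_on_subset[OF smooth_on_continuous_on[OF test_function_smooth[OF assms]]]) simp
  then obtain M where M: "M \<ge> 0" "\<And>x. x \<in> cball 0 B \<Longrightarrow> norm (\<phi> x) \<le> M"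
    using continuous_on_compact_bound[OF compact_cball] by metis
  show thesis
  proof (rule that[of "M + 1"])
    show "norm (\<phi> x) \<le> M + 1" for x
      using M(1) M(2)[of x] B(2)[of x] by (cases "norm x \<le> B") auto
  qed (use M in simp)
qed

text \<open>Partial derivatives of a test function are test functions, hence bounded. Their bounds
  add up to a bound on the operator norm, and the mean value inequality on the whole space
  finishes.\<close>

lemma test_function_lipschitz:
  fixes \<psi> :: "'a::euclidean_space \<Rightarrow> 'b::real_normed_vector"
  assumes "test_function U \<psi>"
  obtains L where "L > 0" "\<And>x y. norm (\<psi> x - \<psi> y) \<le> L * norm (x - y)"
proof -
  have "\<exists>M>0. \<forall>x. norm (frechet_derivative \<psi> (at x) i) \<le> M" for i
  proof -
    have "test_function U (\<lambda>x. frechet_derivative \<psi> (at x) i)"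
      by (rule test_function_subset[OF assms])
         (auto intro!: smooth_on_frechet_derivative test_function_smooth[OF assms] frechet_derivative_outside_support)
    then show ?thesis using test_function_bounded by blast
  qed
  then obtain M where M: "\<And>i. M i > 0" "\<And>i x. norm (frechet_derivative \<psi> (at x) i) \<le> M i"
    by metis
  define L where "L = (\<Sum>i\<in>(Basis::'a set). M i)"
  have D: "(\<psi> has_derivative frechet_derivative \<psi> (at x)) (at x within UNIV)" for x
    using smooth_on_has_derivative[OF test_function_smooth[OF assms]] by simp
  have "onorm (frechet_derivative \<psi> (at x)) \<le> L" for x
  proof (rule onorm_le)
    fix v :: 'a
    have l: "linear (frechet_derivative \<psi> (at x))" using D by (rule has_derivative_linear)
    have "frechet_derivative \<psi> (at x) v = frechet_derivative \<psi> (at x) (\<Sum>i\<in>Basis. (v \<bullet> i) *\<^sub>R i)"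
      by (simp add: euclidean_representation)
    also have "\<dots> = (\<Sum>i\<in>Basis. (v \<bullet> i) *\<^sub>R frechet_derivative \<psi> (at x) i)"
      using l by (simp add: linear_sum linear_cmul)
    also have "norm \<dots> \<le> (\<Sum>i\<in>Basis. norm v * M i)"
      by (intro order.trans[OF norm_sum] sum_mono)
         (auto intro!: mult_mono M Basis_le_norm)
    finally show "norm (frechet_derivative \<psi> (at x) v) \<le> L * norm v"
      unfolding L_def sum_distrib_right by (simp add: mult.commute)
  qed
  then have "norm (\<psi> x - \<psi> y) \<le> L * norm (x - y)" for x y
    using differentiable_bound[OF convex_UNIV D] by blast
  moreover have "L > 0" unfolding L_def using M(1) by (intro sum_pos) auto
  ultimately show thesis by (blast intro: that)
qed

section \<open>The divergence theorem for balls\<close>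

text \<open>The definitions integrate over \<open>lebesgue_on U\<close>, whereas translation and
  scaling are carried out for \<open>lborel\<close>; for Borel integrands one may pass between the
  two.\<close>

lemma LINT_lebesgue_on_eq_lborel:
  fixes f :: "'a::euclidean_space \<Rightarrow> 'b::{banach, second_countable_topology}"
  assumes "U \<in> sets borel" "f \<in> borel_measurable borel"
  shows "(LINT x|lebesgue_on U. f x) = (LINT x|lborel. indicator U x *\<^sub>R f x)"
proof -
  have "(LINT x|lebesgue_on U. f x) = (LINT x|lebesgue. indicator U x *\<^sub>R f x)"
    using assms by (intro integral_restrict_space) auto
  also have "\<dots> = (LINT x|lborel. indicator U x *\<^sub>R f x)"
    using assms by (intro integral_completion) auto
  finally show ?thesis .
qed

lemma integrable_lebesgue_on_iff_lborel:
  fixes f :: "'a::euclidean_space \<Rightarrow> 'b::{banach, second_countable_topology}"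
  assumes "U \<in> sets borel" "f \<in> borel_measurable borel"
  shows "integrable (lebesgue_on U) f \<longleftrightarrow> integrable lborel (\<lambda>x. indicator U x *\<^sub>R f x)"
proof -
  have "integrable (lebesgue_on U) f \<longleftrightarrow> integrable lebesgue (\<lambda>x. indicator U x *\<^sub>R f x)"
    using assms by (intro integrable_restrict_space) auto
  also have "\<dots> = integrable lborel (\<lambda>x. indicator U x *\<^sub>R f x)"
    using assms by (intro integrable_completion) auto
  finally show ?thesis .
qed

lemma integrable_lborel_bounded_support:
  fixes f :: "'a::euclidean_space \<Rightarrow> 'b::{banach, second_countable_topology}"
  assumes "f \<in> borel_measurable borel" "\<And>x. norm (f x) \<le> M" "\<And>x. norm x > B \<Longrightarrow> f x = 0"
  shows "integrable lborel f"
proof (rule Bochner_Integration.integrable_bound)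
  show "integrable lborel (\<lambda>x::'a. indicator (cball 0 B) x *\<^sub>R M)"
    by (rule borel_integrable_compact) auto
  show "AE x in lborel. norm (f x) \<le> norm (indicator (cball 0 B) x *\<^sub>R M)"
  proof (rule AE_I2)
    fix x
    show "norm (f x) \<le> norm (indicator (cball 0 B) x *\<^sub>R M)"
      using assms(2)[of x] assms(3)[of x] by (cases "norm x \<le> B") auto
  qed
qed (use assms in auto)

lemma test_function_borel: "test_function U \<phi> \<Longrightarrow> \<phi> \<in> borel_measurable borel"
  by (rule borel_measurable_continuous_onI[OF smooth_on_continuous_on[OF test_function_smooth]])

lemma integrable_lborel_test_function:
  fixes \<phi> :: "'a::euclidean_space \<Rightarrow> 'b::euclidean_space"
  assumes "test_function U \<phi>"
  shows "integrable lborel \<phi>"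
proof -
  obtain B where B: "\<And>x. norm x \<ge> B \<Longrightarrow> \<phi> x = 0"
    using test_function_obtain_ball[OF assms] by metis
  obtain M where M: "\<And>x. norm (\<phi> x) \<le> M"
    using test_function_bounded[OF assms] by metis
  show ?thesis
    by (rule integrable_lborel_bounded_support[OF test_function_borel[OF assms] M, of B]) (use B in simp)
qed

lemma integral_translation:
  fixes f :: "'a::euclidean_space \<Rightarrow> real"
  assumes "f \<in> borel_measurable borel"
  shows "(LINT x|lborel. f (x + a)) = (LINT x|lborel. f x)"
proof -
  have "(LINT x|lborel. f x) = (LINT x|distr lborel borel ((+) a). f x)"
    by (simp add: lborel_distr_plus)
  also have "\<dots> = (LINT x|lborel. f (a + x))"
    using assms by (intro integral_distr) auto
  finally show ?thesis by (simp add: add.commute)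
qed

lemma integrable_translation:
  fixes f :: "'a::euclidean_space \<Rightarrow> real"
  assumes "integrable lborel f"
  shows "integrable lborel (\<lambda>x. f (x + a))"
proof -
  have "integrable (distr lborel borel ((+) a)) f"
    using assms by (simp add: lborel_distr_plus)
  then have "integrable lborel (\<lambda>x. f (a + x))"
    by (subst (asm) integrable_distr_eq) (use assms borel_measurable_integrable[OF assms] in auto)
  then show ?thesis by (simp add: add.commute)
qed

text \<open>By translation invariance the integrals of all difference quotients vanish.\<close>

lemma has_bochner_integral_directional_derivative:
  fixes f D :: "'a::euclidean_space \<Rightarrow> real"
  assumes f: "integrable lborel f" and D: "D \<in> borel_measurable borel"
    and h: "integrable lborel h"
    and bd: "\<And>x t. 0 < t \<Longrightarrow> t \<le> 1 \<Longrightarrow> \<bar>f (x + t *\<^sub>R e) - f x\<bar> \<le> t * h x"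
    and lim: "AE x in lborel. ((\<lambda>t. f (x + t *\<^sub>R e)) has_real_derivative D x) (at 0)"
  shows "has_bochner_integral lborel D 0"
proof -
  define s where "s k x = (f (x + inverse (real (Suc k)) *\<^sub>R e) - f x) / inverse (real (Suc k))" for k x
  have fm: "f \<in> borel_measurable borel" using borel_measurable_integrable[OF f] by simp
  have s_int: "(LINT x|lborel. s k x) = 0" for k
    unfolding s_def using f integral_translation[OF fm] integrable_translation[OF f] by simp
  have sm: "s k \<in> borel_measurable lborel" for k
    unfolding s_def using fm by measurable
  have sl: "AE x in lborel. (\<lambda>k. s k x) \<longlonglongrightarrow> D x"
    using lim
  proof eventually_elim
    case (elim x)
    have "((\<lambda>t. (f (x + t *\<^sub>R e) - f x) / t) \<longlongrightarrow> D x) (at 0)"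
      using elim by (simp add: has_field_derivative_iff)
    moreover have "filterlim (\<lambda>k. inverse (real (Suc k))) (at 0) sequentially"
      unfolding filterlim_at using LIMSEQ_inverse_real_of_nat by (auto simp: inverse_eq_divide)
    ultimately show ?case unfolding s_def by (rule filterlim_compose)
  qed
  have sb: "AE x in lborel. norm (s k x) \<le> h x" for k
  proof (rule AE_I2)
    fix x
    have "\<bar>f (x + inverse (real (Suc k)) *\<^sub>R e) - f x\<bar> \<le> inverse (real (Suc k)) * h x"
      by (rule bd) (auto simp: inverse_le_1_iff)
    then show "norm (s k x) \<le> h x"
      by (simp add: s_def abs_divide divide_le_eq mult.commute del: inverse_Suc of_nat_Suc)
  qed
  have "integrable lborel D"
    by (rule integrable_dominated_convergence[OF _ sm h sl sb]) (use D in simp)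
  moreover have "(\<lambda>k. LINT x|lborel. s k x) \<longlonglongrightarrow> (LINT x|lborel. D x)"
    by (rule integral_dominated_convergence[OF _ sm h sl sb]) (use D in simp)
  then have "(LINT x|lborel. D x) = 0"
    by (simp add: s_int LIMSEQ_const_iff)
  ultimately show ?thesis by (simp add: has_bochner_integral_iff)
qed

text \<open>Integration by parts against a factor that is only Lipschitz, meant for distance
  functions with kinks on null sets. The bounds on \<eta> give the domination that carries the
  difference quotients to the limit.\<close>

lemma has_bochner_integral_lipschitz_partial:
  fixes g \<eta> d\<eta> :: "'a::euclidean_space \<Rightarrow> real"
  assumes g: "test_function UNIV g" and e: "e \<in> Basis"
    and \<eta>: "continuous_on UNIV \<eta>" "\<And>x. \<bar>\<eta> x\<bar> \<le> M" "\<And>x y. \<bar>\<eta> x - \<eta> y\<bar> \<le> K * norm (x - y)"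
    and d\<eta>: "d\<eta> \<in> borel_measurable borel"
    and lim: "AE x in lborel. ((\<lambda>t. \<eta> (x + t *\<^sub>R e)) has_real_derivative d\<eta> x) (at 0)"
  shows "has_bochner_integral lborel (\<lambda>x. d\<eta> x * g x + \<eta> x * frechet_derivative g (at x) e) 0"
proof -
  obtain B where B: "B > 0" "\<And>x. norm x \<ge> B \<Longrightarrow> g x = 0"
    using test_function_obtain_ball[OF g] by metis
  obtain G where G: "G > 0" "\<And>x. norm (g x) \<le> G"
    using test_function_bounded[OF g] by metis
  obtain L where L: "L > 0" "\<And>x y. norm (g x - g y) \<le> L * norm (x - y)"
    using test_function_lipschitz[OF g] by metis
  have M: "M \<ge> 0" using \<eta>(2)[of 0] by linarith
  have gm: "g \<in> borel_measurable borel" by (rule test_function_borel[OF g])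
  have \<eta>m: "\<eta> \<in> borel_measurable borel" by (rule borel_measurable_continuous_onI[OF \<eta>(1)])
  have D: "(g has_derivative frechet_derivative g (at x)) (at x)" for x
    by (rule smooth_on_has_derivative[OF test_function_smooth[OF g]]) simp
  have Dm: "(\<lambda>x. frechet_derivative g (at x) e) \<in> borel_measurable borel"
    by (rule borel_measurable_continuous_onI[OF smooth_on_continuous_on[OF
          smooth_on_frechet_derivative[OF test_function_smooth[OF g]]]])
  show ?thesis
  proof (rule has_bochner_integral_directional_derivative[where f="\<lambda>x. \<eta> x * g x" and e=e and
        h="\<lambda>x. indicator (cball 0 (B + 1)) x *\<^sub>R (K * G + M * L)"])
    show "integrable lborel (\<lambda>x. \<eta> x * g x)"
    proof (rule integrable_lborel_bounded_support[where M="M * G" and B=B])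
      show "norm (\<eta> x * g x) \<le> M * G" for x
        unfolding norm_mult by (rule mult_mono) (use \<eta>(2) G M in auto)
    qed (use gm \<eta>m B in auto)
    show "integrable lborel (\<lambda>x::'a. indicator (cball 0 (B + 1)) x *\<^sub>R (K * G + M * L))"
      by (rule borel_integrable_compact) auto
    \<comment> \<open>The radius \<open>B + 1\<close> is safe: a translation by at most 1 cannot
      bring a point outside that ball into the support of \<open>g\<close>.\<close>
    show "\<bar>\<eta> (x + t *\<^sub>R e) * g (x + t *\<^sub>R e) - \<eta> x * g x\<bar>
        \<le> t * (indicator (cball 0 (B + 1)) x *\<^sub>R (K * G + M * L))" if t: "0 < t" "t \<le> 1" for x t
    proof (cases "norm x \<le> B + 1")
      case True
      have "\<bar>\<eta> (x + t *\<^sub>R e) - \<eta> x\<bar> \<le> K * t" "\<bar>g (x + t *\<^sub>R e) - g x\<bar> \<le> L * t"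
        using \<eta>(3)[of "x + t *\<^sub>R e" x] L(2)[of "x + t *\<^sub>R e" x] t e by auto
      then have "\<bar>(\<eta> (x + t *\<^sub>R e) - \<eta> x) * g (x + t *\<^sub>R e)\<bar> \<le> (K * t) * G"
        "\<bar>\<eta> x * (g (x + t *\<^sub>R e) - g x)\<bar> \<le> M * (L * t)"
        unfolding abs_mult using G M \<eta>(2)[of x]
        by (intro mult_mono; force simp: order.trans[OF abs_ge_zero])+
      then have "\<bar>(\<eta> (x + t *\<^sub>R e) - \<eta> x) * g (x + t *\<^sub>R e) + \<eta> x * (g (x + t *\<^sub>R e) - g x)\<bar>
         \<le> (K * t) * G + M * (L * t)" by linarith
      with True show ?thesis by (simp add: algebra_simps)
    next
      case False
      then have "norm (x + t *\<^sub>R e) \<ge> B"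
        using norm_triangle_ineq2[of x "- (t *\<^sub>R e)"] t e by auto
      with False B show ?thesis by simp
    qed
    show "AE x in lborel. ((\<lambda>t. \<eta> (x + t *\<^sub>R e) * g (x + t *\<^sub>R e)) has_real_derivative
        d\<eta> x * g x + \<eta> x * frechet_derivative g (at x) e) (at 0)"
      using lim
    proof eventually_elim
      case (elim x)
      have "((\<lambda>t. x + t *\<^sub>R e) has_derivative (\<lambda>t. t *\<^sub>R e)) (at 0)"
        by (auto intro!: derivative_eq_intros)
      then have "((\<lambda>t. g (x + t *\<^sub>R e)) has_derivative (\<lambda>t. frechet_derivative g (at x) (t *\<^sub>R e))) (at 0)"
        by (rule has_derivative_compose) (simp add: D)
      moreover have "(\<lambda>t. frechet_derivative g (at x) (t *\<^sub>R e)) = (*) (frechet_derivative g (at x) e)"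
        by (simp add: linear_cmul[OF has_derivative_linear[OF D]] fun_eq_iff)
      ultimately have "((\<lambda>t. g (x + t *\<^sub>R e)) has_real_derivative frechet_derivative g (at x) e) (at 0)"
        by (simp add: has_field_derivative_def)
      from DERIV_mult[OF elim this] show ?case by (simp add: mult.commute)
    qed
  qed (use d\<eta> gm \<eta>m Dm in measurable)
qed

text \<open>Integration by parts with the constant factor 1, coordinate by coordinate.\<close>

lemma integral_divergence_eq_0:
  fixes \<psi> :: "'a::euclidean_space \<Rightarrow> 'a"
  assumes "test_function UNIV \<psi>"
  shows "(LINT x|lborel. divergence \<psi> x) = 0"
proof -
  have "has_bochner_integral lborel (\<lambda>x. 0 * (\<psi> x \<bullet> i) + 1 * frechet_derivative (\<lambda>x. \<psi> x \<bullet> i) (at x) i) 0"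
    if "i \<in> Basis" for i
    by (rule has_bochner_integral_lipschitz_partial[OF test_function_inner[OF assms] that,
          where M=1 and K=0]) auto
  moreover have "frechet_derivative (\<lambda>x. \<psi> x \<bullet> i) (at x) i = frechet_derivative \<psi> (at x) i \<bullet> i" for i x
    by (rule fun_cong[OF frechet_derivative_eqI])
       (intro has_derivative_inner_left smooth_on_has_derivative[OF test_function_smooth[OF assms]] UNIV_I)
  ultimately have "has_bochner_integral lborel (\<lambda>x. \<Sum>i\<in>Basis. frechet_derivative \<psi> (at x) i \<bullet> i) (\<Sum>i\<in>(Basis::'a set). 0)"
    by (intro has_bochner_integral_sum) simp
  then show ?thesis
    by (simp add: divergence_def[abs_def] has_bochner_integral_iff)
qed

section \<open>Null spheres and the tent function of a ball\<close>

lemma sgn_borel_measurable [measurable]: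
  "(sgn :: 'a::euclidean_space \<Rightarrow> 'a) \<in> borel_measurable borel"
  unfolding sgn_div_norm[abs_def] by measurable

lemma indicator_ball_borel_measurable [measurable]:
  "(indicator (ball (a::'a::euclidean_space) r) :: 'a \<Rightarrow> real) \<in> borel_measurable borel"
  by (intro borel_measurable_indicator) simp

lemma AE_norm_neq: "AE x in lborel. norm (x::'a::euclidean_space) \<noteq> r"
proof -
  have "sphere (0::'a) r \<in> null_sets lborel"
    using negligible_sphere[of "0::'a" r]
    by (auto simp: null_sets_completion_iff negligible_iff_null_sets)
  then show ?thesis
    by (rule AE_I') (auto simp: space_borel)
qed

text \<open>Gauss-Green in integrated form: the tent function \<open>max 0 (r - norm x)\<close> has
  gradient \<open>- sgn x\<close> inside the ball, so the boundary integral is replaced by one over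
  the solid ball. Differentiating in \<open>r\<close> later recovers the boundary.\<close>

lemma has_bochner_integral_distance_cutoff:
  fixes \<psi> :: "'a::euclidean_space \<Rightarrow> 'a"
  assumes "test_function UNIV \<psi>" "r > 0"
  shows "has_bochner_integral lborel
    (\<lambda>x. max 0 (r - norm x) * divergence \<psi> x - indicator (ball 0 r) x * (\<psi> x \<bullet> sgn x)) 0"
proof -
  have fr: "frechet_derivative (\<lambda>x. \<psi> x \<bullet> i) (at x) i = frechet_derivative \<psi> (at x) i \<bullet> i" for i x
    by (rule fun_cong[OF frechet_derivative_eqI])
       (intro has_derivative_inner_left smooth_on_has_derivative[OF test_function_smooth[OF assms(1)]] UNIV_I)
  have "has_bochner_integral lborel (\<lambda>x. - indicator (ball 0 r) x * (sgn x \<bullet> i) * (\<psi> x \<bullet> i) +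
      max 0 (r - norm x) * frechet_derivative (\<lambda>x. \<psi> x \<bullet> i) (at x) i) 0" if i: "i \<in> Basis" for i
  proof (rule has_bochner_integral_lipschitz_partial[OF test_function_inner[OF assms(1)] i, where M=r and K=1])
    show "\<bar>max 0 (r - norm x)\<bar> \<le> r" for x :: 'a using assms(2) by auto
    show "\<bar>max 0 (r - norm x) - max 0 (r - norm y)\<bar> \<le> 1 * norm (x - y)" for x y :: 'a
      using norm_triangle_ineq3[of x y] by auto
    \<comment> \<open>The kinks of the tent function lie on the sphere of radius \<open>r\<close>
      and at the origin.\<close>
    show "AE x in lborel. ((\<lambda>t. max 0 (r - norm (x + t *\<^sub>R i))) has_real_derivative
         - indicator (ball 0 r) x * (sgn x \<bullet> i)) (at 0)"
      using AE_norm_neq[of r] AE_norm_neq[of 0]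
    proof eventually_elim
      case (elim x)
      have n: "((\<lambda>t. norm (x + t *\<^sub>R i)) has_real_derivative sgn x \<bullet> i) (at 0)"
      proof -
        have "((\<lambda>t. x + t *\<^sub>R i) has_derivative (\<lambda>t. t *\<^sub>R i)) (at 0)"
          by (auto intro!: derivative_eq_intros)
        then have "((\<lambda>t. norm (x + t *\<^sub>R i)) has_derivative (\<lambda>t. (t *\<^sub>R i) \<bullet> sgn x)) (at 0)"
          by (rule has_derivative_compose) (use elim has_derivative_norm[of x] in simp)
        moreover have "(\<lambda>t. (t *\<^sub>R i) \<bullet> sgn x) = (*) (sgn x \<bullet> i)"
          by (auto simp: inner_commute mult.commute)
        ultimately show ?thesis by (simp add: has_field_derivative_def)
      qed
      have cont: "continuous (at 0) (\<lambda>t. norm (x + t *\<^sub>R i))" by (intro continuous_intros)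
      show ?case
      proof (cases "norm x < r")
        case True
        have "((\<lambda>t. r - norm (x + t *\<^sub>R i)) has_real_derivative - (sgn x \<bullet> i)) (at 0)"
          using n by (auto intro!: derivative_eq_intros)
        moreover have "open {t. norm (x + t *\<^sub>R i) < r}"
          by (intro open_Collect_less continuous_intros)
        ultimately have "((\<lambda>t. max 0 (r - norm (x + t *\<^sub>R i))) has_real_derivative - (sgn x \<bullet> i)) (at 0)"
          by (rule has_field_derivative_transform_within_open) (use True in auto)
        then show ?thesis using True by simp
      next
        case False
        have "((\<lambda>t. 0) has_real_derivative 0) (at 0)" by simp
        moreover have "open {t. norm (x + t *\<^sub>R i) > r}"
          by (intro open_Collect_less continuous_intros)
        ultimately have "((\<lambda>t. max 0 (r - norm (x + t *\<^sub>R i))) has_real_derivative 0) (at 0)"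
          by (rule has_field_derivative_transform_within_open) (use False elim in auto)
        then show ?thesis using False by simp
      qed
    qed
    show "(\<lambda>x. - indicator (ball 0 r) x * (sgn x \<bullet> i)) \<in> borel_measurable borel"
      by (intro borel_measurable_times borel_measurable_uminus borel_measurable_inner
          indicator_ball_borel_measurable sgn_borel_measurable borel_measurable_const)
  qed (auto intro!: continuous_intros)
  then have *: "has_bochner_integral lborel (\<lambda>x. \<Sum>i\<in>Basis. - indicator (ball 0 r) x * (sgn x \<bullet> i) * (\<psi> x \<bullet> i) +
      max 0 (r - norm x) * (frechet_derivative \<psi> (at x) i \<bullet> i)) (\<Sum>i\<in>(Basis::'a set). 0)"
    unfolding fr by (rule has_bochner_integral_sum)
  have "(\<Sum>i\<in>Basis. - indicator (ball 0 r) x * (sgn x \<bullet> i) * (\<psi> x \<bullet> i) +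
      max 0 (r - norm x) * (frechet_derivative \<psi> (at x) i \<bullet> i)) =
     max 0 (r - norm x) * divergence \<psi> x - indicator (ball 0 r) x * (\<psi> x \<bullet> sgn x)" for x
    unfolding euclidean_inner[of "\<psi> x" "sgn x"] divergence_def sum_distrib_left sum_subtractf[symmetric]
    by (rule sum.cong) (auto simp: indicator_def)
  with * show ?thesis by simp
qed

text \<open>The substitution by \<open>r *\<^sub>R x\<close> multiplies volume by a power of
  \<open>r\<close>; by \<open>hom\<close> the integrand does not notice it.\<close>

lemma integral_scale_ball:
  fixes f :: "'a::euclidean_space \<Rightarrow> real"
  assumes f: "f \<in> borel_measurable borel" and r: "r > 0"
    and hom: "\<And>x. f (r *\<^sub>R x) = f x"
  shows "(LINT x|lborel. indicator (ball 0 r) x * f x) = r ^ DIM('a) * (LINT x|lborel. indicator (ball 0 1) x * f x)"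
proof -
  have m: "(\<lambda>x. indicator (ball 0 r) x * f x) \<in> borel_measurable borel"
    by (intro borel_measurable_times indicator_ball_borel_measurable f)
  have "(LINT x|lborel. indicator (ball 0 r) x * f x) =
    (LINT x|density (distr lborel borel (\<lambda>x. 0 + r *\<^sub>R x)) (\<lambda>_. \<bar>r\<bar> ^ DIM('a)). indicator (ball 0 r) x * f x)"
    using lborel_affine[of r "0::'a"] r by simp
  also have "\<dots> = (LINT x|distr lborel borel (\<lambda>x. 0 + r *\<^sub>R x). (\<bar>r\<bar> ^ DIM('a)) *\<^sub>R (indicator (ball 0 r) x * f x))"
    using m by (intro integral_density) auto
  also have "\<dots> = (LINT x|lborel. (\<bar>r\<bar> ^ DIM('a)) *\<^sub>R (indicator (ball 0 r) (0 + r *\<^sub>R x) * f (0 + r *\<^sub>R x)))"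
    using m by (intro integral_distr) auto
  also have "\<dots> = (LINT x|lborel. r ^ DIM('a) * (indicator (ball 0 1) x * f x))"
    using r by (intro Bochner_Integration.integral_cong refl) (auto simp: hom indicator_def)
  finally show ?thesis by simp
qed

text \<open>The surface integral of \<open>f\<close> over the sphere of radius \<open>r\<close>,
  written through radial projection of the solid unit ball. In polar coordinates the ball
  contributes a factor 1/n, cancelled by the leading dimension; in dimension one the value is f(r) +
  f(-r).\<close>

definition sphere_flux :: "real \<Rightarrow> ('a::euclidean_space \<Rightarrow> real) \<Rightarrow> real" where
  "sphere_flux r f = real DIM('a) * r ^ (DIM('a) - 1) * (LINT x|lborel. indicator (ball 0 1) x * f (r *\<^sub>R sgn x))"

lemma sgn_scaleR_pos: "r > 0 \<Longrightarrow> sgn (r *\<^sub>R x) = sgn (x::'a::real_normed_vector)"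
  by (simp add: sgn_scaleR)

lemma sgn_sgn_vector: "sgn (sgn x) = sgn (x::'a::real_normed_vector)"
  by (cases "x = 0") (simp_all add: sgn_div_norm)

lemma has_real_derivative_imp_LIMSEQ:
  assumes "(f has_real_derivative D) (at x)"
  shows "(\<lambda>k. (f (x + inverse (real (Suc k))) - f x) / inverse (real (Suc k))) \<longlonglongrightarrow> D"
proof -
  have "((\<lambda>h. (f (x + h) - f x) / h) \<longlongrightarrow> D) (at 0)"
    using assms by (simp add: DERIV_def)
  moreover have "filterlim (\<lambda>k. inverse (real (Suc k))) (at 0) sequentially"
    unfolding filterlim_at using LIMSEQ_inverse_real_of_nat by (auto simp: inverse_eq_divide)
  ultimately show ?thesis by (rule filterlim_compose)
qed

text \<open>Both sides are the derivative at \<open>R\<close> of the integral of \<open>\<psi> x \<bullet> sgn x\<close> over the ball of radius \<open>r\<close>.\<close>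

lemma divergence_theorem_ball:
  fixes \<psi> :: "'a::euclidean_space \<Rightarrow> 'a"
  assumes \<psi>: "test_function UNIV \<psi>" and R: "R > 0"
  shows "(LINT x|lborel. indicator (ball 0 R) x * divergence \<psi> x) = sphere_flux R (\<lambda>x. \<psi> x \<bullet> sgn x)"
proof -
  let ?n = "DIM('a)"
  define h where "h k = inverse (real (Suc k))" for k
  have h: "h k > 0" "h k \<le> 1" for k by (auto simp: h_def inverse_le_1_iff)
  have h0: "h \<longlonglongrightarrow> 0" unfolding h_def by (rule LIMSEQ_inverse_real_of_nat)
  define u where "u x = \<psi> x \<bullet> sgn x" for x
  \<comment> \<open>\<open>u\<close> frozen radially at its value on the sphere of radius
    \<open>R\<close>, hence invariant under scaling.\<close>
  define g where "g x = \<psi> (R *\<^sub>R sgn x) \<bullet> sgn x" for x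
  define J where "J = (LINT x|lborel. indicator (ball 0 1) x * g x)"
  define V where "V = (LINT x|lborel. indicator (ball (0::'a) 1) x * (1::real))"
  define A where "A r = (LINT x|lborel. indicator (ball 0 r) x * u x)" for r
  obtain M where M: "M > 0" "\<And>x. norm (\<psi> x) \<le> M" using test_function_bounded[OF \<psi>] by metis
  obtain L where L: "L > 0" "\<And>x y. norm (\<psi> x - \<psi> y) \<le> L * norm (x - y)"
    using test_function_lipschitz[OF \<psi>] by metis
  have \<psi>m: "\<psi> \<in> borel_measurable borel" by (rule test_function_borel[OF \<psi>])
  have um: "u \<in> borel_measurable borel" unfolding u_def
    by (intro borel_measurable_inner \<psi>m sgn_borel_measurable)
  have gm: "g \<in> borel_measurable borel" unfolding g_def
    by (intro borel_measurable_inner measurable_compose[OF _ \<psi>m] borel_measurable_scaleR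
        borel_measurable_const sgn_borel_measurable)
  have bd: "\<bar>a \<bullet> sgn x\<bar> \<le> norm a" for a x :: 'a
    by (rule order.trans[OF Cauchy_Schwarz_ineq2]) (auto simp: norm_sgn)
  have ub: "\<bar>u x\<bar> \<le> M" and gb: "\<bar>g x\<bar> \<le> M" for x
    unfolding u_def g_def by (rule order.trans[OF bd M(2)])+
  have int: "integrable lborel (\<lambda>x. indicator (ball 0 r) x * f x)"
    if "f \<in> borel_measurable borel" "\<And>x::'a. \<bar>f x\<bar> \<le> C" for f r and C :: real
  proof (rule integrable_lborel_bounded_support[where M=C and B=r])
    show "(\<lambda>x. indicator (ball 0 r) x * f x) \<in> borel_measurable borel"
      by (intro borel_measurable_times indicator_ball_borel_measurable that)
    show "norm (indicator (ball 0 r) x * f x) \<le> C" for x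
      using that(2)[of x] by (auto simp: indicator_def)
  qed auto
  note iu = int[OF um ub] and ig = int[OF gm gb]
  have i1: "integrable lborel (\<lambda>x::'a. indicator (ball 0 r) x * (1::real))" for r
    by (rule int[where C=1]) auto
  have dv: "test_function UNIV (divergence \<psi>)" by (rule test_function_divergence[OF \<psi>])
  note dm = test_function_borel[OF dv] and dint = integrable_lborel_test_function[OF dv]
  have cut_int: "integrable lborel (\<lambda>x. max 0 (r - norm x) * divergence \<psi> x)" if "r > 0" for r
  proof (rule Bochner_Integration.integrable_bound[where f="\<lambda>x. r * divergence \<psi> x"])
    show "(\<lambda>x. max 0 (r - norm x) * divergence \<psi> x) \<in> borel_measurable lborel"
      using dm by auto
    show "AE x in lborel. norm (max 0 (r - norm x) * divergence \<psi> x) \<le> norm (r * divergence \<psi> x)"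
      using that by (intro AE_I2) (auto simp: abs_mult intro!: mult_right_mono)
  qed (use dint in simp)
  have A: "A r = (LINT x|lborel. max 0 (r - norm x) * divergence \<psi> x)" if "r > 0" for r
    using has_bochner_integral_distance_cutoff[OF \<psi> that] cut_int[OF that] iu[of r]
    by (simp add: has_bochner_integral_iff A_def u_def)
  \<comment> \<open>First evaluation of the derivative of \<open>A\<close> at \<open>R\<close>: the
    difference quotients of the tent functions are bounded by 1 and tend to the indicator of the
    closed ball.\<close>
  have lim1: "(\<lambda>k. (A (R + h k) - A R) / h k) \<longlonglongrightarrow> (LINT x|lborel. indicator (cball 0 R) x * divergence \<psi> x)"
  proof -
    define s where "s k x = (max 0 (R + h k - norm x) - max 0 (R - norm x)) / h k * divergence \<psi> x" for k x
    have eq: "(A (R + h k) - A R) / h k = (LINT x|lborel. s k x)" for k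
    proof -
      have "(LINT x|lborel. s k x) = (LINT x|lborel. (max 0 (R + h k - norm x) * divergence \<psi> x
          - max 0 (R - norm x) * divergence \<psi> x) / h k)"
        by (intro Bochner_Integration.integral_cong refl) (simp add: s_def left_diff_distrib)
      also have "\<dots> = (A (R + h k) - A R) / h k"
        using cut_int[of "R + h k"] cut_int[of R] R h[of k] by (simp add: A)
      finally show ?thesis by simp
    qed
    have "(\<lambda>k. LINT x|lborel. s k x) \<longlonglongrightarrow> (LINT x|lborel. indicator (cball 0 R) x * divergence \<psi> x)"
    proof (rule integral_dominated_convergence[where w="\<lambda>x. \<bar>divergence \<psi> x\<bar>"])
      show "AE x in lborel. (\<lambda>k. s k x) \<longlonglongrightarrow> indicator (cball 0 R) x * divergence \<psi> x"
      proof (rule AE_I2)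
        fix x :: 'a
        show "(\<lambda>k. s k x) \<longlonglongrightarrow> indicator (cball 0 R) x * divergence \<psi> x"
        proof (cases "norm x \<le> R")
          case True
          then have "s k x = indicator (cball 0 R) x * divergence \<psi> x" for k
            using h[of k] by (simp add: s_def max_def)
          then show ?thesis by simp
        next
          case False
          then have "eventually (\<lambda>k. h k < norm x - R) sequentially"
            by (intro order_tendstoD[OF h0]) simp
          then have "eventually (\<lambda>k. s k x = indicator (cball 0 R) x * divergence \<psi> x) sequentially"
            by eventually_elim (use False in \<open>simp add: s_def max_def\<close>)
          then show ?thesis by (rule tendsto_eventually)
        qed
      qed
      show "AE x in lborel. norm (s k x) \<le> \<bar>divergence \<psi> x\<bar>" for k
      proof (rule AE_I2)
        fix x :: 'a
        have "\<bar>(max 0 (R + h k - norm x) - max 0 (R - norm x)) / h k\<bar> \<le> 1"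
          using h(1)[of k] by (auto simp: max_def field_simps)
        then show "norm (s k x) \<le> \<bar>divergence \<psi> x\<bar>"
          unfolding s_def real_norm_def abs_mult by (intro mult_left_le_one_le) auto
      qed
      show "(\<lambda>x. indicator (cball 0 R) x * divergence \<psi> x) \<in> borel_measurable lborel"
        using dm by (intro borel_measurable_times borel_measurable_indicator) auto
      show "s k \<in> borel_measurable lborel" for k
        unfolding s_def using dm by auto
    qed (use dint in auto)
    then show ?thesis by (simp add: eq)
  qed
  have B: "(LINT x|lborel. indicator (ball 0 r) x * g x) = r ^ ?n * J" if "r > 0" for r
    unfolding J_def by (rule integral_scale_ball[OF gm that]) (simp add: g_def sgn_scaleR_pos that)
  have W: "(LINT x|lborel. indicator (ball (0::'a) r) x * 1) = r ^ ?n * V" if "r > 0" for r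
    unfolding V_def by (rule integral_scale_ball[OF _ that]) auto
  \<comment> \<open>Second evaluation: on the shell of thickness \<open>h k\<close>, replacing
    \<open>u\<close> by \<open>g\<close> costs at most \<open>L * h k\<close> per unit volume. The
    shell volume is itself O(\<open>h k\<close>), so the error is of second order.\<close>
  have err: "\<bar>(A (R + h k) - A R) - ((R + h k) ^ ?n - R ^ ?n) * J\<bar> \<le> L * h k * (((R + h k) ^ ?n - R ^ ?n) * V)" for k
  proof -
    let ?I = "\<lambda>x::'a. indicator (ball 0 (R + h k)) x - indicator (ball 0 R) x :: real"
    have "(A (R + h k) - A R) - ((R + h k) ^ ?n - R ^ ?n) * J =
      (LINT x|lborel. (indicator (ball 0 (R + h k)) x * u x - indicator (ball 0 R) x * u x)
         - (indicator (ball 0 (R + h k)) x * g x - indicator (ball 0 R) x * g x))"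
      using iu ig B[OF R] B[of "R + h k"] R h[of k] by (simp add: A_def left_diff_distrib)
    also have "\<dots> = (LINT x|lborel. ?I x * (u x - g x))"
      by (intro Bochner_Integration.integral_cong refl) (simp add: algebra_simps)
    finally have "\<bar>(A (R + h k) - A R) - ((R + h k) ^ ?n - R ^ ?n) * J\<bar> = norm (LINT x|lborel. ?I x * (u x - g x))"
      by simp
    also have "\<dots> \<le> (LINT x|lborel. norm (?I x * (u x - g x)))"
      by (rule integral_norm_bound)
    also have "\<dots> \<le> (LINT x|lborel. L * h k * (indicator (ball (0::'a) (R + h k)) x * 1 - indicator (ball 0 R) x * 1))"
    proof (rule integral_mono)
      have "integrable lborel (\<lambda>x. (indicator (ball 0 (R + h k)) x * u x - indicator (ball 0 R) x * u x)
         - (indicator (ball 0 (R + h k)) x * g x - indicator (ball 0 R) x * g x))"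
        using iu ig by simp
      then have "integrable lborel (\<lambda>x. ?I x * (u x - g x))"
        by (rule Bochner_Integration.integrable_cong[THEN iffD1, rotated 2]) (auto simp: algebra_simps)
      then show "integrable lborel (\<lambda>x. norm (?I x * (u x - g x)))" by simp
      show "integrable lborel (\<lambda>x::'a. L * h k * (indicator (ball 0 (R + h k)) x * 1 - indicator (ball 0 R) x * 1))"
        using i1 by simp
      fix x :: 'a
      show "norm (?I x * (u x - g x)) \<le> L * h k * (indicator (ball 0 (R + h k)) x * 1 - indicator (ball 0 R) x * 1)"
      proof (cases "R \<le> norm x \<and> norm x < R + h k")
        case True
        have "x - R *\<^sub>R sgn x = (norm x - R) *\<^sub>R sgn x"
        proof -
          have "norm x \<noteq> 0" using True R by linarith
          then have "norm x *\<^sub>R sgn x = x" by (simp add: sgn_div_norm)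
          then show ?thesis by (simp add: scaleR_diff_left)
        qed
        then have "norm (x - R *\<^sub>R sgn x) \<le> h k"
          using True R by (simp add: norm_sgn)
        then have "L * norm (x - R *\<^sub>R sgn x) \<le> L * h k" using L by simp
        moreover have "\<bar>u x - g x\<bar> \<le> norm (\<psi> x - \<psi> (R *\<^sub>R sgn x))"
          unfolding u_def g_def inner_diff_left[symmetric] by (rule bd)
        ultimately have "\<bar>u x - g x\<bar> \<le> L * h k" using L(2)[of x "R *\<^sub>R sgn x"] by linarith
        then show ?thesis using True by simp
      next
        case False
        then have "?I x = 0" using h[of k] by (auto simp: indicator_def)
        then show ?thesis by simp
      qed
    qed
    also have "\<dots> = L * h k * (((R + h k) ^ ?n - R ^ ?n) * V)"
      using i1 W[OF R] W[of "R + h k"] R h[of k] by (simp add: left_diff_distrib)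
    finally show ?thesis .
  qed
  have D: "(\<lambda>k. ((R + h k) ^ ?n - R ^ ?n) / h k) \<longlonglongrightarrow> real ?n * R ^ (?n - 1)"
    unfolding h_def by (rule has_real_derivative_imp_LIMSEQ) (auto intro!: derivative_eq_intros)
  have "(\<lambda>k. (A (R + h k) - A R) / h k - ((R + h k) ^ ?n - R ^ ?n) / h k * J) \<longlonglongrightarrow> 0"
  proof (rule Lim_null_comparison)
    have "(\<lambda>k. L * ((R + h k) ^ ?n - R ^ ?n) * V) \<longlonglongrightarrow> L * ((R + 0) ^ ?n - R ^ ?n) * V"
      by (intro tendsto_intros h0)
    then show "(\<lambda>k. L * ((R + h k) ^ ?n - R ^ ?n) * V) \<longlonglongrightarrow> 0" by simp
    show "\<forall>\<^sub>F k in sequentially. norm ((A (R + h k) - A R) / h k - ((R + h k) ^ ?n - R ^ ?n) / h k * J)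
       \<le> L * ((R + h k) ^ ?n - R ^ ?n) * V"
    proof (intro always_eventually allI)
      fix k
      have "(A (R + h k) - A R) / h k - ((R + h k) ^ ?n - R ^ ?n) / h k * J
        = ((A (R + h k) - A R) - ((R + h k) ^ ?n - R ^ ?n) * J) / h k"
        by (simp add: diff_divide_distrib left_diff_distrib)
      then show "norm ((A (R + h k) - A R) / h k - ((R + h k) ^ ?n - R ^ ?n) / h k * J)
       \<le> L * ((R + h k) ^ ?n - R ^ ?n) * V"
        using err[of k] h(1)[of k] by (simp add: abs_divide divide_le_eq mult_ac)
    qed
  qed
  from tendsto_add[OF this tendsto_mult[OF D tendsto_const[of J]]]
  have "(\<lambda>k. (A (R + h k) - A R) / h k) \<longlonglongrightarrow> real ?n * R ^ (?n - 1) * J" by simp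
  with lim1 have "(LINT x|lborel. indicator (cball 0 R) x * divergence \<psi> x) = real ?n * R ^ (?n - 1) * J"
    by (rule LIMSEQ_unique)
  moreover have "(LINT x|lborel. indicator (cball 0 R) x * divergence \<psi> x) = (LINT x|lborel. indicator (ball 0 R) x * divergence \<psi> x)"
    by (rule integral_cong_AE) (use AE_norm_neq[of R] dm in \<open>auto elim!: eventually_mono simp: indicator_def\<close>)
  moreover have "J = (LINT x|lborel. indicator (ball 0 1) x * (\<psi> (R *\<^sub>R sgn x) \<bullet> sgn (R *\<^sub>R sgn x)))"
    unfolding J_def g_def using R
    by (intro Bochner_Integration.integral_cong refl) (simp add: sgn_scaleR_pos sgn_sgn_vector)
  ultimately show ?thesis by (simp add: sphere_flux_def)
qed

text \<open>The unit ball is projected to the sphere of radius \<open>r\<^sub>1\<close> and the shell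
  \<open>1 \<le> norm x < 2\<close> to the sphere of radius \<open>r\<^sub>2\<close>.\<close>

lemma two_spheres_measure:
  fixes r\<^sub>1 r\<^sub>2 \<alpha> \<beta> :: real
  assumes r: "r\<^sub>1 > 0" "r\<^sub>2 > 0" and \<alpha>: "\<alpha> \<ge> 0" and \<beta>: "\<beta> \<ge> 0"
  obtains \<sigma> :: "'a::euclidean_space measure" where "sets \<sigma> = sets borel" "emeasure \<sigma> UNIV < \<infinity>"
    "\<And>A. A \<in> sets borel \<Longrightarrow> A \<inter> (sphere 0 r\<^sub>1 \<union> sphere 0 r\<^sub>2) = {} \<Longrightarrow> emeasure \<sigma> A = 0"
    "\<And>f M. f \<in> borel_measurable borel \<Longrightarrow> (\<And>x. \<bar>f x\<bar> \<le> M) \<Longrightarrow>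
        (LINT x|\<sigma>. f x) = \<alpha> * sphere_flux r\<^sub>1 f + \<beta> * sphere_flux r\<^sub>2 f"
proof -
  let ?n = "DIM('a)"
  define c\<^sub>1 where "c\<^sub>1 = \<alpha> * (real ?n * r\<^sub>1 ^ (?n - 1))"
  \<comment> \<open>The shell has \<open>2 ^ ?n - 1\<close> times the volume of the unit ball, which
    this denominator compensates.\<close>
  define c\<^sub>2 where "c\<^sub>2 = \<beta> * (real ?n * r\<^sub>2 ^ (?n - 1)) / (2 ^ ?n - 1)"
  define shell where "shell x = (indicator (ball 0 2) x - indicator (ball 0 1) x :: real)" for x :: 'a
  define \<rho> where "\<rho> x = c\<^sub>1 * indicator (ball 0 1) x + c\<^sub>2 * shell x" for x :: 'a
  define \<pi> where "\<pi> x = (indicator (ball 0 1) x * r\<^sub>1 + (1 - indicator (ball 0 1) x) * r\<^sub>2) *\<^sub>R sgn x" for x :: 'a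
  define \<sigma> where "\<sigma> = distr (density lborel \<rho>) borel \<pi>"
  have two: "(2::real) ^ ?n - 1 > 0"
    using one_less_power[of "2::real" ?n] by simp
  have c: "c\<^sub>1 \<ge> 0" "c\<^sub>2 \<ge> 0" using r \<alpha> \<beta> two by (auto simp: c\<^sub>1_def c\<^sub>2_def intro!: mult_nonneg_nonneg divide_nonneg_pos)
  have sh: "0 \<le> shell x" "shell x \<le> 1" for x by (auto simp: shell_def indicator_def)
  have shm: "shell \<in> borel_measurable borel" unfolding shell_def
    by (intro borel_measurable_diff indicator_ball_borel_measurable)
  have \<rho>m: "\<rho> \<in> borel_measurable borel" unfolding \<rho>_def
    by (intro borel_measurable_add borel_measurable_times borel_measurable_const shm indicator_ball_borel_measurable)
  have \<pi>m: "\<pi> \<in> borel_measurable borel" unfolding \<pi>_def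
    by (intro borel_measurable_scaleR borel_measurable_add borel_measurable_times borel_measurable_const
        borel_measurable_diff indicator_ball_borel_measurable sgn_borel_measurable)
  have \<rho>0: "\<rho> x \<ge> 0" for x unfolding \<rho>_def using c sh by (intro add_nonneg_nonneg mult_nonneg_nonneg) auto
  have \<rho>le: "\<rho> x \<le> (c\<^sub>1 + c\<^sub>2) * indicator (ball 0 2) x" for x
    using c by (auto simp: \<rho>_def shell_def indicator_def)
  have em: "emeasure \<sigma> A = (\<integral>\<^sup>+x. ennreal (\<rho> x) * indicator A (\<pi> x) \<partial>lborel)" if "A \<in> sets borel" for A
  proof -
    have "emeasure \<sigma> A = emeasure (density lborel \<rho>) (\<pi> -` A)"
      unfolding \<sigma>_def using \<pi>m that by (subst emeasure_distr) auto
    also have "\<dots> = (\<integral>\<^sup>+x. ennreal (\<rho> x) * indicator (\<pi> -` A) x \<partial>lborel)"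
      using \<rho>m measurable_sets_borel[OF \<pi>m that] by (intro emeasure_density) auto
    finally show ?thesis by (simp add: indicator_def)
  qed
  show thesis
  proof (rule that)
    show "sets \<sigma> = sets borel" by (simp add: \<sigma>_def)
    have "emeasure \<sigma> UNIV \<le> (\<integral>\<^sup>+x. ennreal (c\<^sub>1 + c\<^sub>2) * indicator (ball (0::'a) 2) x \<partial>lborel)"
    proof -
      have "ennreal (\<rho> x) * indicator UNIV (\<pi> x) \<le> ennreal (c\<^sub>1 + c\<^sub>2) * indicator (ball 0 2) x" for x
        using ennreal_leI[OF \<rho>le[of x]] by (cases "x \<in> ball 0 2") auto
      then show ?thesis using em[of UNIV] by (simp add: nn_integral_mono)
    qed
    also have "\<dots> < \<infinity>"
      using emeasure_lborel_ball_finite[of "0::'a" 2]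
      by (subst nn_integral_cmult_indicator) (auto simp: ennreal_mult_less_top)
    finally show "emeasure \<sigma> UNIV < \<infinity>" .
    show "emeasure \<sigma> A = 0" if A: "A \<in> sets borel" "A \<inter> (sphere 0 r\<^sub>1 \<union> sphere 0 r\<^sub>2) = {}" for A
    proof -
      \<comment> \<open>Only the origin fails to be sent to one of the two spheres, as
        \<open>sgn 0 = 0\<close>.\<close>
      have "AE x in lborel. ennreal (\<rho> x) * indicator A (\<pi> x) = 0"
        using AE_norm_neq[of 0]
      proof eventually_elim
        case (elim x)
        then have "norm (\<pi> x) = r\<^sub>1 \<or> norm (\<pi> x) = r\<^sub>2"
          using r by (auto simp: \<pi>_def indicator_def norm_sgn)
        then have "\<pi> x \<notin> A" using A(2) by auto
        then show ?case by simp
      qed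
      then show ?thesis
        unfolding em[OF A(1)] using nn_integral_cong_AE by fastforce
    qed
    fix f :: "'a \<Rightarrow> real" and M
    assume f: "f \<in> borel_measurable borel" "\<And>x. \<bar>f x\<bar> \<le> M"
    have fm: "(\<lambda>x. f (r *\<^sub>R sgn x)) \<in> borel_measurable borel" for r
      by (intro measurable_compose[OF _ f(1)] borel_measurable_scaleR borel_measurable_const sgn_borel_measurable)
    have int: "integrable lborel (\<lambda>x. indicator (ball 0 s) x * f (r *\<^sub>R sgn x))" for s r
    proof (rule integrable_lborel_bounded_support[where M=M and B=s])
      show "(\<lambda>x. indicator (ball 0 s) x * f (r *\<^sub>R sgn x)) \<in> borel_measurable borel"
        by (intro borel_measurable_times indicator_ball_borel_measurable fm)
      show "norm (indicator (ball 0 s) x * f (r *\<^sub>R sgn x)) \<le> M" for x :: 'a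
        using f(2)[of "r *\<^sub>R sgn x"] by (auto simp: indicator_def)
    qed auto
    have sc: "(LINT x|lborel. indicator (ball 0 2) x * f (r *\<^sub>R sgn x)) =
      2 ^ ?n * (LINT x|lborel. indicator (ball 0 1) x * f (r *\<^sub>R sgn x))" for r
      by (rule integral_scale_ball[OF fm]) (auto simp: sgn_scaleR_pos)
    have "(LINT x|\<sigma>. f x) = (LINT x|density lborel \<rho>. f (\<pi> x))"
      unfolding \<sigma>_def using \<pi>m f(1) by (intro integral_distr) auto
    also have "\<dots> = (LINT x|lborel. \<rho> x *\<^sub>R f (\<pi> x))"
      using \<rho>m \<rho>0 measurable_compose[OF \<pi>m f(1)] by (intro integral_density) auto
    also have "\<dots> = (LINT x|lborel. c\<^sub>1 * (indicator (ball 0 1) x * f (r\<^sub>1 *\<^sub>R sgn x)) +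
       c\<^sub>2 * (indicator (ball 0 2) x * f (r\<^sub>2 *\<^sub>R sgn x) - indicator (ball 0 1) x * f (r\<^sub>2 *\<^sub>R sgn x)))"
      by (intro Bochner_Integration.integral_cong refl) (auto simp: \<rho>_def \<pi>_def shell_def indicator_def)
    also have "\<dots> = c\<^sub>1 * (LINT x|lborel. indicator (ball 0 1) x * f (r\<^sub>1 *\<^sub>R sgn x)) +
       c\<^sub>2 * ((2 ^ ?n - 1) * (LINT x|lborel. indicator (ball 0 1) x * f (r\<^sub>2 *\<^sub>R sgn x)))"
      using int sc[of r\<^sub>2] by (simp add: left_diff_distrib)
    also have "c\<^sub>2 * ((2 ^ ?n - 1) * I) = \<beta> * (real ?n * r\<^sub>2 ^ (?n - 1) * I)" for I
    proof -
      have "(2::real) ^ ?n - 1 \<noteq> 0" using two by linarith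
      then show ?thesis by (simp add: c\<^sub>2_def)
    qed
    also have "c\<^sub>1 * (LINT x|lborel. indicator (ball 0 1) x * f (r\<^sub>1 *\<^sub>R sgn x)) +
       \<beta> * (real ?n * r\<^sub>2 ^ (?n - 1) * (LINT x|lborel. indicator (ball 0 1) x * f (r\<^sub>2 *\<^sub>R sgn x)))
      = \<alpha> * sphere_flux r\<^sub>1 f + \<beta> * sphere_flux r\<^sub>2 f"
      using two by (simp add: c\<^sub>1_def c\<^sub>2_def sphere_flux_def)
    finally show "(LINT x|\<sigma>. f x) = \<alpha> * sphere_flux r\<^sub>1 f + \<beta> * sphere_flux r\<^sub>2 f" .
  qed
qed

section \<open>Radial functions\<close>

lemma has_derivative_radial:
  fixes x :: "'a::euclidean_space"
  assumes "x \<noteq> 0" "(f has_real_derivative f') (at (norm x))"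
  shows "((\<lambda>x. f (norm x)) has_derivative (\<lambda>v. (f' *\<^sub>R sgn x) \<bullet> v)) (at x)"
proof -
  have "((\<lambda>x. f (norm x)) has_derivative (\<lambda>v. f' * (v \<bullet> sgn x))) (at x)"
    using has_derivative_compose[OF has_derivative_norm[OF assms(1)], of f "(*) f'"] assms(2)
    by (simp add: has_field_derivative_def)
  then show ?thesis by (simp add: inner_commute)
qed

lemma grad_radial:
  "x \<noteq> 0 \<Longrightarrow> (f has_real_derivative f') (at (norm x)) \<Longrightarrow> grad (\<lambda>x. f (norm x)) x = f' *\<^sub>R sgn x"
  by (rule grad_eqI) (rule has_derivative_radial)

lemma has_derivative_sgn:
  fixes x :: "'a::euclidean_space"
  assumes "x \<noteq> 0"
  shows "(sgn has_derivative (\<lambda>v. (v - (sgn x \<bullet> v) *\<^sub>R sgn x) /\<^sub>R norm x)) (at x)"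
proof -
  have i: "((\<lambda>x. inverse (norm x)) has_derivative (\<lambda>v. ((- inverse ((norm x)\<^sup>2)) *\<^sub>R sgn x) \<bullet> v)) (at x)"
    by (rule has_derivative_radial[OF assms]) (use DERIV_inverse[of "norm x"] assms in \<open>simp add: numeral_2_eq_2\<close>)
  have "((\<lambda>x. inverse (norm x) *\<^sub>R x) has_derivative
      (\<lambda>v. inverse (norm x) *\<^sub>R v + (((- inverse ((norm x)\<^sup>2)) *\<^sub>R sgn x) \<bullet> v) *\<^sub>R x)) (at x)"
    by (rule has_derivative_scaleR[OF i]) simp
  moreover have "inverse (norm x) *\<^sub>R v + (((- inverse ((norm x)\<^sup>2)) *\<^sub>R sgn x) \<bullet> v) *\<^sub>R x
     = (v - (sgn x \<bullet> v) *\<^sub>R sgn x) /\<^sub>R norm x" for v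
    using assms by (simp add: sgn_div_norm power2_eq_square scaleR_diff_right mult.assoc)
  ultimately have "((\<lambda>x. inverse (norm x) *\<^sub>R x) has_derivative (\<lambda>v. (v - (sgn x \<bullet> v) *\<^sub>R sgn x) /\<^sub>R norm x)) (at x)"
    by simp
  then show ?thesis by (simp add: sgn_div_norm[abs_def])
qed

lemma inner_sgn_self: "x \<noteq> 0 \<Longrightarrow> sgn x \<bullet> sgn x = (1::real)"
  by (simp add: dot_square_norm norm_sgn)

text \<open>This is the trace of the orthogonal projection onto the hyperplane normal to
  \<open>p\<close>, whose rank is one less than the dimension.\<close>

lemma sum_Basis_projection:
  fixes p :: "'a::euclidean_space"
  assumes "p \<noteq> 0"
  shows "(\<Sum>i\<in>Basis. (i - (sgn p \<bullet> i) *\<^sub>R sgn p) \<bullet> i) = real DIM('a) - 1"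
proof -
  have "(\<Sum>i\<in>Basis. (i - (sgn p \<bullet> i) *\<^sub>R sgn p) \<bullet> i) = (\<Sum>i\<in>(Basis::'a set). 1 - (sgn p \<bullet> i) * (sgn p \<bullet> i))"
    by (intro sum.cong refl) (simp add: inner_diff_left)
  also have "\<dots> = real DIM('a) - sgn p \<bullet> sgn p"
    by (subst euclidean_inner[of "sgn p" "sgn p"]) (simp add: sum_subtractf)
  finally show ?thesis using assms by (simp add: inner_sgn_self)
qed

lemma divergence_radial:
  fixes x :: "'a::euclidean_space"
  assumes "x \<noteq> 0" "(f has_real_derivative f') (at (norm x))"
  shows "divergence (\<lambda>x. f (norm x) *\<^sub>R sgn x) x = f' + (real DIM('a) - 1) * f (norm x) / norm x"
proof -
  have "divergence (\<lambda>x. f (norm x) *\<^sub>R sgn x) x = f (norm x) * divergence sgn x + grad (\<lambda>x. f (norm x)) x \<bullet> sgn x"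
    by (rule divergence_scaleR)
       (use has_derivative_radial[OF assms] has_derivative_sgn[OF assms(1)] in \<open>blast intro: differentiableI\<close>)+
  also have "divergence sgn x = (\<Sum>i\<in>Basis. (i - (sgn x \<bullet> i) *\<^sub>R sgn x) \<bullet> i) / norm x"
    unfolding divergence_eqI[OF has_derivative_sgn[OF assms(1)]]
    by (simp add: sum_divide_distrib divide_inverse mult.commute sum_distrib_left)
  finally show ?thesis
    by (simp add: grad_radial[OF assms] sum_Basis_projection[OF assms(1)] inner_sgn_self[OF assms(1)])
qed

lemma smooth_on_radial:
  fixes f :: "real \<Rightarrow> real"
  assumes "open S" "open T" "smooth_on T f" "\<And>x::'a::euclidean_space. x \<in> S \<Longrightarrow> x \<noteq> 0 \<and> norm x \<in> T"
  shows "smooth_on S (\<lambda>x. f (norm x))"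
  by (rule smooth_on_comp_real[OF assms(1) smooth_on_subset[OF smooth_on_norm] assms(2,3)]) (use assms(4) in auto)

lemma smooth_on_sgn: "smooth_on (- {0}) (sgn :: 'a::euclidean_space \<Rightarrow> 'a)"
proof -
  have "smooth_on (- {0}) (\<lambda>x::'a. inverse (norm x) *\<^sub>R x)"
    by (intro smooth_on_scaleR smooth_on_id smooth_on_radial[OF _ _ smooth_on_inverse]) auto
  then show ?thesis by (simp add: sgn_div_norm[abs_def])
qed

section \<open>Normal and mean curvature of radial domains\<close>

text \<open>The direction \<open>b - a\<close> would otherwise have a negative product with
  \<open>a\<close> and a positive one with \<open>b\<close>. Used to show that a normal depends only
  on the set near the point.\<close>

lemma unit_vectors_eqI:
  fixes a b :: "'a::real_inner"
  assumes "norm a = 1" "norm b = 1" "\<And>v. a \<bullet> v < 0 \<Longrightarrow> b \<bullet> v \<le> 0"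
  shows "a = b"
proof (rule ccontr)
  assume "a \<noteq> b"
  then have "(b - a) \<bullet> (b - a) > 0" by simp
  moreover have "a \<bullet> a = 1" "b \<bullet> b = 1" using assms by (auto simp: dot_square_norm)
  ultimately have "a \<bullet> b < 1" by (simp add: inner_diff_left inner_diff_right inner_commute)
  then have "a \<bullet> (b - a) < 0" using \<open>a \<bullet> a = 1\<close> by (simp add: inner_diff_right)
  from assms(3)[OF this] show False
    using \<open>b \<bullet> b = 1\<close> \<open>a \<bullet> b < 1\<close> by (simp add: inner_diff_right inner_commute)
qed

text \<open>A negative value would put \<open>p\<close> into the open set \<open>U\<close>; a
  positive one would keep a whole neighbourhood of \<open>p\<close> out of \<open>U\<close>.\<close>

lemma local_defining_function_zero:
  assumes "local_defining_function U p V f" "p \<in> frontier U" "open U"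
  shows "f p = 0"
proof (rule ccontr)
  assume "f p \<noteq> 0"
  have V: "open V" "p \<in> V" "smooth_on V f" "U \<inter> V = {x \<in> V. f x < 0}"
    using assms(1) unfolding local_defining_function_def by auto
  have "p \<notin> U" using assms(2,3) by (simp add: frontier_def interior_open)
  then have "f p > 0" using V \<open>f p \<noteq> 0\<close> by force
  have "open (V \<inter> f -` {0<..})"
    by (rule continuous_open_preimage[OF smooth_on_continuous_on[OF V(3)] V(1)]) simp
  moreover have "p \<in> V \<inter> f -` {0<..}" using V \<open>f p > 0\<close> by simp
  moreover have "p \<in> closure U" using assms(2) by (simp add: frontier_def)
  ultimately have "U \<inter> (V \<inter> f -` {0<..}) \<noteq> {}"
    using open_Int_closure_eq_empty by blast
  then show False using V(4) by force
qed

lemma directional_derivative_sgn: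
  assumes "(f has_derivative (\<lambda>v. a \<bullet> v)) (at p)" "f p = 0"
  shows "((\<lambda>t. f (p + t *\<^sub>R v)) has_real_derivative a \<bullet> v) (at 0)"
proof -
  have "((\<lambda>t. p + t *\<^sub>R v) has_derivative (\<lambda>t. t *\<^sub>R v)) (at 0)"
    by (auto intro!: derivative_eq_intros)
  then have "((\<lambda>t. f (p + t *\<^sub>R v)) has_derivative (\<lambda>t. a \<bullet> (t *\<^sub>R v))) (at 0)"
    by (rule has_derivative_compose) (use assms in simp)
  moreover have "(\<lambda>t. a \<bullet> (t *\<^sub>R v)) = (*) (a \<bullet> v)" by (auto simp: mult.commute)
  ultimately show ?thesis by (simp add: has_field_derivative_def)
qed

text \<open>Along a direction in which \<open>f\<close> decreases one enters \<open>U\<close>, so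
  \<open>g\<close> cannot increase along it. Hence the half-spaces of the two gradients are nested,
  and the description operator in \<open>outer_normal\<close> is meaningful.\<close>

lemma local_defining_function_normal_unique:
  assumes f: "local_defining_function U p V f" and g: "local_defining_function U p W g"
    and p: "p \<in> frontier U" and U: "open U"
  shows "grad f p /\<^sub>R norm (grad f p) = grad g p /\<^sub>R norm (grad g p)"
proof (rule unit_vectors_eqI)
  have V: "open V" "p \<in> V" "smooth_on V f" "grad f p \<noteq> 0" "U \<inter> V = {x \<in> V. f x < 0}"
    using f unfolding local_defining_function_def by auto
  have W: "open W" "p \<in> W" "smooth_on W g" "grad g p \<noteq> 0" "U \<inter> W = {x \<in> W. g x < 0}"
    using g unfolding local_defining_function_def by auto
  show "norm (grad f p /\<^sub>R norm (grad f p)) = 1" "norm (grad g p /\<^sub>R norm (grad g p)) = 1"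
    using V W by auto
  fix v assume "(grad f p /\<^sub>R norm (grad f p)) \<bullet> v < 0"
  then have neg: "grad f p \<bullet> v < 0" using V(4) by (simp add: mult_less_0_iff)
  have Df: "((\<lambda>t. f (p + t *\<^sub>R v)) has_real_derivative grad f p \<bullet> v) (at 0)"
    by (rule directional_derivative_sgn[OF has_derivative_grad[OF smooth_on_differentiable[OF V(3,2)]]
          local_defining_function_zero[OF f p U]])
  have Dg: "((\<lambda>t. g (p + t *\<^sub>R v)) has_real_derivative grad g p \<bullet> v) (at 0)"
    by (rule directional_derivative_sgn[OF has_derivative_grad[OF smooth_on_differentiable[OF W(3,2)]]
          local_defining_function_zero[OF g p U]])
  have "grad g p \<bullet> v \<le> 0"
  proof (rule ccontr)
    assume "\<not> grad g p \<bullet> v \<le> 0"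
    then obtain d where d: "d > 0" "\<And>h. 0 < h \<Longrightarrow> h < d \<Longrightarrow> g p < g (p + h *\<^sub>R v)"
      using DERIV_pos_inc_right[OF Dg] by auto
    obtain e where e: "e > 0" "\<And>h. 0 < h \<Longrightarrow> h < e \<Longrightarrow> f (p + h *\<^sub>R v) < f p"
      using DERIV_neg_dec_right[OF Df neg] by auto
    have "open ((\<lambda>t. p + t *\<^sub>R v) -` (V \<inter> W))"
      by (intro open_vimage open_Int V W continuous_intros)
    moreover have "0 \<in> (\<lambda>t. p + t *\<^sub>R v) -` (V \<inter> W)" using V W by simp
    ultimately obtain c where c: "c > 0" "ball 0 c \<subseteq> (\<lambda>t. p + t *\<^sub>R v) -` (V \<inter> W)"
      unfolding open_contains_ball by blast
    define h where "h = min c (min d e) / 2"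
    have h: "0 < h" "h < c" "h < d" "h < e" using c d e by (auto simp: h_def min_def)
    have "h \<in> ball 0 c" using h by simp
    then have "p + h *\<^sub>R v \<in> V \<inter> W" using c(2) by blast
    moreover have "f (p + h *\<^sub>R v) < 0" "g (p + h *\<^sub>R v) > 0"
      using d(2)[OF h(1,3)] e(2)[OF h(1,4)] local_defining_function_zero[OF f p U]
        local_defining_function_zero[OF g p U] by auto
    ultimately show False using V(5) W(5) by force
  qed
  then show "(grad g p /\<^sub>R norm (grad g p)) \<bullet> v \<le> 0"
    using W(4) by (simp add: mult_le_0_iff)
qed

lemma outer_normal_eqI:
  assumes "local_defining_function U p V f" "p \<in> frontier U" "open U"
  shows "outer_normal U p = grad f p /\<^sub>R norm (grad f p)"
  unfolding outer_normal_def
proof (rule the_equality)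
  show "\<exists>V g. local_defining_function U p V g \<and> grad f p /\<^sub>R norm (grad f p) = grad g p /\<^sub>R norm (grad g p)"
    using assms(1) by blast
  fix v assume "\<exists>V g. local_defining_function U p V g \<and> v = grad g p /\<^sub>R norm (grad g p)"
  then show "v = grad f p /\<^sub>R norm (grad f p)"
    using local_defining_function_normal_unique[OF _ assms] by blast
qed

text \<open>One defining function covers balls, exteriors and annuli at once. \<open>regular\<close>
  keeps the boundary away from the origin, where the norm is not smooth, and makes \<open>F\<close>
  change sign across every boundary sphere.\<close>

locale radial_domain =
  fixes F F' :: "real \<Rightarrow> real" and U :: "'a::euclidean_space set"
  assumes F_smooth: "smooth_on UNIV F"
    and F_deriv: "\<And>r. (F has_real_derivative F' r) (at r)"
    and U_eq: "U = {x. F (norm x) < 0}"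
    and regular: "\<And>r. 0 \<le> r \<Longrightarrow> F r = 0 \<Longrightarrow> r > 0 \<and> F' r \<noteq> 0"

lemma (in radial_domain) F_cont: "continuous_on UNIV F"
  by (rule smooth_on_continuous_on[OF F_smooth])

lemma (in radial_domain) F'_smooth: "smooth_on UNIV F'"
proof -
  have "deriv F = F'" using F_deriv DERIV_imp_deriv by blast
  with smooth_on_deriv(1)[OF open_UNIV F_smooth] show ?thesis by simp
qed

lemma (in radial_domain) F'_cont: "continuous_on UNIV F'"
  by (rule smooth_on_continuous_on[OF F'_smooth])

lemma (in radial_domain) F_norm_cont: "continuous_on A (\<lambda>x. F (norm x))"
  by (rule continuous_on_compose2[OF F_cont]) (auto intro: continuous_intros)

lemma (in radial_domain) F'_norm_cont: "continuous_on A (\<lambda>x. F' (norm x))"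
  by (rule continuous_on_compose2[OF F'_cont]) (auto intro: continuous_intros)

lemma (in radial_domain) open_U: "open U"
  unfolding U_eq by (intro open_Collect_less F_norm_cont continuous_intros)

lemma (in radial_domain) closure_U: "x \<in> closure U \<Longrightarrow> F (norm x) \<le> 0"
proof -
  have "closed {x. F (norm x) \<le> 0}" by (intro closed_Collect_le F_norm_cont continuous_intros)
  then have "closure U \<subseteq> {x. F (norm x) \<le> 0}" by (rule closure_minimal[rotated]) (auto simp: U_eq)
  then show "x \<in> closure U \<Longrightarrow> F (norm x) \<le> 0" by blast
qed

text \<open>At a zero of \<open>F\<close> the derivative is nonzero, so a small radial displacement
  to one side makes \<open>F\<close> negative; which side depends on the sign of
  \<open>F'\<close>.\<close>

lemma (in radial_domain) frontier_iff: "p \<in> frontier U \<longleftrightarrow> F (norm p) = 0"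
proof
  assume "p \<in> frontier U"
  then have "p \<in> closure U" "p \<notin> U" using open_U by (auto simp: frontier_def interior_open)
  then show "F (norm p) = 0" using closure_U[of p] U_eq by auto
next
  assume z: "F (norm p) = 0"
  then have r: "norm p > 0" "F' (norm p) \<noteq> 0" using regular[of "norm p"] by auto
  then have p0: "p \<noteq> 0" by auto
  have "\<exists>x\<in>U. dist x p < e" if "e > 0" for e
  proof -
    have "\<exists>h. \<bar>h\<bar> < min e (norm p) \<and> F (norm p + h) < 0"
    proof (cases "F' (norm p) > 0")
      case True
      then obtain d where d: "d > 0" "\<And>h. 0 < h \<Longrightarrow> h < d \<Longrightarrow> F (norm p - h) < F (norm p)"
        using DERIV_pos_inc_left[OF F_deriv] by blast
      define h where "h = min d (min e (norm p)) / 2"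
      have "h > 0" "h < d" "h < e" "h < norm p" using d that r by (auto simp: h_def min_def)
      then show ?thesis using d(2)[of h] z by (intro exI[of _ "- h"]) simp
    next
      case False
      then have "F' (norm p) < 0" using r by simp
      then obtain d where d: "d > 0" "\<And>h. 0 < h \<Longrightarrow> h < d \<Longrightarrow> F (norm p + h) < F (norm p)"
        using DERIV_neg_dec_right[OF F_deriv] by metis
      define h where "h = min d (min e (norm p)) / 2"
      have "h > 0" "h < d" "h < e" "h < norm p" using d that r by (auto simp: h_def min_def)
      then show ?thesis using d(2)[of h] z by (intro exI[of _ h]) simp
    qed
    then obtain h where h: "\<bar>h\<bar> < e" "\<bar>h\<bar> < norm p" "F (norm p + h) < 0" by auto
    define x where "x = (norm p + h) *\<^sub>R sgn p"
    have "norm x = norm p + h" using h(2) p0 by (simp add: x_def norm_sgn)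
    then have "x \<in> U" using h(3) by (simp add: U_eq)
    moreover have "x - p = h *\<^sub>R sgn p"
    proof -
      have "norm p *\<^sub>R sgn p = p" using p0 by (simp add: sgn_div_norm)
      then show ?thesis by (simp add: x_def scaleR_add_left)
    qed
    then have "dist x p < e" using h(1) p0 by (simp add: dist_norm norm_sgn)
    ultimately show ?thesis by blast
  qed
  then have "p \<in> closure U" by (auto simp: closure_approachable)
  moreover have "p \<notin> U" using z by (simp add: U_eq)
  ultimately show "p \<in> frontier U" using open_U by (simp add: frontier_def interior_open)
qed

lemma (in radial_domain) frontier_props:
  assumes "p \<in> frontier U"
  shows "norm p > 0" "p \<noteq> 0" "F' (norm p) \<noteq> 0"
  using assms regular[of "norm p"] by (auto simp: frontier_iff)

lemma (in radial_domain) local_defining_function_F: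
  assumes "p \<in> frontier U"
  shows "local_defining_function U p {x. x \<noteq> 0 \<and> F' (norm x) \<noteq> 0} (\<lambda>x. F (norm x))"
  unfolding local_defining_function_def
proof (intro conjI ballI)
  have *: "{x. x \<noteq> 0 \<and> F' (norm x) \<noteq> 0} = - {0} \<inter> {x. F' (norm x) \<noteq> 0}" by auto
  show op: "open {x::'a. x \<noteq> 0 \<and> F' (norm x) \<noteq> 0}"
    unfolding * by (intro open_Int open_Collect_neq F'_norm_cont continuous_intros)
  show "p \<in> {x. x \<noteq> 0 \<and> F' (norm x) \<noteq> 0}" using frontier_props[OF assms] by simp
  show "smooth_on {x::'a. x \<noteq> 0 \<and> F' (norm x) \<noteq> 0} (\<lambda>x. F (norm x))"
    by (rule smooth_on_radial[OF op open_UNIV F_smooth]) auto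
  show "grad (\<lambda>x. F (norm x)) x \<noteq> 0" if "x \<in> {x. x \<noteq> 0 \<and> F' (norm x) \<noteq> 0}" for x
    using that grad_radial[OF _ F_deriv, of x] by (auto simp: sgn_zero_iff)
  show "U \<inter> {x. x \<noteq> 0 \<and> F' (norm x) \<noteq> 0} = {x \<in> {x. x \<noteq> 0 \<and> F' (norm x) \<noteq> 0}. F (norm x) < 0}"
    by (auto simp: U_eq)
qed

lemma (in radial_domain) smooth_open_set_U: "smooth_open_set U"
  unfolding smooth_open_set_def using open_U local_defining_function_F by blast

lemma (in radial_domain) outer_normal_U:
  assumes "p \<in> frontier U"
  shows "outer_normal U p = sgn (F' (norm p)) *\<^sub>R sgn p"
proof -
  have "grad (\<lambda>x. F (norm x)) p = F' (norm p) *\<^sub>R sgn p"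
    by (rule grad_radial[OF _ F_deriv]) (use frontier_props[OF assms] in auto)
  then show ?thesis
    using outer_normal_eqI[OF local_defining_function_F[OF assms] assms open_U] frontier_props[OF assms]
    by (simp add: norm_sgn real_sgn_eq divide_inverse mult.commute)
qed

text \<open>The derivative of \<open>N\<close> at \<open>p\<close> is known on tangential vectors,
  where it comes from differentiating \<open>sgn\<close>, and its values have no radial component
  because \<open>N\<close> has constant length. These two facts determine its trace.\<close>

lemma divergence_unit_field:
  fixes N :: "'a::euclidean_space \<Rightarrow> 'a"
  assumes V: "open V" "p \<in> V" "smooth_on V N" "\<And>x. x \<in> V \<Longrightarrow> norm (N x) = 1"
    and p: "p \<noteq> 0" and eps: "\<bar>\<epsilon>\<bar> = 1"
    and eq: "\<And>x. x \<in> V \<Longrightarrow> norm x = norm p \<Longrightarrow> N x = \<epsilon> *\<^sub>R sgn x"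
  shows "divergence N p = \<epsilon> * (real DIM('a) - 1) / norm p"
proof -
  define D where "D = frechet_derivative N (at p)"
  have D: "(N has_derivative D) (at p)" unfolding D_def by (rule smooth_on_has_derivative[OF V(3,2)])
  have lin: "linear D" by (rule has_derivative_linear[OF D])
  define P where "P v = v - (sgn p \<bullet> v) *\<^sub>R sgn p" for v
  have Np: "N p = \<epsilon> *\<^sub>R sgn p" using eq V by simp
  have normal: "D v \<bullet> sgn p = 0" for v
  proof -
    have "((\<lambda>x. N x \<bullet> N x) has_derivative (\<lambda>v. N p \<bullet> D v + D v \<bullet> N p)) (at p)"
      by (intro has_derivative_inner D)
    moreover have "((\<lambda>x. N x \<bullet> N x) has_derivative (\<lambda>v. 0)) (at p)"
      by (rule has_derivative_transform_within_open[OF has_derivative_const[of 1] V(1,2)])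
         (simp add: V(4) dot_square_norm)
    ultimately have "(\<lambda>v. N p \<bullet> D v + D v \<bullet> N p) = (\<lambda>v. 0)"
      by (rule has_derivative_unique)
    then have "N p \<bullet> D v + D v \<bullet> N p = 0" by meson
    then show ?thesis using eps by (auto simp: Np inner_commute)
  qed
  \<comment> \<open>Composing \<open>N\<close> with the radial projection onto the sphere through
    \<open>p\<close> gives an explicitly known map; its derivative at \<open>p\<close> is
    \<open>D\<close> on the tangential part.\<close>
  have tang: "D (P v) = \<epsilon> *\<^sub>R (P v /\<^sub>R norm p)" for v
  proof -
    have r: "((\<lambda>x. norm p *\<^sub>R sgn x) has_derivative P) (at p)"
      using has_derivative_scaleR_right[OF has_derivative_sgn[OF p], of "norm p"] p
      by (simp add: P_def[abs_def])
    have pp: "norm p *\<^sub>R sgn p = p" using p by (simp add: sgn_div_norm)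
    have "((\<lambda>x. N (norm p *\<^sub>R sgn x)) has_derivative (\<lambda>v. D (P v))) (at p)"
      by (rule has_derivative_compose[OF r]) (simp add: pp D)
    moreover have "((\<lambda>x. N (norm p *\<^sub>R sgn x)) has_derivative (\<lambda>v. \<epsilon> *\<^sub>R (P v /\<^sub>R norm p))) (at p)"
    proof (rule has_derivative_transform_within_open)
      show "((\<lambda>x. \<epsilon> *\<^sub>R sgn x) has_derivative (\<lambda>v. \<epsilon> *\<^sub>R (P v /\<^sub>R norm p))) (at p)"
        unfolding P_def by (intro has_derivative_scaleR_right has_derivative_sgn p)
      have "continuous_on (- {0}) (\<lambda>x::'a. norm p *\<^sub>R sgn x)"
        by (intro continuous_intros smooth_on_continuous_on[OF smooth_on_sgn])
      then show "open (- {0} \<inter> (\<lambda>x. norm p *\<^sub>R sgn x) -` V)"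
        by (rule continuous_open_preimage) (use V in auto)
      show "p \<in> - {0} \<inter> (\<lambda>x. norm p *\<^sub>R sgn x) -` V" using p pp V by simp
      show "\<epsilon> *\<^sub>R sgn x = N (norm p *\<^sub>R sgn x)" if "x \<in> - {0} \<inter> (\<lambda>x. norm p *\<^sub>R sgn x) -` V" for x
        using that p by (subst eq) (auto simp: norm_sgn sgn_scaleR_pos sgn_sgn_vector)
    qed
    ultimately have "(\<lambda>v. D (P v)) = (\<lambda>v. \<epsilon> *\<^sub>R (P v /\<^sub>R norm p))" by (rule has_derivative_unique)
    then show ?thesis by meson
  qed
  have "D i \<bullet> i = \<epsilon> / norm p * (P i \<bullet> i) + (sgn p \<bullet> i) * (D (sgn p) \<bullet> i)" for i
  proof -
    have "D i = D (P i + (sgn p \<bullet> i) *\<^sub>R sgn p)" by (simp add: P_def)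
    also have "\<dots> = \<epsilon> *\<^sub>R (P i /\<^sub>R norm p) + (sgn p \<bullet> i) *\<^sub>R D (sgn p)"
      using lin tang by (simp add: linear_add linear_cmul)
    finally show ?thesis by (simp add: inner_add_left divide_inverse)
  qed
  then have "divergence N p = \<epsilon> / norm p * (\<Sum>i\<in>Basis. P i \<bullet> i) + (\<Sum>i\<in>Basis. (sgn p \<bullet> i) * (D (sgn p) \<bullet> i))"
    by (simp add: divergence_eqI[OF D] sum.distrib sum_distrib_left)
  also have "(\<Sum>i\<in>Basis. (sgn p \<bullet> i) * (D (sgn p) \<bullet> i)) = D (sgn p) \<bullet> sgn p"
    by (subst euclidean_inner[of "D (sgn p)"]) (simp add: mult.commute)
  finally show ?thesis using normal sum_Basis_projection[OF p] by (simp add: P_def)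
qed

lemma (in radial_domain) mean_curvature_U:
  assumes p: "p \<in> frontier U"
  shows "mean_curvature U p = sgn (F' (norm p)) * (real DIM('a) - 1) / norm p"
proof -
  define \<epsilon> where "\<epsilon> = sgn (F' (norm p))"
  note pp = frontier_props[OF p]
  have eps: "\<bar>\<epsilon>\<bar> = 1" using pp by (simp add: \<epsilon>_def abs_sgn_eq)
  have key: "divergence N p = \<epsilon> * (real DIM('a) - 1) / norm p"
    if "open V" "p \<in> V" "smooth_on V N" "\<forall>x\<in>V. norm (N x) = 1" "\<forall>x\<in>V \<inter> frontier U. N x = outer_normal U x" for V N
  proof (rule divergence_unit_field[OF that(1-3) _ pp(2) eps])
    fix x assume x: "x \<in> V" "norm x = norm p"
    then have "x \<in> frontier U" using p by (simp add: frontier_iff)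
    then show "N x = \<epsilon> *\<^sub>R sgn x" using that(5) x outer_normal_U[of x] by (simp add: \<epsilon>_def)
  qed (use that in auto)
  \<comment> \<open>\<open>F'\<close> keeps its sign on \<open>V\<close>, so that the single field
    \<open>\<epsilon> *\<^sub>R sgn x\<close> extends the normal; on an annulus this excludes the
    other boundary sphere.\<close>
  define V where "V = - {0} \<inter> {x::'a. F' (norm x) * F' (norm p) > 0}"
  have V: "open V" unfolding V_def by (intro open_Int open_Collect_less continuous_intros F'_norm_cont)
  have pV: "p \<in> V" using pp by (simp add: V_def zero_less_mult_iff) linarith
  have sm: "smooth_on V (\<lambda>x. \<epsilon> *\<^sub>R sgn x)"
    by (rule smooth_on_scaleR[OF V smooth_on_const[OF V] smooth_on_subset[OF smooth_on_sgn]]) (auto simp: V_def)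
  have ex: "\<exists>V N. open V \<and> p \<in> V \<and> smooth_on V N \<and> (\<forall>x\<in>V. norm (N x) = 1) \<and>
      (\<forall>x\<in>V \<inter> frontier U. N x = outer_normal U x) \<and> \<epsilon> * (real DIM('a) - 1) / norm p = divergence N p"
  proof (intro exI conjI)
    show 1: "\<forall>x\<in>V. norm (\<epsilon> *\<^sub>R sgn x) = 1" using eps by (auto simp: V_def norm_sgn)
    show 2: "\<forall>x\<in>V \<inter> frontier U. \<epsilon> *\<^sub>R sgn x = outer_normal U x"
      by (auto simp: V_def outer_normal_U \<epsilon>_def zero_less_mult_iff)
    show "\<epsilon> * (real DIM('a) - 1) / norm p = divergence (\<lambda>x. \<epsilon> *\<^sub>R sgn x) p"
      using key[OF V pV sm 1 2] by simp
  qed (fact V pV sm)+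
  show ?thesis
    unfolding mean_curvature_def \<epsilon>_def[symmetric]
  proof (rule the_equality)
    show "\<exists>V N. open V \<and> p \<in> V \<and> smooth_on V N \<and> (\<forall>x\<in>V. norm (N x) = 1) \<and>
      (\<forall>x\<in>V \<inter> frontier U. N x = outer_normal U x) \<and> \<epsilon> * (real DIM('a) - 1) / norm p = divergence N p"
      by (fact ex)
  qed (use key in blast)
qed

section \<open>Surface measures\<close>

lemma sphere_flux_cong:
  assumes "f \<in> borel_measurable borel" "g \<in> borel_measurable borel" "r > 0"
    and "\<And>x::'a::euclidean_space. norm x = r \<Longrightarrow> f x = g x"
  shows "sphere_flux r f = sphere_flux r g"
proof -
  have "(LINT x|lborel. indicator (ball 0 1) x * f (r *\<^sub>R sgn x)) = (LINT x|lborel. indicator (ball 0 1) x * g (r *\<^sub>R sgn (x::'a)))"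
  proof (rule integral_cong_AE)
    show "AE x in lborel. indicator (ball 0 1) x * f (r *\<^sub>R sgn x) = indicator (ball 0 1) x * g (r *\<^sub>R sgn (x::'a))"
      using AE_norm_neq[of 0] by eventually_elim (use assms(3,4) in \<open>simp add: norm_sgn\<close>)
    have m: "(\<lambda>x. indicator (ball 0 1) x * h (r *\<^sub>R sgn (x::'a))) \<in> borel_measurable lborel" if "h \<in> borel_measurable borel" for h :: "'a \<Rightarrow> real"
    proof -
      have "(\<lambda>x. indicator (ball 0 1) x * h (r *\<^sub>R sgn (x::'a))) \<in> borel_measurable borel"
        by (intro borel_measurable_times indicator_ball_borel_measurable measurable_compose[OF _ that]
            borel_measurable_scaleR borel_measurable_const sgn_borel_measurable)
      then show ?thesis by simp
    qed
    show "(\<lambda>x. indicator (ball 0 1) x * f (r *\<^sub>R sgn (x::'a))) \<in> borel_measurable lborel"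
      "(\<lambda>x. indicator (ball 0 1) x * g (r *\<^sub>R sgn (x::'a))) \<in> borel_measurable lborel"
      using m assms(1,2) by auto
  qed
  then show ?thesis by (simp add: sphere_flux_def)
qed

lemma sphere_flux_cmult: "sphere_flux r (\<lambda>x. c * f x) = c * sphere_flux r f"
  by (simp add: sphere_flux_def mult.left_commute[of _ c])

lemma (in radial_domain) frontier_borel: "frontier U \<in> sets borel"
  by (simp add: frontier_closed borel_closed)

lemma (in radial_domain) normal_borel:
  "(\<lambda>x. sgn (F' (norm x)) *\<^sub>R sgn x) \<in> borel_measurable (borel :: 'a measure)"
proof -
  have "(\<lambda>x::'a. F' (norm x)) \<in> borel_measurable borel"
    by (rule borel_measurable_continuous_onI[OF F'_norm_cont])
  then have "(\<lambda>x::'a. sgn (F' (norm x))) \<in> borel_measurable borel"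
    by (rule measurable_compose[OF _ sgn_borel_measurable])
  then show ?thesis by (rule borel_measurable_scaleR[OF _ sgn_borel_measurable])
qed

lemma (in radial_domain) flux_borel:
  fixes \<psi> :: "'a \<Rightarrow> 'a"
  assumes "test_function UNIV \<psi>"
  shows "(\<lambda>x. \<psi> x \<bullet> (sgn (F' (norm x)) *\<^sub>R sgn x)) \<in> borel_measurable borel"
  by (intro borel_measurable_inner normal_borel test_function_borel[OF assms])

text \<open>Existence, so that the measure selected by \<open>SOME\<close> really satisfies the
  Gauss-Green formula. Two weights cover one or two boundary spheres: for a single one, both radii
  coincide and \<beta> is 0.\<close>

lemma (in radial_domain) is_surface_measure_U:
  assumes r: "r\<^sub>1 > 0" "r\<^sub>2 > 0" "\<alpha> \<ge> 0" "\<beta> \<ge> 0"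
    and zeros: "\<And>r. r \<ge> 0 \<Longrightarrow> F r = 0 \<longleftrightarrow> r = r\<^sub>1 \<or> r = r\<^sub>2"
    and gg: "\<And>\<psi>. test_function UNIV \<psi> \<Longrightarrow> (LINT x|lborel. indicator U x * divergence \<psi> x) =
       \<alpha> * sphere_flux r\<^sub>1 (\<lambda>x. \<psi> x \<bullet> (sgn (F' (norm x)) *\<^sub>R sgn x)) +
       \<beta> * sphere_flux r\<^sub>2 (\<lambda>x. \<psi> x \<bullet> (sgn (F' (norm x)) *\<^sub>R sgn x))"
  shows "is_surface_measure U (surface_measure U)"
proof -
  obtain \<sigma> :: "'a measure" where \<sigma>: "sets \<sigma> = sets borel" "emeasure \<sigma> UNIV < \<infinity>"
    "\<And>A. A \<in> sets borel \<Longrightarrow> A \<inter> (sphere 0 r\<^sub>1 \<union> sphere 0 r\<^sub>2) = {} \<Longrightarrow> emeasure \<sigma> A = 0"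
    "\<And>f M. f \<in> borel_measurable borel \<Longrightarrow> (\<And>x. \<bar>f x\<bar> \<le> M) \<Longrightarrow>
        (LINT x|\<sigma>. f x) = \<alpha> * sphere_flux r\<^sub>1 f + \<beta> * sphere_flux r\<^sub>2 f"
    using two_spheres_measure[OF r] by metis
  have "is_surface_measure U \<sigma>"
    unfolding is_surface_measure_def
  proof (intro conjI allI impI)
    show "sets \<sigma> = sets borel" by (fact \<sigma>)
    show "emeasure \<sigma> K < \<infinity>" if "compact K" for K
    proof -
      have "emeasure \<sigma> K \<le> emeasure \<sigma> UNIV" by (rule emeasure_mono) (simp_all add: \<sigma>(1))
      with \<sigma>(2) show ?thesis by (rule le_less_trans[rotated])
    qed
    show "emeasure \<sigma> (- frontier U) = 0"
      by (rule \<sigma>(3)) (use frontier_borel zeros frontier_iff in \<open>auto simp: Compl_in_sets_lebesgue\<close>)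
    fix \<psi> :: "'a \<Rightarrow> 'a" assume \<psi>: "test_function UNIV \<psi>"
    obtain M where M: "M > 0" "\<And>x. norm (\<psi> x) \<le> M" using test_function_bounded[OF \<psi>] by metis
    define g where "g x = \<psi> x \<bullet> (sgn (F' (norm x)) *\<^sub>R sgn x)" for x
    define f where "f x = indicator (frontier U) x * g x" for x
    have gm: "g \<in> borel_measurable borel" unfolding g_def[abs_def] by (rule flux_borel[OF \<psi>])
    have fm: "f \<in> borel_measurable borel" unfolding f_def[abs_def]
      by (intro borel_measurable_times borel_measurable_indicator frontier_borel gm)
    have fb: "\<bar>f x\<bar> \<le> M" for x
    proof -
      have "\<bar>g x\<bar> \<le> norm (\<psi> x) * norm (sgn (F' (norm x)) *\<^sub>R sgn x)"
        unfolding g_def by (rule Cauchy_Schwarz_ineq2)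
      also have "\<dots> \<le> norm (\<psi> x) * 1"
        by (intro mult_left_mono) (auto simp: norm_sgn abs_sgn_eq)
      finally show ?thesis using M(2)[of x] M(1) by (auto simp: f_def indicator_def)
    qed
    have "(LINT x:frontier U|\<sigma>. \<psi> x \<bullet> outer_normal U x) = (LINT x|\<sigma>. f x)"
      unfolding set_lebesgue_integral_def
      by (intro Bochner_Integration.integral_cong refl) (auto simp: f_def g_def indicator_def outer_normal_U)
    also have "\<dots> = \<alpha> * sphere_flux r\<^sub>1 f + \<beta> * sphere_flux r\<^sub>2 f" by (rule \<sigma>(4)[OF fm fb])
    also have "sphere_flux r\<^sub>1 f = sphere_flux r\<^sub>1 g"
      by (rule sphere_flux_cong[OF fm gm r(1)]) (use zeros[of r\<^sub>1] r frontier_iff in \<open>simp add: f_def\<close>)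
    also have "sphere_flux r\<^sub>2 f = sphere_flux r\<^sub>2 g"
      by (rule sphere_flux_cong[OF fm gm r(2)]) (use zeros[of r\<^sub>2] r frontier_iff in \<open>simp add: f_def\<close>)
    also have "\<alpha> * sphere_flux r\<^sub>1 g + \<beta> * sphere_flux r\<^sub>2 g = (LINT x|lborel. indicator U x * divergence \<psi> x)"
      unfolding gg[OF \<psi>] g_def ..
    also have "\<dots> = (LINT x|lebesgue_on U. divergence \<psi> x)"
      using open_U by (subst LINT_lebesgue_on_eq_lborel)
         (auto intro!: test_function_borel[OF test_function_divergence[OF \<psi>]])
    finally show "(LINT x|lebesgue_on U. divergence \<psi> x) = (LINT x:frontier U|\<sigma>. \<psi> x \<bullet> outer_normal U x)" ..
  qed
  then show ?thesis unfolding surface_measure_def by (rule someI)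
qed

locale gauss_domain = radial_domain F F' U for F F' :: "real \<Rightarrow> real" and U :: "'a::euclidean_space set" +
  assumes surface: "is_surface_measure U (surface_measure U)"

section \<open>Balls, exteriors and annuli as Gauss-Green domains\<close>

lemma smooth_on_ident: "smooth_on UNIV (\<lambda>x::real. x)"
  by (rule smooth_on_id) simp

lemma radial_domain_ball:
  assumes "R > 0"
  shows "radial_domain (\<lambda>r. r - R) (\<lambda>_. 1) (ball (0::'a::euclidean_space) R)"
proof
  show "smooth_on UNIV (\<lambda>r. r - R)"
    by (intro smooth_on_diff smooth_on_ident smooth_on_const open_UNIV)
qed (use assms in \<open>auto intro!: derivative_eq_intros\<close>)

lemma integral_ball_cball:
  fixes f :: "'a::euclidean_space \<Rightarrow> real"
  assumes "f \<in> borel_measurable borel"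
  shows "(LINT x|lborel. indicator (cball 0 R) x * f x) = (LINT x|lborel. indicator (ball 0 R) x * f x)"
  by (rule integral_cong_AE)
     (use AE_norm_neq[of R] assms in \<open>auto elim!: eventually_mono simp: indicator_def
       intro!: borel_measurable_times borel_measurable_indicator\<close>)

lemma gauss_domain_ball:
  assumes "R > 0"
  shows "gauss_domain (\<lambda>r. r - R) (\<lambda>_. 1) (ball (0::'a::euclidean_space) R)"
proof -
  interpret radial_domain "\<lambda>r. r - R" "\<lambda>_. 1" "ball (0::'a) R" by (rule radial_domain_ball[OF assms])
  show ?thesis
  proof
    show "is_surface_measure (ball (0::'a) R) (surface_measure (ball 0 R))"
      by (rule is_surface_measure_U[of R R 1 0]) (use assms divergence_theorem_ball[OF _ assms] in auto)
  qed
qed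

lemma radial_domain_exterior:
  assumes "R > 0"
  shows "radial_domain (\<lambda>r. R - r) (\<lambda>_. -1) (- cball (0::'a::euclidean_space) R)"
proof
  show "smooth_on UNIV (\<lambda>r. R - r)"
    by (intro smooth_on_diff smooth_on_ident smooth_on_const open_UNIV)
qed (use assms in \<open>auto intro!: derivative_eq_intros\<close>)

lemma integrable_indicator_test_function:
  fixes \<phi> :: "'a::euclidean_space \<Rightarrow> real"
  assumes "test_function V \<phi>" "A \<in> sets borel"
  shows "integrable lborel (\<lambda>x. indicator A x * \<phi> x)"
  using integrable_mult_indicator[of A lborel \<phi>] integrable_lborel_test_function[OF assms(1)] assms(2) by simp

text \<open>The divergence of a compactly supported field integrates to zero over the whole space,
  so the exterior gets minus the flux of the ball, matching the reversed normal.\<close>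

lemma gauss_domain_exterior:
  assumes "R > 0"
  shows "gauss_domain (\<lambda>r. R - r) (\<lambda>_. -1) (- cball (0::'a::euclidean_space) R)"
proof -
  interpret radial_domain "\<lambda>r. R - r" "\<lambda>_. -1" "- cball (0::'a) R" by (rule radial_domain_exterior[OF assms])
  show ?thesis
  proof
    show "is_surface_measure (- cball (0::'a) R) (surface_measure (- cball 0 R))"
    proof (rule is_surface_measure_U[of R R 1 0])
      fix \<psi> :: "'a \<Rightarrow> 'a" assume \<psi>: "test_function UNIV \<psi>"
      note d = test_function_divergence[OF \<psi>]
      have "(LINT x|lborel. indicator (- cball 0 R) x * divergence \<psi> x) =
         (LINT x|lborel. divergence \<psi> x - indicator (cball 0 R) x * divergence \<psi> x)"
        by (intro Bochner_Integration.integral_cong refl) (auto simp: indicator_def)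
      also have "\<dots> = (LINT x|lborel. divergence \<psi> x) - (LINT x|lborel. indicator (cball 0 R) x * divergence \<psi> x)"
        by (intro Bochner_Integration.integral_diff integrable_lborel_test_function[OF d]
            integrable_indicator_test_function[OF d]) auto
      also have "\<dots> = - sphere_flux R (\<lambda>x. \<psi> x \<bullet> sgn x)"
        using integral_ball_cball[OF test_function_borel[OF d], of R] divergence_theorem_ball[OF \<psi> assms]
        by (simp add: integral_divergence_eq_0[OF \<psi>])
      also have "\<dots> = sphere_flux R (\<lambda>x. \<psi> x \<bullet> (- sgn x))"
        using sphere_flux_cmult[of R "-1" "\<lambda>x. \<psi> x \<bullet> sgn x"] by simp
      finally show "(LINT x|lborel. indicator (- cball 0 R) x * divergence \<psi> x) =
         1 * sphere_flux R (\<lambda>x. \<psi> x \<bullet> (sgn (- 1) *\<^sub>R sgn x)) + 0 * sphere_flux R (\<lambda>x. \<psi> x \<bullet> (sgn (- 1) *\<^sub>R sgn x))"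
        by simp
    qed (use assms in auto)
  qed
qed

lemma radial_domain_annulus:
  assumes "0 < R\<^sub>0" "R\<^sub>0 < R\<^sub>1"
  shows "radial_domain (\<lambda>r. (r - R\<^sub>0) * (r - R\<^sub>1)) (\<lambda>r. 2 * r - R\<^sub>0 - R\<^sub>1) (annulus R\<^sub>0 R\<^sub>1 :: 'a::euclidean_space set)"
proof
  show "smooth_on UNIV (\<lambda>r. (r - R\<^sub>0) * (r - R\<^sub>1))"
    by (intro smooth_on_mult smooth_on_diff smooth_on_ident smooth_on_const open_UNIV)
  show "((\<lambda>r. (r - R\<^sub>0) * (r - R\<^sub>1)) has_real_derivative 2 * r - R\<^sub>0 - R\<^sub>1) (at r)" for r
    by (auto intro!: derivative_eq_intros)
  show "annulus R\<^sub>0 R\<^sub>1 = {x::'a. (norm x - R\<^sub>0) * (norm x - R\<^sub>1) < 0}"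
    using assms by (auto simp: annulus_def mult_less_0_iff)
qed (use assms in auto)

text \<open>The larger ball minus the smaller one. The sign of
  \<open>2 * r - R\<^sub>0 - R\<^sub>1\<close> is -1 at the inner and 1 at the outer radius, which
  turns the difference of fluxes into a sum.\<close>

lemma gauss_domain_annulus:
  assumes "0 < R\<^sub>0" "R\<^sub>0 < R\<^sub>1"
  shows "gauss_domain (\<lambda>r. (r - R\<^sub>0) * (r - R\<^sub>1)) (\<lambda>r. 2 * r - R\<^sub>0 - R\<^sub>1) (annulus R\<^sub>0 R\<^sub>1 :: 'a::euclidean_space set)"
proof -
  interpret radial_domain "\<lambda>r. (r - R\<^sub>0) * (r - R\<^sub>1)" "\<lambda>r. 2 * r - R\<^sub>0 - R\<^sub>1" "annulus R\<^sub>0 R\<^sub>1 :: 'a set"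
    by (rule radial_domain_annulus[OF assms])
  have R1: "R\<^sub>1 > 0" using assms by simp
  show ?thesis
  proof
    show "is_surface_measure (annulus R\<^sub>0 R\<^sub>1 :: 'a set) (surface_measure (annulus R\<^sub>0 R\<^sub>1))"
    proof (rule is_surface_measure_U[of R\<^sub>0 R\<^sub>1 1 1])
      fix \<psi> :: "'a \<Rightarrow> 'a" assume \<psi>: "test_function UNIV \<psi>"
      note d = test_function_divergence[OF \<psi>]
      define N where "N x = sgn (2 * norm x - R\<^sub>0 - R\<^sub>1) *\<^sub>R sgn x" for x :: 'a
      have m: "(\<lambda>x. \<psi> x \<bullet> N x) \<in> borel_measurable borel" unfolding N_def by (rule flux_borel[OF \<psi>])
      have m': "(\<lambda>x. c * (\<psi> x \<bullet> sgn x)) \<in> borel_measurable borel" for c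
        by (intro borel_measurable_times borel_measurable_inner borel_measurable_const
            test_function_borel[OF \<psi>] sgn_borel_measurable)
      have "(LINT x|lborel. indicator (annulus R\<^sub>0 R\<^sub>1) x * divergence \<psi> x) =
         (LINT x|lborel. indicator (ball 0 R\<^sub>1) x * divergence \<psi> x - indicator (cball 0 R\<^sub>0) x * divergence \<psi> x)"
        using assms by (intro Bochner_Integration.integral_cong refl) (auto simp: indicator_def annulus_def)
      also have "\<dots> = (LINT x|lborel. indicator (ball 0 R\<^sub>1) x * divergence \<psi> x) - (LINT x|lborel. indicator (cball 0 R\<^sub>0) x * divergence \<psi> x)"
        by (intro Bochner_Integration.integral_diff integrable_indicator_test_function[OF d]) auto
      also have "\<dots> = (-1) * sphere_flux R\<^sub>0 (\<lambda>x. \<psi> x \<bullet> sgn x) + sphere_flux R\<^sub>1 (\<lambda>x. \<psi> x \<bullet> sgn x)"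
        using integral_ball_cball[OF test_function_borel[OF d], of R\<^sub>0] divergence_theorem_ball[OF \<psi> assms(1)]
          divergence_theorem_ball[OF \<psi> R1] by simp
      also have "(-1) * sphere_flux R\<^sub>0 (\<lambda>x. \<psi> x \<bullet> sgn x) = sphere_flux R\<^sub>0 (\<lambda>x. (-1) * (\<psi> x \<bullet> sgn x))"
        by (rule sphere_flux_cmult[symmetric])
      also have "\<dots> = sphere_flux R\<^sub>0 (\<lambda>x. \<psi> x \<bullet> N x)"
        by (rule sphere_flux_cong[OF m' m assms(1)]) (use assms in \<open>simp add: N_def\<close>)
      also have "sphere_flux R\<^sub>1 (\<lambda>x. \<psi> x \<bullet> sgn x) = sphere_flux R\<^sub>1 (\<lambda>x. 1 * (\<psi> x \<bullet> sgn x))" by simp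
      also have "\<dots> = sphere_flux R\<^sub>1 (\<lambda>x. \<psi> x \<bullet> N x)"
        by (rule sphere_flux_cong[OF m' m R1]) (use assms in \<open>simp add: N_def\<close>)
      finally show "(LINT x|lborel. indicator (annulus R\<^sub>0 R\<^sub>1) x * divergence \<psi> x) =
         1 * sphere_flux R\<^sub>0 (\<lambda>x. \<psi> x \<bullet> (sgn (2 * norm x - R\<^sub>0 - R\<^sub>1) *\<^sub>R sgn x)) +
         1 * sphere_flux R\<^sub>1 (\<lambda>x. \<psi> x \<bullet> (sgn (2 * norm x - R\<^sub>0 - R\<^sub>1) *\<^sub>R sgn x))"
        by (simp add: N_def)
    qed (use assms in auto)
  qed
qed

section \<open>Smooth calibrations\<close>

lemma integrable_continuous_compact_support:
  fixes f :: "'a::euclidean_space \<Rightarrow> 'b::euclidean_space"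
  assumes "continuous_on UNIV f" "compact K" "\<And>x. x \<notin> K \<Longrightarrow> f x = 0" "S \<in> sets borel"
  shows "integrable (lebesgue_on S) f"
proof -
  have "integrable lborel (\<lambda>x. indicator K x *\<^sub>R f x)"
    by (rule borel_integrable_compact[OF assms(2)]) (use assms(1) continuous_on_subset in blast)
  moreover have "(\<lambda>x. indicator K x *\<^sub>R f x) = f"
    using assms(3) by (auto simp: indicator_def fun_eq_iff)
  ultimately have "integrable lborel (\<lambda>x. indicator S x *\<^sub>R f x)"
    using assms(4) by (intro integrable_mult_indicator) auto
  then show ?thesis
    by (subst integrable_lebesgue_on_iff_lborel[OF assms(4) borel_measurable_continuous_onI[OF assms(1)]])
qed

lemma integrable_continuous_bounded_set:
  fixes f :: "'a::euclidean_space \<Rightarrow> 'b::euclidean_space"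
  assumes "continuous_on UNIV f" "compact K" "S \<subseteq> K" "S \<in> sets borel"
  shows "integrable (lebesgue_on S) f"
proof -
  have "integrable lborel (\<lambda>x. indicator K x *\<^sub>R f x)"
    by (rule borel_integrable_compact[OF assms(2)]) (use assms(1) continuous_on_subset in blast)
  then have "integrable lborel (\<lambda>x. indicator S x *\<^sub>R (indicator K x *\<^sub>R f x))"
    by (rule integrable_mult_indicator[rotated]) (use assms(4) in simp)
  moreover have "(\<lambda>x. indicator S x *\<^sub>R (indicator K x *\<^sub>R f x)) = (\<lambda>x. indicator S x *\<^sub>R f x)"
    using assms(3) by (auto simp: indicator_def fun_eq_iff)
  ultimately have "integrable lborel (\<lambda>x. indicator S x *\<^sub>R f x)" by (simp only:)
  then show ?thesis
    by (subst integrable_lebesgue_on_iff_lborel[OF assms(4) borel_measurable_continuous_onI[OF assms(1)]])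
qed

lemma integrable_test_mult:
  fixes f :: "'a::euclidean_space \<Rightarrow> real"
  assumes "test_function V \<phi>" "continuous_on UNIV f" "S \<in> sets borel"
  shows "integrable (lebesgue_on S) (\<lambda>x. f x * \<phi> x)"
proof (rule integrable_continuous_compact_support[where K="closure {x. \<phi> x \<noteq> 0}"])
  show "continuous_on UNIV (\<lambda>x. f x * \<phi> x)"
    by (intro continuous_on_mult assms smooth_on_continuous_on[OF test_function_smooth[OF assms(1)]])
  show "f x * \<phi> x = 0" if "x \<notin> closure {x. \<phi> x \<noteq> 0}" for x
    using eq_0_outside_support[OF that] by simp
qed (use assms in \<open>auto simp: test_function_def\<close>)

lemma integrable_test_inner:
  fixes G :: "'a::euclidean_space \<Rightarrow> 'a"
  assumes "test_function V \<psi>" "continuous_on UNIV G" "S \<in> sets borel"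
  shows "integrable (lebesgue_on S) (\<lambda>x. G x \<bullet> \<psi> x)"
proof (rule integrable_continuous_compact_support[where K="closure {x. \<psi> x \<noteq> 0}"])
  show "continuous_on UNIV (\<lambda>x. G x \<bullet> \<psi> x)"
    by (intro continuous_on_inner assms smooth_on_continuous_on[OF test_function_smooth[OF assms(1)]])
  show "G x \<bullet> \<psi> x = 0" if "x \<notin> closure {x. \<psi> x \<noteq> 0}" for x
    using eq_0_outside_support[OF that] by simp
qed (use assms in \<open>auto simp: test_function_def\<close>)

lemma (in gauss_domain) gauss_green:
  "test_function UNIV \<psi> \<Longrightarrow> (LINT x|lebesgue_on U. divergence \<psi> x) =
     (LINT x:frontier U|surface_measure U. \<psi> x \<bullet> outer_normal U x)"
  using surface unfolding is_surface_measure_def by blast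

lemma (in gauss_domain) boundary_integral_cong:
  fixes f g :: "'a \<Rightarrow> real"
  shows "(\<And>x. x \<in> frontier U \<Longrightarrow> f x = g x) \<Longrightarrow>
    (LINT x:frontier U|surface_measure U. f x) = (LINT x:frontier U|surface_measure U. g x)"
  unfolding set_lebesgue_integral_def by (intro Bochner_Integration.integral_cong refl) (auto simp: indicator_def)

lemma (in gauss_domain) test_function_frontier:
  assumes "test_function U \<phi>" "x \<in> frontier U"
  shows "\<phi> x = 0"
proof -
  have "x \<notin> closure {x. \<phi> x \<noteq> 0}"
    using assms open_U unfolding test_function_def by (auto simp: frontier_def interior_open)
  then show ?thesis by (rule eq_0_outside_support)
qed

lemma (in gauss_domain) interior_gauss_green:
  assumes "test_function U \<psi>"
  shows "(LINT x|lebesgue_on U. divergence \<psi> x) = 0"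
proof -
  have "(LINT x:frontier U|surface_measure U. \<psi> x \<bullet> outer_normal U x) = (LINT x:frontier U|surface_measure U. 0)"
    by (rule boundary_integral_cong) (simp add: test_function_frontier[OF assms])
  then show ?thesis using gauss_green[OF test_function_mono[OF assms]] by simp
qed

lemma U_integral_cong:
  fixes f g :: "'a::euclidean_space \<Rightarrow> real"
  assumes "\<And>x. x \<in> S \<Longrightarrow> f x = g x"
  shows "(LINT x|lebesgue_on S. f x) = (LINT x|lebesgue_on S. g x)"
  by (intro Bochner_Integration.integral_cong refl) (simp add: assms)

text \<open>For smooth data every condition of calibrability is an instance of the Gauss--Green formula.\<close>

lemma (in gauss_domain) smooth_weak_calibration:
  fixes Z :: "'a \<Rightarrow> 'a" and w :: "'a \<Rightarrow> real"
  assumes Z: "smooth_on UNIV Z" and w: "smooth_on UNIV w"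
    and dv: "\<And>x. x \<in> U \<Longrightarrow> divergence Z x = w x"
    and lap: "\<And>x. x \<in> U \<Longrightarrow> laplacian w x = c"
    and Zb: "\<And>p. p \<in> frontier U \<Longrightarrow> Z p \<bullet> outer_normal U p = s"
    and wb: "\<And>p. p \<in> frontier U \<Longrightarrow> w p = s * mean_curvature U p"
  shows "weak_divergence U Z w" "weak_gradient U w (grad w)" "has_normal_trace U Z w (\<lambda>_. s)"
    "has_trace U w (grad w) (\<lambda>x. s * mean_curvature U x)" "weak_laplacian U w (\<lambda>_. c)"
proof -
  have Ub: "U \<in> sets borel" using open_U by simp
  have Zc: "continuous_on UNIV Z" by (rule smooth_on_continuous_on[OF Z])
  have wc: "continuous_on UNIV w" by (rule smooth_on_continuous_on[OF w])
  have gs: "smooth_on UNIV (grad w)" by (rule smooth_on_grad[OF open_UNIV w])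
  have gc: "continuous_on UNIV (grad w)" by (rule smooth_on_continuous_on[OF gs])
  have Zd: "Z differentiable (at x)" and wd: "w differentiable (at x)" and gd: "grad w differentiable (at x)" for x
    using smooth_on_differentiable Z w gs by blast+
  have loc: "locally_integrable_on U f" if "continuous_on UNIV f" for f :: "'a \<Rightarrow> 'c::euclidean_space"
    unfolding locally_integrable_on_def
    using integrable_continuous_bounded_set[OF that] by (auto intro: borel_compact)
  have upto: "integrable_up_to_boundary U f" if "continuous_on UNIV f" for f :: "'a \<Rightarrow> 'c::euclidean_space"
    unfolding integrable_up_to_boundary_def
    using integrable_continuous_bounded_set[OF that _ Int_lower2] Ub by (simp add: borel_compact sets.Int)
  \<comment> \<open>These product rules are integrated over \<open>U\<close>: the divergence sides
    become boundary integrals, which are zero for test functions supported inside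
    \<open>U\<close>.\<close>
  have dZ: "divergence (\<lambda>x. \<phi> x *\<^sub>R Z x) x = w x * \<phi> x + Z x \<bullet> grad \<phi> x"
    if "test_function V \<phi>" "x \<in> U" for \<phi> x V
    using divergence_scaleR[OF test_function_differentiable[OF that(1)] Zd] dv[OF that(2)]
    by (simp add: inner_commute mult.commute)
  have dw: "divergence (\<lambda>x. w x *\<^sub>R \<psi> x) x = w x * divergence \<psi> x + grad w x \<bullet> \<psi> x"
    if "test_function V \<psi>" for \<psi> :: "'a \<Rightarrow> 'a" and x V
    by (rule divergence_scaleR[OF wd test_function_differentiable[OF that]])
  have dg: "divergence (\<lambda>x. \<phi> x *\<^sub>R grad w x) x = c * \<phi> x + grad w x \<bullet> grad \<phi> x"
    if "test_function V \<phi>" "x \<in> U" for \<phi> x V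
    using divergence_scaleR[OF test_function_differentiable[OF that(1)] gd] lap[OF that(2)]
    by (simp add: inner_commute mult.commute laplacian_def)
  have i_wphi: "integrable (lebesgue_on U) (\<lambda>x. w x * \<phi> x)" if "test_function V \<phi>" for V \<phi>
    by (rule integrable_test_mult[OF that wc Ub])
  have i_cphi: "integrable (lebesgue_on U) (\<lambda>x. c * \<phi> x)" if "test_function V \<phi>" for V \<phi>
    by (rule integrable_test_mult[OF that _ Ub]) simp
  have i_Z: "integrable (lebesgue_on U) (\<lambda>x. Z x \<bullet> \<psi> x)" if "test_function V \<psi>" for V \<psi>
    by (rule integrable_test_inner[OF that Zc Ub])
  have i_g: "integrable (lebesgue_on U) (\<lambda>x. grad w x \<bullet> \<psi> x)" if "test_function V \<psi>" for V \<psi>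
    by (rule integrable_test_inner[OF that gc Ub])
  have wdiv: "weak_divergence U Z w"
    unfolding weak_divergence_def
  proof (intro conjI loc Zc wc allI impI)
    fix \<phi> :: "'a \<Rightarrow> real" assume t: "test_function U \<phi>"
    have "(LINT x|lebesgue_on U. w x * \<phi> x + Z x \<bullet> grad \<phi> x) = (LINT x|lebesgue_on U. divergence (\<lambda>x. \<phi> x *\<^sub>R Z x) x)"
      by (rule U_integral_cong) (simp add: dZ[OF t])
    also have "\<dots> = 0" by (rule interior_gauss_green[OF test_function_scaleR[OF t Z]])
    finally show "(LINT x|lebesgue_on U. Z x \<bullet> grad \<phi> x) = - (LINT x|lebesgue_on U. w x * \<phi> x)"
      using i_wphi[OF t] i_Z[OF test_function_grad[OF t]] by simp
  qed
  have wgrad_eq: "(LINT x|lebesgue_on U. w x * divergence \<psi> x) = - (LINT x|lebesgue_on U. grad w x \<bullet> \<psi> x)"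
    if t: "test_function U \<psi>" for \<psi> :: "'a \<Rightarrow> 'a"
  proof -
    have "(LINT x|lebesgue_on U. w x * divergence \<psi> x + grad w x \<bullet> \<psi> x) = (LINT x|lebesgue_on U. divergence (\<lambda>x. w x *\<^sub>R \<psi> x) x)"
      by (rule U_integral_cong) (simp add: dw[OF t])
    also have "\<dots> = 0" by (rule interior_gauss_green[OF test_function_scaleR'[OF t w]])
    finally show ?thesis
      using i_wphi[OF test_function_divergence[OF t]] i_g[OF t] by simp
  qed
  have wgrad: "weak_gradient U w (grad w)"
    unfolding weak_gradient_def using wgrad_eq by (intro conjI loc wc gc allI impI) auto
  \<comment> \<open>The Laplacian is transferred in two stages: the weak gradient identity for
    \<open>grad \<phi>\<close> leads to \<open>grad w \<bullet> grad \<phi>\<close>, and the product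
    rule \<open>dg\<close> leads from there to \<open>c * \<phi>\<close>.\<close>
  have wlap: "weak_laplacian U w (\<lambda>_. c)"
    unfolding weak_laplacian_def
  proof (intro conjI loc wc continuous_on_const allI impI)
    fix \<phi> :: "'a \<Rightarrow> real" assume t: "test_function U \<phi>"
    have "(LINT x|lebesgue_on U. c * \<phi> x + grad w x \<bullet> grad \<phi> x) = (LINT x|lebesgue_on U. divergence (\<lambda>x. \<phi> x *\<^sub>R grad w x) x)"
      by (rule U_integral_cong) (simp add: dg[OF t])
    also have "\<dots> = 0" by (rule interior_gauss_green[OF test_function_scaleR[OF t gs]])
    finally have "(LINT x|lebesgue_on U. grad w x \<bullet> grad \<phi> x) = - (LINT x|lebesgue_on U. c * \<phi> x)"
      using i_cphi[OF t] i_g[OF test_function_grad[OF t]] by simp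
    then show "(LINT x|lebesgue_on U. w x * laplacian \<phi> x) = (LINT x|lebesgue_on U. c * \<phi> x)"
      using wgrad_eq[OF test_function_grad[OF t]] by (simp add: laplacian_def)
  qed
  have ntr: "has_normal_trace U Z w (\<lambda>_. s)"
    unfolding has_normal_trace_def
  proof (intro conjI upto Zc wc allI impI)
    fix \<phi> :: "'a \<Rightarrow> real" assume t: "test_function UNIV \<phi>"
    have "(LINT x|lebesgue_on U. w x * \<phi> x + Z x \<bullet> grad \<phi> x) = (LINT x|lebesgue_on U. divergence (\<lambda>x. \<phi> x *\<^sub>R Z x) x)"
      by (rule U_integral_cong) (simp add: dZ[OF t])
    also have "\<dots> = (LINT x:frontier U|surface_measure U. (\<phi> x *\<^sub>R Z x) \<bullet> outer_normal U x)"
      by (rule gauss_green[OF test_function_scaleR[OF t Z]])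
    also have "\<dots> = (LINT x:frontier U|surface_measure U. s * \<phi> x)"
      by (rule boundary_integral_cong) (simp add: Zb)
    finally show "(LINT x|lebesgue_on U. w x * \<phi> x + Z x \<bullet> grad \<phi> x) = (LINT x:frontier U|surface_measure U. s * \<phi> x)" .
  qed
  have tr: "has_trace U w (grad w) (\<lambda>x. s * mean_curvature U x)"
    unfolding has_trace_def
  proof (intro conjI upto gc wc allI impI)
    fix \<psi> :: "'a \<Rightarrow> 'a" assume t: "test_function UNIV \<psi>"
    have "(LINT x|lebesgue_on U. w x * divergence \<psi> x + grad w x \<bullet> \<psi> x) = (LINT x|lebesgue_on U. divergence (\<lambda>x. w x *\<^sub>R \<psi> x) x)"
      by (rule U_integral_cong) (simp add: dw[OF t])
    also have "\<dots> = (LINT x:frontier U|surface_measure U. (w x *\<^sub>R \<psi> x) \<bullet> outer_normal U x)"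
      by (rule gauss_green[OF test_function_scaleR'[OF t w]])
    also have "\<dots> = (LINT x:frontier U|surface_measure U. s * mean_curvature U x * (\<psi> x \<bullet> outer_normal U x))"
      by (rule boundary_integral_cong) (simp add: wb)
    finally show "(LINT x|lebesgue_on U. w x * divergence \<psi> x + grad w x \<bullet> \<psi> x) =
       (LINT x:frontier U|surface_measure U. s * mean_curvature U x * (\<psi> x \<bullet> outer_normal U x))" .
  qed
  show "weak_divergence U Z w" "weak_gradient U w (grad w)" "has_normal_trace U Z w (\<lambda>_. s)"
    "has_trace U w (grad w) (\<lambda>x. s * mean_curvature U x)" "weak_laplacian U w (\<lambda>_. c)"
    by (fact wdiv wgrad ntr tr wlap)+
qed

lemma (in gauss_domain) continuous_measurable_on:
  fixes f :: "'a \<Rightarrow> 'c::euclidean_space"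
  assumes "continuous_on UNIV f"
  shows "f \<in> borel_measurable (lebesgue_on U)"
  by (rule measurable_restrict_space1[OF measurable_completion])
     (use borel_measurable_continuous_onI[OF assms] in simp)

lemma (in gauss_domain) calibrableI:
  fixes Z :: "'a \<Rightarrow> 'a" and w :: "'a \<Rightarrow> real"
  assumes Z: "smooth_on UNIV Z" and w: "smooth_on UNIV w" and s: "s \<in> {-1, 1}"
    and bound: "\<And>x. x \<in> U \<Longrightarrow> norm (Z x) \<le> 1"
    and dv: "\<And>x. x \<in> U \<Longrightarrow> divergence Z x = w x"
    and lap: "\<And>x. x \<in> U \<Longrightarrow> laplacian w x = c"
    and Zb: "\<And>p. p \<in> frontier U \<Longrightarrow> Z p \<bullet> outer_normal U p = s"
    and wb: "\<And>p. p \<in> frontier U \<Longrightarrow> w p = s * mean_curvature U p"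
    and G: "integrable (lebesgue_on U) (\<lambda>x. (norm (grad w x))\<^sup>2)"
  shows "calibrable U (\<lambda>_. s)"
proof -
  have sq: "square_integrable_on U (grad w)"
    unfolding square_integrable_on_def
    using continuous_measurable_on[OF smooth_on_continuous_on[OF smooth_on_grad[OF open_UNIV w]]] G by blast
  have "AE x in lebesgue_on U. norm (Z x) \<le> 1"
    by (rule AE_I2) (use bound in simp)
  then show ?thesis
    unfolding calibrable_def signature_on_def
    using smooth_open_set_U s continuous_measurable_on[OF smooth_on_continuous_on[OF Z]] sq
      smooth_weak_calibration[OF Z w dv lap Zb wb]
    by (intro conjI exI) auto
qed

section \<open>Radial calibrations\<close>

text \<open>Switches \<open>f\<close> off between the radii \<rho> and \<rho>/2. Profiles may be
  singular at the origin, while the calibration criterion asks for fields smooth on the whole space;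
  the domains in question lie beyond \<rho>.\<close>

definition cut :: "real \<Rightarrow> (real \<Rightarrow> real) \<Rightarrow> real \<Rightarrow> real" where
  "cut \<rho> f r = smooth_step (2 * r / \<rho> - 1) * f r"

lemma cut_eq: "0 < \<rho> \<Longrightarrow> \<rho> \<le> r \<Longrightarrow> cut \<rho> f r = f r"
  by (simp add: cut_def smooth_step_1 field_simps)

lemma cut_eq_0: "0 < \<rho> \<Longrightarrow> r \<le> \<rho> / 2 \<Longrightarrow> cut \<rho> f r = 0"
  by (simp add: cut_def smooth_step_0 field_simps)

lemma smooth_on_affine_step: "smooth_on UNIV (\<lambda>r. smooth_step (a * r + b))"
proof -
  have "smooth_on UNIV (\<lambda>r::real. a * r + b)"
    by (intro smooth_on_add smooth_on_mult smooth_on_const smooth_on_ident open_UNIV)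
  from smooth_on_comp_real[OF open_UNIV this open_UNIV smooth_on_smooth_step] show ?thesis by simp
qed

lemma smooth_on_cut:
  assumes "smooth_on {0<..} f"
  shows "smooth_on {0<..} (cut \<rho> f)"
proof -
  have "smooth_on {0<..} (\<lambda>r. smooth_step ((2 / \<rho>) * r + (- 1)))"
    by (rule smooth_on_subset[OF smooth_on_affine_step]) simp
  then have "smooth_on {0<..} (\<lambda>r. smooth_step ((2 / \<rho>) * r + (- 1)) * f r)"
    by (rule smooth_on_mult[OF open_greaterThan _ assms])
  then show ?thesis by (simp add: cut_def[abs_def] mult.commute)
qed

lemma smooth_on_UNIV_extend:
  fixes f :: "'a::euclidean_space \<Rightarrow> 'b::real_normed_vector"
  assumes "smooth_on (- {0}) f" "\<delta> > 0" "\<And>x. norm x < \<delta> \<Longrightarrow> f x = c"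
  shows "smooth_on UNIV f"
proof -
  have "smooth_on (ball 0 \<delta>) f = smooth_on (ball 0 \<delta>) (\<lambda>x::'a. c)"
    by (rule smooth_on_cong) (use assms in auto)
  then have "smooth_on (ball 0 \<delta>) f" by (simp add: smooth_on_const)
  then have "smooth_on (- {0} \<union> ball 0 \<delta>) f"
    by (intro smooth_on_Un assms(1)) auto
  moreover have "- {0} \<union> ball (0::'a) \<delta> = UNIV" using assms(2) by auto
  ultimately show ?thesis by simp
qed

lemma smooth_on_cut_radial:
  assumes "smooth_on {0<..} f" "\<rho> > 0"
  shows "smooth_on UNIV (\<lambda>x::'a::euclidean_space. cut \<rho> f (norm x))"
    and "smooth_on UNIV (\<lambda>x::'a::euclidean_space. cut \<rho> f (norm x) *\<^sub>R sgn x)"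
proof -
  have 1: "smooth_on (- {0}) (\<lambda>x::'a. cut \<rho> f (norm x))"
    by (rule smooth_on_radial[OF _ open_greaterThan smooth_on_cut[OF assms(1)]]) auto
  then have 2: "smooth_on (- {0}) (\<lambda>x::'a. cut \<rho> f (norm x) *\<^sub>R sgn x)"
    by (intro smooth_on_scaleR smooth_on_sgn) auto
  show "smooth_on UNIV (\<lambda>x::'a. cut \<rho> f (norm x))"
    by (rule smooth_on_UNIV_extend[OF 1, where \<delta>="\<rho> / 2" and c=0]) (use assms in \<open>auto simp: cut_eq_0\<close>)
  show "smooth_on UNIV (\<lambda>x::'a. cut \<rho> f (norm x) *\<^sub>R sgn x)"
    by (rule smooth_on_UNIV_extend[OF 2, where \<delta>="\<rho> / 2" and c=0]) (use assms in \<open>auto simp: cut_eq_0\<close>)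
qed

lemma laplacian_radial:
  fixes x :: "'a::euclidean_space"
  assumes "x \<noteq> 0" "\<And>r. r > 0 \<Longrightarrow> (w has_real_derivative w' r) (at r)"
    and "(w' has_real_derivative w'') (at (norm x))"
  shows "laplacian (\<lambda>x. w (norm x)) x = w'' + (real DIM('a) - 1) * w' (norm x) / norm x"
proof -
  have "divergence (grad (\<lambda>x::'a. w (norm x))) x = divergence (\<lambda>x. w' (norm x) *\<^sub>R sgn x) x"
    by (rule divergence_transform_open[of "- {0}"]) (use assms in \<open>auto intro!: grad_radial\<close>)
  then show ?thesis unfolding laplacian_def using divergence_radial[OF assms(1,3)] by simp
qed

lemma laplacian_cmult:
  assumes "smooth_on UNIV f"
  shows "laplacian (\<lambda>x. c * f x) x = c * laplacian f x"
proof -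
  have "grad (\<lambda>x. c * f x) = (\<lambda>x. c *\<^sub>R grad f x)"
    using grad_cmult[OF smooth_on_differentiable[OF assms]] by auto
  then show ?thesis
    unfolding laplacian_def
    by (simp add: divergence_cmult[OF smooth_on_differentiable[OF smooth_on_grad[OF open_UNIV assms]]])
qed

text \<open>The three differential equations are the radial forms of div Z = w, of the gradient of
  \<open>w\<close> and of a constant Laplacian. The bound on \<open>z\<close> is kept out, since the
  lemma also supplies the comparison field for wide annuli, whose length exceeds one.\<close>

lemma (in gauss_domain) radial_weak_calibration:
  assumes \<rho>: "\<rho> > 0" "\<And>r. r \<ge> 0 \<Longrightarrow> F r \<le> 0 \<Longrightarrow> r > \<rho>"
    and sm: "smooth_on {0<..} z" "smooth_on {0<..} w"
    and z: "\<And>r. r > 0 \<Longrightarrow> (z has_real_derivative w r - (real DIM('a) - 1) * z r / r) (at r)"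
    and w: "\<And>r. r > 0 \<Longrightarrow> (w has_real_derivative w' r) (at r)"
    and w': "\<And>r. r > 0 \<Longrightarrow> (w' has_real_derivative c - (real DIM('a) - 1) * w' r / r) (at r)"
    and zb: "\<And>r. r > 0 \<Longrightarrow> F r = 0 \<Longrightarrow> z r = sgn (F' r)"
    and wb: "\<And>r. r > 0 \<Longrightarrow> F r = 0 \<Longrightarrow> w r = sgn (F' r) * (real DIM('a) - 1) / r"
  obtains Z :: "'a \<Rightarrow> 'a" and W :: "'a \<Rightarrow> real" where
    "smooth_on UNIV Z" "smooth_on UNIV W"
    "\<And>x. x \<in> U \<Longrightarrow> Z x = (s * z (norm x)) *\<^sub>R sgn x"
    "\<And>x. x \<in> U \<Longrightarrow> grad W x = (s * w' (norm x)) *\<^sub>R sgn x"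
    "\<And>x. x \<in> U \<Longrightarrow> divergence Z x = W x" "\<And>x. x \<in> U \<Longrightarrow> laplacian W x = s * c"
    "\<And>p. p \<in> frontier U \<Longrightarrow> Z p \<bullet> outer_normal U p = s"
    "\<And>p. p \<in> frontier U \<Longrightarrow> W p = s * mean_curvature U p"
proof -
  let ?n = "real DIM('a)"
  define Z where "Z x = cut \<rho> z (norm x) *\<^sub>R sgn x" for x :: 'a
  define W where "W x = cut \<rho> w (norm x)" for x :: 'a
  have Zs: "smooth_on UNIV Z" and Ws: "smooth_on UNIV W"
    unfolding Z_def[abs_def] W_def[abs_def] using smooth_on_cut_radial sm \<rho>(1) by auto
  have op: "open {x::'a. norm x > \<rho>}" by (intro open_Collect_less continuous_intros)
  have Zeq: "Z x = z (norm x) *\<^sub>R sgn x" and Weq: "W x = w (norm x)" if "norm x > \<rho>" for x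
    using that \<rho>(1) by (simp_all add: Z_def W_def cut_eq)
  have U\<rho>: "norm x > \<rho>" if "x \<in> U" for x using \<rho>(2)[of "norm x"] that by (simp add: U_eq)
  have f\<rho>: "norm x > \<rho>" if "x \<in> frontier U" for x using \<rho>(2)[of "norm x"] that by (simp add: frontier_iff)
  show thesis
  proof (rule that[of "\<lambda>x. s *\<^sub>R Z x" "\<lambda>x. s * W x"])
    show "smooth_on UNIV (\<lambda>x. s *\<^sub>R Z x)" "smooth_on UNIV (\<lambda>x. s * W x)"
      by (intro smooth_on_scaleR smooth_on_mult smooth_on_const open_UNIV Zs Ws)+
    fix x
    show "s *\<^sub>R Z x = (s * z (norm x)) *\<^sub>R sgn x" if "x \<in> U" by (simp add: Zeq[OF U\<rho>[OF that]])
    show "grad (\<lambda>x. s * W x) x = (s * w' (norm x)) *\<^sub>R sgn x" if "x \<in> U"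
    proof -
      have "grad W x = grad (\<lambda>x. w (norm x)) x"
        by (rule grad_transform_open[OF op]) (use U\<rho>[OF that] Weq in auto)
      also have "\<dots> = w' (norm x) *\<^sub>R sgn x"
        by (rule grad_radial[OF _ w]) (use U\<rho>[OF that] \<rho> in auto)
      finally show ?thesis by (simp add: grad_cmult[OF smooth_on_differentiable[OF Ws]])
    qed
    show "divergence (\<lambda>x. s *\<^sub>R Z x) x = s * W x" if "x \<in> U"
    proof -
      have x: "norm x > \<rho>" "norm x > 0" "x \<noteq> 0" using U\<rho>[OF that] \<rho>(1) by auto
      have "divergence Z x = divergence (\<lambda>x. z (norm x) *\<^sub>R sgn x) x"
        by (rule divergence_transform_open[OF op]) (use x Zeq in auto)
      also have "\<dots> = W x"
        using divergence_radial[OF x(3) z[OF x(2)]] by (simp add: Weq[OF x(1)])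
      finally show ?thesis
        using divergence_cmult[OF smooth_on_differentiable[OF Zs], of x s] by simp
    qed
    show "laplacian (\<lambda>x. s * W x) x = s * c" if "x \<in> U"
    proof -
      have x: "norm x > \<rho>" "norm x > 0" "x \<noteq> 0" using U\<rho>[OF that] \<rho>(1) by auto
      have "laplacian W x = laplacian (\<lambda>x. w (norm x)) x"
        by (rule laplacian_transform_open[OF op]) (use x Weq in auto)
      also have "\<dots> = c"
        using laplacian_radial[OF x(3) w w'[OF x(2)]] by simp
      finally show ?thesis using laplacian_cmult[OF Ws] by simp
    qed
    show "s *\<^sub>R Z x \<bullet> outer_normal U x = s" if "x \<in> frontier U"
      using frontier_props[OF that] zb[of "norm x"] that
      by (simp add: Zeq[OF f\<rho>[OF that]] outer_normal_U frontier_iff inner_sgn_self sgn_mult[symmetric] sgn_mult_self_eq mult.assoc)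
    show "s * W x = s * mean_curvature U x" if "x \<in> frontier U"
      using frontier_props[OF that] wb[of "norm x"] that
      by (simp add: Weq[OF f\<rho>[OF that]] mean_curvature_U frontier_iff)
  qed
qed

lemma (in gauss_domain) radial_calibrable:
  assumes \<rho>: "\<rho> > 0" "\<And>r. r \<ge> 0 \<Longrightarrow> F r \<le> 0 \<Longrightarrow> r > \<rho>"
    and sm: "smooth_on {0<..} z" "smooth_on {0<..} w"
    and z: "\<And>r. r > 0 \<Longrightarrow> (z has_real_derivative w r - (real DIM('a) - 1) * z r / r) (at r)"
    and w: "\<And>r. r > 0 \<Longrightarrow> (w has_real_derivative w' r) (at r)"
    and w': "\<And>r. r > 0 \<Longrightarrow> (w' has_real_derivative c - (real DIM('a) - 1) * w' r / r) (at r)"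
    and bound: "\<And>r. r > 0 \<Longrightarrow> F r < 0 \<Longrightarrow> \<bar>z r\<bar> \<le> 1"
    and zb: "\<And>r. r > 0 \<Longrightarrow> F r = 0 \<Longrightarrow> z r = sgn (F' r)"
    and wb: "\<And>r. r > 0 \<Longrightarrow> F r = 0 \<Longrightarrow> w r = sgn (F' r) * (real DIM('a) - 1) / r"
    and int: "integrable (lebesgue_on U) (\<lambda>x. (w' (norm x))\<^sup>2)"
    and s: "s \<in> {-1, 1}"
  shows "calibrable U (\<lambda>_. s)"
proof -
  obtain Z :: "'a \<Rightarrow> 'a" and W :: "'a \<Rightarrow> real" where ZW:
    "smooth_on UNIV Z" "smooth_on UNIV W"
    "\<And>x. x \<in> U \<Longrightarrow> Z x = (s * z (norm x)) *\<^sub>R sgn x"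
    "\<And>x. x \<in> U \<Longrightarrow> grad W x = (s * w' (norm x)) *\<^sub>R sgn x"
    "\<And>x. x \<in> U \<Longrightarrow> divergence Z x = W x" "\<And>x. x \<in> U \<Longrightarrow> laplacian W x = s * c"
    "\<And>p. p \<in> frontier U \<Longrightarrow> Z p \<bullet> outer_normal U p = s"
    "\<And>p. p \<in> frontier U \<Longrightarrow> W p = s * mean_curvature U p"
    using radial_weak_calibration[OF \<rho> sm z w w' zb wb] by blast
  have pos: "norm x > 0" if "x \<in> U" for x
  proof -
    have "norm x > \<rho>" using \<rho>(2)[of "norm x"] that by (simp add: U_eq)
    then show ?thesis using \<rho>(1) by linarith
  qed
  have ss: "\<bar>s\<bar> = 1" "s * s = 1" using s by auto
  show ?thesis
  proof (rule calibrableI[OF ZW(1,2) s _ ZW(5,6,7,8)])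
    show "norm (Z x) \<le> 1" if "x \<in> U" for x
      using bound[of "norm x"] pos[OF that] that ss by (simp add: ZW(3) norm_sgn abs_mult U_eq)
    have "(norm (grad W x))\<^sup>2 = (w' (norm x))\<^sup>2" if "x \<in> U" for x
      using pos[OF that] ss by (auto simp: ZW(4)[OF that] norm_sgn power_mult_distrib power2_eq_square)
    then show "integrable (lebesgue_on U) (\<lambda>x. (norm (grad W x))\<^sup>2)"
      by (subst Bochner_Integration.integrable_cong[OF refl, where g="\<lambda>x. (w' (norm x))\<^sup>2"]) (use int in auto)
  qed
qed

text \<open>With t = |x| / R the field has radial part s t (3 - t^2) / 2. Being a polynomial in
  \<open>x\<close>, it is smooth at the centre without any cut-off.\<close>

lemma calibrable_ball:
  assumes R: "R > 0" and s: "s \<in> {-1, 1}"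
  shows "calibrable (ball 0 R :: 'a::euclidean_space set) (\<lambda>_. s)"
proof -
  let ?n = "real DIM('a)"
  interpret gauss_domain "\<lambda>r. r - R" "\<lambda>_. 1" "ball (0::'a) R" by (rule gauss_domain_ball[OF R])
  \<comment> \<open>\<open>a\<close> and \<open>b\<close> solve the boundary conditions a R - b R^3
    = s and n a - (n + 2) b R^2 = s (n - 1) / R; the dimension drops out.\<close>
  define a where "a = 3 * s / (2 * R)"
  define b where "b = s / (2 * R ^ 3)"
  define f where "f x = a - b * (x \<bullet> x)" for x :: 'a
  define w where "w x = ?n * a - (?n + 2) * b * (x \<bullet> x)" for x :: 'a
  have sq: "smooth_on UNIV (\<lambda>x::'a. x \<bullet> x)" by (intro smooth_on_inner smooth_on_id open_UNIV)
  have fs: "smooth_on UNIV f" and ws: "smooth_on UNIV w"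
    unfolding f_def[abs_def] w_def[abs_def]
    by (intro smooth_on_diff smooth_on_mult smooth_on_const open_UNIV sq)+
  have idn: "smooth_on UNIV (\<lambda>x::'a. x)" by (intro smooth_on_id open_UNIV)
  have gf: "grad (\<lambda>x. p - q * (x \<bullet> x)) x = (- 2 * q) *\<^sub>R x" for x :: 'a and p q
    by (rule grad_eqI) (auto intro!: derivative_eq_intros simp: inner_commute)
  have did: "divergence (\<lambda>x::'a. x) x = ?n" for x
    by (subst divergence_eqI[OF has_derivative_ident]) simp
  have df: "divergence (\<lambda>x. f x *\<^sub>R x) x = w x" for x
    by (subst divergence_scaleR[OF smooth_on_differentiable[OF fs] smooth_on_differentiable[OF idn]])
       (simp_all add: did f_def[abs_def] gf w_def algebra_simps)
  have gw: "grad w = (\<lambda>x. (- 2 * ((?n + 2) * b)) *\<^sub>R x)"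
    unfolding w_def[abs_def] using gf by auto
  have lw: "laplacian w x = - 2 * ((?n + 2) * b) * ?n" for x
    unfolding laplacian_def gw by (subst divergence_cmult[OF smooth_on_differentiable[OF idn]]) (simp_all add: did)
  show ?thesis
  proof (rule calibrableI[where Z="\<lambda>x. f x *\<^sub>R x" and w=w])
    show "smooth_on UNIV (\<lambda>x. f x *\<^sub>R x)" by (intro smooth_on_scaleR fs idn open_UNIV)
    show "smooth_on UNIV w" by (fact ws)
    show "norm (f x *\<^sub>R x) \<le> 1" if "x \<in> ball 0 R" for x
    proof -
      define t where "t = norm x / R"
      have t: "0 \<le> t" "t \<le> 1" using that R by (auto simp: t_def)
      have xx: "x \<bullet> x = (norm x)\<^sup>2" by (simp add: dot_square_norm)
      have "f x * norm x = s * (t * (3 - t\<^sup>2) / 2)"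
        using R by (simp add: f_def a_def b_def t_def xx field_simps power2_eq_square power3_eq_cube)
      moreover have "norm (f x *\<^sub>R x) = \<bar>f x * norm x\<bar>" by (simp add: abs_mult)
      ultimately have "norm (f x *\<^sub>R x) = \<bar>s * (t * (3 - t\<^sup>2) / 2)\<bar>" by simp
      then have "norm (f x *\<^sub>R x) = \<bar>t * (3 - t\<^sup>2) / 2\<bar>"
        using s by (auto simp del: norm_scaleR)
      \<comment> \<open>This product expands to 2 - t (3 - t^2).\<close>
      moreover have "0 \<le> (1 - t)\<^sup>2 * (t + 2)" using t by simp
      then have "t * (3 - t\<^sup>2) \<le> 2" by (simp add: algebra_simps power2_eq_square)
      moreover have "t\<^sup>2 \<le> 1" using t by (simp add: power_le_one)
      then have "0 \<le> t * (3 - t\<^sup>2)" using t by simp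
      ultimately show ?thesis by simp
    qed
    show "divergence (\<lambda>x. f x *\<^sub>R x) x = w x" for x by (fact df)
    show "laplacian w x = - 2 * ((?n + 2) * b) * ?n" for x by (fact lw)
    fix p :: 'a assume p: "p \<in> frontier (ball 0 R)"
    then have n: "norm p = R" "p \<noteq> 0" using frontier_iff[of p] frontier_props[OF p] by auto
    have pp: "p \<bullet> p = R\<^sup>2" by (simp add: dot_square_norm n)
    have ps: "p \<bullet> sgn p = R" using R n pp by (simp add: sgn_div_norm power2_eq_square)
    show "f p *\<^sub>R p \<bullet> outer_normal (ball 0 R) p = s"
      using R by (simp add: outer_normal_U[OF p] ps f_def pp a_def b_def field_simps power2_eq_square power3_eq_cube)
    show "w p = s * mean_curvature (ball 0 R) p"
      using R by (simp add: mean_curvature_U[OF p] n w_def pp a_def b_def field_simps power2_eq_square power3_eq_cube)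
  next
    have c: "continuous_on UNIV (\<lambda>x::'a. (norm (grad w x))\<^sup>2)"
      unfolding gw by (intro continuous_intros)
    show "integrable (lebesgue_on (ball 0 R)) (\<lambda>x. (norm (grad w x))\<^sup>2)"
      by (rule integrable_continuous_bounded_set[OF c compact_cball[of 0 R]]) auto
  qed (use s in auto)
qed

section \<open>The radial profiles\<close>

text \<open>\<open>pw n r\<close> is \<open>r\<^bsup>1-n\<^esup>\<close>, and \<open>fs n\<close> is an antiderivative: up to constants, the fundamental
  solution of the Laplacian in dimension \<open>n\<close>.\<close>

definition pw :: "nat \<Rightarrow> real \<Rightarrow> real" where
  "pw n r = inverse r ^ (n - 1)"

definition fs :: "nat \<Rightarrow> real \<Rightarrow> real" where
  "fs n r = (if n = 2 then ln r else r * pw n r / (2 - real n))"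

definition dz :: "nat \<Rightarrow> real \<Rightarrow> real \<Rightarrow> real \<Rightarrow> real \<Rightarrow> real" where
  "dz n a b c r = a + b * fs n r + c * r\<^sup>2 / 2"

definition ddz :: "nat \<Rightarrow> real \<Rightarrow> real \<Rightarrow> real \<Rightarrow> real" where
  "ddz n b c r = b * pw n r + c * r"

text \<open>\<open>dz\<close> and \<open>ddz\<close> are the radial profiles of \<open>div Z\<close> and of its gradient when \<open>zz\<close> is that
  of \<open>Z\<close>.\<close>

definition zz :: "nat \<Rightarrow> real \<Rightarrow> real \<Rightarrow> real \<Rightarrow> real \<Rightarrow> real \<Rightarrow> real" where
  "zz n a b c d r = a * r / real n + b * (r * fs n r - r\<^sup>2 * pw n r / 2) / real n
     + c * r ^ 3 / (2 * (real n + 2)) + d * pw n r"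

lemma pw_pos: "r > 0 \<Longrightarrow> pw n r > 0"
  by (simp add: pw_def)

lemma pw_mult_power: "r > 0 \<Longrightarrow> n \<ge> 1 \<Longrightarrow> pw n r * r ^ n = r"
  by (cases n) (auto simp: pw_def power_inverse field_simps)

lemma has_real_derivative_pw:
  assumes "r > 0" "n \<ge> 1"
  shows "(pw n has_real_derivative - (real n - 1) * pw n r / r) (at r)"
proof -
  obtain m where m: "n = Suc m" using assms(2) by (cases n) auto
  have "(inverse has_real_derivative - (inverse r * inverse r)) (at r)"
    using assms(1) DERIV_inverse[of r] by (simp add: power2_eq_square)
  from DERIV_power[OF this, of m]
  have "((\<lambda>r. inverse r ^ m) has_real_derivative real m * (- (inverse r * inverse r) * inverse r ^ (m - 1))) (at r)"
    by simp
  moreover have "real m * (- (inverse r * inverse r) * inverse r ^ (m - 1)) = - (real n - 1) * pw n r / r"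
    unfolding pw_def m by (cases m) (simp_all add: divide_inverse algebra_simps)
  ultimately show ?thesis by (simp add: pw_def[abs_def] m)
qed

lemma has_real_derivative_fs:
  assumes "r > 0" "n \<ge> 1"
  shows "(fs n has_real_derivative pw n r) (at r)"
proof (cases "n = 2")
  case True
  have "fs n = ln" using True by (simp add: fs_def[abs_def])
  then show ?thesis using DERIV_ln[OF assms(1)] True by (simp add: pw_def)
next
  case False
  have "((\<lambda>r. r * pw n r / (2 - real n)) has_real_derivative (pw n r + r * (- (real n - 1) * pw n r / r)) / (2 - real n)) (at r)"
    by (rule derivative_eq_intros has_real_derivative_pw assms refl | use False in simp)+
  moreover have "(pw n r + r * (- (real n - 1) * pw n r / r)) / (2 - real n) = pw n r"
    using assms False by (simp add: field_simps)
  ultimately show ?thesis using False by (simp add: fs_def[abs_def])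
qed

lemma has_real_derivative_dz:
  "r > 0 \<Longrightarrow> n \<ge> 1 \<Longrightarrow> (dz n a b c has_real_derivative ddz n b c r) (at r)"
  unfolding dz_def[abs_def] ddz_def
  by (rule derivative_eq_intros has_real_derivative_fs refl | simp)+

text \<open>\<open>b * pw n r\<close> is the radial derivative of a harmonic function;
  \<open>c * r\<close> contributes the constant Laplacian n c.\<close>

lemma has_real_derivative_ddz:
  assumes "r > 0" "n \<ge> 1"
  shows "(ddz n b c has_real_derivative real n * c - (real n - 1) * ddz n b c r / r) (at r)"
proof -
  have "(ddz n b c has_real_derivative b * (- (real n - 1) * pw n r / r) + c) (at r)"
    unfolding ddz_def[abs_def] by (rule derivative_eq_intros has_real_derivative_pw assms refl | simp)+
  moreover have "b * (- (real n - 1) * pw n r / r) + c = real n * c - (real n - 1) * ddz n b c r / r"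
    using assms by (simp add: ddz_def field_simps)
  ultimately show ?thesis by simp
qed

text \<open>\<open>zz\<close> times r^(n-1) is an antiderivative of r^(n-1) times \<open>dz\<close>:
  the \<open>b\<close> term comes from integrating \<open>fs\<close> by parts, the \<open>c\<close>
  term is a power, and \<open>d * pw n r\<close> is the homogeneous solution.\<close>

lemma has_real_derivative_zz:
  assumes "r > 0" "n \<ge> 1"
  shows "(zz n a b c d has_real_derivative dz n a b c r - (real n - 1) * zz n a b c d r / r) (at r)"
proof -
  let ?p = "pw n r" and ?e = "fs n r" and ?N = "real n"
  have eq: "zz n a b c d = (\<lambda>r. (a / ?N) * r + (b / ?N) * (r * fs n r - (1/2) * (r\<^sup>2 * pw n r))
     + (c / (2 * (?N + 2))) * r ^ 3 + d * pw n r)"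
    by (simp add: zz_def fun_eq_iff)
  have "(zz n a b c d has_real_derivative a / ?N
      + (b / ?N) * (?e + r * ?p - (1/2) * (2 * r * ?p + r\<^sup>2 * (- (?N - 1) * ?p / r)))
      + (c / (2 * (?N + 2))) * (3 * r\<^sup>2) + d * (- (?N - 1) * ?p / r)) (at r)"
    unfolding eq
    by (rule derivative_eq_intros has_real_derivative_pw has_real_derivative_fs assms refl | simp add: mult_ac)+
  moreover have "a / ?N + (b / ?N) * (?e + r * ?p - (1/2) * (2 * r * ?p + r\<^sup>2 * (- (?N - 1) * ?p / r)))
      + (c / (2 * (?N + 2))) * (3 * r\<^sup>2) + d * (- (?N - 1) * ?p / r)
     = dz n a b c r - (?N - 1) * zz n a b c d r / r"
  proof -
    have "r \<noteq> 0" "?N \<noteq> 0" "?N + 2 \<noteq> 0" using assms by auto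
    then show ?thesis by (simp add: dz_def zz_def divide_simps) algebra
  qed
  ultimately show ?thesis by simp
qed

lemma smooth_on_pw: "smooth_on {0<..} (pw n)"
  unfolding pw_def[abs_def] by (intro smooth_on_power smooth_on_inverse open_greaterThan)

lemma smooth_on_ident': "smooth_on {0<..} (\<lambda>x::real. x)"
  by (rule smooth_on_id) simp

lemma smooth_on_fs: "smooth_on {0<..} (fs n)"
proof (cases "n = 2")
  case True
  then have "fs n = ln" by (simp add: fs_def[abs_def])
  then show ?thesis using smooth_on_ln by simp
next
  case False
  have "smooth_on {0<..} (\<lambda>r. (1 / (2 - real n)) * (r * pw n r))"
    by (intro smooth_on_mult smooth_on_const smooth_on_ident' smooth_on_pw open_greaterThan)
  then show ?thesis using False by (simp add: fs_def[abs_def])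
qed

lemma smooth_on_dz: "smooth_on {0<..} (dz n a b c)"
proof -
  have "smooth_on {0<..} (\<lambda>r. a + b * fs n r + (c / 2) * r\<^sup>2)"
    by (intro smooth_on_add smooth_on_mult smooth_on_power smooth_on_const smooth_on_ident' smooth_on_fs open_greaterThan)
  then show ?thesis by (simp add: dz_def[abs_def])
qed

lemma smooth_on_zz: "smooth_on {0<..} (zz n a b c d)"
proof -
  have "smooth_on {0<..} (\<lambda>r. (a / real n) * r + (b / real n) * (r * fs n r - (1/2) * (r\<^sup>2 * pw n r))
     + (c / (2 * (real n + 2))) * r ^ 3 + d * pw n r)"
    by (intro smooth_on_add smooth_on_diff smooth_on_mult smooth_on_power smooth_on_const smooth_on_ident' smooth_on_fs
        smooth_on_pw open_greaterThan)
  then show ?thesis by (simp add: zz_def[abs_def])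
qed

subsection \<open>Exterior domains\<close>

text \<open>Passing from k to k + 1 adds t^2 - 1 on the left and 2 t^(k-1) (t - 1) on the right; the
  difference factors as (t - 1) (2 t^(k-1) - t - 1). This is the bound z >= -1 for
  exteriors.\<close>

lemma exterior_inequality:
  fixes t :: real
  assumes "t \<ge> 1" "n \<ge> 3"
  shows "(real n - 1) * t\<^sup>2 - (real n - 3) \<le> 2 * t ^ (n - 1)"
  using assms(2)
proof (induction n rule: dec_induct)
  case base
  show ?case by simp
next
  case (step k)
  have "t \<le> t ^ (k - 1)" using assms(1) step.hyps self_le_power[of t "k - 1"] by simp
  then have "0 \<le> (t - 1) * (2 * t ^ (k - 1) - t - 1)" using assms(1) by (intro mult_nonneg_nonneg) auto
  moreover have "t ^ k = t * t ^ (k - 1)" using step.hyps by (cases k) auto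
  ultimately show ?case using step.IH by (simp add: algebra_simps power2_eq_square)
qed

text \<open>With a = c = 0 the two remaining constants are fixed by the two traces. In t = r / R the
  profile is ((n - 3) - (n - 1) t^2) / (2 t^(n-1)). For n = 1 it is the constant -1; for n >= 3 it
  stays bounded because \<open>r * fs n r\<close> is of order r^(3-n).\<close>

lemma exterior_profile:
  fixes R :: real
  assumes R: "R > 0" and n: "n \<ge> 1" "n \<noteq> 2"
  defines "b \<equiv> (real n - 1) * (real n - 2) / (pw n R * R\<^sup>2)"
  defines "d \<equiv> (real n - 3) / (2 * pw n R)"
  shows "zz n 0 b 0 d R = -1" "dz n 0 b 0 R = - (real n - 1) / R"
    and "r \<ge> R \<Longrightarrow> \<bar>zz n 0 b 0 d r\<bar> \<le> 1"
proof -
  let ?N = "real n"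
  have P: "pw n R > 0" using R by (rule pw_pos)
  have n2: "2 - ?N \<noteq> 0" using n by auto
  have f: "zz n 0 b 0 d r = (pw n r / pw n R) * ((?N - 3) - (?N - 1) * (r / R)\<^sup>2) / 2" if "r > 0" for r
  proof -
    have "zz n 0 b 0 d r = pw n r * (b * r\<^sup>2 * ((1 / (2 - ?N) - 1 / 2) / ?N) + d)"
    proof -
      have "fs n r = r * pw n r / (2 - ?N)" using n by (simp add: fs_def)
      moreover have "b * (r * (r * q / (2 - ?N)) - r\<^sup>2 * q / 2) / ?N + d * q = q * (b * r\<^sup>2 * ((1 / (2 - ?N) - 1 / 2) / ?N) + d)" for q
      proof -
        have e1: "r * (r * q / k) - r\<^sup>2 * q / 2 = (r\<^sup>2 * q) * (1 / k - 1 / 2)" for k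
          by (simp add: power2_eq_square right_diff_distrib)
        have e2: "b * ((r\<^sup>2 * q) * k) / ?N + d * q = q * (b * r\<^sup>2 * (k / ?N) + d)" for k
          by (simp add: distrib_left mult_ac)
        show ?thesis unfolding e1 by (rule e2)
      qed
      ultimately show ?thesis by (simp add: zz_def)
    qed
    also have "(1 / (2 - ?N) - 1 / 2) / ?N = 1 / (2 * (2 - ?N))"
    proof -
      have "1 / k - 1 / 2 = (2 - k) / (2 * k)" if "k \<noteq> 0" for k :: real
        using that by (simp add: diff_divide_distrib)
      from this[OF n2] show ?thesis using n by simp
    qed
    also have "b * r\<^sup>2 * (1 / (2 * (2 - ?N))) = - (?N - 1) * (r / R)\<^sup>2 / (2 * pw n R)"
    proof -
      have "(?N - 2) / (2 - ?N) = -1" using n2 by (simp add: divide_eq_minus_1_iff)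
      moreover have "b * r\<^sup>2 * (1 / (2 * (2 - ?N))) = (?N - 1) * ((?N - 2) / (2 - ?N)) * (r / R)\<^sup>2 / (2 * pw n R)"
        by (simp add: b_def power_divide)
      ultimately show ?thesis by simp
    qed
    finally have e: "zz n 0 b 0 d r = pw n r * (- (?N - 1) * (r / R)\<^sup>2 / (2 * pw n R) + d)" .
    have "p * (- (?N - 1) * q / (2 * pw n R) + (?N - 3) / (2 * pw n R)) = (p / pw n R) * ((?N - 3) - (?N - 1) * q) / 2"
      for p q
    proof -
      have e1: "- (?N - 1) * q / k + (?N - 3) / k = ((?N - 3) - (?N - 1) * q) / k" for k
        by (simp only: add_divide_distrib[symmetric]) (simp add: algebra_simps)
      show ?thesis unfolding e1 by simp
    qed
    then show ?thesis unfolding e unfolding d_def .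
  qed
  show "zz n 0 b 0 d R = -1" using f[OF R] P R by simp
  show "dz n 0 b 0 R = - (?N - 1) / R"
  proof -
    have "dz n 0 b 0 R = (?N - 1) * ((?N - 2) / (2 - ?N)) * (pw n R / pw n R) * (R / R\<^sup>2)"
      using n by (simp add: dz_def fs_def b_def mult_ac)
    moreover have "(?N - 2) / (2 - ?N) = -1" using n2 by (simp add: divide_eq_minus_1_iff)
    ultimately show ?thesis using P R by (simp add: power2_eq_square)
  qed
  show "\<bar>zz n 0 b 0 d r\<bar> \<le> 1" if r: "r \<ge> R"
  proof -
    define t where "t = r / R"
    have t: "t \<ge> 1" using r R by (simp add: t_def)
    have pt: "pw n r / pw n R = inverse (t ^ (n - 1))"
    proof -
      have "inverse r / inverse R = inverse t" using R r by (simp add: t_def field_simps)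
      moreover have "pw n r / pw n R = (inverse r / inverse R) ^ (n - 1)" by (simp add: pw_def power_divide)
      ultimately have "pw n r / pw n R = inverse t ^ (n - 1)" by (simp only:)
      then show ?thesis by (simp only: power_inverse)
    qed
    have r0: "r > 0" using r R by linarith
    have z: "zz n 0 b 0 d r = ((?N - 3) - (?N - 1) * t\<^sup>2) / (2 * t ^ (n - 1))"
    proof -
      have "zz n 0 b 0 d r = inverse (t ^ (n - 1)) * ((?N - 3) - (?N - 1) * t\<^sup>2) / 2"
        unfolding pt[symmetric] unfolding t_def by (rule f[OF r0])
      moreover have "inverse T * X / 2 = X / (2 * T)" for T X :: real by (simp add: inverse_eq_divide)
      ultimately show ?thesis by (rule trans)
    qed
    have pos: "t ^ (n - 1) > 0" using t by simp
    have t2: "t\<^sup>2 \<ge> 1" using t by simp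
    have A1: "(?N - 1) * t\<^sup>2 - (?N - 3) \<le> 2 * t ^ (n - 1)"
    proof (cases "n = 1")
      case False
      then have "n \<ge> 3" using n by linarith
      then show ?thesis by (rule exterior_inequality[OF t])
    qed simp
    have A2: "(?N - 1) * 1 \<le> (?N - 1) * t\<^sup>2" using t2 n by (intro mult_left_mono) auto
    \<comment> \<open>\<open>A1\<close> is the bound z >= -1, while \<open>A2\<close> makes z
      negative.\<close>
    have "\<bar>(?N - 3) - (?N - 1) * t\<^sup>2\<bar> \<le> 2 * t ^ (n - 1)"
    proof -
      have gen: "\<bar>x - A\<bar> \<le> T" if "A - x \<le> T" "x + 2 \<le> A" "0 \<le> T" for x A T :: real
        using that by linarith
      have A3: "(?N - 3) + 2 \<le> (?N - 1) * t\<^sup>2" using A2 by (rule order.trans[rotated]) simp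
      have "0 \<le> 2 * t ^ (n - 1)" using pos by simp
      then show ?thesis by (rule gen[OF A1 A3])
    qed
    then have "\<bar>(?N - 3) - (?N - 1) * t\<^sup>2\<bar> / (2 * t ^ (n - 1)) \<le> 1" using pos by (simp only: pos_divide_le_eq)
    moreover have "\<bar>2 * t ^ (n - 1)\<bar> = 2 * t ^ (n - 1)" using pos by simp
    ultimately show ?thesis unfolding z abs_divide by (simp only:)
  qed
qed

subsection \<open>Annuli\<close>

lemma fs_strict_mono: "0 < r \<Longrightarrow> r < s \<Longrightarrow> n \<ge> 1 \<Longrightarrow> fs n r < fs n s"
  by (rule DERIV_pos_imp_increasing[of r s "fs n"]) (auto intro!: exI has_real_derivative_fs pw_pos)

text \<open>The Cauchy--Schwarz inequality for the weight \<open>pw n\<close>, from the derivative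
  \<open>pw n r * (x - r ^ n)\<^sup>2\<close>.\<close>

lemma annulus_determinant_pos:
  assumes R: "0 < R\<^sub>0" "R\<^sub>0 < R\<^sub>1" and n: "n \<ge> 1"
  shows "((R\<^sub>1\<^sup>2 - R\<^sub>0\<^sup>2) / 2)\<^sup>2 < (fs n R\<^sub>1 - fs n R\<^sub>0) * ((R\<^sub>1 ^ (n + 2) - R\<^sub>0 ^ (n + 2)) / (real n + 2))"
proof -
  define A1 where "A1 = fs n R\<^sub>1 - fs n R\<^sub>0"
  define A2 where "A2 = (R\<^sub>1\<^sup>2 - R\<^sub>0\<^sup>2) / 2"
  define A3 where "A3 = (R\<^sub>1 ^ (n + 2) - R\<^sub>0 ^ (n + 2)) / (real n + 2)"
  have A1: "A1 > 0" using fs_strict_mono[OF R n] by (simp add: A1_def)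
  \<comment> \<open>The minimiser of the quadratic x^2 A1 - 2 x A2 + A3, whose value there is A3 -
    A2^2 / A1.\<close>
  define x where "x = A2 / A1"
  define H where "H r = x\<^sup>2 * fs n r - x * r\<^sup>2 + (1 / (real n + 2)) * r ^ (n + 2)" for r
  have H': "(H has_real_derivative pw n r * (x - r ^ n)\<^sup>2) (at r)" if "r > 0" for r
  proof -
    have "(H has_real_derivative x\<^sup>2 * pw n r - x * (2 * r) + (1 / (real n + 2)) * (real (n + 2) * r ^ (n + 1))) (at r)"
      unfolding H_def[abs_def]
      by (rule derivative_eq_intros has_real_derivative_fs that n refl | simp)+
    moreover have "(1 / (real n + 2)) * (real (n + 2) * r ^ (n + 1)) = r ^ (n + 1)"
    proof -
      have "real n + 2 \<noteq> 0" by linarith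
      then show ?thesis by (simp add: add.commute)
    qed
    moreover have "pw n r * (x - r ^ n)\<^sup>2 = x\<^sup>2 * pw n r - 2 * x * (pw n r * r ^ n) + (pw n r * r ^ n) * r ^ n"
      by (simp add: power2_eq_square algebra_simps)
    moreover from this have "pw n r * (x - r ^ n)\<^sup>2 = x\<^sup>2 * pw n r - x * (2 * r) + r ^ (n + 1)"
      by (simp add: pw_mult_power[OF that n])
    ultimately show ?thesis by simp
  qed
  \<comment> \<open>The derivative of \<open>H\<close> vanishes only where r^n = x, hence in the
    interior of at most one of the two halves; on the other half \<open>H\<close> increases
    strictly.\<close>
  define m where "m = (R\<^sub>0 + R\<^sub>1) / 2"
  have m: "R\<^sub>0 < m" "m < R\<^sub>1" "0 < m" using R by (auto simp: m_def)
  have le: "H r \<le> H s" if "0 < r" "r \<le> s" for r s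
  proof (rule DERIV_nonneg_imp_nondecreasing[OF that(2)])
    fix y assume "r \<le> y" "y \<le> s"
    then have "y > 0" using that by simp
    then show "\<exists>l. (H has_real_derivative l) (at y) \<and> 0 \<le> l"
      using H'[of y] pw_pos[of y n]
      by (intro exI[of _ "pw n y * (x - y ^ n)\<^sup>2"] conjI mult_nonneg_nonneg) auto
  qed
  have less: "H r < H s" if "0 < r" "r < s" and ne: "\<And>y. r < y \<Longrightarrow> y < s \<Longrightarrow> y ^ n \<noteq> x" for r s
  proof (rule DERIV_pos_imp_increasing_open[OF that(2)])
    show "\<exists>l. (H has_real_derivative l) (at y) \<and> 0 < l" if "r < y" "y < s" for y
    proof -
      have y: "y > 0" "x - y ^ n \<noteq> 0" using that(1) \<open>0 < r\<close> ne[OF that] by auto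
      have "pw n y * (x - y ^ n)\<^sup>2 > 0" using y pw_pos[of y n] by (intro mult_pos_pos) auto
      with H'[OF y(1)] show ?thesis by blast
    qed
    show "continuous_on {r..s} H"
    proof (rule DERIV_continuous_on)
      show "(H has_real_derivative pw n y * (x - y ^ n)\<^sup>2) (at y within {r..s})" if "y \<in> {r..s}" for y
        using H'[of y] that \<open>0 < r\<close> by (simp add: has_field_derivative_at_within)
    qed
  qed
  have "H R\<^sub>0 < H R\<^sub>1"
  proof (cases "x \<le> m ^ n")
    case True
    have "H m < H R\<^sub>1"
    proof (rule less)
      fix y assume "m < y"
      then have "m ^ n < y ^ n" using m n by (intro power_strict_mono) auto
      then show "y ^ n \<noteq> x" using True by simp
    qed (use m in auto)
    then show ?thesis using le[of R\<^sub>0 m] m R by simp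
  next
    case False
    have "H R\<^sub>0 < H m"
    proof (rule less)
      fix y assume "R\<^sub>0 < y" "y < m"
      then have "y ^ n < m ^ n" using R n by (intro power_strict_mono) auto
      then show "y ^ n \<noteq> x" using False by simp
    qed (use m R in auto)
    then show ?thesis using le[of m R\<^sub>1] m R by simp
  qed
  then have "0 < x\<^sup>2 * A1 - 2 * x * A2 + A3"
    by (simp add: H_def A1_def A2_def A3_def algebra_simps diff_divide_distrib)
  moreover have "x\<^sup>2 * A1 - 2 * x * A2 = - (A2\<^sup>2 / A1)"
    using A1 by (simp add: x_def power2_eq_square)
  ultimately have "A2\<^sup>2 / A1 < A3" by simp
  then have "A2\<^sup>2 < A1 * A3" using A1 by (simp add: divide_less_eq mult.commute)
  then show ?thesis by (simp add: A1_def A2_def A3_def)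
qed

text \<open>Subtracting the two conditions on \<open>dz\<close> eliminates \<open>a\<close>; a
  combination with the conditions on \<open>zz\<close> eliminates \<open>d\<close>. What remains is
  b A1 + c A2 = S1, b A2 + c A3 = - S2, solved by Cramer's rule with the determinant of
  \<open>annulus_determinant_pos\<close>. The signs of \<open>b\<close> and \<open>c\<close> feed
  the maximum principle.\<close>

lemma annulus_profile:
  fixes R\<^sub>0 R\<^sub>1 :: real and n :: nat
  assumes R: "0 < R\<^sub>0" "R\<^sub>0 < R\<^sub>1" and n: "n \<ge> 1"
  defines "A1 \<equiv> fs n R\<^sub>1 - fs n R\<^sub>0"
  defines "A2 \<equiv> (R\<^sub>1\<^sup>2 - R\<^sub>0\<^sup>2) / 2"
  defines "A3 \<equiv> (R\<^sub>1 ^ (n + 2) - R\<^sub>0 ^ (n + 2)) / (real n + 2)"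
  defines "S1 \<equiv> (real n - 1) * (1 / R\<^sub>1 + 1 / R\<^sub>0)"
  defines "S2 \<equiv> R\<^sub>1 ^ (n - 1) + R\<^sub>0 ^ (n - 1)"
  obtains a b c d where
    "b * (A1 * A3 - A2\<^sup>2) = S1 * A3 + S2 * A2" "c * (A1 * A3 - A2\<^sup>2) = - (S2 * A1 + S1 * A2)"
    "b > 0" "c < 0"
    "zz n a b c d R\<^sub>0 = -1" "zz n a b c d R\<^sub>1 = 1"
    "dz n a b c R\<^sub>0 = - (real n - 1) / R\<^sub>0" "dz n a b c R\<^sub>1 = (real n - 1) / R\<^sub>1"
proof -
  let ?N = "real n"
  define \<Delta> where "\<Delta> = A1 * A3 - A2\<^sup>2"
  have R1: "R\<^sub>1 > 0" using R by simp
  have \<Delta>: "\<Delta> > 0" using annulus_determinant_pos[OF R n] by (simp add: \<Delta>_def A1_def A2_def A3_def)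
  have A1: "A1 > 0" using fs_strict_mono[OF R n] by (simp add: A1_def)
  have A2: "A2 > 0" using R by (simp add: A2_def power_strict_mono)
  have A3: "A3 > 0" unfolding A3_def using R power_strict_mono[of R\<^sub>0 R\<^sub>1 "n + 2"] by (intro divide_pos_pos) auto
  have S1: "S1 \<ge> 0" using R n by (simp add: S1_def)
  have S2: "S2 > 0" using R by (simp add: S2_def add_pos_pos)
  define b where "b = (S1 * A3 + S2 * A2) / \<Delta>"
  define c where "c = - (S2 * A1 + S1 * A2) / \<Delta>"
  have b: "b * \<Delta> = S1 * A3 + S2 * A2" and c: "c * \<Delta> = - (S2 * A1 + S1 * A2)"
    using \<Delta> by (auto simp: b_def c_def)
  have pos: "S1 * A3 + S2 * A2 > 0" "S2 * A1 + S1 * A2 > 0"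
    using S1 S2 A1 A2 A3 by (simp_all add: add_nonneg_pos add_pos_nonneg)
  have eq1: "b * A1 + c * A2 = S1"
  proof -
    have "(b * A1 + c * A2) * \<Delta> = (b * \<Delta>) * A1 + (c * \<Delta>) * A2" by algebra
    also have "\<dots> = (S1 * A3 + S2 * A2) * A1 + (- (S2 * A1 + S1 * A2)) * A2" by (simp only: b c)
    also have "\<dots> = S1 * \<Delta>" unfolding \<Delta>_def by algebra
    finally show ?thesis using \<Delta> by simp
  qed
  have eq2: "b * A2 + c * A3 = - S2"
  proof -
    have "(b * A2 + c * A3) * \<Delta> = (b * \<Delta>) * A2 + (c * \<Delta>) * A3" by algebra
    also have "\<dots> = (S1 * A3 + S2 * A2) * A2 + (- (S2 * A1 + S1 * A2)) * A3" by (simp only: b c)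
    also have "\<dots> = (- S2) * \<Delta>" unfolding \<Delta>_def by algebra
    finally show ?thesis using \<Delta> mult_right_cancel[of \<Delta> "b * A2 + c * A3" "- S2"] by simp
  qed
  define a where "a = - (?N - 1) / R\<^sub>0 - b * fs n R\<^sub>0 - c * R\<^sub>0\<^sup>2 / 2"
  define d where "d = (- 1 - zz n a b c 0 R\<^sub>0) / pw n R\<^sub>0"
  have w0: "dz n a b c R\<^sub>0 = - (?N - 1) / R\<^sub>0" by (simp add: dz_def a_def)
  then have w0': "dz n a b c R\<^sub>0 = - ((?N - 1) / R\<^sub>0)" by (simp only: minus_divide_left[symmetric])
  have w1: "dz n a b c R\<^sub>1 = (?N - 1) / R\<^sub>1"
  proof -
    have "dz n a b c R\<^sub>1 - dz n a b c R\<^sub>0 = b * A1 + c * A2"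
      by (simp add: dz_def A1_def A2_def algebra_simps diff_divide_distrib)
    moreover have "S1 = (?N - 1) / R\<^sub>1 + (?N - 1) / R\<^sub>0"
      by (simp add: S1_def distrib_left)
    ultimately show ?thesis using eq1 w0' by linarith
  qed
  have zd: "zz n a b c d r = zz n a b c 0 r + d * pw n r" for r by (simp add: zz_def)
  have z0: "zz n a b c d R\<^sub>0 = -1" 
  proof -
    have "d * pw n R\<^sub>0 = - 1 - zz n a b c 0 R\<^sub>0" using pw_pos[OF R(1), of n] by (simp add: d_def)
    then show ?thesis using zd[of R\<^sub>0] by simp
  qed
  \<comment> \<open>In this combination the terms with \<open>a\<close> and \<open>fs\<close>
    cancel, and \<open>d\<close> becomes an additive constant that disappears from
    \<open>K R\<^sub>1 - K R\<^sub>0\<close>.\<close>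
  define K where "K r = r ^ (n - 1) * zz n a b c d r - r ^ n * dz n a b c r / ?N" for r
  have K: "K r = d - (b * (r\<^sup>2 / 2) + c * (r ^ (n + 2) / (?N + 2))) / ?N" if "r > 0" for r
  proof -
    obtain m where m: "n = Suc m" using n by (cases n) auto
    have p: "r ^ m * pw n r = 1" using that by (simp add: pw_def m power_inverse)
    have "K r = a * (r ^ n - r ^ n) / ?N + b * (r ^ n * fs n r - r ^ n * fs n r) / ?N - b * r\<^sup>2 / (2 * ?N) * (r ^ m * pw n r)
       + c * r ^ (n + 2) * (1 / (2 * (?N + 2)) - 1 / (2 * ?N)) + d * (r ^ m * pw n r)"
      unfolding K_def zz_def dz_def m by (simp add: algebra_simps diff_divide_distrib add_divide_distrib power2_eq_square power3_eq_cube)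
    moreover have "1 / (2 * (?N + 2)) - 1 / (2 * ?N) = - 1 / (?N * (?N + 2))"
    proof -
      have "?N \<noteq> 0" "?N + 2 \<noteq> 0" using n by auto
      then show ?thesis by (simp add: divide_simps)
    qed
    ultimately have "K r = a * (r ^ n - r ^ n) / ?N + b * (r ^ n * fs n r - r ^ n * fs n r) / ?N - b * r\<^sup>2 / (2 * ?N) * 1
       + c * r ^ (n + 2) * (- 1 / (?N * (?N + 2))) + d * 1"
      by (simp only: p)
    then have "K r = - (b * r\<^sup>2 / (2 * ?N)) + c * r ^ (n + 2) * (- 1 / (?N * (?N + 2))) + d"
      by simp
    moreover have "d - (b * (q / 2) + c * (X / (?N + 2))) / ?N = - (b * q / (2 * ?N)) + c * X * (- 1 / (?N * (?N + 2))) + d" for q X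
    proof -
      have "?N \<noteq> 0" "?N + 2 \<noteq> 0" using n by auto
      then show ?thesis by (simp add: divide_simps)
    qed
    ultimately show ?thesis by simp
  qed
  have "K R\<^sub>1 - K R\<^sub>0 = - (b * A2 + c * A3) / ?N"
    unfolding K[OF R1] K[OF R(1)] A2_def A3_def
    by (simp add: algebra_simps diff_divide_distrib add_divide_distrib)
  then have Kd: "K R\<^sub>1 - K R\<^sub>0 = S2 / ?N" using eq2 by simp
  have pn: "r ^ n * ((?N - 1) / r) / ?N = r ^ (n - 1) * ((?N - 1) / ?N)" if "r > 0" for r
    using that n by (cases n) auto
  have "K R\<^sub>1 = R\<^sub>1 ^ (n - 1) * zz n a b c d R\<^sub>1 - R\<^sub>1 ^ (n - 1) * ((?N - 1) / ?N)"
    using pn[OF R1] by (simp add: K_def w1)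
  moreover have "K R\<^sub>0 = - (R\<^sub>0 ^ (n - 1)) + R\<^sub>0 ^ (n - 1) * ((?N - 1) / ?N)"
    using pn[OF R(1)] by (simp add: K_def w0' z0)
  moreover have N1: "(?N - 1) / ?N = 1 - 1 / ?N" using n by (simp add: field_simps)
  ultimately have "R\<^sub>1 ^ (n - 1) * zz n a b c d R\<^sub>1 = R\<^sub>1 ^ (n - 1)"
    using Kd by (simp add: S2_def algebra_simps add_divide_distrib)
  then have z1: "zz n a b c d R\<^sub>1 = 1" using R1 by simp
  show thesis
  proof (rule that[of b c a d])
    show "b > 0" using pos \<Delta> by (simp add: b_def)
    show "c < 0" unfolding c_def using pos \<Delta> by (intro divide_neg_pos) auto
  qed (use b c z0 z1 w0 w1 in \<open>simp_all add: \<Delta>_def\<close>)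
qed

text \<open>The derivative of the profile \<open>z\<close>, multiplied by the weight \<open>r\<^bsup>n-1\<^esup>\<close>, satisfies a second order
  equation with a maximum principle. In dimension two this needs information at the inner radius.\<close>

lemma zz_monotone:
  fixes R\<^sub>0 R\<^sub>1 :: real and n :: nat
  assumes R: "0 < R\<^sub>0" "R\<^sub>0 < R\<^sub>1" and n: "n \<ge> 1" and b: "b > 0" and c: "c < 0"
    and z: "zz n a b c d R\<^sub>0 = -1" "zz n a b c d R\<^sub>1 = 1"
      "dz n a b c R\<^sub>0 = - (real n - 1) / R\<^sub>0" "dz n a b c R\<^sub>1 = (real n - 1) / R\<^sub>1"
    and two: "n = 2 \<Longrightarrow> b * R\<^sub>0 + c * R\<^sub>0 ^ 3 \<ge> 1"
    and r: "R\<^sub>0 \<le> r" "r \<le> R\<^sub>1"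
  shows "\<bar>zz n a b c d r\<bar> \<le> 1"
proof -
  let ?N = "real n"
  define Z where "Z = zz n a b c d"
  define W where "W = dz n a b c"
  define W1 where "W1 = ddz n b c"
  \<comment> \<open>\<open>v\<close> is the derivative of \<open>Z\<close>, \<open>V\<close> its
    product with r^(n-1), and \<open>y\<close> is the derivative of \<open>V\<close> divided by
    r^(n-1).\<close>
  define v where "v r = W r - (?N - 1) * Z r / r" for r
  define V where "V r = v r / pw n r" for r
  define y where "y r = W1 r + (?N - 1) * Z r / r\<^sup>2" for r
  have dZ: "(Z has_real_derivative v r) (at r)" if "r > 0" for r
    unfolding Z_def W_def v_def using has_real_derivative_zz[OF that n] by simp
  have dW: "(W has_real_derivative W1 r) (at r)" if "r > 0" for r
    unfolding W_def W1_def using has_real_derivative_dz[OF that n] by simp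
  have dW1: "(W1 has_real_derivative ?N * c - (?N - 1) * W1 r / r) (at r)" if "r > 0" for r
    unfolding W1_def using has_real_derivative_ddz[OF that n] by simp
  have dv: "(v has_real_derivative y r - (?N - 1) * v r / r) (at r)" if "r > 0" for r
  proof -
    have "(v has_real_derivative W1 r - ((?N - 1) * v r * r - (?N - 1) * Z r * 1) / (r * r)) (at r)"
      unfolding v_def[abs_def] 
      by (rule derivative_eq_intros dW[OF that] dZ[OF that] refl | use that in \<open>simp add: v_def\<close>)+
    moreover have "W1 r - ((?N - 1) * v r * r - (?N - 1) * Z r * 1) / (r * r) = y r - (?N - 1) * v r / r"
      using that by (simp add: y_def diff_divide_distrib power2_eq_square)
    ultimately show ?thesis by simp
  qed
  have dV: "(V has_real_derivative y r / pw n r) (at r)" if "r > 0" for r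
  proof -
    have p: "pw n r \<noteq> 0" using pw_pos[OF that, of n] by simp
    have "(V has_real_derivative ((y r - (?N - 1) * v r / r) * pw n r - v r * (- (?N - 1) * pw n r / r)) / (pw n r * pw n r)) (at r)"
      unfolding V_def[abs_def] by (rule DERIV_divide[OF dv[OF that] has_real_derivative_pw[OF that n] p])
    moreover have "((y r - (?N - 1) * v r / r) * pw n r - v r * (- (?N - 1) * pw n r / r)) / (pw n r * pw n r) = y r / pw n r"
      using p that by (simp add: divide_simps) algebra
    ultimately show ?thesis by simp
  qed
  have dy: "(y has_real_derivative ?N * c - (?N - 1) * W1 r / r + (?N - 1) * (v r / r\<^sup>2 - 2 * Z r / r ^ 3)) (at r)" if "r > 0" for r
  proof -
    have "(y has_real_derivative (?N * c - (?N - 1) * W1 r / r) + ((?N - 1) * v r * r\<^sup>2 - (?N - 1) * Z r * (2 * r)) / (r\<^sup>2 * r\<^sup>2)) (at r)"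
      unfolding y_def[abs_def]
      by (rule derivative_eq_intros dW1[OF that] dZ[OF that] refl | use that in simp)+
    moreover have "((?N - 1) * v r * r\<^sup>2 - (?N - 1) * Z r * (2 * r)) / (r\<^sup>2 * r\<^sup>2) = (?N - 1) * (v r / r\<^sup>2 - 2 * Z r / r ^ 3)"
      using that by (simp add: divide_simps power2_eq_square power3_eq_cube) algebra
    ultimately show ?thesis by simp
  qed
  have R1: "R\<^sub>1 > 0" using R by simp
  \<comment> \<open>The values of \<open>Z\<close> and \<open>W\<close> at the two radii are matched
    so that the slope of the profile vanishes at both.\<close>
  have v0: "v R\<^sub>0 = 0" "v R\<^sub>1 = 0" using z R R1 by (auto simp: v_def Z_def W_def divide_inverse)
  have V0: "V R\<^sub>0 = 0" "V R\<^sub>1 = 0" using v0 by (simp_all add: V_def)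
  have Vcont: "continuous_on {R\<^sub>0..R\<^sub>1} V"
  proof (rule DERIV_continuous_on)
    show "(V has_real_derivative y r / pw n r) (at r within {R\<^sub>0..R\<^sub>1})" if "r \<in> {R\<^sub>0..R\<^sub>1}" for r
      using dV[of r] that R by (simp add: has_field_derivative_at_within)
  qed
  obtain \<rho> where \<rho>: "\<rho> \<in> {R\<^sub>0..R\<^sub>1}" "\<And>r. r \<in> {R\<^sub>0..R\<^sub>1} \<Longrightarrow> V \<rho> \<le> V r"
    using continuous_attains_inf[OF compact_Icc _ Vcont] R by force
  have \<rho>0: "\<rho> > 0" using \<rho>(1) R by simp
  \<comment> \<open>At a negative minimum \<open>y\<close> vanishes and has nonnegative derivative.
    Eliminating \<open>Z\<close> through y = 0 expresses that derivative by \<open>b\<close>,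
    \<open>c\<close> and \<open>v\<close>, whose signs contradict this except in the plane.\<close>
  have "V \<rho> \<ge> 0"
  proof (rule ccontr)
    assume neg: "\<not> V \<rho> \<ge> 0"
    have ne: "\<rho> \<noteq> R\<^sub>0" "\<rho> \<noteq> R\<^sub>1" using neg V0 by auto
    then have int: "R\<^sub>0 < \<rho>" "\<rho> < R\<^sub>1" using \<rho>(1) by auto
    have vneg: "v \<rho> < 0" using neg pw_pos[OF \<rho>0, of n] by (simp add: V_def divide_less_0_iff not_le)
    define \<delta> where "\<delta> = min (\<rho> - R\<^sub>0) (R\<^sub>1 - \<rho>)"
    have "\<delta> > 0" using int by (simp add: \<delta>_def)
    moreover have "\<forall>s. \<bar>\<rho> - s\<bar> < \<delta> \<longrightarrow> V \<rho> \<le> V s"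
      by (auto intro!: \<rho>(2) simp: \<delta>_def)
    ultimately have "y \<rho> / pw n \<rho> = 0" by (rule DERIV_local_min[OF dV[OF \<rho>0]])
    then have y0: "y \<rho> = 0" using pw_pos[OF \<rho>0, of n] by simp
    \<comment> \<open>Otherwise \<open>y\<close> would be positive just left of the minimum, and
      \<open>V\<close> strictly smaller there.\<close>
    have y'_nonneg: "?N * c - (?N - 1) * W1 \<rho> / \<rho> + (?N - 1) * (v \<rho> / \<rho>\<^sup>2 - 2 * Z \<rho> / \<rho> ^ 3) \<ge> 0" (is "?y' \<ge> 0")
    proof (rule ccontr)
      assume "\<not> ?y' \<ge> 0"
      then have "?y' < 0" by simp
      then obtain e where e: "e > 0" "\<And>h. 0 < h \<Longrightarrow> h < e \<Longrightarrow> y \<rho> < y (\<rho> - h)"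
        using DERIV_neg_dec_left[OF dy[OF \<rho>0]] by blast
      define h where "h = min e (\<rho> - R\<^sub>0) / 2"
      have h: "0 < h" "h < e" "h < \<rho> - R\<^sub>0" using e int by (auto simp: h_def min_def)
      have "V (\<rho> - h) < V \<rho>"
      proof (rule DERIV_pos_imp_increasing_open[where f=V])
        show "\<rho> - h < \<rho>" using h by simp
        show "\<exists>l. (V has_real_derivative l) (at s) \<and> 0 < l" if "\<rho> - h < s" "s < \<rho>" for s
        proof -
          have s: "s > 0" using that h R by linarith
          have "y s > 0" using e(2)[of "\<rho> - s"] that h y0 by simp
          then have "y s / pw n s > 0" using pw_pos[OF s, of n] by simp
          then show ?thesis using dV[OF s] by blast
        qed
        show "continuous_on {\<rho> - h..\<rho>} V"
          by (rule continuous_on_subset[OF Vcont]) (use h int in auto)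
      qed
      moreover have "V \<rho> \<le> V (\<rho> - h)" using h int by (intro \<rho>(2)) auto
      ultimately show False by simp
    qed
    have Zr: "(?N - 1) * Z \<rho> / \<rho>\<^sup>2 = - W1 \<rho>" using y0 by (simp add: y_def)
    have W1r: "W1 \<rho> / \<rho> = b * pw n \<rho> / \<rho> + c" using \<rho>0 by (simp add: W1_def ddz_def field_simps)
    have "?y' = ?N * c - (?N - 1) * (W1 \<rho> / \<rho>) + (?N - 1) * v \<rho> / \<rho>\<^sup>2 - 2 * ((?N - 1) * Z \<rho> / \<rho>\<^sup>2) / \<rho>"
      by (simp add: algebra_simps power2_eq_square power3_eq_cube)
    also have "\<dots> = ?N * c - (?N - 3) * (W1 \<rho> / \<rho>) + (?N - 1) * v \<rho> / \<rho>\<^sup>2"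
      unfolding Zr by (simp add: algebra_simps diff_divide_distrib)
    finally have y': "?N * c - (?N - 3) * (W1 \<rho> / \<rho>) + (?N - 1) * v \<rho> / \<rho>\<^sup>2 \<ge> 0" using y'_nonneg by simp
    consider "n = 1" | "n = 2" | "n \<ge> 3" using n by linarith
    then show False
    proof cases
      case 1
      then have "W1 \<rho> = 0" using y0 by (simp add: y_def)
      then show False using y' c 1 by simp
    next
      \<comment> \<open>For n >= 3 the coefficient n - 3 of the \<open>b\<close> term has the right
        sign; for n = 2 it does not.\<close>
      case 3
      have "(?N - 3) * (b * pw n \<rho> / \<rho>) \<ge> 0"
        using 3 b pw_pos[OF \<rho>0, of n] \<rho>0 by (intro mult_nonneg_nonneg) auto
      moreover have "(?N - 1) * v \<rho> / \<rho>\<^sup>2 \<le> 0" using 3 vneg \<rho>0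
        by (intro divide_nonpos_pos mult_nonneg_nonpos) auto
      moreover have "?N * c - (?N - 3) * (W1 \<rho> / \<rho>) = 3 * c - (?N - 3) * (b * pw n \<rho> / \<rho>)"
        unfolding W1r by (simp add: algebra_simps)
      ultimately show False using y' c by linarith
    next
      \<comment> \<open>The minimum only yields b + 3 c r^2 > 0 at \<rho>, hence at all smaller
        radii because c < 0. Then \<open>T\<close> increases from a nonnegative value, so r V is
        nondecreasing up to \<rho> and cannot become negative.\<close>
      case 2
      have pw2: "pw n r = inverse r" for r using 2 by (simp add: pw_def)
      have Vv: "V r = r * v r" for r by (simp add: V_def pw2 divide_inverse mult.commute)
      have pw2': "pw 2 r = inverse r" for r by (simp add: pw_def)
      have "v \<rho> / \<rho>\<^sup>2 < 0" using vneg \<rho>0 by (simp add: divide_neg_pos)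
      then have "3 * c + b / \<rho>\<^sup>2 > 0"
        using y' \<rho>0 unfolding W1r by (simp add: 2 pw2' power2_eq_square divide_inverse)
      then have g\<rho>: "b + 3 * c * \<rho>\<^sup>2 > 0" using \<rho>0 by (simp add: field_simps)
      have g: "b + 3 * c * r\<^sup>2 > 0" if "0 < r" "r \<le> \<rho>" for r
      proof -
        have "r\<^sup>2 \<le> \<rho>\<^sup>2" using that by (intro power_mono) auto
        then have "c * \<rho>\<^sup>2 \<le> c * r\<^sup>2" using c by (intro mult_left_mono_neg) auto
        then show ?thesis using g\<rho> by linarith
      qed
      \<comment> \<open>Chosen so that r T is the derivative of r V.\<close>
      define T where "T r = r * y r + v r" for r
      have dT: "(T has_real_derivative (b + 3 * c * r\<^sup>2) / r) (at r)" if "r > 0" for r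
      proof -
        have "(T has_real_derivative (1 * y r + (?N * c - (?N - 1) * W1 r / r + (?N - 1) * (v r / r\<^sup>2 - 2 * Z r / r ^ 3)) * r)
            + (y r - (?N - 1) * v r / r)) (at r)"
          unfolding T_def[abs_def]
          by (intro DERIV_add DERIV_mult DERIV_ident dy[OF that] dv[OF that])
        moreover have "(1 * y r + (?N * c - (?N - 1) * W1 r / r + (?N - 1) * (v r / r\<^sup>2 - 2 * Z r / r ^ 3)) * r)
            + (y r - (?N - 1) * v r / r) = (b + 3 * c * r\<^sup>2) / r"
          using that 2 by (simp add: y_def W1_def ddz_def pw2' field_simps power2_eq_square power3_eq_cube)
        ultimately show ?thesis by simp
      qed
      \<comment> \<open>As \<open>v\<close> vanishes at the inner radius, this is the assumption
        \<open>two\<close>: the second derivative of the profile there is nonnegative.\<close>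
      have T0: "T R\<^sub>0 \<ge> 0"
      proof -
        have "R\<^sub>0 * T R\<^sub>0 = b * R\<^sub>0 + c * R\<^sub>0 ^ 3 - 1"
          using R z 2 by (simp add: T_def v0 y_def W1_def ddz_def pw2' Z_def field_simps power2_eq_square power3_eq_cube)
        then have "R\<^sub>0 * T R\<^sub>0 \<ge> 0" using two[OF 2] by simp
        then show ?thesis using R by (simp add: zero_le_mult_iff)
      qed
      have Tpos: "T r \<ge> 0" if "R\<^sub>0 \<le> r" "r \<le> \<rho>" for r
      proof -
        have "T R\<^sub>0 \<le> T r"
        proof (rule DERIV_nonneg_imp_nondecreasing[OF that(1)])
          fix s assume "R\<^sub>0 \<le> s" "s \<le> r"
          then have "s > 0" "s \<le> \<rho>" using R that by auto
          then show "\<exists>l. (T has_real_derivative l) (at s) \<and> 0 \<le> l"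
            using dT[of s] g[of s] by (intro exI[of _ "(b + 3 * c * s\<^sup>2) / s"]) auto
        qed
        with T0 show ?thesis by simp
      qed
      have "R\<^sub>0 * V R\<^sub>0 \<le> \<rho> * V \<rho>"
      proof (rule DERIV_nonneg_imp_nondecreasing[where f="\<lambda>r. r * V r"])
        show "R\<^sub>0 \<le> \<rho>" using int by simp
        fix s assume s: "R\<^sub>0 \<le> s" "s \<le> \<rho>"
        then have s0: "s > 0" using R by simp
        have "((\<lambda>r. r * V r) has_real_derivative 1 * V s + (y s / pw n s) * s) (at s)"
          by (intro DERIV_mult DERIV_ident dV[OF s0])
        moreover have "1 * V s + (y s / pw n s) * s = s * T s"
          using s0 by (simp add: Vv T_def pw2 field_simps)
        ultimately have "((\<lambda>r. r * V r) has_real_derivative s * T s) (at s)" by simp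
        moreover have "s * T s \<ge> 0" using Tpos[OF s] s0 by simp
        ultimately show "\<exists>l. ((\<lambda>r. r * V r) has_real_derivative l) (at s) \<and> 0 \<le> l" by blast
      qed
      then have "V \<rho> \<ge> 0" using V0 \<rho>0 by (simp add: zero_le_mult_iff)
      then show False using neg by simp
    qed
  qed
  then have vpos: "v r \<ge> 0" if "r \<in> {R\<^sub>0..R\<^sub>1}" for r
  proof -
    have "V r \<ge> 0" using \<rho>(2)[OF that] \<open>V \<rho> \<ge> 0\<close> by simp
    moreover have "pw n r > 0" using that R by (intro pw_pos) auto
    ultimately show ?thesis by (simp add: V_def zero_le_divide_iff)
  qed
  have mono: "Z s \<le> Z t" if "R\<^sub>0 \<le> s" "s \<le> t" "t \<le> R\<^sub>1" for s t
  proof (rule DERIV_nonneg_imp_nondecreasing[OF that(2)])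
    fix q assume "s \<le> q" "q \<le> t"
    then show "\<exists>l. (Z has_real_derivative l) (at q) \<and> 0 \<le> l"
      using dZ[of q] vpos[of q] that R by auto
  qed
  show ?thesis using mono[of R\<^sub>0 r] mono[of r R\<^sub>1] r z by (simp add: Z_def)
qed

subsection \<open>Calibrability\<close>

lemma integrable_bounded_on_bounded_set:
  fixes f :: "'a::euclidean_space \<Rightarrow> real"
  assumes "f \<in> borel_measurable borel" "S \<in> sets borel" "\<And>x. x \<in> S \<Longrightarrow> \<bar>f x\<bar> \<le> M" "\<And>x. x \<in> S \<Longrightarrow> norm x \<le> B"
  shows "integrable (lebesgue_on S) f"
proof -
  have "integrable lborel (\<lambda>x. indicator S x *\<^sub>R f x)"
  proof (rule integrable_lborel_bounded_support[where M="max M 0" and B=B])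
    show "norm (indicator S x *\<^sub>R f x) \<le> max M 0" for x
      using assms(3)[of x] by (cases "x \<in> S") auto
    show "indicator S x *\<^sub>R f x = 0" if "norm x > B" for x
      using assms(4)[of x] that by (cases "x \<in> S") auto
    show "(\<lambda>x. indicator S x *\<^sub>R f x) \<in> borel_measurable borel"
      by (intro borel_measurable_scaleR borel_measurable_indicator assms)
  qed
  then show ?thesis by (subst integrable_lebesgue_on_iff_lborel[OF assms(2,1)])
qed

lemma pw_antimono: "0 < r \<Longrightarrow> r \<le> s \<Longrightarrow> pw n s \<le> pw n r"
  unfolding pw_def by (intro power_mono le_imp_inverse_le) auto

lemma ddz_borel: "(\<lambda>x::'a::euclidean_space. (ddz n b c (norm x))\<^sup>2) \<in> borel_measurable borel"
  unfolding ddz_def pw_def by measurable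

lemma dyadic_shell:
  fixes r R :: real
  assumes "0 < R" "R < r"
  obtains k where "2 ^ k * R \<le> r" "r < 2 * 2 ^ k * R"
proof -
  obtain j where "r / R < 2 ^ j" using real_arch_pow[of 2 "r / R"] by auto
  then have j: "r < 2 ^ j * R" using assms by (simp add: divide_less_eq)
  define k where "k = (LEAST k. r < 2 * 2 ^ k * R)"
  have "2 ^ j * R \<le> 2 * 2 ^ j * R" using assms by simp
  then have ex: "r < 2 * 2 ^ j * R" using j by linarith
  have k: "r < 2 * 2 ^ k * R" unfolding k_def by (rule LeastI[of _ j]) (fact ex)
  have "2 ^ k * R \<le> r"
  proof (cases k)
    case 0
    then show ?thesis using assms by simp
  next
    case (Suc l)
    then have "\<not> r < 2 * 2 ^ l * R" unfolding k_def using not_less_Least by (metis lessI)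
    then show ?thesis using Suc by simp
  qed
  with k show thesis by (blast intro: that)
qed

text \<open>On the dyadic shell with inner radius y = 2^k R the integrand is at most y^(2-2n) and
  the volume is O(y^n). The products y^(2-n) are summable with ratio at most 1/2 as soon as n >= 3;
  \<open>m + 1\<close> below is n - 2.\<close>

lemma integrable_pw_exterior:
  fixes R :: real
  defines "n \<equiv> DIM('a::euclidean_space)"
  assumes n: "n \<ge> 3" and R: "R > 0"
  shows "integrable (lebesgue_on (- cball (0::'a) R)) (\<lambda>x. (pw n (norm x))\<^sup>2)"
proof -
  define f where "f x = (pw n (norm x))\<^sup>2" for x :: 'a
  have fm: "f \<in> borel_measurable borel" unfolding f_def pw_def by measurable
  obtain m where m: "n = m + 3" using n by (metis add.commute le_Suc_ex)
  define a where "a k x = ennreal ((pw n (2 ^ k * R))\<^sup>2) * indicator (ball (0::'a) (2 * 2 ^ k * R)) x" for k :: nat and x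
  define C where "C = unit_ball_vol (real n) * 2 ^ n * inverse R ^ (m + 1)"
  have C: "C \<ge> 0" using R by (simp add: C_def)
  have le: "ennreal (norm (indicator (- cball 0 R) x *\<^sub>R f x)) \<le> (\<Sum>k. a k x)" for x :: 'a
  proof (cases "norm x > R")
    case True
    obtain k where k: "2 ^ k * R \<le> norm x" "norm x < 2 * 2 ^ k * R" using dyadic_shell[OF R True] .
    have "pw n (norm x) \<le> pw n (2 ^ k * R)" using k R by (intro pw_antimono) auto
    moreover have "0 \<le> pw n (norm x)" by (simp add: pw_def)
    ultimately have "f x \<le> (pw n (2 ^ k * R))\<^sup>2" unfolding f_def by (intro power_mono)
    then have "ennreal (norm (indicator (- cball 0 R) x *\<^sub>R f x)) \<le> a k x"
      using True k by (auto simp: a_def f_def intro!: ennreal_leI)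
    also have "\<dots> \<le> (\<Sum>k. a k x)"
      using sum_le_suminf[OF summableI, of "{k}" "\<lambda>k. a k x"] by simp
    finally show ?thesis .
  qed simp
  have int: "(\<integral>\<^sup>+x. a k x \<partial>lborel) \<le> ennreal (C * (1 / 2) ^ k)" for k
  proof -
    define y where "y = 2 ^ k * R"
    have y: "y > 0" using R by (simp add: y_def)
    have "(\<integral>\<^sup>+x. a k x \<partial>lborel) = ennreal ((pw n y)\<^sup>2) * emeasure lborel (ball (0::'a) (2 * y))"
      unfolding a_def y_def by (subst nn_integral_cmult_indicator) (auto simp: mult.assoc)
    also have "\<dots> = ennreal ((pw n y)\<^sup>2 * (unit_ball_vol (real n) * (2 * y) ^ n))"
      using y by (subst emeasure_ball) (auto simp: n_def ennreal_mult)
    also have "(pw n y)\<^sup>2 * (unit_ball_vol (real n) * (2 * y) ^ n) = unit_ball_vol (real n) * 2 ^ n * inverse y ^ (m + 1)"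
    proof -
      have "(pw n y)\<^sup>2 * y ^ n = inverse y ^ (m + 1) * (inverse y * y) ^ n"
        by (simp add: pw_def m power_mult_distrib[symmetric] power2_eq_square power_add[symmetric])
           (simp add: power_mult_distrib power_add power2_eq_square power3_eq_cube algebra_simps)
      then have "(pw n y)\<^sup>2 * y ^ n = inverse y ^ (m + 1)" using y by simp
      then show ?thesis by (simp add: power_mult_distrib)
    qed
    also have "\<dots> \<le> C * (1 / 2) ^ k"
    proof -
      have "inverse y ^ (m + 1) = inverse R ^ (m + 1) * ((1 / 2) ^ k) ^ (m + 1)"
        by (simp add: y_def power_mult_distrib power_divide power_one_over inverse_eq_divide)
      also have "\<dots> \<le> inverse R ^ (m + 1) * ((1 / 2) ^ k) ^ 1"
        using R by (intro mult_left_mono power_decreasing) (auto simp: power_le_one)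
      finally show ?thesis unfolding C_def by (simp add: mult.assoc mult_left_mono)
    qed
    finally show ?thesis by (simp add: ennreal_leI)
  qed
  have am: "a k \<in> borel_measurable lborel" for k
    unfolding a_def by (intro borel_measurable_times_ennreal borel_measurable_const borel_measurable_indicator) auto
  have "(\<integral>\<^sup>+x. ennreal (norm (indicator (- cball 0 R) x *\<^sub>R f x)) \<partial>lborel) \<le> (\<integral>\<^sup>+x. (\<Sum>k. a k x) \<partial>lborel)"
    by (intro nn_integral_mono le)
  also have "\<dots> = (\<Sum>k. \<integral>\<^sup>+x. a k x \<partial>lborel)" by (rule nn_integral_suminf[OF am])
  also have "\<dots> \<le> (\<Sum>k. ennreal (C * (1 / 2) ^ k))" by (intro suminf_le int summableI)
  also have "\<dots> < \<infinity>"
  proof -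
    have "summable (\<lambda>k. C * (1 / 2) ^ k :: real)" by (intro summable_mult summable_geometric) simp
    then have "(\<Sum>k. ennreal (C * (1 / 2) ^ k)) = ennreal (\<Sum>k. C * (1 / 2) ^ k)"
      using C by (intro suminf_ennreal2) auto
    then show ?thesis by simp
  qed
  finally have fin: "(\<integral>\<^sup>+x. ennreal (norm (indicator (- cball 0 R) x *\<^sub>R f x)) \<partial>lborel) < \<infinity>" .
  have "- cball (0::'a) R \<in> sets borel" by auto
  moreover have "(\<lambda>x. indicator (- cball 0 R) x *\<^sub>R f x) \<in> borel_measurable lborel"
    using fm calculation by (auto intro!: borel_measurable_scaleR borel_measurable_indicator)
  ultimately show ?thesis
    unfolding f_def[symmetric]
    by (subst integrable_lebesgue_on_iff_lborel[OF _ fm]) (use fin in \<open>auto simp: integrable_iff_bounded\<close>)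
qed

lemma calibrable_exterior:
  assumes R: "R > 0" and n: "DIM('a::euclidean_space) \<noteq> 2" and s: "s \<in> {-1, 1}"
  shows "calibrable (- cball 0 R :: 'a set) (\<lambda>_. s)"
proof -
  let ?n = "DIM('a)"
  interpret gauss_domain "\<lambda>r. R - r" "\<lambda>_. -1" "- cball (0::'a) R" by (rule gauss_domain_exterior[OF R])
  define b where "b = (real ?n - 1) * (real ?n - 2) / (pw ?n R * R\<^sup>2)"
  define d where "d = (real ?n - 3) / (2 * pw ?n R)"
  have n1: "?n \<ge> 1" using DIM_positive[where 'a='a] by simp
  have dd: "(ddz ?n b 0 has_real_derivative - ((real ?n - 1) * ddz ?n b 0 r / r)) (at r)" if "r > 0" for r
    using has_real_derivative_ddz[OF that n1, of b 0] by simp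
  note prof = exterior_profile[OF R n1 n, folded b_def d_def]
  show ?thesis
  proof (rule radial_calibrable[where \<rho>="R / 2" and z="zz ?n 0 b 0 d" and w="dz ?n 0 b 0" and w'="ddz ?n b 0" and c="real ?n * 0"])
    show "integrable (lebesgue_on (- cball (0::'a) R)) (\<lambda>x. (ddz ?n b 0 (norm x))\<^sup>2)"
    proof (cases "?n = 1")
      \<comment> \<open>On the line \<open>pw\<close> is constant and not square integrable, but
        \<open>b\<close> is zero.\<close>
      case True
      then show ?thesis by (simp add: ddz_def b_def)
    next
      case False
      then have "?n \<ge> 3" using n n1 by linarith
      then have "integrable (lebesgue_on (- cball (0::'a) R)) (\<lambda>x. b\<^sup>2 * (pw ?n (norm x))\<^sup>2)"
        using integrable_pw_exterior[where 'a='a, of R] R by simp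
      then show ?thesis by (simp add: ddz_def power_mult_distrib)
    qed
  qed (use R s n1 prof in \<open>auto simp del: of_nat_Suc intro!: smooth_on_zz smooth_on_dz has_real_derivative_zz
      has_real_derivative_dz dd\<close>)
qed

text \<open>Up to the factor \<open>R\<^sub>0\<^sup>2\<close>, hypothesis \<open>two\<close> says
  that the profile has nonnegative second derivative at the inner radius.\<close>

lemma calibrable_annulusI:
  fixes R\<^sub>0 R\<^sub>1 :: real
  defines "n \<equiv> DIM('a::euclidean_space)"
  assumes R: "0 < R\<^sub>0" "R\<^sub>0 < R\<^sub>1" and b: "b > 0" and c: "c < 0"
    and z: "zz n a b c d R\<^sub>0 = -1" "zz n a b c d R\<^sub>1 = 1"
      "dz n a b c R\<^sub>0 = - (real n - 1) / R\<^sub>0" "dz n a b c R\<^sub>1 = (real n - 1) / R\<^sub>1"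
    and two: "n = 2 \<Longrightarrow> b * R\<^sub>0 + c * R\<^sub>0 ^ 3 \<ge> 1"
    and s: "s \<in> {-1, 1}"
  shows "calibrable (annulus R\<^sub>0 R\<^sub>1 :: 'a set) (\<lambda>_. s)"
proof -
  interpret gauss_domain "\<lambda>r. (r - R\<^sub>0) * (r - R\<^sub>1)" "\<lambda>r. 2 * r - R\<^sub>0 - R\<^sub>1" "annulus R\<^sub>0 R\<^sub>1 :: 'a set"
    by (rule gauss_domain_annulus[OF R])
  have n1: "n \<ge> 1" using DIM_positive[where 'a='a] by (simp add: n_def)
  have sgns: "sgn (2 * R\<^sub>0 - R\<^sub>0 - R\<^sub>1) = -1" "sgn (2 * R\<^sub>1 - R\<^sub>0 - R\<^sub>1) = 1" using R by auto
  show ?thesis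
  proof (rule radial_calibrable[where \<rho>="R\<^sub>0 / 2" and z="zz n a b c d" and w="dz n a b c" and w'="ddz n b c" and c="real n * c"])
    show "R\<^sub>0 / 2 > 0" using R by simp
    show "r > R\<^sub>0 / 2" if "r \<ge> 0" "(r - R\<^sub>0) * (r - R\<^sub>1) \<le> 0" for r
      using that R by (auto simp: mult_le_0_iff)
    show "smooth_on {0<..} (zz n a b c d)" "smooth_on {0<..} (dz n a b c)" by (rule smooth_on_zz smooth_on_dz)+
    fix r :: real assume r: "r > 0"
    show "(zz n a b c d has_real_derivative dz n a b c r - (real DIM('a) - 1) * zz n a b c d r / r) (at r)"
      using has_real_derivative_zz[OF r n1] by (simp add: n_def)
    show "(dz n a b c has_real_derivative ddz n b c r) (at r)" by (rule has_real_derivative_dz[OF r n1])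
    show "(ddz n b c has_real_derivative real n * c - (real DIM('a) - 1) * ddz n b c r / r) (at r)"
      using has_real_derivative_ddz[OF r n1] by (simp add: n_def)
    show "\<bar>zz n a b c d r\<bar> \<le> 1" if "(r - R\<^sub>0) * (r - R\<^sub>1) < 0"
      by (rule zz_monotone[OF R n1 b c z two]) (use that R in \<open>auto simp: mult_less_0_iff\<close>)
    show "zz n a b c d r = sgn (2 * r - R\<^sub>0 - R\<^sub>1)" if "(r - R\<^sub>0) * (r - R\<^sub>1) = 0"
      using that z sgns by auto
    show "dz n a b c r = sgn (2 * r - R\<^sub>0 - R\<^sub>1) * (real DIM('a) - 1) / r" if "(r - R\<^sub>0) * (r - R\<^sub>1) = 0"
      using that z sgns by (auto simp: n_def)
  next
    show "integrable (lebesgue_on (annulus R\<^sub>0 R\<^sub>1 :: 'a set)) (\<lambda>x. (ddz n b c (norm x))\<^sup>2)"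
    proof (rule integrable_bounded_on_bounded_set[OF ddz_borel, where B=R\<^sub>1 and M="(b * pw n R\<^sub>0 + \<bar>c\<bar> * R\<^sub>1)\<^sup>2"])
      show "(annulus R\<^sub>0 R\<^sub>1 :: 'a set) \<in> sets borel" using open_U by simp
      fix x :: 'a assume "x \<in> annulus R\<^sub>0 R\<^sub>1"
      then have x: "R\<^sub>0 < norm x" "norm x < R\<^sub>1" by (auto simp: annulus_def)
      show "norm x \<le> R\<^sub>1" using x by simp
      have "\<bar>ddz n b c (norm x)\<bar> \<le> \<bar>b * pw n (norm x)\<bar> + \<bar>c * norm x\<bar>" unfolding ddz_def by (rule abs_triangle_ineq)
      also have "\<dots> \<le> b * pw n R\<^sub>0 + \<bar>c\<bar> * R\<^sub>1"
      proof (rule add_mono)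
        have "0 < pw n (norm x)" using x R by (intro pw_pos) linarith
        then show "\<bar>b * pw n (norm x)\<bar> \<le> b * pw n R\<^sub>0"
          using x R b pw_antimono[of R\<^sub>0 "norm x" n] by (simp add: abs_mult)
        show "\<bar>c * norm x\<bar> \<le> \<bar>c\<bar> * R\<^sub>1" using x by (simp add: abs_mult mult_left_mono)
      qed
      finally have "\<bar>ddz n b c (norm x)\<bar>\<^sup>2 \<le> (b * pw n R\<^sub>0 + \<bar>c\<bar> * R\<^sub>1)\<^sup>2" by (intro power_mono) auto
      then show "\<bar>(ddz n b c (norm x))\<^sup>2\<bar> \<le> (b * pw n R\<^sub>0 + \<bar>c\<bar> * R\<^sub>1)\<^sup>2" by simp
    qed
  qed (use s in auto)
qed

lemma calibrable_annulus:
  assumes R: "0 < R\<^sub>0" "R\<^sub>0 < R\<^sub>1" and n: "DIM('a::euclidean_space) \<noteq> 2" and s: "s \<in> {-1, 1}"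
  shows "calibrable (annulus R\<^sub>0 R\<^sub>1 :: 'a set) (\<lambda>_. s)"
proof -
  let ?n = "DIM('a)"
  have n1: "?n \<ge> 1" using DIM_positive[where 'a='a] by simp
  obtain a b c d where "b > 0" "c < 0" "zz ?n a b c d R\<^sub>0 = -1" "zz ?n a b c d R\<^sub>1 = 1"
    "dz ?n a b c R\<^sub>0 = - (real ?n - 1) / R\<^sub>0" "dz ?n a b c R\<^sub>1 = (real ?n - 1) / R\<^sub>1"
    using annulus_profile[OF R n1] by metis
  then show ?thesis using calibrable_annulusI[OF R] n s by blast
qed

subsection \<open>The critical ratio in the plane\<close>

text \<open>Up to a positive factor, the second derivative of the planar annulus profile at the
  inner radius, as a function of q = \<open>R\<^sub>1 / R\<^sub>0\<close>. Giving the logarithm a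
  constant coefficient makes the derivative rational.\<close>

definition ratio_excess :: "real \<Rightarrow> real" where
  "ratio_excess q = (q\<^sup>2 - 1) * (2 * q - 1) / (q * (q\<^sup>2 - 2 * q + 3)) - ln q"

lemma quadratic_pos: "q\<^sup>2 - 2 * q + 3 > (0::real)"
proof -
  have "q\<^sup>2 - 2 * q + 3 = (q - 1)\<^sup>2 + 2" by (simp add: power2_eq_square algebra_simps)
  then show ?thesis by (metis add_nonneg_pos zero_le_power2 zero_less_numeral)
qed

text \<open>The numerator factors completely. Its only zero beyond 1 is 3, so
  \<open>ratio_excess\<close> first rises and then falls.\<close>

lemma has_real_derivative_ratio_excess:
  assumes "q > 0"
  shows "(ratio_excess has_real_derivative (q - 1) * (3 - q) * (q + 1) ^ 3 / (q * (q\<^sup>2 - 2 * q + 3))\<^sup>2) (at q)"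
proof -
  have D: "q * (q\<^sup>2 - 2 * q + 3) \<noteq> 0" using assms quadratic_pos[of q] by simp
  have "(ratio_excess has_real_derivative
     (((2 * q) * (2 * q - 1) + 2 * (q\<^sup>2 - 1)) * (q * (q\<^sup>2 - 2 * q + 3)) - ((q\<^sup>2 - 1) * (2 * q - 1)) * (1 * (q\<^sup>2 - 2 * q + 3) + (2 * q - 2) * q))
       / ((q * (q\<^sup>2 - 2 * q + 3)) * (q * (q\<^sup>2 - 2 * q + 3))) - 1 / q) (at q)"
    unfolding ratio_excess_def[abs_def]
  proof (intro DERIV_diff DERIV_divide D)
    show "((\<lambda>q. (q\<^sup>2 - 1) * (2 * q - 1)) has_real_derivative (2 * q) * (2 * q - 1) + 2 * (q\<^sup>2 - 1)) (at q)"
      by (rule derivative_eq_intros refl | simp)+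
    show "((\<lambda>q. q * (q\<^sup>2 - 2 * q + 3)) has_real_derivative 1 * (q\<^sup>2 - 2 * q + 3) + (2 * q - 2) * q) (at q)"
      by (rule derivative_eq_intros refl | simp)+
    show "(ln has_real_derivative 1 / q) (at q)" using DERIV_ln[OF assms] by (simp add: divide_inverse)
  qed
  moreover have "(((2 * q) * (2 * q - 1) + 2 * (q\<^sup>2 - 1)) * (q * (q\<^sup>2 - 2 * q + 3)) - ((q\<^sup>2 - 1) * (2 * q - 1)) * (1 * (q\<^sup>2 - 2 * q + 3) + (2 * q - 2) * q))
       / ((q * (q\<^sup>2 - 2 * q + 3)) * (q * (q\<^sup>2 - 2 * q + 3))) - 1 / q
     = (q - 1) * (3 - q) * (q + 1) ^ 3 / (q * (q\<^sup>2 - 2 * q + 3))\<^sup>2"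
  proof -
    have e: "1 / q = q * (q\<^sup>2 - 2 * q + 3)\<^sup>2 / (q * (q\<^sup>2 - 2 * q + 3))\<^sup>2"
      using D by (simp add: power2_eq_square)
    show ?thesis
      unfolding e power2_eq_square[symmetric, of "q * (q\<^sup>2 - 2 * q + 3)"] diff_divide_distrib[symmetric]
      by (rule arg_cong[where f="\<lambda>x. x / (q * (q\<^sup>2 - 2 * q + 3))\<^sup>2"]) algebra
  qed
  ultimately show ?thesis by simp
qed

text \<open>Starting from the value 0 at q = 1, the function is positive up to 3, then decreases
  strictly and becomes negative; it therefore has exactly one zero beyond 1.\<close>

lemma critical_ratio: "\<exists>Q>1. \<forall>q>1. ratio_excess q \<ge> 0 \<longleftrightarrow> q \<le> Q"
proof -
  have one: "ratio_excess 1 = 0" by (simp add: ratio_excess_def)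
  have cont: "continuous_on {x..y} ratio_excess" if "x > 0" for x y
    by (rule DERIV_continuous_on[OF has_field_derivative_at_within[OF has_real_derivative_ratio_excess]]) (use that in auto)
  have D: "(q * (q\<^sup>2 - 2 * q + 3))\<^sup>2 > 0" if "q > 0" for q :: real
    using that quadratic_pos[of q] by simp
  have inc: "ratio_excess q > 0" if "1 < q" "q \<le> 3" for q
  proof -
    have "ratio_excess 1 < ratio_excess q"
    proof (rule DERIV_pos_imp_increasing_open[where f=ratio_excess, OF that(1) _ cont])
      fix y assume y: "1 < y" "y < q"
      then have "(y - 1) * (3 - y) * (y + 1) ^ 3 / (y * (y\<^sup>2 - 2 * y + 3))\<^sup>2 > 0"
        using that D[of y] by (intro divide_pos_pos mult_pos_pos) auto
      then show "\<exists>l. (ratio_excess has_real_derivative l) (at y) \<and> 0 < l"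
        using has_real_derivative_ratio_excess[of y] y by auto
    qed simp
    then show ?thesis using one by simp
  qed
  have dec: "ratio_excess r < ratio_excess q" if "3 \<le> q" "q < r" for q r
  proof (rule DERIV_neg_imp_decreasing_open[where f=ratio_excess, OF that(2) _ cont])
    fix y assume y: "q < y" "y < r"
    then have "(y - 1) * (3 - y) * (y + 1) ^ 3 / (y * (y\<^sup>2 - 2 * y + 3))\<^sup>2 < 0"
      using that D[of y] by (intro divide_neg_pos mult_neg_pos mult_pos_neg) auto
    then show "\<exists>l. (ratio_excess has_real_derivative l) (at y) \<and> l < 0"
      using has_real_derivative_ratio_excess[of y] y that by auto
  qed (use that in simp)
  \<comment> \<open>The rational part is at most 4 at this point, while the logarithm is 5.\<close>
  define M where "M = exp (5::real)"
  have M3: "M \<ge> 3" unfolding M_def using exp_ge_add_one_self[of 5] by simp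
  have "(M\<^sup>2 - 1) * (2 * M - 1) \<le> 4 * (M * (M\<^sup>2 - 2 * M + 3))"
  proof -
    have "0 \<le> M * (2 * (M - 7 / 4)\<^sup>2 + 6) - 1"
    proof -
      have "1 * 6 \<le> M * (2 * (M - 7 / 4)\<^sup>2 + 6)" using M3 by (intro mult_mono) auto
      then show ?thesis by simp
    qed
    moreover have "4 * (M * (M\<^sup>2 - 2 * M + 3)) - (M\<^sup>2 - 1) * (2 * M - 1) = M * (2 * (M - 7 / 4)\<^sup>2 + 6) - 1 + (15 / 8) * M"
      by (simp add: power2_eq_square algebra_simps)
    ultimately show ?thesis using M3 by linarith
  qed
  then have "(M\<^sup>2 - 1) * (2 * M - 1) / (M * (M\<^sup>2 - 2 * M + 3)) \<le> 4"
    using M3 quadratic_pos[of M] by (simp add: divide_le_eq)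
  then have Mneg: "ratio_excess M < 0" by (simp add: ratio_excess_def M_def)
  have three: "ratio_excess 3 > 0" using inc[of 3] by simp
  obtain Q where Q: "3 \<le> Q" "Q \<le> M" "ratio_excess Q = 0"
    using IVT2'[of ratio_excess M 0 3] Mneg three M3 cont[of 3 M] by auto
  have "ratio_excess q \<ge> 0 \<longleftrightarrow> q \<le> Q" if "q > 1" for q
  proof (cases "q \<le> 3")
    case True
    then show ?thesis using inc[OF that] Q by auto
  next
    case False
    then show ?thesis using dec[of q Q] dec[of Q q] Q by (cases q Q rule: linorder_cases) auto
  qed
  then show ?thesis using Q by (intro exI[of _ Q]) auto
qed

text \<open>The factor \<open>q + 1\<close> squared drops out; what remains is \<open>ratio_excess\<close> cleared of denominators.\<close>

lemma annulus_coefficients_criterion: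
  fixes R\<^sub>0 R\<^sub>1 b c :: real
  assumes R: "0 < R\<^sub>0" "R\<^sub>0 < R\<^sub>1"
  defines "A1 \<equiv> fs 2 R\<^sub>1 - fs 2 R\<^sub>0"
  defines "A2 \<equiv> (R\<^sub>1\<^sup>2 - R\<^sub>0\<^sup>2) / 2"
  defines "A3 \<equiv> (R\<^sub>1 ^ (2 + 2) - R\<^sub>0 ^ (2 + 2)) / (real 2 + 2)"
  defines "S1 \<equiv> (real 2 - 1) * (1 / R\<^sub>1 + 1 / R\<^sub>0)"
  defines "S2 \<equiv> R\<^sub>1 ^ (2 - 1) + R\<^sub>0 ^ (2 - 1)"
  assumes b: "b * (A1 * A3 - A2\<^sup>2) = S1 * A3 + S2 * A2"
    and c: "c * (A1 * A3 - A2\<^sup>2) = - (S2 * A1 + S1 * A2)"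
  shows "b * R\<^sub>0 + c * R\<^sub>0 ^ 3 \<ge> 1 \<longleftrightarrow> ratio_excess (R\<^sub>1 / R\<^sub>0) \<ge> 0"
proof -
  define q where "q = R\<^sub>1 / R\<^sub>0"
  have q: "q > 1" using R by (simp add: q_def)
  have R1: "R\<^sub>1 = q * R\<^sub>0" using R by (simp add: q_def)
  define l where "l = ln q"
  define \<Delta> where "\<Delta> = A1 * A3 - A2\<^sup>2"
  have \<Delta>: "\<Delta> > 0" using annulus_determinant_pos[OF R, of 2] by (simp add: \<Delta>_def A1_def A2_def A3_def)
  have A1: "A1 = l" using R q by (simp add: A1_def fs_def l_def R1 ln_mult)
  have A2: "A2 = R\<^sub>0\<^sup>2 * (q\<^sup>2 - 1) / 2" by (simp add: A2_def R1 power_mult_distrib algebra_simps)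
  have A3: "A3 = R\<^sub>0 ^ 4 * (q ^ 4 - 1) / 4" by (simp add: A3_def R1 power_mult_distrib algebra_simps)
  have S2: "S2 = R\<^sub>0 * (q + 1)" by (simp add: S2_def R1 algebra_simps)
  have S1: "q * R\<^sub>0 * S1 = q + 1" using R q by (simp add: S1_def R1 field_simps)
  define N where "N = (q\<^sup>2 - 1) * (2 * q - 1)"
  define D where "D = q * (q\<^sup>2 - 2 * q + 3)"
  have D: "D > 0" using q quadratic_pos[of q] by (simp add: D_def)
  \<comment> \<open>Multiplying by the determinant lets \<open>b\<close> and \<open>c\<close> enter
    only through the given products; the factor 4 q clears the denominators of \<open>A2\<close>,
    \<open>A3\<close> and \<open>S1\<close>.\<close>
  have "(b * R\<^sub>0 + c * R\<^sub>0 ^ 3 - 1) * \<Delta> * (4 * q) =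
     4 * q * R\<^sub>0 * (b * \<Delta>) + 4 * q * R\<^sub>0 ^ 3 * (c * \<Delta>) - 4 * q * \<Delta>" by algebra
  also have "\<dots> = 4 * q * R\<^sub>0 * (S1 * A3 + S2 * A2) - 4 * q * R\<^sub>0 ^ 3 * (S2 * A1 + S1 * A2) - 4 * q * (A1 * A3 - A2\<^sup>2)"
    using b c unfolding \<Delta>_def[symmetric] by (simp only: mult_minus_right diff_conv_add_uminus)
  also have "\<dots> = 4 * (q * R\<^sub>0 * S1) * A3 + 4 * q * R\<^sub>0 * S2 * A2 - 4 * q * R\<^sub>0 ^ 3 * S2 * A1 - 4 * R\<^sub>0\<^sup>2 * (q * R\<^sub>0 * S1) * A2
     - 4 * q * (A1 * A3 - A2\<^sup>2)" by algebra
  also have "\<dots> = R\<^sub>0 ^ 4 * (q + 1)\<^sup>2 * (N - D * l)"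
    unfolding S1 S2 A1 A2 A3 N_def D_def by (simp add: divide_simps) algebra
  finally have eq: "(b * R\<^sub>0 + c * R\<^sub>0 ^ 3 - 1) * (\<Delta> * (4 * q)) = R\<^sub>0 ^ 4 * (q + 1)\<^sup>2 * (N - D * l)"
    by (simp add: mult.assoc)
  have nonneg_iff: "0 \<le> x * y \<longleftrightarrow> 0 \<le> x" if "y > 0" for x y :: real
    using that by (simp add: zero_le_mult_iff)
  have p1: "\<Delta> * (4 * q) > 0" and p2: "R\<^sub>0 ^ 4 * (q + 1)\<^sup>2 > 0" using \<Delta> q R by simp_all
  have "b * R\<^sub>0 + c * R\<^sub>0 ^ 3 \<ge> 1 \<longleftrightarrow> (b * R\<^sub>0 + c * R\<^sub>0 ^ 3 - 1) * (\<Delta> * (4 * q)) \<ge> 0"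
    unfolding nonneg_iff[OF p1] by simp
  also have "\<dots> \<longleftrightarrow> N - D * l \<ge> 0" 
    unfolding eq mult.commute[of "R\<^sub>0 ^ 4 * (q + 1)\<^sup>2"] nonneg_iff[OF p2] ..
  also have "\<dots> \<longleftrightarrow> N / D - l \<ge> 0" using D by (simp add: field_simps)
  also have "N / D - l = ratio_excess q" by (simp add: ratio_excess_def N_def D_def l_def)
  finally show ?thesis by (simp add: q_def)
qed

section \<open>Testing a weak calibration\<close>

text \<open>The data of a weak calibration are integrable only on bounded pieces of the domain; a
  bounded factor vanishing off \<open>K\<close> extends this to all of \<open>S\<close>.\<close>

lemma integrable_lebesgue_on_mult_bounded:
  fixes f h :: "'a::euclidean_space \<Rightarrow> real"
  assumes f: "integrable (lebesgue_on (S \<inter> K)) f" and h: "h \<in> borel_measurable borel" "\<And>x. \<bar>h x\<bar> \<le> M"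
    and 0: "\<And>x. x \<notin> K \<Longrightarrow> h x = 0" and S: "S \<in> sets borel" "K \<in> sets borel"
  shows "integrable (lebesgue_on S) (\<lambda>x. f x * h x)"
proof -
  have hm: "h \<in> borel_measurable (lebesgue_on A)" for A
    by (rule measurable_restrict_space1[OF measurable_completion]) (use h in simp)
  have "integrable (lebesgue_on (S \<inter> K)) (\<lambda>x. f x * h x)"
  proof (rule Bochner_Integration.integrable_bound)
    show "integrable (lebesgue_on (S \<inter> K)) (\<lambda>x. M * f x)" using f by simp
    show "(\<lambda>x. f x * h x) \<in> borel_measurable (lebesgue_on (S \<inter> K))"
      using borel_measurable_integrable[OF f] hm by (rule borel_measurable_times)
    have M: "M \<ge> 0" using h(2)[of 0] by linarith
    show "AE x in lebesgue_on (S \<inter> K). norm (f x * h x) \<le> norm (M * f x)"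
    proof (rule AE_I2)
      fix x
      have "\<bar>h x\<bar> * \<bar>f x\<bar> \<le> M * \<bar>f x\<bar>" by (intro mult_right_mono h(2)) simp
      then show "norm (f x * h x) \<le> norm (M * f x)" using M by (simp add: abs_mult mult.commute)
    qed
  qed
  then have "integrable lebesgue (\<lambda>x. indicator (S \<inter> K) x *\<^sub>R (f x * h x))"
    using S by (subst (asm) integrable_restrict_space) auto
  moreover have "(\<lambda>x. indicator (S \<inter> K) x *\<^sub>R (f x * h x)) = (\<lambda>x. indicator S x *\<^sub>R (f x * h x))"
    using 0 by (auto simp: indicator_def fun_eq_iff)
  ultimately have "integrable lebesgue (\<lambda>x. indicator S x *\<^sub>R (f x * h x))" by (simp only:)
  then show ?thesis using S by (subst integrable_restrict_space) auto
qed

lemma (in gauss_domain) integrable_up_to_boundary_test: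
  fixes w :: "'a \<Rightarrow> real" and G :: "'a \<Rightarrow> 'a"
  shows "integrable_up_to_boundary U w \<Longrightarrow> test_function V \<phi> \<Longrightarrow> integrable (lebesgue_on U) (\<lambda>x. w x * \<phi> x)"
    and "integrable_up_to_boundary U G \<Longrightarrow> test_function V \<psi> \<Longrightarrow> integrable (lebesgue_on U) (\<lambda>x. G x \<bullet> \<psi> x)"
proof -
  have Ub: "U \<in> sets borel" using open_U by simp
  have main: "integrable (lebesgue_on U) (\<lambda>x. w x * \<phi> x)"
    if w: "integrable_up_to_boundary U w" and t: "test_function V \<phi>" for w \<phi> :: "'a \<Rightarrow> real"
  proof -
    obtain M where M: "\<And>x. norm (\<phi> x) \<le> M" using test_function_bounded[OF t] by metis
    have K: "compact (closure {x. \<phi> x \<noteq> 0})" using t by (simp add: test_function_def)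
    show ?thesis
    proof (rule integrable_lebesgue_on_mult_bounded)
      show "integrable (lebesgue_on (U \<inter> closure {x. \<phi> x \<noteq> 0})) w"
        using w K unfolding integrable_up_to_boundary_def by blast
      show "\<phi> x = 0" if "x \<notin> closure {x. \<phi> x \<noteq> 0}" for x using that by (rule eq_0_outside_support)
    qed (use test_function_borel[OF t] M Ub in auto)
  qed
  show "integrable_up_to_boundary U w \<Longrightarrow> test_function V \<phi> \<Longrightarrow> integrable (lebesgue_on U) (\<lambda>x. w x * \<phi> x)"
    by (rule main)
  assume G: "integrable_up_to_boundary U G" and t: "test_function V \<psi>"
  have "integrable (lebesgue_on U) (\<lambda>x. (G x \<bullet> i) * (\<psi> x \<bullet> i))" for i
    by (rule main[OF _ test_function_inner[OF t]])
       (use G in \<open>auto simp: integrable_up_to_boundary_def\<close>)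
  then have "integrable (lebesgue_on U) (\<lambda>x. \<Sum>i\<in>Basis. (G x \<bullet> i) * (\<psi> x \<bullet> i))" by simp
  moreover have "(\<lambda>x. \<Sum>i\<in>Basis. (G x \<bullet> i) * (\<psi> x \<bullet> i)) = (\<lambda>x. G x \<bullet> \<psi> x)"
    by (rule ext) (rule euclidean_inner[symmetric])
  ultimately show "integrable (lebesgue_on U) (\<lambda>x. G x \<bullet> \<psi> x)" by (simp only:)
qed

section \<open>Bounds for the derivative of the smooth step\<close>

lemma smooth_step_deriv: "(smooth_step has_real_derivative deriv smooth_step x) (at x)"
  by (rule smooth_on_deriv(2)[OF open_UNIV smooth_on_smooth_step]) simp

lemma smooth_step_deriv_cont: "continuous_on UNIV (deriv smooth_step)"
  by (rule smooth_on_continuous_on[OF smooth_on_deriv(1)[OF open_UNIV smooth_on_smooth_step]])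

lemma smooth_step_deriv_0:
  assumes "x < 0 \<or> x > 1"
  shows "deriv smooth_step x = 0"
proof (rule DERIV_imp_deriv)
  show "(smooth_step has_real_derivative 0) (at x)"
  proof (cases "x < 0")
    case True
    have "((\<lambda>_. 0) has_real_derivative 0) (at x)" by simp
    then show ?thesis
      by (rule has_field_derivative_transform_within_open[where S="{..<0}"])
         (use True in \<open>auto simp: smooth_step_0\<close>)
  next
    case False
    have "((\<lambda>_. 1) has_real_derivative 0) (at x)" by simp
    then show ?thesis
      by (rule has_field_derivative_transform_within_open[where S="{1<..}"])
         (use False assms in \<open>auto simp: smooth_step_1\<close>)
  qed
qed

lemma smooth_step_deriv_bounded: obtains D where "D \<ge> 0" "\<And>x. \<bar>deriv smooth_step x\<bar> \<le> D"
proof -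
  have "continuous_on {0..1} (deriv smooth_step)"
    by (rule continuous_on_subset[OF smooth_step_deriv_cont]) simp
  then obtain D where D: "D \<ge> 0" "\<And>x. x \<in> {0..1} \<Longrightarrow> norm (deriv smooth_step x) \<le> D"
    using continuous_on_compact_bound[OF compact_Icc] by metis
  have "\<bar>deriv smooth_step x\<bar> \<le> D" for x
    using D(2)[of x] smooth_step_deriv_0[of x] D(1) by (cases "x \<in> {0..1}") auto
  with D(1) show thesis by (rule that)
qed

text \<open>The trace and the equation determine the integral of \<open>G \<bullet> grad v\<close> for test functions \<open>v\<close> vanishing on the
  boundary: multiply by cut-offs \<open>\<eta>\<close> that are 1 where \<open>F \<le> -2/k\<close> and 0 where \<open>F \<ge> -1/k\<close>. The terms
  \<open>v grad \<eta>\<close> stay bounded because \<open>v\<close> is bounded by a multiple of \<open>F\<close>.\<close>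

lemma (in gauss_domain) weak_laplacian_boundary_layer:
  assumes \<rho>: "\<rho> > 0" "\<And>r. 0 \<le> r \<Longrightarrow> r \<le> \<rho> \<Longrightarrow> F r > 0"
    and tr: "has_trace U w G g" and lap: "weak_laplacian U w (\<lambda>_. c)"
    and v: "test_function UNIV v" and C: "C \<ge> 0" "\<And>x. x \<in> U \<Longrightarrow> \<bar>v x\<bar> \<le> C * \<bar>F (norm x)\<bar>"
  shows "(LINT x|lebesgue_on U. G x \<bullet> grad v x) = - c * (LINT x|lebesgue_on U. v x)"
proof -
  have Ub: "U \<in> sets borel" using open_U by simp
  have wi: "integrable_up_to_boundary U w" and Gi: "integrable_up_to_boundary U G"
    and treq: "\<And>\<psi> :: 'a \<Rightarrow> 'a. test_function UNIV \<psi> \<Longrightarrow> (LINT x|lebesgue_on U. w x * divergence \<psi> x + G x \<bullet> \<psi> x) =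
        (LINT x:frontier U|surface_measure U. g x * (\<psi> x \<bullet> outer_normal U x))"
    using tr unfolding has_trace_def by auto
  obtain B where B: "B > 0" "\<And>x. norm x \<ge> B \<Longrightarrow> v x = 0" using test_function_obtain_ball[OF v] by metis
  obtain D where D: "D \<ge> 0" "\<And>x. \<bar>deriv smooth_step x\<bar> \<le> D" using smooth_step_deriv_bounded by metis
  obtain M1 where M1: "M1 > 0" "\<And>x. norm (grad v x) \<le> M1" using test_function_bounded[OF test_function_grad[OF v]] by metis
  have "continuous_on {0..B} F'" by (rule continuous_on_subset[OF F'_cont]) simp
  then obtain M2 where M2: "M2 \<ge> 0" "\<And>r. r \<in> {0..B} \<Longrightarrow> norm (F' r) \<le> M2"
    using continuous_on_compact_bound[OF compact_Icc] by metis
  \<comment> \<open>\<open>y k\<close> passes from 0 to 1 while -F passes from 1/(k+1) to 2/(k+1);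
    the shift by one keeps the factor positive for k = 0.\<close>
  define y where "y k r = - real (Suc k) * F r - 1" for k r
  define \<eta> where "\<eta> k x = smooth_step (y k (norm x))" for k and x :: 'a
  have dy: "(y k has_real_derivative - real (Suc k) * F' r) (at r)" for k r
    unfolding y_def[abs_def] by (rule derivative_eq_intros F_deriv refl | simp)+
  have ys: "smooth_on UNIV (y k)" for k
    unfolding y_def[abs_def] by (intro smooth_on_diff smooth_on_mult smooth_on_const F_smooth open_UNIV)
  have \<eta>s: "smooth_on UNIV (\<eta> k)" for k
  proof (rule smooth_on_UNIV_extend[OF _ \<rho>(1), where c=0])
    have "smooth_on UNIV (\<lambda>r. smooth_step (y k r))"
      by (rule smooth_on_comp_real[OF open_UNIV ys open_UNIV smooth_on_smooth_step]) simp
    then show "smooth_on (- {0}) (\<eta> k)"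
      unfolding \<eta>_def[abs_def] by (intro smooth_on_radial[OF _ open_UNIV]) auto
    show "\<eta> k x = 0" if "norm x < \<rho>" for x
    proof -
      have "real (Suc k) * F (norm x) \<ge> 0" using \<rho>(2)[of "norm x"] that by (intro mult_nonneg_nonneg) auto
      then have "y k (norm x) \<le> 0" by (simp add: y_def algebra_simps)
      then show ?thesis by (simp add: \<eta>_def smooth_step_0)
    qed
  qed
  have vd: "v differentiable (at x)" and \<eta>d: "\<eta> k differentiable (at x)" for k x
    using test_function_differentiable[OF v] smooth_on_differentiable[OF \<eta>s] by auto
  define u where "u k x = \<eta> k x * v x" for k x
  have us: "smooth_on UNIV (u k)" for k
    unfolding u_def[abs_def] by (intro smooth_on_mult \<eta>s test_function_smooth[OF v] open_UNIV)
  have ut: "test_function U (u k)" for k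
  proof (rule test_functionI[OF us])
    let ?K = "cball 0 B \<inter> {x::'a. F (norm x) \<le> - 1 / real (Suc k)}"
    show "compact ?K"
      by (intro compact_Int_closed compact_cball closed_Collect_le F_norm_cont continuous_intros)
    show "?K \<subseteq> U"
    proof
      fix x assume "x \<in> ?K"
      then have "F (norm x) \<le> - 1 / real (Suc k)" by simp
      also have "\<dots> < 0" by (simp add: divide_neg_pos)
      finally show "x \<in> U" by (simp add: U_eq)
    qed
    show "u k x = 0" if "x \<notin> ?K" for x
    proof (cases "norm x \<le> B")
      case True
      then have "F (norm x) > - 1 / real (Suc k)" using that by auto
      then have "y k (norm x) \<le> 0" unfolding y_def by (simp add: field_simps)
      then show ?thesis by (simp add: u_def \<eta>_def smooth_step_0)
    qed (use B in \<open>simp add: u_def\<close>)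
  qed
  have gu: "grad (u k) x = \<eta> k x *\<^sub>R grad v x + v x *\<^sub>R grad (\<eta> k) x" for k x
    unfolding u_def[abs_def] by (rule grad_mult[OF \<eta>d vd])
  have g\<eta>: "grad (\<eta> k) x = (deriv smooth_step (y k (norm x)) * (- real (Suc k) * F' (norm x))) *\<^sub>R sgn x" if "x \<noteq> 0" for k x
    unfolding \<eta>_def[abs_def]
    by (rule grad_radial[OF that]) (rule DERIV_chain2[OF smooth_step_deriv dy])
  have U0: "x \<noteq> 0" if "x \<in> U" for x using that \<rho>(2)[of 0] \<rho>(1) by (auto simp: U_eq)
  \<comment> \<open>\<open>u k\<close> is supported inside \<open>U\<close>: the weak equation
    applies to it, and the trace formula applies to its gradient with zero boundary term. Together
    they exchange the Laplacian for \<open>G\<close>.\<close>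
  have step: "(LINT x|lebesgue_on U. G x \<bullet> grad (u k) x) = - c * (LINT x|lebesgue_on U. u k x)" for k
  proof -
    have "(LINT x|lebesgue_on U. w x * laplacian (u k) x) = c * (LINT x|lebesgue_on U. u k x)"
      using lap ut[of k] unfolding weak_laplacian_def by simp
    moreover have "(LINT x|lebesgue_on U. w x * laplacian (u k) x + G x \<bullet> grad (u k) x) = 0"
    proof -
      have "(LINT x|lebesgue_on U. w x * laplacian (u k) x + G x \<bullet> grad (u k) x)
        = (LINT x:frontier U|surface_measure U. g x * (grad (u k) x \<bullet> outer_normal U x))"
        unfolding laplacian_def by (rule treq[OF test_function_mono[OF test_function_grad[OF ut]]]) simp
      also have "\<dots> = (LINT x:frontier U|surface_measure U. 0)"
        by (rule boundary_integral_cong) (simp add: test_function_frontier[OF test_function_grad[OF ut]])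
      finally show ?thesis by simp
    qed
    moreover have "integrable (lebesgue_on U) (\<lambda>x. w x * laplacian (u k) x)"
      unfolding laplacian_def
      by (rule integrable_up_to_boundary_test(1)[OF wi test_function_divergence[OF test_function_grad[OF ut]]])
    moreover have "integrable (lebesgue_on U) (\<lambda>x. G x \<bullet> grad (u k) x)"
      by (rule integrable_up_to_boundary_test(2)[OF Gi test_function_grad[OF ut]])
    ultimately show ?thesis by simp
  qed
  have ev: "\<forall>\<^sub>F k in sequentially. y k (norm x) > 1" if "x \<in> U" for x
  proof -
    have Fn: "- F (norm x) > 0" using that by (simp add: U_eq)
    obtain N where N: "real N > 2 / (- F (norm x))" using reals_Archimedean2 by blast
    have "y k (norm x) > 1" if "k \<ge> N" for k
    proof -
      have "2 / (- F (norm x)) < real (Suc k)" using N that by linarith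
      then have "2 < real (Suc k) * (- F (norm x))" using Fn by (subst (asm) pos_divide_less_eq) auto
      then show ?thesis by (simp add: y_def algebra_simps)
    qed
    then show ?thesis by (auto simp: eventually_sequentially)
  qed
  have lim1: "(\<lambda>k. LINT x|lebesgue_on U. u k x) \<longlonglongrightarrow> (LINT x|lebesgue_on U. v x)"
  proof (rule integral_dominated_convergence[where w="\<lambda>x. \<bar>v x\<bar>"])
    have iv: "integrable (lebesgue_on U) v"
      using integrable_test_mult[OF v continuous_on_const[of UNIV 1] Ub] by simp
    then show "integrable (lebesgue_on U) (\<lambda>x. \<bar>v x\<bar>)" by simp
    show "v \<in> borel_measurable (lebesgue_on U)" using borel_measurable_integrable[OF iv] .
    show "u k \<in> borel_measurable (lebesgue_on U)" for k
      by (rule continuous_measurable_on[OF smooth_on_continuous_on[OF us]])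
    show "AE x in lebesgue_on U. (\<lambda>k. u k x) \<longlonglongrightarrow> v x"
    proof (rule AE_I2)
      fix x assume "x \<in> space (lebesgue_on U)"
      then have "x \<in> U" by simp
      from ev[OF this] have "\<forall>\<^sub>F k in sequentially. u k x = v x"
        by eventually_elim (simp add: u_def \<eta>_def smooth_step_1)
      then show "(\<lambda>k. u k x) \<longlonglongrightarrow> v x" by (rule tendsto_eventually)
    qed
    show "AE x in lebesgue_on U. norm (u k x) \<le> \<bar>v x\<bar>" for k
      using smooth_step_bounds by (intro AE_I2) (auto simp: u_def \<eta>_def abs_mult intro!: mult_left_le_one_le)
  qed
  define K where "K = M1 + C * 2 * D * M2"
  have K0: "K \<ge> 0" using M1 C D M2 by (simp add: K_def)
  have bound: "norm (grad (u k) x) \<le> K * indicator (cball 0 B) x" if xU: "x \<in> U" for k x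
  proof (cases "norm x \<le> B")
    case True
    have "norm (\<eta> k x *\<^sub>R grad v x) \<le> 1 * M1"
      unfolding norm_scaleR using smooth_step_bounds M1 by (intro mult_mono) (auto simp: \<eta>_def)
    moreover have "norm (v x *\<^sub>R grad (\<eta> k) x) \<le> C * 2 * D * M2"
    proof (cases "0 \<le> y k (norm x) \<and> y k (norm x) \<le> 1")
      case True
      \<comment> \<open>In the transition layer |F| is at most 2/(k+1). Through |v| <= C |F| this
        absorbs the factor k + 1 from the gradient of the cut-off.\<close>
      have "real (Suc k) * \<bar>F (norm x)\<bar> \<le> 2"
        using True xU by (simp add: y_def U_eq algebra_simps)
      then have 1: "C * (real (Suc k) * \<bar>F (norm x)\<bar>) \<le> C * 2" using C(1) by (rule mult_left_mono)
      have 2: "\<bar>deriv smooth_step (y k (norm x))\<bar> * \<bar>F' (norm x)\<bar> \<le> D * M2"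
        using D(2) M2(2)[of "norm x"] \<open>norm x \<le> B\<close> D(1) by (intro mult_mono) auto
      have "norm (v x *\<^sub>R grad (\<eta> k) x) = \<bar>v x\<bar> * (\<bar>deriv smooth_step (y k (norm x))\<bar> * (real (Suc k) * \<bar>F' (norm x)\<bar>))"
        using U0[OF xU] by (simp add: g\<eta> norm_sgn abs_mult)
      also have "\<dots> \<le> (C * \<bar>F (norm x)\<bar>) * (\<bar>deriv smooth_step (y k (norm x))\<bar> * (real (Suc k) * \<bar>F' (norm x)\<bar>))"
        by (intro mult_right_mono C(2)[OF xU]) auto
      also have "\<dots> = (C * (real (Suc k) * \<bar>F (norm x)\<bar>)) * (\<bar>deriv smooth_step (y k (norm x))\<bar> * \<bar>F' (norm x)\<bar>)"
        by (simp only: mult_ac)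
      also have "\<dots> \<le> (C * 2) * (D * M2)"
        by (rule mult_mono[OF 1 2]) (use C D in auto)
      finally show ?thesis by (simp add: mult_ac)
    next
      case False
      then have "deriv smooth_step (y k (norm x)) = 0" by (intro smooth_step_deriv_0) auto
      then show ?thesis using g\<eta>[OF U0[OF xU]] C D M2 by simp
    qed
    ultimately have "norm (grad (u k) x) \<le> K"
      unfolding gu K_def by (intro order.trans[OF norm_triangle_ineq] add_mono) auto
    then show ?thesis using True by simp
  next
    case False
    have "norm (grad (u k) x) = 0"
    proof -
      have "grad (u k) x = grad (\<lambda>_. 0) x"
      proof (rule grad_transform_open)
        show "open {x::'a. norm x > B}" by (intro open_Collect_less continuous_intros)
      qed (use False B in \<open>auto simp: u_def\<close>)
      then show ?thesis by (simp add: grad_def)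
    qed
    then show ?thesis using False K0 by simp
  qed
  have lim2: "(\<lambda>k. LINT x|lebesgue_on U. G x \<bullet> grad (u k) x) \<longlonglongrightarrow> (LINT x|lebesgue_on U. G x \<bullet> grad v x)"
  proof (rule integral_dominated_convergence[where w="\<lambda>x. norm (G x) * (K * indicator (cball 0 B) x)"])
    show "integrable (lebesgue_on U) (\<lambda>x. norm (G x) * (K * indicator (cball 0 B) x))"
    proof (rule integrable_lebesgue_on_mult_bounded[where K="cball 0 B" and M=K])
      show "integrable (lebesgue_on (U \<inter> cball 0 B)) (\<lambda>x. norm (G x))"
        using Gi unfolding integrable_up_to_boundary_def by (intro integrable_norm) auto
      show "\<bar>K * indicator (cball 0 B) x\<bar> \<le> K" for x :: 'a using K0 by (auto simp: indicator_def)
      show "(\<lambda>x::'a. K * indicator (cball 0 B) x) \<in> borel_measurable borel"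
        by (intro borel_measurable_times borel_measurable_const borel_measurable_indicator) auto
    qed (use Ub in auto)
    show "(\<lambda>x. G x \<bullet> grad v x) \<in> borel_measurable (lebesgue_on U)"
      by (rule borel_measurable_integrable[OF integrable_up_to_boundary_test(2)[OF Gi test_function_grad[OF v]]])
    show "(\<lambda>x. G x \<bullet> grad (u k) x) \<in> borel_measurable (lebesgue_on U)" for k
      by (rule borel_measurable_integrable[OF integrable_up_to_boundary_test(2)[OF Gi test_function_grad[OF ut]]])
    show "AE x in lebesgue_on U. (\<lambda>k. G x \<bullet> grad (u k) x) \<longlonglongrightarrow> G x \<bullet> grad v x"
    proof (rule AE_I2)
      fix x assume "x \<in> space (lebesgue_on U)"
      then have x: "x \<in> U" by simp
      from ev[OF x] have "\<forall>\<^sub>F k in sequentially. G x \<bullet> grad (u k) x = G x \<bullet> grad v x"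
      proof eventually_elim
        case (elim k)
        then have "deriv smooth_step (y k (norm x)) = 0" by (intro smooth_step_deriv_0) auto
        then show ?case using elim unfolding gu g\<eta>[OF U0[OF x]] by (simp add: \<eta>_def smooth_step_1)
      qed
      then show "(\<lambda>k. G x \<bullet> grad (u k) x) \<longlonglongrightarrow> G x \<bullet> grad v x" by (rule tendsto_eventually)
    qed
    show "AE x in lebesgue_on U. norm (G x \<bullet> grad (u k) x) \<le> norm (G x) * (K * indicator (cball 0 B) x)" for k
    proof (rule AE_I2)
      fix x assume "x \<in> space (lebesgue_on U)"
      then have "x \<in> U" by simp
      from bound[OF this] show "norm (G x \<bullet> grad (u k) x) \<le> norm (G x) * (K * indicator (cball 0 B) x)"
        unfolding real_norm_def by (intro order.trans[OF Cauchy_Schwarz_ineq2] mult_left_mono) auto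
    qed
  qed
  have "(\<lambda>k. LINT x|lebesgue_on U. G x \<bullet> grad (u k) x) \<longlonglongrightarrow> - c * (LINT x|lebesgue_on U. v x)"
    unfolding step by (intro tendsto_mult tendsto_const lim1)
  with lim2 show ?thesis by (rule LIMSEQ_unique)
qed

text \<open>Green's second formula for \<open>v\<close> vanishing on the boundary: the trace of
  \<open>w\<close> is paired with the normal derivative of \<open>v\<close>, and the unknown flux of
  \<open>G\<close> does not occur.\<close>

lemma (in gauss_domain) weak_laplacian_up_to_boundary:
  assumes \<rho>: "\<rho> > 0" "\<And>r. 0 \<le> r \<Longrightarrow> r \<le> \<rho> \<Longrightarrow> F r > 0"
    and tr: "has_trace U w G g" and lap: "weak_laplacian U w (\<lambda>_. c)"
    and v: "test_function UNIV v" and C: "C \<ge> 0" "\<And>x. x \<in> U \<Longrightarrow> \<bar>v x\<bar> \<le> C * \<bar>F (norm x)\<bar>"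
  shows "(LINT x|lebesgue_on U. w x * laplacian v x) =
    (LINT x:frontier U|surface_measure U. g x * (grad v x \<bullet> outer_normal U x)) + c * (LINT x|lebesgue_on U. v x)"
proof -
  have wi: "integrable_up_to_boundary U w" and Gi: "integrable_up_to_boundary U G"
    and treq: "\<And>\<psi> :: 'a \<Rightarrow> 'a. test_function UNIV \<psi> \<Longrightarrow> (LINT x|lebesgue_on U. w x * divergence \<psi> x + G x \<bullet> \<psi> x) =
        (LINT x:frontier U|surface_measure U. g x * (\<psi> x \<bullet> outer_normal U x))"
    using tr unfolding has_trace_def by auto
  have "integrable (lebesgue_on U) (\<lambda>x. w x * laplacian v x)" "integrable (lebesgue_on U) (\<lambda>x. G x \<bullet> grad v x)"
    unfolding laplacian_def
    by (rule integrable_up_to_boundary_test(1)[OF wi test_function_divergence[OF test_function_grad[OF v]]]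
        integrable_up_to_boundary_test(2)[OF Gi test_function_grad[OF v]])+
  moreover have "(LINT x|lebesgue_on U. w x * laplacian v x + G x \<bullet> grad v x) =
     (LINT x:frontier U|surface_measure U. g x * (grad v x \<bullet> outer_normal U x))"
    unfolding laplacian_def by (rule treq[OF test_function_grad[OF v]])
  ultimately show ?thesis
    using weak_laplacian_boundary_layer[OF \<rho> tr lap v C] by simp
qed

section \<open>Radial test functions\<close>

text \<open>Turns a function of the radius, possibly singular at 0 and without compact support, into
  a test function on the whole space that still equals \<open>f\<close> for radii in
  [\<rho>, M].\<close>

definition radial_test :: "real \<Rightarrow> real \<Rightarrow> (real \<Rightarrow> real) \<Rightarrow> 'a::euclidean_space \<Rightarrow> real" where
  "radial_test \<rho> M f x = cut \<rho> (\<lambda>r. f r * smooth_step (M + 1 - r)) (norm x)"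

lemma radial_test_eq: "0 < \<rho> \<Longrightarrow> \<rho> \<le> norm x \<Longrightarrow> norm x \<le> M \<Longrightarrow> radial_test \<rho> M f x = f (norm x)"
  by (simp add: radial_test_def cut_eq smooth_step_1)

lemma test_function_radial_test:
  assumes "\<rho> > 0" "smooth_on {0<..} f"
  shows "test_function UNIV (radial_test \<rho> M f :: 'a::euclidean_space \<Rightarrow> real)"
proof (rule test_functionI[where K="cball 0 (M + 1)"])
  have "smooth_on {0<..} (\<lambda>r. smooth_step ((-1) * r + (M + 1)))"
    by (rule smooth_on_subset[OF smooth_on_affine_step]) simp
  moreover have "(\<lambda>r. smooth_step ((-1) * r + (M + 1))) = (\<lambda>r. smooth_step (M + 1 - r))" by simp
  ultimately have "smooth_on {0<..} (\<lambda>r. smooth_step (M + 1 - r))" by (simp only:)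
  then have "smooth_on {0<..} (\<lambda>r. f r * smooth_step (M + 1 - r))"
    by (rule smooth_on_mult[OF open_greaterThan assms(2)])
  from smooth_on_cut_radial(1)[OF this assms(1)]
  show "smooth_on UNIV (radial_test \<rho> M f :: 'a \<Rightarrow> real)" unfolding radial_test_def[abs_def] .
  show "radial_test \<rho> M f x = 0" if "x \<notin> cball 0 (M + 1)" for x :: 'a
    using that by (simp add: radial_test_def cut_def smooth_step_0)
qed auto

lemma open_shell: "open {x::'a::euclidean_space. \<rho> < norm x \<and> norm x < M}"
  by (intro open_Collect_conj open_Collect_less continuous_intros)

lemma grad_radial_test:
  fixes x :: "'a::euclidean_space"
  assumes "0 < \<rho>" "\<rho> < norm x" "norm x < M" "(f has_real_derivative f') (at (norm x))"
  shows "grad (radial_test \<rho> M f) x = f' *\<^sub>R sgn x"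
proof -
  have "grad (radial_test \<rho> M f) x = grad (\<lambda>x. f (norm x)) x"
    by (rule grad_transform_open[OF open_shell]) (use assms in \<open>auto intro!: radial_test_eq\<close>)
  also have "\<dots> = f' *\<^sub>R sgn x" by (rule grad_radial) (use assms in auto)
  finally show ?thesis .
qed

lemma laplacian_radial_test:
  fixes x :: "'a::euclidean_space"
  assumes "0 < \<rho>" "\<rho> < norm x" "norm x < M" "\<And>r. r > 0 \<Longrightarrow> (f has_real_derivative f' r) (at r)"
    and "(f' has_real_derivative f'') (at (norm x))"
  shows "laplacian (radial_test \<rho> M f) x = f'' + (real DIM('a) - 1) * f' (norm x) / norm x"
proof -
  have "laplacian (radial_test \<rho> M f) x = laplacian (\<lambda>x. f (norm x)) x"
    by (rule laplacian_transform_open[OF open_shell]) (use assms in \<open>auto intro!: radial_test_eq\<close>)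
  also have "\<dots> = f'' + (real DIM('a) - 1) * f' (norm x) / norm x" by (rule laplacian_radial) (use assms in auto)
  finally show ?thesis .
qed

section \<open>Annuli in the plane\<close>

lemma ex_antiderivative:
  fixes g :: "real \<Rightarrow> real"
  assumes "continuous_on {0<..} g"
  obtains P where "\<And>r. r > 0 \<Longrightarrow> (P has_real_derivative g r) (at r)"
proof -
  define P where "P r = (LBINT y=ereal 1..ereal r. g y)" for r :: real
  have "(P has_real_derivative g r) (at r)" if r: "r > 0" for r
  proof -
    define a b where "a = min 1 r / 2" and "b = max 1 r + 1"
    have ab: "0 < a" "a < 1" "1 < b" "a < r" "r < b" using r by (auto simp: a_def b_def min_def max_def)
    have "((\<lambda>u. LBINT y=ereal 1..ereal u. g y) has_vector_derivative g r) (at r within {a..b})"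
    proof (rule interval_integral_FTC2)
      show "continuous_on {a..b} g" by (rule continuous_on_subset[OF assms]) (use ab in auto)
    qed (use ab in auto)
    then have "(P has_real_derivative g r) (at r within {a..b})"
      by (simp add: P_def[abs_def] has_real_derivative_iff_has_vector_derivative)
    then show ?thesis using ab by (simp add: at_within_Icc_at)
  qed
  then show thesis by (rule that)
qed

text \<open>Two successive integrations, with weights r^(n-1) and \<open>pw n\<close>, solve the
  equation. Adding a multiple of \<open>fs n\<close> and a constant achieves both boundary values,
  since \<open>fs n\<close> separates the two radii.\<close>

lemma radial_poisson:
  assumes n: "n \<ge> 1" and R: "0 < R\<^sub>0" "R\<^sub>0 < R\<^sub>1" and f: "smooth_on {0<..} f"
  obtains u u' where "smooth_on {0<..} u" "smooth_on {0<..} u'"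
    "\<And>r. r > 0 \<Longrightarrow> (u has_real_derivative u' r) (at r)"
    "\<And>r. r > 0 \<Longrightarrow> (u' has_real_derivative f r - (real n - 1) * u' r / r) (at r)"
    "u R\<^sub>0 = 0" "u R\<^sub>1 = 0"
proof -
  have pows: "smooth_on {0<..} (\<lambda>r::real. r ^ (n - 1) * f r)"
    by (intro smooth_on_mult smooth_on_power smooth_on_ident' f open_greaterThan)
  obtain P where P: "\<And>r. r > 0 \<Longrightarrow> (P has_real_derivative r ^ (n - 1) * f r) (at r)"
    using ex_antiderivative[OF smooth_on_continuous_on[OF pows]] by metis
  have Ps: "smooth_on {0<..} P" by (rule smooth_on_realI[OF _ P pows]) auto
  have pP: "smooth_on {0<..} (\<lambda>r. pw n r * P r)"
    by (intro smooth_on_mult smooth_on_pw Ps open_greaterThan)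
  obtain A where A: "\<And>r. r > 0 \<Longrightarrow> (A has_real_derivative pw n r * P r) (at r)"
    using ex_antiderivative[OF smooth_on_continuous_on[OF pP]] by metis
  have As: "smooth_on {0<..} A" by (rule smooth_on_realI[OF _ A pP]) auto
  define \<alpha> where "\<alpha> = - (A R\<^sub>1 - A R\<^sub>0) / (fs n R\<^sub>1 - fs n R\<^sub>0)"
  define \<beta> where "\<beta> = - A R\<^sub>0 - \<alpha> * fs n R\<^sub>0"
  define u where "u r = A r + \<alpha> * fs n r + \<beta>" for r
  define u' where "u' r = pw n r * P r + \<alpha> * pw n r" for r
  have fs: "fs n R\<^sub>1 - fs n R\<^sub>0 > 0" using fs_strict_mono[OF R n] by simp
  show thesis
  proof (rule that[of u u'])
    show "smooth_on {0<..} u" unfolding u_def[abs_def]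
      by (intro smooth_on_add smooth_on_mult smooth_on_const As smooth_on_fs open_greaterThan)
    show "smooth_on {0<..} u'" unfolding u'_def[abs_def]
      by (intro smooth_on_add smooth_on_mult smooth_on_const pP smooth_on_pw open_greaterThan)
    show "u R\<^sub>0 = 0" by (simp add: u_def \<beta>_def)
    have "\<alpha> * (fs n R\<^sub>1 - fs n R\<^sub>0) = - (A R\<^sub>1 - A R\<^sub>0)" using fs by (simp add: \<alpha>_def)
    then show "u R\<^sub>1 = 0" by (simp add: u_def \<beta>_def algebra_simps)
    fix r :: real assume r: "r > 0"
    show "(u has_real_derivative u' r) (at r)" unfolding u_def[abs_def] u'_def
      by (rule derivative_eq_intros A has_real_derivative_fs r n refl | simp)+
    have "(u' has_real_derivative (- (real n - 1) * pw n r / r) * P r + (r ^ (n - 1) * f r) * pw n r + \<alpha> * (- (real n - 1) * pw n r / r)) (at r)"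
      unfolding u'_def[abs_def]
      by (intro DERIV_add DERIV_mult DERIV_cmult has_real_derivative_pw P r n)
    moreover have "r ^ (n - 1) * pw n r = 1" using r by (simp add: pw_def power_inverse)
    then have "(r ^ (n - 1) * f r) * pw n r = f r" by (simp add: mult_ac)
    then have "(- (real n - 1) * pw n r / r) * P r + (r ^ (n - 1) * f r) * pw n r + \<alpha> * (- (real n - 1) * pw n r / r)
       = f r - (real n - 1) * u' r / r"
      using r by (simp add: u'_def field_simps)
    ultimately show "(u' has_real_derivative f r - (real n - 1) * u' r / r) (at r)" by simp
  qed
qed

text \<open>A zero integral would make the nonempty open set \<open>S\<close> negligible.\<close>

lemma integral_pos_open:
  fixes f :: "'a::euclidean_space \<Rightarrow> real"
  assumes f: "integrable (lebesgue_on U) f" and U: "U \<in> sets borel" and S: "open S" "S \<noteq> {}" "S \<subseteq> U"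
    and nonneg: "\<And>x. x \<in> U \<Longrightarrow> f x \<ge> 0" and pos: "\<And>x. x \<in> S \<Longrightarrow> f x > 0"
  shows "(LINT x|lebesgue_on U. f x) > 0"
proof -
  have ae: "AE x in lebesgue_on U. 0 \<le> f x" by (rule AE_I2) (use nonneg in simp)
  have "(LINT x|lebesgue_on U. f x) \<noteq> 0"
  proof
    assume "(LINT x|lebesgue_on U. f x) = 0"
    then have "AE x in lebesgue_on U. f x = 0" using integral_nonneg_eq_0_iff_AE[OF f ae] by simp
    then have "AE x in lebesgue. x \<in> U \<longrightarrow> f x = 0" using U by (subst (asm) AE_restrict_space_iff) auto
    then have "AE x in lebesgue. x \<notin> S" by eventually_elim (use S pos in force)
    then have "S \<in> null_sets lebesgue" using S(1) by (subst AE_iff_null_sets) auto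
    then have "negligible S" by (simp add: negligible_iff_null_sets)
    with open_not_negligible[OF S(1,2)] show False by simp
  qed
  moreover have "(LINT x|lebesgue_on U. f x) \<ge> 0" by (rule integral_nonneg_AE[OF ae])
  ultimately show ?thesis by linarith
qed

text \<open>At an interior maximum u' = 0, so the equation gives u' the slope 1 there, and
  \<open>u\<close> would be larger just to the left. The lemma serves to show that the torsion
  function has nonzero integral.\<close>

lemma torsion_negative:
  assumes R: "0 < R\<^sub>0" "R\<^sub>0 < R\<^sub>1"
    and u: "\<And>r. r > 0 \<Longrightarrow> (u has_real_derivative u' r) (at r)"
    "\<And>r. r > 0 \<Longrightarrow> (u' has_real_derivative 1 - (real n - 1) * u' r / r) (at r)"
    "u R\<^sub>0 = 0" "u R\<^sub>1 = 0" and r: "R\<^sub>0 < r" "r < R\<^sub>1"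
  shows "u r < 0"
proof (rule ccontr)
  assume "\<not> u r < 0"
  have cont: "continuous_on {R\<^sub>0..R\<^sub>1} u"
  proof (rule DERIV_continuous_on)
    show "(u has_real_derivative u' s) (at s within {R\<^sub>0..R\<^sub>1})" if "s \<in> {R\<^sub>0..R\<^sub>1}" for s
      using u(1)[of s] that R by (simp add: has_field_derivative_at_within)
  qed
  obtain m where m: "m \<in> {R\<^sub>0..R\<^sub>1}" "\<And>s. s \<in> {R\<^sub>0..R\<^sub>1} \<Longrightarrow> u s \<le> u m"
    using continuous_attains_sup[OF compact_Icc _ cont] R by force
  \<comment> \<open>If the maximum over the closed interval is attained at an endpoint it is 0, and
    then \<open>r\<close>, where \<open>u\<close> is nonnegative, is an interior maximum as
    well.\<close>
  obtain \<rho> where \<rho>: "R\<^sub>0 < \<rho>" "\<rho> < R\<^sub>1" "\<And>s. s \<in> {R\<^sub>0..R\<^sub>1} \<Longrightarrow> u s \<le> u \<rho>"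
  proof (cases "m = R\<^sub>0 \<or> m = R\<^sub>1")
    case True
    then have "u m = 0" using u by auto
    then show thesis using m r \<open>\<not> u r < 0\<close> by (intro that[of r]) (auto intro: order.trans[of _ "u m"])
  next
    case False
    then show thesis using m by (intro that[of m]) auto
  qed
  have \<rho>0: "\<rho> > 0" using \<rho> R by simp
  have "u' \<rho> = 0"
  proof (rule DERIV_local_max[OF u(1)[OF \<rho>0]])
    show "0 < min (\<rho> - R\<^sub>0) (R\<^sub>1 - \<rho>)" using \<rho> by simp
    show "\<forall>s. \<bar>\<rho> - s\<bar> < min (\<rho> - R\<^sub>0) (R\<^sub>1 - \<rho>) \<longrightarrow> u s \<le> u \<rho>" by (auto intro!: \<rho>(3))
  qed
  then have "(u' has_real_derivative 1) (at \<rho>)" using u(2)[OF \<rho>0] by simp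
  then obtain e where e: "e > 0" "\<And>h. 0 < h \<Longrightarrow> h < e \<Longrightarrow> u' (\<rho> - h) < u' \<rho>"
    using DERIV_pos_inc_left by (metis zero_less_one)
  define h where "h = min e (\<rho> - R\<^sub>0) / 2"
  have h: "0 < h" "h < e" "h < \<rho> - R\<^sub>0" using e \<rho> by (auto simp: h_def min_def)
  have "u \<rho> < u (\<rho> - h)"
  proof (rule DERIV_neg_imp_decreasing_open[where f=u])
    show "\<rho> - h < \<rho>" using h by simp
    show "\<exists>l. (u has_real_derivative l) (at s) \<and> l < 0" if "\<rho> - h < s" "s < \<rho>" for s
      using u(1)[of s] e(2)[of "\<rho> - s"] that h R \<open>u' \<rho> = 0\<close> by auto
    show "continuous_on {\<rho> - h..\<rho>} u"
      by (rule continuous_on_subset[OF cont]) (use h \<rho> in auto)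
  qed
  moreover have "u (\<rho> - h) \<le> u \<rho>" using h \<rho> by (intro \<rho>(3)) auto
  ultimately show False by simp
qed

text \<open>Vanishing at both ends bounds \<open>u\<close> by \<open>L\<close> times the distance to
  either end. The larger of the two distances is at least half the width, hence the constant 2 L /
  \<delta>. This supplies the constant \<open>C\<close> required by the boundary layer
  lemma.\<close>

lemma boundary_distance_bound:
  assumes R: "0 < R\<^sub>0" "R\<^sub>0 < R\<^sub>1" and u': "continuous_on {0<..} u'"
    and u: "\<And>r. r > 0 \<Longrightarrow> (u has_real_derivative u' r) (at r)" "u R\<^sub>0 = 0" "u R\<^sub>1 = 0"
  obtains C where "C \<ge> 0" "\<And>r. R\<^sub>0 < r \<Longrightarrow> r < R\<^sub>1 \<Longrightarrow> \<bar>u r\<bar> \<le> C * \<bar>(r - R\<^sub>0) * (r - R\<^sub>1)\<bar>"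
proof -
  have "continuous_on {R\<^sub>0..R\<^sub>1} u'" by (rule continuous_on_subset[OF u']) (use R in auto)
  then obtain L where L: "L \<ge> 0" "\<And>r. r \<in> {R\<^sub>0..R\<^sub>1} \<Longrightarrow> norm (u' r) \<le> L"
    using continuous_on_compact_bound[OF compact_Icc] by metis
  have lip: "\<bar>u s - u t\<bar> \<le> L * \<bar>s - t\<bar>" if "s \<in> {R\<^sub>0..R\<^sub>1}" "t \<in> {R\<^sub>0..R\<^sub>1}" for s t
  proof -
    have "norm (u s - u t) \<le> L * norm (s - t)"
    proof (rule field_differentiable_bound[OF convex_real_interval(5)])
      show "(u has_field_derivative u' r) (at r within {R\<^sub>0..R\<^sub>1})" if "r \<in> {R\<^sub>0..R\<^sub>1}" for r
        using u(1)[of r] that R by (simp add: has_field_derivative_at_within)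
    qed (use that L in auto)
    then show ?thesis by simp
  qed
  define \<delta> where "\<delta> = R\<^sub>1 - R\<^sub>0"
  have \<delta>: "\<delta> > 0" using R by (simp add: \<delta>_def)
  show thesis
  proof (rule that[of "2 * L / \<delta>"])
    show "0 \<le> 2 * L / \<delta>" using L \<delta> by simp
    fix r assume r: "R\<^sub>0 < r" "r < R\<^sub>1"
    have 1: "\<bar>u r\<bar> \<le> L * (r - R\<^sub>0)" "\<bar>u r\<bar> \<le> L * (R\<^sub>1 - r)"
      using lip[of r R\<^sub>0] lip[of r R\<^sub>1] r u by auto
    have abs: "\<bar>(r - R\<^sub>0) * (r - R\<^sub>1)\<bar> = (r - R\<^sub>0) * (R\<^sub>1 - r)" using r by (simp add: abs_mult)
    have "\<bar>u r\<bar> * \<delta> \<le> 2 * L * ((r - R\<^sub>0) * (R\<^sub>1 - r))"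
    proof (cases "r - R\<^sub>0 \<le> R\<^sub>1 - r")
      case True
      have "\<bar>u r\<bar> * \<delta> \<le> (L * (r - R\<^sub>0)) * (2 * (R\<^sub>1 - r))"
        using 1 True r L \<delta> by (intro mult_mono) (auto simp: \<delta>_def)
      then show ?thesis by (simp only: mult_ac)
    next
      case False
      have "\<bar>u r\<bar> * \<delta> \<le> (L * (R\<^sub>1 - r)) * (2 * (r - R\<^sub>0))"
        using 1 False r L \<delta> by (intro mult_mono) (auto simp: \<delta>_def)
      then show ?thesis by (simp only: mult_ac)
    qed
    then show "\<bar>u r\<bar> \<le> 2 * L / \<delta> * \<bar>(r - R\<^sub>0) * (r - R\<^sub>1)\<bar>"
      unfolding abs using \<delta> by (simp add: pos_le_divide_eq)
  qed
qed

text \<open>Two weak calibrations differ by data with zero traces. Solving \<open>\<Delta>u = f\<close> with zero boundary values shows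
  that the difference of the divergences integrates to zero against every radial function; the constants
  agree by the case \<open>f = 1\<close>.\<close>

lemma annulus_radial_flux_unique:
  fixes Z\<^sub>1 Z\<^sub>2 G\<^sub>1 G\<^sub>2 :: "'a::euclidean_space \<Rightarrow> 'a" and w\<^sub>1 w\<^sub>2 :: "'a \<Rightarrow> real"
  assumes R: "0 < R\<^sub>0" "R\<^sub>0 < R\<^sub>1"
  defines "U \<equiv> annulus R\<^sub>0 R\<^sub>1"
  assumes 1: "has_normal_trace U Z\<^sub>1 w\<^sub>1 \<eta>" "has_trace U w\<^sub>1 G\<^sub>1 g" "weak_laplacian U w\<^sub>1 (\<lambda>_. c\<^sub>1)"
    and 2: "has_normal_trace U Z\<^sub>2 w\<^sub>2 \<eta>" "has_trace U w\<^sub>2 G\<^sub>2 g" "weak_laplacian U w\<^sub>2 (\<lambda>_. c\<^sub>2)"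
    and f: "smooth_on {0<..} f" "\<And>r. r > 0 \<Longrightarrow> (f has_real_derivative f' r) (at r)"
  shows "(LINT x|lebesgue_on U. f' (norm x) * (Z\<^sub>1 x \<bullet> sgn x)) = (LINT x|lebesgue_on U. f' (norm x) * (Z\<^sub>2 x \<bullet> sgn x))"
    and "integrable (lebesgue_on U) (\<lambda>x. f' (norm x) * (Z\<^sub>1 x \<bullet> sgn x))"
proof -
  let ?n = "DIM('a)"
  interpret gauss_domain "\<lambda>r. (r - R\<^sub>0) * (r - R\<^sub>1)" "\<lambda>r. 2 * r - R\<^sub>0 - R\<^sub>1" U
    unfolding U_def by (rule gauss_domain_annulus[OF R])
  have n1: "?n \<ge> 1" using DIM_positive[where 'a='a] by simp
  have Ub: "U \<in> sets borel" using open_U by simp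
  define \<rho> where "\<rho> = R\<^sub>0 / 2"
  define M where "M = R\<^sub>1 + 1"
  have \<rho>: "\<rho> > 0" "\<And>r. 0 \<le> r \<Longrightarrow> r \<le> \<rho> \<Longrightarrow> (r - R\<^sub>0) * (r - R\<^sub>1) > 0"
    using R by (auto simp: \<rho>_def intro!: mult_neg_neg)
  have xU: "R\<^sub>0 < norm x" "norm x < R\<^sub>1" "\<rho> < norm x" "norm x < M" "\<rho> \<le> norm x" "norm x \<le> M" if "x \<in> U" for x
    using that R by (auto simp: U_def annulus_def \<rho>_def M_def)
  note rt = test_function_radial_test[OF \<rho>(1), where M=M and 'a='a]
  \<comment> \<open>The normal trace identity with a radial test function: the right side involves
    only \<eta> and \<open>h\<close>, so it is common to both calibrations.\<close>
  have flux: "(LINT x|lebesgue_on U. w x * h (norm x)) + (LINT x|lebesgue_on U. h' (norm x) * (Z x \<bullet> sgn x)) =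
      (LINT x:frontier U|surface_measure U. \<eta> x * radial_test \<rho> M h x)"
    and flux_int: "integrable (lebesgue_on U) (\<lambda>x. h' (norm x) * (Z x \<bullet> sgn x))"
    if tr: "has_normal_trace U Z w \<eta>" and h: "smooth_on {0<..} h" "\<And>r. r > 0 \<Longrightarrow> (h has_real_derivative h' r) (at r)"
    for Z w h h'
  proof -
    have i: "integrable_up_to_boundary U w" "integrable_up_to_boundary U Z"
      and e: "(LINT x|lebesgue_on U. w x * radial_test \<rho> M h x + Z x \<bullet> grad (radial_test \<rho> M h) x) =
        (LINT x:frontier U|surface_measure U. \<eta> x * radial_test \<rho> M h x)"
      using tr rt[OF h(1)] unfolding has_normal_trace_def by blast+
    have eq: "w x * radial_test \<rho> M h x = w x * h (norm x)"
      "Z x \<bullet> grad (radial_test \<rho> M h) x = h' (norm x) * (Z x \<bullet> sgn x)" if "x \<in> U" for x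
    proof -
      have "norm x > 0" using xU[OF that] \<rho>(1) by linarith
      then show "w x * radial_test \<rho> M h x = w x * h (norm x)"
        "Z x \<bullet> grad (radial_test \<rho> M h) x = h' (norm x) * (Z x \<bullet> sgn x)"
        using radial_test_eq[OF \<rho>(1) xU(5,6)[OF that]] grad_radial_test[OF \<rho>(1) xU(3,4)[OF that] h(2)] by auto
    qed
    have i1: "integrable (lebesgue_on U) (\<lambda>x. w x * h (norm x))"
      using integrable_up_to_boundary_test(1)[OF i(1) rt[OF h(1)]]
      by (rule Bochner_Integration.integrable_cong[THEN iffD1, rotated 2]) (use eq in auto)
    show i2: "integrable (lebesgue_on U) (\<lambda>x. h' (norm x) * (Z x \<bullet> sgn x))"
      using integrable_up_to_boundary_test(2)[OF i(2) test_function_grad[OF rt[OF h(1)]]]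
      by (rule Bochner_Integration.integrable_cong[THEN iffD1, rotated 2]) (use eq in auto)
    have "(LINT x|lebesgue_on U. w x * radial_test \<rho> M h x + Z x \<bullet> grad (radial_test \<rho> M h) x) =
       (LINT x|lebesgue_on U. w x * h (norm x) + h' (norm x) * (Z x \<bullet> sgn x))"
      by (rule U_integral_cong) (simp add: eq)
    with e i1 i2 show "(LINT x|lebesgue_on U. w x * h (norm x)) + (LINT x|lebesgue_on U. h' (norm x) * (Z x \<bullet> sgn x)) =
      (LINT x:frontier U|surface_measure U. \<eta> x * radial_test \<rho> M h x)" by simp
  qed
  \<comment> \<open>Testing with \<open>u\<close> produces \<open>h\<close> under the integral of
    \<open>w\<close>; the boundary terms depend on \<open>g\<close> and \<open>u\<close> alone and
    cancel.\<close>
  have diff: "(LINT x|lebesgue_on U. w\<^sub>1 x * h (norm x)) - (LINT x|lebesgue_on U. w\<^sub>2 x * h (norm x))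
     = (c\<^sub>1 - c\<^sub>2) * (LINT x|lebesgue_on U. radial_test \<rho> M u x)"
    if h: "smooth_on {0<..} h" and u: "smooth_on {0<..} u" "smooth_on {0<..} u'"
      "\<And>r. r > 0 \<Longrightarrow> (u has_real_derivative u' r) (at r)"
      "\<And>r. r > 0 \<Longrightarrow> (u' has_real_derivative h r - (real ?n - 1) * u' r / r) (at r)"
      "u R\<^sub>0 = 0" "u R\<^sub>1 = 0" for h u u'
  proof -
    obtain C where C: "C \<ge> 0" "\<And>r. R\<^sub>0 < r \<Longrightarrow> r < R\<^sub>1 \<Longrightarrow> \<bar>u r\<bar> \<le> C * \<bar>(r - R\<^sub>0) * (r - R\<^sub>1)\<bar>"
      using boundary_distance_bound[OF R smooth_on_continuous_on[OF u(2)] u(3,5,6)] by blast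
    have Cb: "\<bar>radial_test \<rho> M u x\<bar> \<le> C * \<bar>(norm x - R\<^sub>0) * (norm x - R\<^sub>1)\<bar>" if "x \<in> U" for x
      using C(2)[OF xU(1,2)[OF that]] radial_test_eq[OF \<rho>(1) xU(5,6)[OF that]] by simp
    have lap: "laplacian (radial_test \<rho> M u) x = h (norm x)" if "x \<in> U" for x
    proof -
      have "norm x > 0" using xU[OF that] \<rho>(1) by linarith
      then show ?thesis
        using laplacian_radial_test[OF \<rho>(1) xU(3,4)[OF that] u(3) u(4)] by simp
    qed
    have "(LINT x|lebesgue_on U. w x * h (norm x)) = 
       (LINT x:frontier U|surface_measure U. g x * (grad (radial_test \<rho> M u) x \<bullet> outer_normal U x))
         + c * (LINT x|lebesgue_on U. radial_test \<rho> M u x)"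
      if "has_trace U w G g" "weak_laplacian U w (\<lambda>_. c)" for w G c
    proof -
      have "(LINT x|lebesgue_on U. w x * h (norm x)) = (LINT x|lebesgue_on U. w x * laplacian (radial_test \<rho> M u) x)"
        by (rule U_integral_cong) (simp add: lap)
      then show ?thesis
        using weak_laplacian_up_to_boundary[OF \<rho> that rt[OF u(1)] C(1) Cb] by simp
    qed
    from this[OF 1(2,3)] this[OF 2(2,3)] show ?thesis by (simp add: algebra_simps)
  qed
  have one: "smooth_on {0<..} (\<lambda>_::real. 1::real)" by (rule smooth_on_const) simp
  \<comment> \<open>Testing the normal trace with 1 fixes the integral of \<open>w\<close>; as the
    torsion function has nonzero integral, \<open>diff\<close> then forces the constants to
    agree.\<close>
  have c: "c\<^sub>1 = c\<^sub>2"
  proof -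
    obtain u u' where u: "smooth_on {0<..} u" "smooth_on {0<..} u'"
      "\<And>r. r > 0 \<Longrightarrow> (u has_real_derivative u' r) (at r)"
      "\<And>r. r > 0 \<Longrightarrow> (u' has_real_derivative 1 - (real ?n - 1) * u' r / r) (at r)"
      "u R\<^sub>0 = 0" "u R\<^sub>1 = 0"
      using radial_poisson[OF n1 R one] by metis
    have d1: "((\<lambda>_. 1) has_real_derivative 0) (at r)" for r :: real by simp
    have "(LINT x|lebesgue_on U. w\<^sub>1 x * 1) = (LINT x|lebesgue_on U. w\<^sub>2 x * 1)"
      using flux[OF 1(1) one d1] flux[OF 2(1) one d1] by simp
    with diff[OF one u] have "(c\<^sub>1 - c\<^sub>2) * (LINT x|lebesgue_on U. radial_test \<rho> M u x) = 0" by simp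
    moreover have "(LINT x|lebesgue_on U. - radial_test \<rho> M u x) > 0"
    proof (rule integral_pos_open[OF _ Ub open_U])
      show "integrable (lebesgue_on U) (\<lambda>x. - radial_test \<rho> M u x)"
        using integrable_test_mult[OF rt[OF u(1)] continuous_on_const[of UNIV "-1"] Ub] by simp
      have pos: "- radial_test \<rho> M u x > 0" if "x \<in> U" for x
        using torsion_negative[OF R u(3-6) xU(1,2)[OF that]] radial_test_eq[OF \<rho>(1) xU(5,6)[OF that], of u] by simp
      show "- radial_test \<rho> M u x > 0" "- radial_test \<rho> M u x \<ge> 0" if "x \<in> U" for x
        using pos[OF that] by auto
      obtain b :: 'a where "norm b = (R\<^sub>0 + R\<^sub>1) / 2" using vector_choose_size[of "(R\<^sub>0 + R\<^sub>1) / 2"] R by auto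
      then have "b \<in> U" using R by (simp add: U_def annulus_def)
      then show "U \<noteq> {}" by blast
    qed simp
    ultimately show ?thesis by simp
  qed
  obtain u u' where u: "smooth_on {0<..} u" "smooth_on {0<..} u'"
      "\<And>r. r > 0 \<Longrightarrow> (u has_real_derivative u' r) (at r)"
      "\<And>r. r > 0 \<Longrightarrow> (u' has_real_derivative f r - (real ?n - 1) * u' r / r) (at r)"
      "u R\<^sub>0 = 0" "u R\<^sub>1 = 0"
    using radial_poisson[OF n1 R f(1)] by metis
  have "(LINT x|lebesgue_on U. w\<^sub>1 x * f (norm x)) = (LINT x|lebesgue_on U. w\<^sub>2 x * f (norm x))"
    using diff[OF f(1) u] c by simp
  then show "(LINT x|lebesgue_on U. f' (norm x) * (Z\<^sub>1 x \<bullet> sgn x)) = (LINT x|lebesgue_on U. f' (norm x) * (Z\<^sub>2 x \<bullet> sgn x))"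
    using flux[OF 1(1) f] flux[OF 2(1) f] by simp
  show "integrable (lebesgue_on U) (\<lambda>x. f' (norm x) * (Z\<^sub>1 x \<bullet> sgn x))" by (rule flux_int[OF 1(1) f])
qed

text \<open>The two values at \<open>R\<^sub>0\<close> make the slope vanish there, and the second
  derivative is \<open>(b * R\<^sub>0 + c * R\<^sub>0 ^ 3 - 1) / R\<^sub>0\<^sup>2\<close>, which is
  negative; so the profile leaves -1 downwards.\<close>

lemma zz_below:
  assumes R: "R\<^sub>0 > 0" and z: "zz 2 a b c d R\<^sub>0 = -1" "dz 2 a b c R\<^sub>0 = - 1 / R\<^sub>0"
    and less: "b * R\<^sub>0 + c * R\<^sub>0 ^ 3 < 1"
  obtains e where "e > 0" "\<And>r. R\<^sub>0 < r \<Longrightarrow> r < R\<^sub>0 + e \<Longrightarrow> zz 2 a b c d r < -1"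
proof -
  define Z where "Z = zz 2 a b c d"
  define v where "v r = dz 2 a b c r - Z r / r" for r
  have dZ: "(Z has_real_derivative v r) (at r)" if "r > 0" for r
    using has_real_derivative_zz[OF that, of 2 a b c d] by (simp add: Z_def v_def)
  have v0: "v R\<^sub>0 = 0" using z R by (simp add: v_def Z_def)
  have "(v has_real_derivative ddz 2 b c R\<^sub>0 - (v R\<^sub>0 * R\<^sub>0 - Z R\<^sub>0 * 1) / (R\<^sub>0 * R\<^sub>0)) (at R\<^sub>0)"
    unfolding v_def[abs_def]
    by (intro DERIV_diff DERIV_divide has_real_derivative_dz DERIV_ident dZ[OF R, unfolded v_def]) (use R in auto)
  moreover have "ddz 2 b c R\<^sub>0 - (v R\<^sub>0 * R\<^sub>0 - Z R\<^sub>0 * 1) / (R\<^sub>0 * R\<^sub>0) = (b * R\<^sub>0 + c * R\<^sub>0 ^ 3 - 1) / R\<^sub>0\<^sup>2"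
    using R z by (simp add: v0 Z_def ddz_def pw_def field_simps power2_eq_square power3_eq_cube)
  moreover have "(b * R\<^sub>0 + c * R\<^sub>0 ^ 3 - 1) / R\<^sub>0\<^sup>2 < 0" using R less by (intro divide_neg_pos) auto
  ultimately obtain e where e: "e > 0" "\<And>h. 0 < h \<Longrightarrow> h < e \<Longrightarrow> v (R\<^sub>0 + h) < v R\<^sub>0"
    using DERIV_neg_dec_right by metis
  show thesis
  proof (rule that[OF e(1)])
    fix r assume r: "R\<^sub>0 < r" "r < R\<^sub>0 + e"
    have "Z r < Z R\<^sub>0"
    proof (rule DERIV_neg_imp_decreasing_open[where f=Z, OF r(1)])
      show "\<exists>l. (Z has_real_derivative l) (at s) \<and> l < 0" if "R\<^sub>0 < s" "s < r" for s
        using dZ[of s] e(2)[of "s - R\<^sub>0"] v0 that r R by auto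
      show "continuous_on {R\<^sub>0..r} Z"
        by (rule DERIV_continuous_on[OF has_field_derivative_at_within[OF dZ]]) (use R in auto)
    qed
    then show "zz 2 a b c d r < -1" using z by (simp add: Z_def)
  qed
qed

section \<open>Flux obstruction for wide annuli\<close>

lemma smooth_step_deriv_nonneg: "deriv smooth_step x \<ge> 0"
proof (rule ccontr)
  assume "\<not> deriv smooth_step x \<ge> 0"
  then have "deriv smooth_step x < 0" by simp
  then obtain e where e: "e > 0" "\<And>h. 0 < h \<Longrightarrow> h < e \<Longrightarrow> smooth_step (x + h) < smooth_step x"
    using DERIV_neg_dec_right[OF smooth_step_deriv] by blast
  from e(2)[of "e / 2"] have "smooth_step (x + e / 2) < smooth_step x" using e(1) by simp
  moreover have "smooth_step x \<le> smooth_step (x + e / 2)" by (rule smooth_step_mono) (use e(1) in simp)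
  ultimately show False by linarith
qed

lemma smooth_step_deriv_pos: obtains y where "0 < y" "y < 1" "deriv smooth_step y > 0"
proof -
  obtain y where "0 < y" "y < 1" "smooth_step 1 - smooth_step 0 = (1 - 0) * deriv smooth_step y"
    using MVT2[of 0 1 smooth_step "deriv smooth_step"] smooth_step_deriv by auto
  then show thesis by (intro that[of y]) (auto simp: smooth_step_0 smooth_step_1)
qed

text \<open>If the profile drops below \<open>-1\<close>, the flux through the shells where it does is too large for a field
  of length at most one.\<close>

lemma not_calibrable_annulus:
  assumes R: "0 < R\<^sub>0" "R\<^sub>0 < R\<^sub>1" and n: "DIM('a::euclidean_space) = 2"
    and z: "zz 2 a b c d R\<^sub>0 = -1" "zz 2 a b c d R\<^sub>1 = 1"
      "dz 2 a b c R\<^sub>0 = - (real 2 - 1) / R\<^sub>0" "dz 2 a b c R\<^sub>1 = (real 2 - 1) / R\<^sub>1"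
    and less: "b * R\<^sub>0 + c * R\<^sub>0 ^ 3 < 1" and s: "s \<in> {-1, 1}"
  shows "\<not> calibrable (annulus R\<^sub>0 R\<^sub>1 :: 'a set) (\<lambda>_. s)"
proof
  let ?U = "annulus R\<^sub>0 R\<^sub>1 :: 'a set"
  interpret gauss_domain "\<lambda>r. (r - R\<^sub>0) * (r - R\<^sub>1)" "\<lambda>r. 2 * r - R\<^sub>0 - R\<^sub>1" ?U
    by (rule gauss_domain_annulus[OF R])
  have Ub: "?U \<in> sets borel" using open_U by simp
  assume "calibrable ?U (\<lambda>_. s)"
  then obtain Z :: "'a \<Rightarrow> 'a" and w G k where Z: "AE x in lebesgue_on ?U. norm (Z x) \<le> 1"
      "has_normal_trace ?U Z w (\<lambda>_. s)" "has_trace ?U w G (\<lambda>x. s * mean_curvature ?U x)" "weak_laplacian ?U w (\<lambda>_. k)"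
    unfolding calibrable_def by blast
  define \<zeta> where "\<zeta> = zz 2 a b c d"
  have sgns: "sgn (2 * R\<^sub>0 - R\<^sub>0 - R\<^sub>1) = -1" "sgn (2 * R\<^sub>1 - R\<^sub>0 - R\<^sub>1) = 1" using R by auto
  \<comment> \<open>The comparison field: it satisfies the weak equations and traces, although its
    length exceeds 1 near the inner radius.\<close>
  obtain Z' :: "'a \<Rightarrow> 'a" and W :: "'a \<Rightarrow> real" where Z':
    "smooth_on UNIV Z'" "smooth_on UNIV W"
    "\<And>x. x \<in> ?U \<Longrightarrow> Z' x = (s * \<zeta> (norm x)) *\<^sub>R sgn x"
    "\<And>x. x \<in> ?U \<Longrightarrow> grad W x = (s * ddz 2 b c (norm x)) *\<^sub>R sgn x"
    "\<And>x. x \<in> ?U \<Longrightarrow> divergence Z' x = W x" "\<And>x. x \<in> ?U \<Longrightarrow> laplacian W x = s * (real 2 * c)"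
    "\<And>p. p \<in> frontier ?U \<Longrightarrow> Z' p \<bullet> outer_normal ?U p = s"
    "\<And>p. p \<in> frontier ?U \<Longrightarrow> W p = s * mean_curvature ?U p"
  proof (rule radial_weak_calibration[of "R\<^sub>0 / 2" \<zeta> "dz 2 a b c" "ddz 2 b c" "real 2 * c" s])
    show "R\<^sub>0 / 2 > 0" using R by simp
    show "r > R\<^sub>0 / 2" if "r \<ge> 0" "(r - R\<^sub>0) * (r - R\<^sub>1) \<le> 0" for r
      using that R by (auto simp: mult_le_0_iff)
    show "smooth_on {0<..} \<zeta>" "smooth_on {0<..} (dz 2 a b c)" unfolding \<zeta>_def by (rule smooth_on_zz smooth_on_dz)+
    fix r :: real assume r: "r > 0"
    show "(\<zeta> has_real_derivative dz 2 a b c r - (real DIM('a) - 1) * \<zeta> r / r) (at r)"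
      using has_real_derivative_zz[OF r, of 2 a b c d] by (simp add: n \<zeta>_def)
    show "(dz 2 a b c has_real_derivative ddz 2 b c r) (at r)" by (rule has_real_derivative_dz[OF r]) simp
    show "(ddz 2 b c has_real_derivative real 2 * c - (real DIM('a) - 1) * ddz 2 b c r / r) (at r)"
      using has_real_derivative_ddz[OF r, of 2 b c] by (simp add: n)
    show "\<zeta> r = sgn (2 * r - R\<^sub>0 - R\<^sub>1)" if "(r - R\<^sub>0) * (r - R\<^sub>1) = 0"
      using that z sgns by (auto simp: \<zeta>_def)
    show "dz 2 a b c r = sgn (2 * r - R\<^sub>0 - R\<^sub>1) * (real DIM('a) - 1) / r" if "(r - R\<^sub>0) * (r - R\<^sub>1) = 0"
      using that z sgns by (auto simp: n)
  qed blast
  have W: "has_normal_trace ?U Z' W (\<lambda>_. s)" "has_trace ?U W (grad W) (\<lambda>x. s * mean_curvature ?U x)"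
    "weak_laplacian ?U W (\<lambda>_. s * (real 2 * c))"
    using smooth_weak_calibration[OF Z'(1,2,5,6,7,8)] by simp_all
  have z0: "dz 2 a b c R\<^sub>0 = - 1 / R\<^sub>0" using z(3) by simp
  obtain e' where e': "e' > 0" "\<And>r. R\<^sub>0 < r \<Longrightarrow> r < R\<^sub>0 + e' \<Longrightarrow> \<zeta> r < -1"
    unfolding \<zeta>_def using zz_below[OF R(1) z(1) z0 less] by metis
  define e where "e = min e' (R\<^sub>1 - R\<^sub>0)"
  have e: "e > 0" "e \<le> e'" "e \<le> R\<^sub>1 - R\<^sub>0" using e' R by (auto simp: e_def)
  \<comment> \<open>The weight \<open>f'\<close> is carried by radii between
    \<open>R\<^sub>0 + e / 3\<close> and \<open>R\<^sub>0 + 2 * e / 3\<close>, inside the region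
    where the profile is below -1.\<close>
  define p where "p = R\<^sub>0 + e / 3"
  define f where "f r = smooth_step ((3 / e) * r + (- (3 / e) * p))" for r
  define f' where "f' r = deriv smooth_step ((3 / e) * r + (- (3 / e) * p)) * (3 / e)" for r
  have fs: "smooth_on {0<..} f" unfolding f_def[abs_def] by (rule smooth_on_subset[OF smooth_on_affine_step]) simp
  have fd: "(f has_real_derivative f' r) (at r)" for r
  proof -
    have "((\<lambda>r. (3 / e) * r + (- (3 / e) * p)) has_real_derivative 3 / e) (at r)"
      by (rule derivative_eq_intros refl | simp)+
    then show ?thesis unfolding f_def[abs_def] f'_def by (rule DERIV_chain2[OF smooth_step_deriv])
  qed
  have f'0: "f' r \<ge> 0" for r unfolding f'_def using smooth_step_deriv_nonneg e by simp
  have below: "\<zeta> r < -1 \<and> R\<^sub>0 < r \<and> r < R\<^sub>1" if "f' r > 0" for r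
  proof -
    let ?y = "(3 / e) * r + (- (3 / e) * p)"
    have "0 \<le> ?y \<and> ?y \<le> 1" using that smooth_step_deriv_0[of ?y] by (force simp: f'_def)
    moreover have "?y = 3 * (r - p) / e" by (simp add: algebra_simps diff_divide_distrib)
    ultimately have "0 \<le> 3 * (r - p)" "3 * (r - p) \<le> e" using e by (auto simp: divide_le_eq zero_le_divide_iff)
    then have "R\<^sub>0 < r" "r < R\<^sub>0 + e" using e by (auto simp: p_def)
    then show ?thesis using e'(2)[of r] e by auto
  qed
  have f'c: "continuous_on UNIV (\<lambda>x::'a. f' (norm x))"
    unfolding f'_def by (intro continuous_intros continuous_on_compose2[OF smooth_step_deriv_cont]) auto
  obtain D where D: "D \<ge> 0" "\<And>x. \<bar>deriv smooth_step x\<bar> \<le> D" using smooth_step_deriv_bounded by metis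
  have if': "integrable (lebesgue_on ?U) (\<lambda>x. f' (norm x))"
    by (rule integrable_continuous_bounded_set[OF f'c compact_cball[of 0 R\<^sub>1] _ Ub]) (auto simp: annulus_def)
  note flux = annulus_radial_flux_unique[OF R Z(2-4) W fs fd]
  have iZ': "integrable (lebesgue_on ?U) (\<lambda>x. f' (norm x) * (Z' x \<bullet> sgn x))"
    by (rule annulus_radial_flux_unique(2)[OF R W Z(2-4) fs fd])
  have eqZ': "f' (norm x) * (Z' x \<bullet> sgn x) = s * (f' (norm x) * \<zeta> (norm x))" if "x \<in> ?U" for x
  proof -
    have "x \<noteq> 0" using that R by (auto simp: annulus_def)
    then show ?thesis by (simp add: Z'(3)[OF that] inner_sgn_self)
  qed
  have ss: "s * s = 1" using s by auto
  have i\<zeta>: "integrable (lebesgue_on ?U) (\<lambda>x. f' (norm x) * \<zeta> (norm x))"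
  proof -
    have i: "integrable (lebesgue_on ?U) (\<lambda>x. s * (f' (norm x) * (Z' x \<bullet> sgn x)))" using iZ' by simp
    have eq: "s * (f' (norm x) * (Z' x \<bullet> sgn x)) = f' (norm x) * \<zeta> (norm x)" if "x \<in> ?U" for x
      unfolding eqZ'[OF that] mult.assoc[of s, symmetric] ss by simp
    show ?thesis
      by (rule Bochner_Integration.integrable_cong[THEN iffD1, OF refl _ i]) (simp add: eq)
  qed
  \<comment> \<open>Uniqueness of the radial flux transfers the value for the comparison field to
    the hypothetical calibration.\<close>
  have "(LINT x|lebesgue_on ?U. f' (norm x) * (Z x \<bullet> sgn x)) = (LINT x|lebesgue_on ?U. s * (f' (norm x) * \<zeta> (norm x)))"
    unfolding flux(1) by (rule U_integral_cong) (rule eqZ')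
  also have "\<dots> = s * (LINT x|lebesgue_on ?U. f' (norm x) * \<zeta> (norm x))"
    by (rule Bochner_Integration.integral_mult_right_zero)
  finally have val: "(LINT x|lebesgue_on ?U. f' (norm x) * \<zeta> (norm x)) = s * (LINT x|lebesgue_on ?U. f' (norm x) * (Z x \<bullet> sgn x))"
    using s by auto
  have ae: "AE x in lebesgue_on ?U. norm (f' (norm x) * (Z x \<bullet> sgn x)) \<le> f' (norm x)"
    using Z(1)
  proof eventually_elim
    case (elim x)
    have "\<bar>Z x \<bullet> sgn x\<bar> \<le> norm (Z x) * norm (sgn x)" by (rule Cauchy_Schwarz_ineq2)
    also have "\<dots> \<le> 1 * 1" using elim by (intro mult_mono) (auto simp: norm_sgn)
    finally have "f' (norm x) * \<bar>Z x \<bullet> sgn x\<bar> \<le> f' (norm x) * 1" using f'0 by (intro mult_left_mono) auto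
    then show ?case using f'0[of "norm x"] by (simp add: abs_mult)
  qed
  have "\<bar>LINT x|lebesgue_on ?U. f' (norm x) * (Z x \<bullet> sgn x)\<bar> \<le> (LINT x|lebesgue_on ?U. f' (norm x))"
  proof -
    have "norm (LINT x|lebesgue_on ?U. f' (norm x) * (Z x \<bullet> sgn x)) \<le> (LINT x|lebesgue_on ?U. norm (f' (norm x) * (Z x \<bullet> sgn x)))"
      by (rule integral_norm_bound)
    also have "\<dots> \<le> (LINT x|lebesgue_on ?U. f' (norm x))"
      by (rule integral_mono_AE[OF integrable_norm[OF flux(2)] if' ae])
    finally show ?thesis by simp
  qed
  then have le: "- (LINT x|lebesgue_on ?U. f' (norm x) * \<zeta> (norm x)) \<le> (LINT x|lebesgue_on ?U. f' (norm x))"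
    unfolding val using s by auto
  define S where "S = {x::'a. f' (norm x) > 0}"
  have SU: "S \<subseteq> ?U"
  proof
    fix x assume "x \<in> S"
    then show "x \<in> ?U" using below[of "norm x"] by (auto simp: S_def annulus_def)
  qed
  \<comment> \<open>The integrand is strictly positive on the nonempty open set where the weight is
    positive; this contradicts \<open>le\<close>.\<close>
  have "(LINT x|lebesgue_on ?U. - (f' (norm x) * \<zeta> (norm x)) - f' (norm x)) > 0"
  proof (rule integral_pos_open[OF _ Ub _ _ SU])
    show "integrable (lebesgue_on ?U) (\<lambda>x. - (f' (norm x) * \<zeta> (norm x)) - f' (norm x))" using i\<zeta> if' by simp
    show "open S" unfolding S_def by (intro open_Collect_less f'c continuous_intros)
    obtain y where y: "0 < y" "y < 1" "deriv smooth_step y > 0" using smooth_step_deriv_pos .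
    have pos: "p + y * (e / 3) \<ge> 0" using R e y by (simp add: p_def)
    then obtain x :: 'a where x: "norm x = p + y * (e / 3)" using vector_choose_size by blast
    have "(3 / e) * norm x + (- (3 / e) * p) = y" using e by (simp add: x field_simps)
    then have "x \<in> S" using y e unfolding S_def f'_def by simp
    then show "S \<noteq> {}" by blast
    have eq: "- (f' (norm x) * \<zeta> (norm x)) - f' (norm x) = f' (norm x) * (- \<zeta> (norm x) - 1)" for x :: 'a
      by (simp add: algebra_simps)
    show "- (f' (norm x) * \<zeta> (norm x)) - f' (norm x) > 0" if "x \<in> S" for x
      unfolding eq using below[of "norm x"] that by (intro mult_pos_pos) (auto simp: S_def)
    show "- (f' (norm x) * \<zeta> (norm x)) - f' (norm x) \<ge> 0" for x :: 'a
      unfolding eq using below[of "norm x"] f'0[of "norm x"] by (cases "f' (norm x) > 0") auto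
  qed
  then show False using le i\<zeta> if' by simp
qed

lemma calibrable_annulus_plane:
  assumes n: "DIM('a::euclidean_space) = 2"
  shows "\<exists>Q>1. \<forall>R\<^sub>0 R\<^sub>1. 0 < R\<^sub>0 \<and> R\<^sub>0 < R\<^sub>1 \<longrightarrow>
           (\<forall>s\<in>{-1, 1}. calibrable (annulus R\<^sub>0 R\<^sub>1 :: 'a set) (\<lambda>_. s) \<longleftrightarrow> R\<^sub>1 / R\<^sub>0 \<le> Q)"
proof -
  obtain Q where Q: "Q > 1" "\<And>q. q > 1 \<Longrightarrow> ratio_excess q \<ge> 0 \<longleftrightarrow> q \<le> Q" using critical_ratio by metis
  have "calibrable (annulus R\<^sub>0 R\<^sub>1 :: 'a set) (\<lambda>_. s) \<longleftrightarrow> R\<^sub>1 / R\<^sub>0 \<le> Q"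
    if R: "0 < R\<^sub>0" "R\<^sub>0 < R\<^sub>1" and s: "s \<in> {-1, 1}" for R\<^sub>0 R\<^sub>1 s
  proof -
    obtain a b c d where prof:
      "b * ((fs 2 R\<^sub>1 - fs 2 R\<^sub>0) * ((R\<^sub>1 ^ (2 + 2) - R\<^sub>0 ^ (2 + 2)) / (real 2 + 2)) - ((R\<^sub>1\<^sup>2 - R\<^sub>0\<^sup>2) / 2)\<^sup>2)
        = (real 2 - 1) * (1 / R\<^sub>1 + 1 / R\<^sub>0) * ((R\<^sub>1 ^ (2 + 2) - R\<^sub>0 ^ (2 + 2)) / (real 2 + 2)) + (R\<^sub>1 ^ (2 - 1) + R\<^sub>0 ^ (2 - 1)) * ((R\<^sub>1\<^sup>2 - R\<^sub>0\<^sup>2) / 2)"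
      "c * ((fs 2 R\<^sub>1 - fs 2 R\<^sub>0) * ((R\<^sub>1 ^ (2 + 2) - R\<^sub>0 ^ (2 + 2)) / (real 2 + 2)) - ((R\<^sub>1\<^sup>2 - R\<^sub>0\<^sup>2) / 2)\<^sup>2)
        = - ((R\<^sub>1 ^ (2 - 1) + R\<^sub>0 ^ (2 - 1)) * (fs 2 R\<^sub>1 - fs 2 R\<^sub>0) + (real 2 - 1) * (1 / R\<^sub>1 + 1 / R\<^sub>0) * ((R\<^sub>1\<^sup>2 - R\<^sub>0\<^sup>2) / 2))"
      "b > 0" "c < 0" "zz 2 a b c d R\<^sub>0 = -1" "zz 2 a b c d R\<^sub>1 = 1"
      "dz 2 a b c R\<^sub>0 = - (real 2 - 1) / R\<^sub>0" "dz 2 a b c R\<^sub>1 = (real 2 - 1) / R\<^sub>1"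
      by (rule annulus_profile[OF R, of 2]) (simp, blast)
    have crit: "b * R\<^sub>0 + c * R\<^sub>0 ^ 3 \<ge> 1 \<longleftrightarrow> R\<^sub>1 / R\<^sub>0 \<le> Q"
      using annulus_coefficients_criterion[OF R prof(1,2)] Q(2)[of "R\<^sub>1 / R\<^sub>0"] R by simp
    show ?thesis
    proof
      assume "R\<^sub>1 / R\<^sub>0 \<le> Q"
      then have "b * R\<^sub>0 + c * R\<^sub>0 ^ 3 \<ge> 1" using crit by simp
      then show "calibrable (annulus R\<^sub>0 R\<^sub>1 :: 'a set) (\<lambda>_. s)"
        by (intro calibrable_annulusI[where 'a='a, unfolded n, OF R prof(3-8) _ s])
    next
      assume "calibrable (annulus R\<^sub>0 R\<^sub>1 :: 'a set) (\<lambda>_. s)"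
      then have "\<not> b * R\<^sub>0 + c * R\<^sub>0 ^ 3 < 1" using not_calibrable_annulus[OF R n prof(5-8) _ s] by blast
      then show "R\<^sub>1 / R\<^sub>0 \<le> Q" using crit by simp
    qed
  qed
  with Q(1) show ?thesis by blast
qed

section \<open>Exterior domains in the plane\<close>

definition far_cutoff :: "real \<Rightarrow> 'a::euclidean_space \<Rightarrow> real" where
  "far_cutoff M x = smooth_step (2 - norm x / M)"

lemma far_cutoff_1: "M > 0 \<Longrightarrow> norm x \<le> M \<Longrightarrow> far_cutoff M x = 1"
  by (simp add: far_cutoff_def smooth_step_1)

lemma far_cutoff_0: "M > 0 \<Longrightarrow> norm x \<ge> 2 * M \<Longrightarrow> far_cutoff M x = 0"
  by (simp add: far_cutoff_def smooth_step_0 pos_le_divide_eq)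

lemma test_function_far_cutoff:
  assumes "M > 0"
  shows "test_function UNIV (far_cutoff M :: 'a::euclidean_space \<Rightarrow> real)"
proof (rule test_functionI[where K="cball 0 (2 * M)"])
  show "smooth_on UNIV (far_cutoff M :: 'a \<Rightarrow> real)"
  proof (rule smooth_on_UNIV_extend[OF _ assms, where c=1])
    have "smooth_on (- {0}) (\<lambda>x::'a. smooth_step ((- (1 / M)) * norm x + 2))"
      by (rule smooth_on_radial[OF _ open_UNIV smooth_on_affine_step]) auto
    then show "smooth_on (- {0}) (far_cutoff M :: 'a \<Rightarrow> real)"
      by (simp add: far_cutoff_def[abs_def])
  qed (use assms in \<open>auto intro: far_cutoff_1\<close>)
qed (use assms in \<open>auto intro: far_cutoff_0\<close>)

lemma grad_far_cutoff:
  fixes x :: "'a::euclidean_space"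
  assumes "x \<noteq> 0"
  shows "grad (far_cutoff M) x = (deriv smooth_step (2 - norm x / M) * (- (1 / M))) *\<^sub>R sgn x"
  unfolding far_cutoff_def[abs_def]
proof (rule grad_radial[OF assms])
  have "((\<lambda>r. 2 - r / M) has_real_derivative - (1 / M)) (at (norm x))"
    using DERIV_diff[OF DERIV_const[of 2] DERIV_cdivide[OF DERIV_ident, of M]] by simp
  then show "((\<lambda>r. smooth_step (2 - r / M)) has_real_derivative
      deriv smooth_step (2 - norm x / M) * (- (1 / M))) (at (norm x))"
    by (rule DERIV_chain2[OF smooth_step_deriv])
qed

lemma integral_indicator_le:
  assumes "S \<in> sets borel" "compact K"
  shows "(LINT x|lebesgue_on S. indicator K (x::'a::euclidean_space)) \<le> measure lborel K"
    and "integrable (lebesgue_on S) (indicator K :: 'a \<Rightarrow> real)"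
proof -
  have Kb: "K \<in> sets borel" using assms(2) by (simp add: borel_compact)
  have m: "(indicator K :: 'a \<Rightarrow> real) \<in> borel_measurable borel" using Kb by simp
  have iK: "integrable lborel (indicator K :: 'a \<Rightarrow> real)"
    using borel_integrable_compact[OF assms(2) continuous_on_const[of K "1::real"]] by simp
  have iS: "integrable lborel (\<lambda>x. indicator S x *\<^sub>R (indicator K x :: real))"
    by (rule integrable_mult_indicator[OF _ iK]) (use assms in simp)
  show "integrable (lebesgue_on S) (indicator K :: 'a \<Rightarrow> real)"
    by (subst integrable_lebesgue_on_iff_lborel[OF assms(1) m]) (rule iS)
  have "(LINT x|lebesgue_on S. indicator K x) = (LINT x|lborel. indicator S x *\<^sub>R (indicator K x :: real))"
    by (rule LINT_lebesgue_on_eq_lborel[OF assms(1) m])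
  also have "\<dots> \<le> (LINT x|lborel. indicator K x)"
    by (rule integral_mono[OF iS iK]) (auto simp: indicator_def)
  finally show "(LINT x|lebesgue_on S. indicator K x) \<le> measure lborel K" using Kb by simp
qed

text \<open>In the plane the Dirichlet energy of \<open>far_cutoff M\<close> does not depend on \<open>M\<close>, and it sits where
  the energy of \<open>G\<close> is small.\<close>

lemma far_flux_tendsto_0:
  fixes G :: "'a::euclidean_space \<Rightarrow> 'a"
  assumes n: "DIM('a) = 2" and U: "U \<in> sets borel" "0 \<notin> U"
    and G: "square_integrable_on U G" "\<And>M. M > 0 \<Longrightarrow> integrable (lebesgue_on U) (\<lambda>x. G x \<bullet> grad (far_cutoff M) x)"
  shows "(\<lambda>k. LINT x|lebesgue_on U. G x \<bullet> grad (far_cutoff (real (Suc k))) x) \<longlonglongrightarrow> 0"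
proof -
  obtain D where D: "D \<ge> 0" "\<And>x. \<bar>deriv smooth_step x\<bar> \<le> D" using smooth_step_deriv_bounded by metis
  define V where "V = unit_ball_vol 2"
  have G2: "integrable (lebesgue_on U) (\<lambda>x. (norm (G x))\<^sup>2)" using G(1) by (simp add: square_integrable_on_def)
  \<comment> \<open>The gradient of the cut-off with index k lives beyond radius k + 1, so it meets
    only this tail of the energy of \<open>G\<close>.\<close>
  define tail where "tail k x = indicator {y::'a. norm y \<ge> real (Suc k)} x * (norm (G x))\<^sup>2" for k x
  have tm: "tail k \<in> borel_measurable (lebesgue_on U)" for k
  proof -
    have "{y::'a. norm y \<ge> real (Suc k)} \<in> sets borel" by measurable
    then have "(indicator {y::'a. norm y \<ge> real (Suc k)} :: 'a \<Rightarrow> real) \<in> borel_measurable borel" by simp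
    then have "(indicator {y::'a. norm y \<ge> real (Suc k)} :: 'a \<Rightarrow> real) \<in> borel_measurable (lebesgue_on U)"
      by (intro measurable_restrict_space1[OF measurable_completion]) simp
    then show ?thesis unfolding tail_def[abs_def]
      by (rule borel_measurable_times[OF _ borel_measurable_integrable[OF G2]])
  qed
  have tle: "norm (tail k x) \<le> (norm (G x))\<^sup>2" for k x by (auto simp: tail_def indicator_def)
  have ti: "integrable (lebesgue_on U) (tail k)" for k
    by (rule Bochner_Integration.integrable_bound[OF G2 tm]) (use tle in auto)
  have tlim: "(\<lambda>k. LINT x|lebesgue_on U. tail k x) \<longlonglongrightarrow> (LINT x|lebesgue_on U. 0)"
  proof (rule integral_dominated_convergence[OF _ tm G2])
    show "AE x in lebesgue_on U. (\<lambda>k. tail k x) \<longlonglongrightarrow> 0"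
    proof (rule AE_I2)
      fix x :: 'a
      obtain N where N: "real N > norm x" using reals_Archimedean2 by blast
      have "tail k x = 0" if "k \<ge> N" for k using N that by (simp add: tail_def indicator_def)
      then have "\<forall>\<^sub>F k in sequentially. tail k x = 0" by (auto simp: eventually_sequentially)
      then show "(\<lambda>k. tail k x) \<longlonglongrightarrow> 0" by (rule tendsto_eventually)
    qed
    show "AE x in lebesgue_on U. norm (tail k x) \<le> (norm (G x))\<^sup>2" for k using tle by auto
  qed simp
  then have tlim0: "(\<lambda>k. LINT x|lebesgue_on U. tail k x) \<longlonglongrightarrow> 0" by simp
  \<comment> \<open>Young's inequality with a free parameter \<delta>: the second term is at most
    \<delta>/2 (D/M)^2 times the area V (2M)^2, which does not depend on M.\<close>
  have est: "\<bar>LINT x|lebesgue_on U. G x \<bullet> grad (far_cutoff (real (Suc k))) x\<bar>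
     \<le> (LINT x|lebesgue_on U. tail k x) / (2 * \<delta>) + 2 * \<delta> * D\<^sup>2 * V" if \<delta>: "\<delta> > 0" for k \<delta>
  proof -
    define M where "M = real (Suc k)"
    have M: "M > 0" by (simp add: M_def)
    let ?K = "cball (0::'a) (2 * M)"
    have pw: "norm (G x \<bullet> grad (far_cutoff M) x) \<le> tail k x / (2 * \<delta>) + \<delta> / 2 * (D / M)\<^sup>2 * indicator ?K x" if x: "x \<in> U" for x
    proof (cases "M \<le> norm x \<and> norm x \<le> 2 * M")
      case True
      have x0: "x \<noteq> 0" using x U(2) by auto
      have "norm (grad (far_cutoff M) x) = \<bar>deriv smooth_step (2 - norm x / M)\<bar> / M"
        using x0 M by (simp add: grad_far_cutoff norm_sgn abs_mult)
      also have "\<dots> \<le> D / M" using D(2) M by (intro divide_right_mono) auto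
      finally have g: "norm (grad (far_cutoff M) x) \<le> D / M" .
      have "norm (G x \<bullet> grad (far_cutoff M) x) \<le> norm (G x) * norm (grad (far_cutoff M) x)"
        unfolding real_norm_def by (rule Cauchy_Schwarz_ineq2)
      also have "\<dots> \<le> norm (G x) * (D / M)" using g by (intro mult_left_mono) auto
      also have "\<dots> \<le> (norm (G x))\<^sup>2 / (2 * \<delta>) + \<delta> / 2 * (D / M)\<^sup>2"
      proof -
        have "0 \<le> (norm (G x) - \<delta> * (D / M))\<^sup>2 / (2 * \<delta>)" using \<delta> by simp
        also have "\<dots> = (norm (G x))\<^sup>2 / (2 * \<delta>) + \<delta> / 2 * (D / M)\<^sup>2 - norm (G x) * (D / M)"
          using \<delta> M by (simp add: power2_eq_square field_simps)
        finally show ?thesis by simp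
      qed
      finally show ?thesis using True by (simp add: tail_def M_def)
    next
      case False
      have x0: "x \<noteq> 0" using x U(2) by auto
      have "2 - norm x / M < 0 \<or> 2 - norm x / M > 1"
        using False M by (auto simp: field_simps)
      then have "deriv smooth_step (2 - norm x / M) = 0" by (rule smooth_step_deriv_0)
      then have "norm (G x \<bullet> grad (far_cutoff M) x) = 0" by (simp add: grad_far_cutoff[OF x0])
      also have "0 \<le> tail k x / (2 * \<delta>) + \<delta> / 2 * (D / M)\<^sup>2 * indicator ?K x"
        using \<delta> by (auto simp: tail_def indicator_def)
      finally show ?thesis .
    qed
    have iK: "integrable (lebesgue_on U) (indicator ?K :: 'a \<Rightarrow> real)" by (rule integral_indicator_le(2)[OF U(1)]) simp
    have "norm (LINT x|lebesgue_on U. G x \<bullet> grad (far_cutoff M) x) \<le> (LINT x|lebesgue_on U. norm (G x \<bullet> grad (far_cutoff M) x))"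
      by (rule integral_norm_bound)
    also have "\<dots> \<le> (LINT x|lebesgue_on U. tail k x / (2 * \<delta>) + \<delta> / 2 * (D / M)\<^sup>2 * indicator ?K x)"
    proof (rule integral_mono)
      show "integrable (lebesgue_on U) (\<lambda>x. norm (G x \<bullet> grad (far_cutoff M) x))" using G(2)[OF M] by simp
      show "integrable (lebesgue_on U) (\<lambda>x. tail k x / (2 * \<delta>) + \<delta> / 2 * (D / M)\<^sup>2 * indicator ?K x)"
        using ti[of k] iK by simp
    qed (use pw in simp)
    also have "\<dots> = (LINT x|lebesgue_on U. tail k x) / (2 * \<delta>) + \<delta> / 2 * (D / M)\<^sup>2 * (LINT x|lebesgue_on U. indicator ?K x)"
      using ti[of k] iK by simp
    also have "\<dots> \<le> (LINT x|lebesgue_on U. tail k x) / (2 * \<delta>) + \<delta> / 2 * (D / M)\<^sup>2 * (V * (2 * M)\<^sup>2)"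
    proof -
      have "(LINT x|lebesgue_on U. indicator ?K x) \<le> V * (2 * M)\<^sup>2"
        using integral_indicator_le(1)[OF U(1) compact_cball[of "0::'a" "2 * M"]] content_cball[of "2 * M" "0::'a"] M n
        by (simp add: V_def)
      then show ?thesis using \<delta> by (intro add_left_mono mult_left_mono) auto
    qed
    also have "\<delta> / 2 * (D / M)\<^sup>2 * (V * (2 * M)\<^sup>2) = 2 * \<delta> * D\<^sup>2 * V"
      using M by (simp add: power2_eq_square field_simps)
    finally show ?thesis by (simp add: M_def)
  qed
  show ?thesis
  proof (rule LIMSEQ_I)
    fix \<epsilon> :: real assume \<epsilon>: "0 < \<epsilon>"
    have V0: "V \<ge> 0" by (simp add: V_def)
    \<comment> \<open>Half of \<epsilon> goes to each term; the added 1 avoids a vanishing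
      denominator.\<close>
    define \<delta> where "\<delta> = \<epsilon> / (4 * (D\<^sup>2 * V + 1))"
    have DV: "D\<^sup>2 * V + 1 > 0" using V0 by (simp add: add_nonneg_pos)
    have \<delta>: "\<delta> > 0" using \<epsilon> DV by (simp add: \<delta>_def)
    have "2 * \<delta> * D\<^sup>2 * V = \<epsilon> / 2 * (D\<^sup>2 * V / (D\<^sup>2 * V + 1))"
    proof -
      have "2 * (\<epsilon> / (4 * Y)) * X = \<epsilon> / 2 * (X / Y)" for X Y :: real by (cases "Y = 0") (simp_all add: field_simps)
      then show ?thesis unfolding \<delta>_def mult.assoc by (simp only: mult.assoc)
    qed
    also have "\<dots> \<le> \<epsilon> / 2 * 1" using \<epsilon> DV by (intro mult_left_mono) auto
    finally have half: "2 * \<delta> * D\<^sup>2 * V \<le> \<epsilon> / 2" by simp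
    have "\<forall>\<^sub>F k in sequentially. (LINT x|lebesgue_on U. tail k x) < \<epsilon> / 2 * (2 * \<delta>)"
      by (rule order_tendstoD(2)[OF tlim0]) (use \<epsilon> \<delta> in simp)
    then obtain N where N: "\<And>k. k \<ge> N \<Longrightarrow> (LINT x|lebesgue_on U. tail k x) < \<epsilon> / 2 * (2 * \<delta>)"
      by (auto simp: eventually_sequentially)
    have "norm ((LINT x|lebesgue_on U. G x \<bullet> grad (far_cutoff (real (Suc k))) x) - 0) < \<epsilon>" if "k \<ge> N" for k
    proof -
      have "(LINT x|lebesgue_on U. tail k x) / (2 * \<delta>) < \<epsilon> / 2" using N[OF that] \<delta> by (subst pos_divide_less_eq) auto
      then show ?thesis using est[OF \<delta>, of k] half by simp
    qed
    then show "\<exists>N. \<forall>k\<ge>N. norm ((LINT x|lebesgue_on U. G x \<bullet> grad (far_cutoff (real (Suc k))) x) - 0) < \<epsilon>" by blast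
  qed
qed

text \<open>The fundamental solution of the plane, truncated at scale one. Rescaled by \<open>N\<close> its gradient on the
  circle of radius \<open>R\<close> is of order \<open>N\<^sup>2 / R\<close>, whereas its Laplacian lives at distance \<open>N\<close>.\<close>

lemma log_profile:
  obtains l l1 l2 f f' :: "real \<Rightarrow> real" and K where
    "smooth_on {0<..} l" "\<And>t. t > 0 \<Longrightarrow> (l has_real_derivative l1 t) (at t)"
    "\<And>t. t > 0 \<Longrightarrow> (l1 has_real_derivative l2 t) (at t)" "\<And>t. f t = l2 t + l1 t / t"
    "\<And>t. t > 0 \<Longrightarrow> (f has_real_derivative f' t) (at t)" "\<And>t. t \<ge> 2 \<Longrightarrow> l t = 0"
    "\<And>t. 0 < t \<Longrightarrow> t < 1 \<Longrightarrow> l1 t = 1 / t" "\<And>t. 0 < t \<Longrightarrow> t < 1 \<Longrightarrow> f t = 0"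
    "K \<ge> 0" "\<And>t. t > 0 \<Longrightarrow> \<bar>f' t\<bar> \<le> K" "\<And>t. t > 2 \<Longrightarrow> f' t = 0"
proof -
  \<comment> \<open>The logarithm up to radius 1, and zero from 2 on. \<open>f\<close> is its planar
    Laplacian, which vanishes below 1 because the logarithm is harmonic, and beyond 2.\<close>
  define l where "l t = ln t * smooth_step (2 - t)" for t :: real
  define f where "f t = deriv (deriv l) t + deriv l t / t" for t
  have st: "smooth_on {0<..} (\<lambda>t. smooth_step (2 - t))"
    using smooth_on_subset[OF smooth_on_affine_step[of "-1" 2], of "{0<..}"] by simp
  have ls: "smooth_on {0<..} l" unfolding l_def[abs_def]
    by (intro smooth_on_mult smooth_on_ln st open_greaterThan)
  note l1 = smooth_on_deriv[OF open_greaterThan ls]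
  note l2 = smooth_on_deriv[OF open_greaterThan l1(1)]
  have fs: "smooth_on {0<..} f"
  proof -
    have "smooth_on {0<..} (\<lambda>t. deriv (deriv l) t + deriv l t * inverse t)"
      by (intro smooth_on_add smooth_on_mult l1(1) l2(1) smooth_on_inverse open_greaterThan)
    then show ?thesis by (simp add: f_def[abs_def] divide_real_def)
  qed
  note f1 = smooth_on_deriv[OF open_greaterThan fs]
  have lt1: "deriv l t = 1 / t" if "0 < t" "t < 1" for t
  proof (rule DERIV_imp_deriv)
    have "(ln has_real_derivative 1 / t) (at t)" using DERIV_ln[OF that(1)] by (simp add: inverse_eq_divide)
    then show "(l has_real_derivative 1 / t) (at t)"
      by (rule has_field_derivative_transform_within_open[where S="{0<..<1}"])
         (use that in \<open>auto simp: l_def smooth_step_1\<close>)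
  qed
  have lt2: "deriv (deriv l) t = - 1 / t\<^sup>2" if "0 < t" "t < 1" for t
  proof (rule DERIV_imp_deriv)
    have "((\<lambda>t. 1 / t) has_real_derivative - 1 / t\<^sup>2) (at t)"
      using that by (auto intro!: derivative_eq_intros simp: power2_eq_square)
    then show "(deriv l has_real_derivative - 1 / t\<^sup>2) (at t)"
      by (rule has_field_derivative_transform_within_open[where S="{0<..<1}"])
         (use that lt1 in auto)
  qed
  have f0: "f t = 0" if "0 < t" "t < 1" for t
    using that by (simp add: f_def lt1 lt2 power2_eq_square)
  have gt1: "deriv l t = 0" if "t > 2" for t
  proof (rule DERIV_imp_deriv)
    have "((\<lambda>_. 0) has_real_derivative 0) (at t)" by simp
    then show "(l has_real_derivative 0) (at t)"
      by (rule has_field_derivative_transform_within_open[where S="{2<..}"])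
         (use that in \<open>auto simp: l_def smooth_step_0\<close>)
  qed
  have gt2: "deriv (deriv l) t = 0" if "t > 2" for t
  proof (rule DERIV_imp_deriv)
    have "((\<lambda>_. 0) has_real_derivative 0) (at t)" by simp
    then show "(deriv l has_real_derivative 0) (at t)"
      by (rule has_field_derivative_transform_within_open[where S="{2<..}"]) (use that gt1 in auto)
  qed
  have fd0: "deriv f t = 0" if "0 < t" "t < 1 \<or> t > 2" for t
  proof (rule DERIV_imp_deriv)
    have "((\<lambda>_. 0) has_real_derivative 0) (at t)" by simp
    then show "(f has_real_derivative 0) (at t)"
      by (rule has_field_derivative_transform_within_open[where S="{0<..<1} \<union> {2<..}"])
         (use that f0 gt1 gt2 in \<open>auto simp: f_def\<close>)
  qed
  \<comment> \<open>Since \<open>f\<close> vanishes below 1 and beyond 2, a bound on this interval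
    is global.\<close>
  have "continuous_on {1..2} (deriv f)"
    by (rule continuous_on_subset[OF smooth_on_continuous_on[OF f1(1)]]) auto
  then obtain K where K: "K \<ge> 0" "\<And>t. t \<in> {1..2} \<Longrightarrow> norm (deriv f t) \<le> K"
    using continuous_on_compact_bound[OF compact_Icc] by metis
  have Kb: "\<bar>deriv f t\<bar> \<le> K" if "t > 0" for t
    using K(1) K(2)[of t] fd0[OF that] by (cases "t \<in> {1..2}") auto
  show thesis
  proof (rule that[of l "deriv l" "deriv (deriv l)" f "deriv f" K])
    show "l t = 0" if "t \<ge> 2" for t using that by (simp add: l_def smooth_step_0)
    show "f t = deriv (deriv l) t + deriv l t / t" for t by (simp add: f_def)
    show "deriv f t = 0" if "t > 2" for t using fd0[of t] that by simp
  qed (use ls l1(2) l2(2) f1(2) lt1 f0 K(1) Kb in auto)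
qed

text \<open>Square integrability of \<open>G\<close> enters through
  \<open>far_flux_tendsto_0\<close> and acts twice: against the growing area it rules out a nonzero
  \<open>c\<close>, and then it removes the flux of \<open>G\<close> through the circle. Only then
  can \<open>w\<close> be tested with functions that are merely constant on the circle.\<close>

lemma not_calibrable_exterior_plane:
  assumes R: "R > 0" and n: "DIM('a::euclidean_space) = 2" and s: "s \<in> {-1, 1}"
  shows "\<not> calibrable (- cball 0 R :: 'a set) (\<lambda>_. s)"
proof
  let ?U = "- cball 0 R :: 'a set"
  interpret gauss_domain "\<lambda>r. R - r" "\<lambda>_. -1" ?U by (rule gauss_domain_exterior[OF R])
  have Ub: "?U \<in> sets borel" using open_U by simp
  have U0: "0 \<notin> ?U" using R by simp
  define V where "V = unit_ball_vol 2"
  have V: "V > 0" by (simp add: V_def)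
  have vol: "measure lborel (cball (0::'a) r) = V * r\<^sup>2" if "r \<ge> 0" for r
    using content_cball[OF that, of "0::'a"] n by (simp add: V_def)
  assume "calibrable ?U (\<lambda>_. s)"
  then obtain Z :: "'a \<Rightarrow> 'a" and w G c where Z: "AE x in lebesgue_on ?U. norm (Z x) \<le> 1"
      "has_normal_trace ?U Z w (\<lambda>_. s)" "has_trace ?U w G (\<lambda>x. s * mean_curvature ?U x)" "weak_laplacian ?U w (\<lambda>_. c)"
      "square_integrable_on ?U G"
    unfolding calibrable_def by blast
  have wi: "integrable_up_to_boundary ?U w" and Gi: "integrable_up_to_boundary ?U G" and Zi: "integrable_up_to_boundary ?U Z"
    using Z(2,3) unfolding has_trace_def has_normal_trace_def by auto
  have treq: "(LINT x|lebesgue_on ?U. w x * divergence \<psi> x + G x \<bullet> \<psi> x) =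
        (LINT x:frontier ?U|surface_measure ?U. s * mean_curvature ?U x * (\<psi> x \<bullet> outer_normal ?U x))"
    if "test_function UNIV \<psi>" for \<psi> :: "'a \<Rightarrow> 'a"
    using Z(3) that unfolding has_trace_def by blast
  have ntreq: "(LINT x|lebesgue_on ?U. w x * \<phi> x + Z x \<bullet> grad \<phi> x) = (LINT x:frontier ?U|surface_measure ?U. s * \<phi> x)"
    if "test_function UNIV \<phi>" for \<phi>
    using Z(2) that unfolding has_normal_trace_def by blast
  have iG: "integrable (lebesgue_on ?U) (\<lambda>x. G x \<bullet> grad \<phi> x)" if "test_function UNIV \<phi>" for \<phi>
    by (rule integrable_up_to_boundary_test(2)[OF Gi test_function_grad[OF that]])
  have it: "integrable (lebesgue_on ?U) \<phi>" if "test_function UNIV \<phi>" for \<phi> :: "'a \<Rightarrow> real"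
    using integrable_test_mult[OF that continuous_on_const[of UNIV 1] Ub] by simp
  define T where "T M = (LINT x|lebesgue_on ?U. G x \<bullet> grad (far_cutoff M) x)" for M
  define I where "I M = (LINT x|lebesgue_on ?U. far_cutoff M x)" for M
  have T0: "(\<lambda>k. T (real (Suc k))) \<longlonglongrightarrow> 0"
    unfolding T_def by (rule far_flux_tendsto_0[OF n Ub U0 Z(5)]) (rule iG[OF test_function_far_cutoff])
  \<comment> \<open>Subtracting \<open>a\<close> times a far cut-off makes \<open>u\<close> vanish
    on the circle, so that the boundary layer lemma applies; the price is the term with
    \<open>T M\<close>.\<close>
  have flux: "(LINT x|lebesgue_on ?U. G x \<bullet> grad u x) - a * T M = - c * ((LINT x|lebesgue_on ?U. u x) - a * I M)"
    if u: "test_function UNIV u" "\<And>x. norm x = R \<Longrightarrow> u x = a" and M: "M \<ge> R" for u a M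
  proof -
    have M0: "M > 0" using R M by simp
    note t = test_function_far_cutoff[OF M0, where 'a='a]
    define v where "v x = u x - a * far_cutoff M x" for x
    have vt: "test_function UNIV v"
    proof -
      obtain B1 where B1: "\<And>x. norm x \<ge> B1 \<Longrightarrow> u x = 0" using test_function_obtain_ball[OF u(1)] by metis
      show ?thesis
      proof (rule test_functionI[where K="cball 0 (max B1 (2 * M))"])
        show "smooth_on UNIV v" unfolding v_def[abs_def]
          by (intro smooth_on_diff smooth_on_mult smooth_on_const open_UNIV test_function_smooth[OF u(1)] test_function_smooth[OF t])
        show "v x = 0" if "x \<notin> cball 0 (max B1 (2 * M))" for x
          using that B1[of x] far_cutoff_0[OF M0, of x] by (simp add: v_def)
      qed auto
    qed
    obtain L where L: "L > 0" "\<And>x y. norm (v x - v y) \<le> L * norm (x - y)" using test_function_lipschitz[OF vt] by metis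
    have vb: "\<bar>v x\<bar> \<le> L * \<bar>R - norm x\<bar>" if "x \<in> ?U" for x
    proof -
      have x0: "x \<noteq> 0" using that U0 by auto
      then have nR: "norm (R *\<^sub>R sgn x) = R" using R by (simp add: norm_sgn)
      have "far_cutoff M (R *\<^sub>R sgn x) = 1" by (rule far_cutoff_1[OF M0]) (use nR M in linarith)
      then have "v (R *\<^sub>R sgn x) = 0" using u(2)[OF nR] by (simp add: v_def)
      moreover have "x - R *\<^sub>R sgn x = (norm x - R) *\<^sub>R sgn x"
      proof -
        have "norm x *\<^sub>R sgn x = x" using x0 by (simp add: sgn_div_norm)
        then show ?thesis by (simp add: scaleR_diff_left)
      qed
      then have "norm (x - R *\<^sub>R sgn x) = \<bar>R - norm x\<bar>" using x0 by (simp add: norm_sgn)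
      ultimately show ?thesis using L(2)[of x "R *\<^sub>R sgn x"] by simp
    qed
    have "(LINT x|lebesgue_on ?U. G x \<bullet> grad v x) = - c * (LINT x|lebesgue_on ?U. v x)"
      by (rule weak_laplacian_boundary_layer[where \<rho>="R / 2", OF _ _ Z(3,4) vt _ vb]) (use R L(1) in auto)
    moreover have "grad v x = grad u x - a *\<^sub>R grad (far_cutoff M) x" for x
    proof (rule grad_eqI)
      have "((\<lambda>x. u x - a * far_cutoff M x) has_derivative (\<lambda>h. grad u x \<bullet> h - a * (grad (far_cutoff M) x \<bullet> h))) (at x)"
        by (intro has_derivative_diff has_derivative_mult_right has_derivative_grad test_function_differentiable[OF u(1)]
            test_function_differentiable[OF t])
      then show "(v has_derivative (\<lambda>h. (grad u x - a *\<^sub>R grad (far_cutoff M) x) \<bullet> h)) (at x)"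
        unfolding v_def[abs_def] by (simp add: inner_diff_left)
    qed
    ultimately show ?thesis
      using iG[OF u(1)] iG[OF t] it[OF u(1)] it[OF t]
      by (simp add: v_def inner_diff_right T_def I_def)
  qed
  have Ilow: "V * (M\<^sup>2 - R\<^sup>2) \<le> I M" if M: "M > R" for M
  proof -
    have M0: "M > 0" using R M by simp
    have "V * (M\<^sup>2 - R\<^sup>2) = (LINT x|lborel. indicator (cball (0::'a) M) x) - (LINT x|lborel. indicator (cball (0::'a) R) x)"
      using vol[of M] vol[of R] M R by (simp add: right_diff_distrib)
    also have "\<dots> = (LINT x|lborel. indicator (cball (0::'a) M) x - indicator (cball (0::'a) R) x)"
    proof -
      have "integrable lborel (indicator (cball (0::'a) r) :: 'a \<Rightarrow> real)" for r
        using borel_integrable_compact[OF compact_cball continuous_on_const[of "cball (0::'a) r" "1::real"]] by simp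
      then show ?thesis by simp
    qed
    also have "\<dots> \<le> (LINT x|lborel. indicator ?U x *\<^sub>R far_cutoff M x)"
    proof (rule integral_mono)
      have "integrable lborel (indicator (cball (0::'a) r) :: 'a \<Rightarrow> real)" for r
        using borel_integrable_compact[OF compact_cball continuous_on_const[of "cball (0::'a) r" "1::real"]] by simp
      then show "integrable lborel (\<lambda>x. indicator (cball (0::'a) M) x - indicator (cball (0::'a) R) x :: real)" by simp
      show "integrable lborel (\<lambda>x. indicator ?U x *\<^sub>R far_cutoff M x)"
        by (rule integrable_mult_indicator[OF _ integrable_lborel_test_function[OF test_function_far_cutoff[OF M0]]]) (use Ub in simp)
      fix x :: 'a
      have "0 \<le> far_cutoff M x" by (simp add: far_cutoff_def smooth_step_bounds)
      then show "indicator (cball 0 M) x - indicator (cball 0 R) x \<le> indicator ?U x *\<^sub>R far_cutoff M x"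
        using far_cutoff_1[OF M0, of x] M by (auto simp: indicator_def)
    qed
    also have "\<dots> = I M" unfolding I_def
      by (rule LINT_lebesgue_on_eq_lborel[symmetric, OF Ub test_function_borel[OF test_function_far_cutoff[OF M0]]])
    finally show ?thesis .
  qed
  \<comment> \<open>\<open>T M\<close> stays bounded along the integers while \<open>I M\<close>
    grows like the area of a disc of radius \<open>M\<close>, so the two sides balance only for c =
    0.\<close>
  have c0: "c = 0"
  proof (rule ccontr)
    assume c: "c \<noteq> 0"
    have eq: "T R - T M = - c * (I R - I M)" if "M \<ge> R" for M
      using flux[of "far_cutoff R" 1 M] test_function_far_cutoff[OF R, where 'a='a] far_cutoff_1[OF R, where 'a='a] that
      by (simp add: T_def I_def)
    have "\<forall>\<^sub>F k in sequentially. \<bar>T (real (Suc k))\<bar> < 1"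
      using tendsto_rabs[OF T0] by (intro order_tendstoD(2)) auto
    moreover have "\<forall>\<^sub>F k in sequentially. real (Suc k) > max R ((\<bar>T R\<bar> + 1) / \<bar>c\<bar> / V + \<bar>I R\<bar> / V + R\<^sup>2 + 1)"
      by (rule filterlim_at_top_dense[THEN iffD1, rule_format, OF filterlim_compose[OF filterlim_real_sequentially filterlim_Suc]])
    ultimately have "\<forall>\<^sub>F k in sequentially. False"
    proof eventually_elim
      case (elim k)
      define M where "M = real (Suc k)"
      have M: "M > R" "M > (\<bar>T R\<bar> + 1) / \<bar>c\<bar> / V + \<bar>I R\<bar> / V + R\<^sup>2 + 1" "\<bar>T M\<bar> < 1"
        using elim by (auto simp: M_def)
      have nn: "(\<bar>T R\<bar> + 1) / \<bar>c\<bar> / V \<ge> 0" "\<bar>I R\<bar> / V \<ge> 0" using V by auto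
      then have "M > 1" using M(2) by (smt (verit) zero_le_power2)
      then have "M \<le> M\<^sup>2" by (simp add: power2_eq_square)
      then have "(\<bar>T R\<bar> + 1) / \<bar>c\<bar> / V + \<bar>I R\<bar> / V < M\<^sup>2 - R\<^sup>2" using M(2) by linarith
      then have "((\<bar>T R\<bar> + 1) / \<bar>c\<bar> / V + \<bar>I R\<bar> / V) * V < (M\<^sup>2 - R\<^sup>2) * V" using V by (intro mult_strict_right_mono)
      moreover have "(X / V + Y / V) * V = X + Y" for X Y using V by (simp add: distrib_right)
      moreover have "(M\<^sup>2 - R\<^sup>2) * V \<le> I M" using Ilow[OF M(1)] by (simp only: mult.commute)
      ultimately have "(\<bar>T R\<bar> + 1) / \<bar>c\<bar> + \<bar>I R\<bar> < I M" by (metis order_less_le_trans)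
      then have "(\<bar>T R\<bar> + 1) / \<bar>c\<bar> < \<bar>I R - I M\<bar>" by linarith
      then have "\<bar>T R\<bar> + 1 < \<bar>c\<bar> * \<bar>I R - I M\<bar>" using c by (simp add: pos_divide_less_eq mult.commute)
      also have "\<dots> = \<bar>T R - T M\<bar>" using eq[of M] M(1) by (simp add: abs_mult)
      finally show False using M(3) by linarith
    qed
    then show False by simp
  qed
  \<comment> \<open>With c = 0 the integral equals \<open>a * T M\<close> for every large
    \<open>M\<close>, and this tends to 0.\<close>
  have flux0: "(LINT x|lebesgue_on ?U. G x \<bullet> grad u x) = 0"
    if u: "test_function UNIV u" "\<And>x. norm x = R \<Longrightarrow> u x = a" for u a
  proof -
    have "\<forall>\<^sub>F k in sequentially. real (Suc k) \<ge> R"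
      by (rule filterlim_at_top[THEN iffD1, rule_format, OF filterlim_compose[OF filterlim_real_sequentially filterlim_Suc]])
    then have "\<forall>\<^sub>F k in sequentially. a * T (real (Suc k)) = (LINT x|lebesgue_on ?U. G x \<bullet> grad u x)"
      by eventually_elim (use flux[OF u] c0 in simp)
    then have "(\<lambda>k. a * T (real (Suc k))) \<longlonglongrightarrow> (LINT x|lebesgue_on ?U. G x \<bullet> grad u x)"
      by (rule tendsto_eventually)
    moreover have "(\<lambda>k. a * T (real (Suc k))) \<longlonglongrightarrow> a * 0" by (intro tendsto_mult tendsto_const T0)
    ultimately show ?thesis using LIMSEQ_unique by fastforce
  qed
  define m where "m = (LINT x:frontier ?U|surface_measure ?U. (1::real))"
  have fr: "norm x = R" "outer_normal ?U x = - sgn x" "mean_curvature ?U x = - 1 / R" "x \<noteq> 0" if "x \<in> frontier ?U" for x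
    using outer_normal_U[OF that] mean_curvature_U[OF that] frontier_props[OF that] that n by (auto simp: frontier_iff)
  have const: "(LINT x:frontier ?U|surface_measure ?U. k) = k * m" for k :: real
    unfolding m_def set_lebesgue_integral_def by (simp add: mult.commute)
  \<comment> \<open>\<open>m\<close> is the length of the circle, found by applying Gauss-Green to a
    cut-off of the identity field; the contradiction will come from its positivity.\<close>
  have m: "m = 2 * V * R"
  proof -
    have R2: "2 * R > 0" using R by simp
    define \<psi> where "\<psi> x = far_cutoff (2 * R) x *\<^sub>R x" for x :: 'a
    have \<psi>t: "test_function UNIV \<psi>" unfolding \<psi>_def[abs_def]
      by (intro test_function_scaleR test_function_far_cutoff R2 smooth_on_id open_UNIV)
    note d = test_function_divergence[OF \<psi>t]
    have div2: "divergence \<psi> x = 2" if "norm x < 2 * R" for x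
    proof -
      have "divergence \<psi> x = divergence (\<lambda>x::'a. x) x"
        by (rule divergence_transform_open[where S="ball 0 (2 * R)"])
           (use that far_cutoff_1[OF R2, where 'a='a] in \<open>auto simp: \<psi>_def\<close>)
      also have "\<dots> = 2" by (subst divergence_eqI[OF has_derivative_ident]) (simp add: n)
      finally show ?thesis .
    qed
    have "(LINT x|lebesgue_on ?U. divergence \<psi> x) = (LINT x|lborel. indicator ?U x *\<^sub>R divergence \<psi> x)"
      by (rule LINT_lebesgue_on_eq_lborel[OF Ub test_function_borel[OF d]])
    also have "\<dots> = (LINT x|lborel. divergence \<psi> x - indicator (cball 0 R) x * divergence \<psi> x)"
      by (intro Bochner_Integration.integral_cong refl) (auto simp: indicator_def)
    also have "\<dots> = (LINT x|lborel. divergence \<psi> x) - (LINT x|lborel. indicator (cball 0 R) x * divergence \<psi> x)"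
      by (intro Bochner_Integration.integral_diff integrable_lborel_test_function[OF d]
            integrable_indicator_test_function[OF d]) auto
    also have "(LINT x|lborel. indicator (cball 0 R) x * divergence \<psi> x) = (LINT x|lborel. 2 * indicator (cball (0::'a) R) x)"
      by (intro Bochner_Integration.integral_cong refl) (use R in \<open>auto simp: indicator_def div2\<close>)
    also have "\<dots> = 2 * (V * R\<^sup>2)" using vol[of R] R by simp
    finally have 1: "(LINT x|lebesgue_on ?U. divergence \<psi> x) = - (2 * V * R\<^sup>2)"
      by (simp add: integral_divergence_eq_0[OF \<psi>t])
    have "(LINT x|lebesgue_on ?U. divergence \<psi> x) = (LINT x:frontier ?U|surface_measure ?U. \<psi> x \<bullet> outer_normal ?U x)"
      by (rule gauss_green[OF \<psi>t])
    also have "\<dots> = (LINT x:frontier ?U|surface_measure ?U. - R)"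
    proof (rule boundary_integral_cong)
      fix x assume x: "x \<in> frontier ?U"
      have "x \<bullet> sgn x = norm x" using fr(4)[OF x] by (simp add: sgn_div_norm dot_square_norm power2_eq_square)
      then show "\<psi> x \<bullet> outer_normal ?U x = - R"
        using fr[OF x] R far_cutoff_1[OF R2, of x] by (simp add: \<psi>_def)
    qed
    also have "\<dots> = - R * m" by (rule const)
    finally have "- R * m = - (2 * V * R\<^sup>2)" using 1 by simp
    then have "R * m = R * (2 * V * R)" by (simp add: power2_eq_square mult.assoc)
    then show ?thesis using R mult_left_cancel[of R m "2 * V * R"] by blast
  qed
  obtain l l1 l2 f f' :: "real \<Rightarrow> real" and K where lam:
    "smooth_on {0<..} l" "\<And>t. t > 0 \<Longrightarrow> (l has_real_derivative l1 t) (at t)"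
    "\<And>t. t > 0 \<Longrightarrow> (l1 has_real_derivative l2 t) (at t)" "\<And>t. f t = l2 t + l1 t / t"
    "\<And>t. t > 0 \<Longrightarrow> (f has_real_derivative f' t) (at t)" "\<And>t. t \<ge> 2 \<Longrightarrow> l t = 0"
    "\<And>t. 0 < t \<Longrightarrow> t < 1 \<Longrightarrow> l1 t = 1 / t" "\<And>t. 0 < t \<Longrightarrow> t < 1 \<Longrightarrow> f t = 0"
    "K \<ge> 0" "\<And>t. t > 0 \<Longrightarrow> \<bar>f' t\<bar> \<le> K" "\<And>t. t > 2 \<Longrightarrow> f' t = 0"
    using log_profile by blast
  \<comment> \<open>\<open>w\<close> is integrated in two ways against the Laplacian \<phi> of a
    rescaled truncated logarithm. By the trace of \<open>w\<close> the result is s N^2 m / R^2; by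
    the normal trace of \<open>Z\<close> it is O(N), because |grad \<phi>| <= K/N on an area of
    order N^2.\<close>
  have bound: "N * m \<le> 4 * K * V * R\<^sup>2" if N: "N > R" for N
  proof -
    have N0: "N > 0" using R N by simp
    define \<rho> where "\<rho> = R / 2"
    have \<rho>: "\<rho> > 0" "\<rho> < R" using R by (auto simp: \<rho>_def)
    \<comment> \<open>The factor N^2 is chosen so that \<phi> becomes \<open>f (norm x / N)\<close>,
      without a power of N.\<close>
    define h where "h r = N\<^sup>2 * l (r / N)" for r
    define h1 where "h1 r = N * l1 (r / N)" for r
    define u where "u x = cut \<rho> h (norm x)" for x :: 'a
    have hs: "smooth_on {0<..} h"
    proof -
      have "smooth_on {0<..} (\<lambda>r. (1 / N) * r)"
        by (intro smooth_on_mult smooth_on_const smooth_on_ident' open_greaterThan)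
      then have "smooth_on {0<..} (\<lambda>r. l ((1 / N) * r))"
        by (rule smooth_on_comp_real[OF open_greaterThan _ open_greaterThan lam(1)]) (use N0 in simp)
      then have "smooth_on {0<..} (\<lambda>r. N\<^sup>2 * l ((1 / N) * r))"
        by (intro smooth_on_mult smooth_on_const open_greaterThan)
      then show ?thesis by (simp add: h_def[abs_def])
    qed
    have dN: "((\<lambda>r. r / N) has_real_derivative 1 / N) (at r)" for r
      using DERIV_cdivide[OF DERIV_ident, of N] by simp
    have dh: "(h has_real_derivative h1 r) (at r)" if "r > 0" for r
    proof -
      have "r / N > 0" using that N0 by simp
      from DERIV_cmult[OF DERIV_chain2[OF lam(2)[OF this] dN], of "N\<^sup>2"]
      show ?thesis using N0 by (simp add: h_def[abs_def] h1_def power2_eq_square)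
    qed
    have dh1: "(h1 has_real_derivative l2 (r / N)) (at r)" if "r > 0" for r
    proof -
      have "r / N > 0" using that N0 by simp
      from DERIV_cmult[OF DERIV_chain2[OF lam(3)[OF this] dN], of N]
      show ?thesis using N0 by (simp add: h1_def[abs_def])
    qed
    have ut: "test_function UNIV u"
    proof (rule test_functionI[where K="cball 0 (2 * N)"])
      show "smooth_on UNIV u" unfolding u_def[abs_def] by (rule smooth_on_cut_radial(1)[OF hs \<rho>(1)])
      show "u x = 0" if "x \<notin> cball 0 (2 * N)" for x
      proof -
        have "norm x / N \<ge> 2" using that N0 by (simp add: pos_le_divide_eq)
        then show ?thesis by (simp add: u_def cut_def h_def lam(6))
      qed
    qed auto
    have op: "open {x::'a. norm x > \<rho>}" by (intro open_Collect_less continuous_intros)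
    have ueq: "u x = h (norm x)" if "norm x > \<rho>" for x using that \<rho> by (simp add: u_def cut_eq)
    have gu: "grad u x = h1 (norm x) *\<^sub>R sgn x" if "norm x > \<rho>" for x
    proof -
      have "grad u x = grad (\<lambda>x. h (norm x)) x"
        by (rule grad_transform_open[OF op]) (use that ueq in auto)
      also have "\<dots> = h1 (norm x) *\<^sub>R sgn x" by (rule grad_radial[OF _ dh]) (use that \<rho> in auto)
      finally show ?thesis .
    qed
    define \<phi> where "\<phi> = laplacian u"
    have \<phi>t: "test_function UNIV \<phi>" unfolding \<phi>_def laplacian_def[abs_def]
      by (rule test_function_divergence[OF test_function_grad[OF ut]])
    have \<phi>eq: "\<phi> x = f (norm x / N)" if "norm x > \<rho>" for x
    proof -
      have x: "x \<noteq> 0" "norm x > 0" using that \<rho> by auto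
      have "\<phi> x = laplacian (\<lambda>x. h (norm x)) x" unfolding \<phi>_def
        by (rule laplacian_transform_open[OF op]) (use that ueq in auto)
      also have "\<dots> = l2 (norm x / N) + (real DIM('a) - 1) * h1 (norm x) / norm x"
        by (rule laplacian_radial[OF x(1) dh dh1[OF x(2)]])
      also have "\<dots> = f (norm x / N)" by (simp add: lam(4) h1_def n)
      finally show ?thesis .
    qed
    have g\<phi>: "grad \<phi> x = (f' (norm x / N) * (1 / N)) *\<^sub>R sgn x" if "norm x > \<rho>" for x
    proof -
      have "norm x > 0" using that \<rho> by linarith
      then have x: "x \<noteq> 0" "norm x / N > 0" using N0 by auto
      have "grad \<phi> x = grad (\<lambda>x. f (norm x / N)) x"
        by (rule grad_transform_open[OF op]) (use that \<phi>eq in auto)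
      also have "\<dots> = (f' (norm x / N) * (1 / N)) *\<^sub>R sgn x"
        by (rule grad_radial[OF x(1), where f="\<lambda>r. f (r / N)"]) (rule DERIV_chain2[OF lam(5)[OF x(2)] dN])
      finally show ?thesis .
    qed
    have fu: "norm x > \<rho>" if "x \<in> ?U" for x using that \<rho> by auto
    have RN: "0 < R / N" "R / N < 1" using R N N0 by auto
    have i1: "integrable (lebesgue_on ?U) (\<lambda>x. w x * \<phi> x)" by (rule integrable_up_to_boundary_test(1)[OF wi \<phi>t])
    have i2: "integrable (lebesgue_on ?U) (\<lambda>x. Z x \<bullet> grad \<phi> x)"
      by (rule integrable_up_to_boundary_test(2)[OF Zi test_function_grad[OF \<phi>t]])
    have "(LINT x|lebesgue_on ?U. w x * \<phi> x + G x \<bullet> grad u x) =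
        (LINT x:frontier ?U|surface_measure ?U. s * mean_curvature ?U x * (grad u x \<bullet> outer_normal ?U x))"
      using treq[OF test_function_grad[OF ut]] unfolding \<phi>_def laplacian_def .
    also have "\<dots> = (LINT x:frontier ?U|surface_measure ?U. s * N\<^sup>2 / R\<^sup>2)"
    proof (rule boundary_integral_cong)
      fix x assume x: "x \<in> frontier ?U"
      have "grad u x = (N * (N / R)) *\<^sub>R sgn x"
        using gu[of x] fr(1)[OF x] \<rho> lam(7)[OF RN] by (simp add: h1_def)
      \<comment> \<open>The curvature -1/R and the normal \<open>- sgn x\<close> both carry a minus
        sign, and the two cancel.\<close>
      then show "s * mean_curvature ?U x * (grad u x \<bullet> outer_normal ?U x) = s * N\<^sup>2 / R\<^sup>2"
        using fr[OF x] by (simp add: inner_sgn_self power2_eq_square)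
    qed
    also have "\<dots> = s * N\<^sup>2 / R\<^sup>2 * m" by (rule const)
    \<comment> \<open>\<open>u\<close> has the constant value \<open>h R\<close> on the circle, so
      \<open>flux0\<close> removes the term with \<open>G\<close>.\<close>
    finally have A: "(LINT x|lebesgue_on ?U. w x * \<phi> x) = s * N\<^sup>2 / R\<^sup>2 * m"
      using i1 iG[OF ut] flux0[OF ut, of "h R"] ueq \<rho> by simp
    have "(LINT x|lebesgue_on ?U. w x * \<phi> x + Z x \<bullet> grad \<phi> x) = (LINT x:frontier ?U|surface_measure ?U. s * \<phi> x)"
      by (rule ntreq[OF \<phi>t])
    also have "\<dots> = (LINT x:frontier ?U|surface_measure ?U. 0)"
    proof (rule boundary_integral_cong)
      fix x assume x: "x \<in> frontier ?U"
      \<comment> \<open>Near the circle the logarithm is not yet truncated, hence harmonic, and the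
        normal trace contributes nothing.\<close>
      show "s * \<phi> x = 0" using \<phi>eq[of x] fr(1)[OF x] \<rho> lam(8)[OF RN] by simp
    qed
    finally have B: "(LINT x|lebesgue_on ?U. w x * \<phi> x) = - (LINT x|lebesgue_on ?U. Z x \<bullet> grad \<phi> x)"
      using i1 i2 const[of 0] by simp
    have iK: "integrable (lebesgue_on ?U) (indicator (cball 0 (2 * N)) :: 'a \<Rightarrow> real)"
      by (rule integral_indicator_le(2)[OF Ub]) simp
    have "norm (LINT x|lebesgue_on ?U. Z x \<bullet> grad \<phi> x) \<le> (LINT x|lebesgue_on ?U. norm (Z x \<bullet> grad \<phi> x))"
      by (rule integral_norm_bound)
    also have "\<dots> \<le> (LINT x|lebesgue_on ?U. K / N * indicator (cball 0 (2 * N)) x)"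
    proof (rule integral_mono_AE)
      show "integrable (lebesgue_on ?U) (\<lambda>x. norm (Z x \<bullet> grad \<phi> x))" using i2 by simp
      show "integrable (lebesgue_on ?U) (\<lambda>x. K / N * indicator (cball 0 (2 * N)) x)" using iK by simp
      have "AE x in lebesgue_on ?U. x \<in> ?U" by (rule AE_I2) simp
      with Z(1) show "AE x in lebesgue_on ?U. norm (Z x \<bullet> grad \<phi> x) \<le> K / N * indicator (cball 0 (2 * N)) x"
      proof eventually_elim
        case (elim x)
        have \<rho>x: "norm x > \<rho>" by (rule fu[OF elim(2)])
        then have "norm x > 0" using \<rho> by linarith
        with \<rho>x have x: "norm x > \<rho>" "x \<noteq> 0" "norm x / N > 0" using N0 by auto
        have ng: "norm (grad \<phi> x) = \<bar>f' (norm x / N)\<bar> / N" using g\<phi>[OF x(1)] x(2) N0 by (simp add: norm_sgn abs_mult)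
        have "norm (Z x \<bullet> grad \<phi> x) \<le> norm (Z x) * norm (grad \<phi> x)"
          unfolding real_norm_def by (rule Cauchy_Schwarz_ineq2)
        also have "\<dots> \<le> 1 * norm (grad \<phi> x)" using elim(1) by (intro mult_right_mono) auto
        also have "\<dots> \<le> K / N * indicator (cball 0 (2 * N)) x"
        proof (cases "norm x \<le> 2 * N")
          case True
          then show ?thesis using lam(10)[OF x(3)] N0 by (simp add: ng divide_right_mono)
        next
          case False
          then have "norm x / N > 2" using N0 by (simp add: pos_less_divide_eq)
          then show ?thesis using False by (simp add: ng lam(11))
        qed
        finally show ?case .
      qed
    qed
    also have "\<dots> = K / N * (LINT x|lebesgue_on ?U. indicator (cball 0 (2 * N)) x)" by simp
    also have "\<dots> \<le> K / N * (V * (2 * N)\<^sup>2)"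
      using integral_indicator_le(1)[OF Ub compact_cball[of "0::'a" "2 * N"]] vol[of "2 * N"] lam(9) N0
      by (intro mult_left_mono) auto
    finally have "\<bar>s * N\<^sup>2 / R\<^sup>2 * m\<bar> \<le> K / N * (V * (2 * N)\<^sup>2)" using A B by simp
    moreover have "\<bar>s * N\<^sup>2 / R\<^sup>2 * m\<bar> = N * (N * m / R\<^sup>2)"
      using s m V R N0 by (auto simp: abs_mult power2_eq_square)
    moreover have "K / N * (V * (2 * N)\<^sup>2) = N * (4 * K * V)" using N0 by (simp add: power2_eq_square)
    ultimately have "N * (N * m / R\<^sup>2) \<le> N * (4 * K * V)" by linarith
    then have "N * m / R\<^sup>2 \<le> 4 * K * V" using mult_le_cancel_left_pos[OF N0] by blast
    then show ?thesis using R by (simp add: pos_divide_le_eq)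
  qed
  have m0: "m > 0" using m V R by simp
  \<comment> \<open>The estimate is linear in N on the left and constant on the right; this N
    exceeds R and violates it.\<close>
  define N where "N = max (2 * R) ((4 * K * V * R\<^sup>2 + 1) / m)"
  have "N > R" using R by (simp add: N_def)
  moreover have "(4 * K * V * R\<^sup>2 + 1) / m \<le> N" by (simp add: N_def)
  then have "4 * K * V * R\<^sup>2 + 1 \<le> N * m" using m0 by (simp add: pos_divide_le_eq)
  ultimately show False using bound[of N] by simp
qed

theorem theorem3:
  shows
    "(\<forall>R>0. \<forall>s\<in>{-1, 1}. calibrable (ball 0 R :: (real ^ 'n) set) (\<lambda>_. s)) \<and>
     (CARD('n) \<noteq> 2 \<longrightarrow>
        (\<forall>R>0. \<forall>s\<in>{-1, 1}. calibrable (- cball 0 R :: (real ^ 'n) set) (\<lambda>_. s))) \<and>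
     (CARD('n) = 2 \<longrightarrow>
        (\<forall>R>0. \<forall>s\<in>{-1, 1}. \<not> calibrable (- cball 0 R :: (real ^ 'n) set) (\<lambda>_. s))) \<and>
     (CARD('n) \<noteq> 2 \<longrightarrow>
        (\<forall>R\<^sub>0 R\<^sub>1. 0 < R\<^sub>0 \<and> R\<^sub>0 < R\<^sub>1 \<longrightarrow>
           (\<forall>s\<in>{-1, 1}. calibrable (annulus R\<^sub>0 R\<^sub>1 :: (real ^ 'n) set) (\<lambda>_. s)))) \<and>
     (CARD('n) = 2 \<longrightarrow>
        (\<exists>Q>1. \<forall>R\<^sub>0 R\<^sub>1. 0 < R\<^sub>0 \<and> R\<^sub>0 < R\<^sub>1 \<longrightarrow>
           (\<forall>s\<in>{-1, 1}. calibrable (annulus R\<^sub>0 R\<^sub>1 :: (real ^ 'n) set) (\<lambda>_. s) \<longleftrightarrow> R\<^sub>1 / R\<^sub>0 \<le> Q)))"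
proof (intro conjI impI allI ballI)
  have dim: "DIM(real ^ 'n) = CARD('n)" by simp
  show "calibrable (ball 0 R :: (real ^ 'n) set) (\<lambda>_. s)" if "R > 0" "s \<in> {-1, 1}" for R s
    using that by (rule calibrable_ball)
  show "calibrable (- cball 0 R :: (real ^ 'n) set) (\<lambda>_. s)"
    if "CARD('n) \<noteq> 2" "R > 0" "s \<in> {-1, 1}" for R s
    using calibrable_exterior[where 'a="real ^ 'n", unfolded dim, OF that(2,1,3)] .
  show "\<not> calibrable (- cball 0 R :: (real ^ 'n) set) (\<lambda>_. s)"
    if "CARD('n) = 2" "R > 0" "s \<in> {-1, 1}" for R s
    using not_calibrable_exterior_plane[where 'a="real ^ 'n", unfolded dim, OF that(2,1,3)] .
  show "calibrable (annulus R\<^sub>0 R\<^sub>1 :: (real ^ 'n) set) (\<lambda>_. s)"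
    if "CARD('n) \<noteq> 2" "0 < R\<^sub>0 \<and> R\<^sub>0 < R\<^sub>1" "s \<in> {-1, 1}" for R\<^sub>0 R\<^sub>1 s
    using calibrable_annulus[where 'a="real ^ 'n", unfolded dim, OF _ _ that(1,3)] that(2) by blast
  show "\<exists>Q>1. \<forall>R\<^sub>0 R\<^sub>1. 0 < R\<^sub>0 \<and> R\<^sub>0 < R\<^sub>1 \<longrightarrow>
      (\<forall>s\<in>{-1, 1}. calibrable (annulus R\<^sub>0 R\<^sub>1 :: (real ^ 'n) set) (\<lambda>_. s) \<longleftrightarrow> R\<^sub>1 / R\<^sub>0 \<le> Q)"
    if "CARD('n) = 2"
    using calibrable_annulus_plane[where 'a="real ^ 'n", unfolded dim, OF that] .
qed

end
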